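(* For every even integer $\ell$, there is a surjective algebra homomorphism $$\mathfrak A_{\ell+2}\longrightarrow \mathcal D_{\mathcal O(\ell)}(Y).$$
   Context: Work over $\mathbb C$, $n\ge 2$. Lie algebra: $\mathfrak g=\mathfrak{sp}_{2n}$ with simple roots $\alpha_1,\dots,\alpha_n$ in Bourbaki's numbering ($\alpha_n$ the long simple root). Let $\mathfrak p=\mathfrak m\oplus\mathfrak r_+$ be the maximal parabolic subalgebra determined by $\alpha_n$: $\mathfrak m\cong\mathfrak{gl}_n$ is the sum of the Cartan subalgebra and the root spaces of roots whose $\alpha_n$-coefficient is $0$; $\mathfrak r_{\pm}$ is the sum of the root spaces of roots whose $\alpha_n$-coefficient is $\pm1$ (both are abelian), so $\mathfrak g=\mathfrak r_-\oplus\mathfrak m\oplus\mathfrak r_+$. Let $z$ be the generator of the one-dimensional center $\mathfrak z$ of $\mathfrak m$ normalized by $[z,x]=x$ for $x\in\mathfrak r_+$ and $[z,y]=-y$ for $y\in\mathfrak r_-$. For an integer $k$ put $z_k:=z+\frac{k}{2}+\frac n4\in U(\mathfrak g)$, and let $\mathfrak A_k$ be the associative subalgebra of $U(\mathfrak g)$ generated by $1$, $\mathfrak m$, $\mathfrak r_-$ and $\{xz_k:x\in\mathfrak r_+\}$. Geometry: $Y=\mathbb P^n(1,\dots,1,2)=\mathrm{Proj}\,S$ with $S=\mathbb C[Q_1,\dots,Q_{n+1}]$, $\deg Q_i=1$ for $i\le n$, $\deg Q_{n+1}=2$. For an integer $m$, $\mathcal O(m)$ on $Y$ is the sheaf associated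 to the shifted graded module $S[m]$; it is invertible exactly when $m$ is even. $\mathcal D_{\mathcal O(\ell)}(Y)$ is the ring of global sections of the sheaf of (Grothendieck) differential operators from the invertible sheaf $\mathcal O(\ell)$ to itself. *)

theory Defs
  imports
    "Jordan_Normal_Form.VS_Connect"
    "HOL-Algebra.QuotRing"
    "HOL-Algebra.Generated_Rings"
    "HOL-Library.Poly_Mapping"
    "HOL-Library.FuncSet"
begin

section \<open>Complex algebras\<close>

text \<open>
  A not necessarily commutative complex algebra is a record of type \<^typ>\<open>(complex, 'b) module\<close>
  whose ring and scalar operations are both meaningful.  (The locale \<open>algebra\<close> of
  \<open>HOL-Algebra.Module\<close> is restricted to commutative algebras.)
\<close>

definition alg_hom :: "(complex, 'a) module \<Rightarrow> (complex, 'b) module \<Rightarrow> ('a \<Rightarrow> 'b) set" where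
  "alg_hom A B = {h \<in> Ring.ring_hom A B.
     \<forall>c. \<forall>x \<in> carrier A. h (c \<odot>\<^bsub>A\<^esub> x) = c \<odot>\<^bsub>B\<^esub> h x}"

definition subalgebra_gen :: "(complex, 'a) module \<Rightarrow> 'a set \<Rightarrow> (complex, 'a) module" where
  "subalgebra_gen A X = A\<lparr>carrier := generate_ring A ({c \<odot>\<^bsub>A\<^esub> \<one>\<^bsub>A\<^esub> | c. True} \<union> X)\<rparr>"


section \<open>The Lie algebra \<open>sp\<^bsub>2n\<^esub>\<close> and its parabolic decomposition\<close>

definition lie :: "complex mat \<Rightarrow> complex mat \<Rightarrow> complex mat" where
  "lie A B = A * B - B * A"

definition symp_form :: "nat \<Rightarrow> complex mat" where
  "symp_form n = four_block_mat (0\<^sub>m n n) (1\<^sub>m n) (- 1\<^sub>m n) (0\<^sub>m n n)"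

definition sp :: "nat \<Rightarrow> complex mat set" where
  "sp n = {X \<in> carrier_mat (2*n) (2*n).
     transpose_mat X * symp_form n + symp_form n * X = 0\<^sub>m (2*n) (2*n)}"

text \<open>The diagonal matrices \<open>diag(t\<^sub>1, \<dots>, t\<^sub>n, -t\<^sub>1, \<dots>, -t\<^sub>n)\<close>.\<close>

definition cartan :: "nat \<Rightarrow> complex mat set" where
  "cartan n = {H \<in> sp n. diagonal_mat H}"

text \<open>
  Linear forms on the Cartan subalgebra are functions of which only the values on
  \<^term>\<open>cartan n\<close> matter.  The index \<open>i\<close> runs through \<open>1, \<dots>, n\<close>, whereas matrix entries are
  counted from \<open>0\<close>.
\<close>

definition eps :: "nat \<Rightarrow> complex mat \<Rightarrow> complex" where
  "eps i H = H $$ (i - 1, i - 1)"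

definition simple_root :: "nat \<Rightarrow> nat \<Rightarrow> complex mat \<Rightarrow> complex" where
  "simple_root n i H = (if i < n then eps i H - eps (i + 1) H else 2 * eps n H)"

definition root_comb :: "nat \<Rightarrow> (nat \<Rightarrow> int) \<Rightarrow> complex mat \<Rightarrow> complex" where
  "root_comb n c H = (\<Sum>i = 1..n. of_int (c i) * simple_root n i H)"

definition root_space :: "nat \<Rightarrow> (complex mat \<Rightarrow> complex) \<Rightarrow> complex mat set" where
  "root_space n \<alpha> = {X \<in> sp n. \<forall>H \<in> cartan n. lie H X = \<alpha> H \<cdot>\<^sub>m X}"

definition is_root :: "nat \<Rightarrow> (complex mat \<Rightarrow> complex) \<Rightarrow> bool" where
  "is_root n \<alpha> \<longleftrightarrow> (\<exists>H \<in> cartan n. \<alpha> H \<noteq> 0) \<and> (\<exists>X \<in> root_space n \<alpha>. X \<noteq> 0\<^sub>m (2*n) (2*n))"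

definition root_vectors :: "nat \<Rightarrow> int \<Rightarrow> complex mat set" where
  "root_vectors n j =
     \<Union> {root_space n (root_comb n c) | c. is_root n (root_comb n c) \<and> c n = j}"

abbreviation mat_span :: "nat \<Rightarrow> complex mat set \<Rightarrow> complex mat set" where
  "mat_span n \<equiv> LinearCombinations.module.span class_ring (module_mat TYPE(complex) (2*n) (2*n))"

definition levi :: "nat \<Rightarrow> complex mat set" where
  "levi n = mat_span n (cartan n \<union> root_vectors n 0)"

definition r_plus :: "nat \<Rightarrow> complex mat set" where
  "r_plus n = mat_span n (root_vectors n 1)"

definition r_minus :: "nat \<Rightarrow> complex mat set" where
  "r_minus n = mat_span n (root_vectors n (- 1))"

definition z_elt :: "nat \<Rightarrow> complex mat" where
  "z_elt n = (THE z. z \<in> levi n \<and> (\<forall>x \<in> levi n. lie z x = 0\<^sub>m (2*n) (2*n)) \<and>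
     (\<forall>x \<in> r_plus n. lie z x = x) \<and> (\<forall>y \<in> r_minus n. lie z y = - y))"


section \<open>Universal enveloping algebras\<close>

text \<open>
  The free monoid, as a type of class \<^class>\<open>monoid_add\<close>: finitely supported functions on it
  then form, with the convolution product of \<open>HOL-Library.Poly_Mapping\<close>, a free associative
  algebra.
\<close>

datatype 'a word = Word (letters: "'a list")

instantiation word :: (type) monoid_add
begin
definition zero_word :: "'a word" where "zero_word = Word []"
definition plus_word :: "'a word \<Rightarrow> 'a word \<Rightarrow> 'a word" where
  "plus_word u v = Word (letters u @ letters v)"
instance by standard (auto simp: zero_word_def plus_word_def)
end

text \<open>
  For a Lie algebra \<open>L\<close> of matrices, \<open>U(L)\<close> is the free complex algebra on the underlying set of
  \<open>L\<close> modulo linearity of \<open>L \<rightarrow> U(L)\<close> and \<open>xy - yx = [x,y]\<close>.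
\<close>

definition free_alg ::
  "complex mat set \<Rightarrow> (complex, complex mat word \<Rightarrow>\<^sub>0 complex) module" where
  "free_alg L = \<lparr>carrier = {f. \<forall>w \<in> Poly_Mapping.keys f. set (letters w) \<subseteq> L},
     mult = (*), one = 1, zero = 0, add = (+),
     smult = (\<lambda>c f. Poly_Mapping.single 0 c * f)\<rparr>"

definition gen :: "complex mat \<Rightarrow> (complex mat word \<Rightarrow>\<^sub>0 complex)" where
  "gen x = Poly_Mapping.single (Word [x]) 1"

definition env_ideal :: "complex mat set \<Rightarrow> (complex mat word \<Rightarrow>\<^sub>0 complex) set" where
  "env_ideal L = Idl\<^bsub>free_alg L\<^esub>
     ({gen (x + y) - gen x - gen y | x y. x \<in> L \<and> y \<in> L} \<union>
      {gen (c \<cdot>\<^sub>m x) - Poly_Mapping.single 0 c * gen x | c x. x \<in> L} \<union>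
      {gen x * gen y - gen y * gen x - gen (lie x y) | x y. x \<in> L \<and> y \<in> L})"

definition env_alg ::
  "complex mat set \<Rightarrow> (complex, (complex mat word \<Rightarrow>\<^sub>0 complex) set) module" where
  "env_alg L = ring.extend (free_alg L Quot env_ideal L)
     (module.fields (\<lambda>c X. \<Union>f \<in> X. env_ideal L +>\<^bsub>free_alg L\<^esub> (c \<odot>\<^bsub>free_alg L\<^esub> f)))"

definition env_incl ::
  "complex mat set \<Rightarrow> complex mat \<Rightarrow> (complex mat word \<Rightarrow>\<^sub>0 complex) set" where
  "env_incl L x = env_ideal L +>\<^bsub>free_alg L\<^esub> gen x"


section \<open>The algebra \<open>A\<^sub>k\<close>\<close>

definition zk_elt :: "nat \<Rightarrow> int \<Rightarrow> (complex mat word \<Rightarrow>\<^sub>0 complex) set" where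
  "zk_elt n k = env_incl (sp n) (z_elt n) \<oplus>\<^bsub>env_alg (sp n)\<^esub>
     (of_int k / 2 + of_nat n / 4) \<odot>\<^bsub>env_alg (sp n)\<^esub> \<one>\<^bsub>env_alg (sp n)\<^esub>"

definition A_alg ::
  "nat \<Rightarrow> int \<Rightarrow> (complex, (complex mat word \<Rightarrow>\<^sub>0 complex) set) module" where
  "A_alg n k = subalgebra_gen (env_alg (sp n))
     (env_incl (sp n) ` levi n \<union> env_incl (sp n) ` r_minus n \<union>
      {env_incl (sp n) x \<otimes>\<^bsub>env_alg (sp n)\<^esub> zk_elt n k | x. x \<in> r_plus n})"


section \<open>Proj of a graded algebra, twisting sheaves and differential operators\<close>

text \<open>
  \<open>S\<close> is a commutative complex algebra with homogeneous parts \<open>G d\<close>; the grading is indexed by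
  all integers so that shifts can be formed, and \<open>G d\<close> is zero for \<open>d < 0\<close>.
\<close>

locale proj =
  fixes S :: "(complex, 'a) module" (structure) and G :: "int \<Rightarrow> 'a set"
begin

definition homog :: "'a set" where
  "homog = (\<Union>d. G d)"

definition points :: "'a set set" where
  "points = {P. primeideal P S \<and> P = Idl (P \<inter> homog) \<and> \<not> Idl (\<Union>d \<in> {0<..}. G d) \<subseteq> P}"

definition zopen :: "'a set set \<Rightarrow> bool" where
  "zopen U \<longleftrightarrow> (\<exists>I. ideal I S \<and> I = Idl (I \<inter> homog) \<and> U = {P \<in> points. \<not> I \<subseteq> P})"

text \<open>
  The stalk at \<open>P\<close> of the sheaf associated to \<open>S[m]\<close> is the degree \<open>0\<close> part of the localisation of
  \<open>S[m]\<close> at the homogeneous elements outside \<open>P\<close>.  A fraction is represented by its equivalence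
  class of pairs (numerator, denominator); the operations below are computed on representatives.
\<close>

definition fracs :: "'a set \<Rightarrow> int \<Rightarrow> ('a \<times> 'a) set" where
  "fracs P m = {(a, b). \<exists>d. a \<in> G (d + m) \<and> b \<in> G d \<and> b \<notin> P}"

definition frac :: "'a set \<Rightarrow> int \<Rightarrow> 'a \<Rightarrow> 'a \<Rightarrow> ('a \<times> 'a) set" where
  "frac P m a b = {(a', b') \<in> fracs P m. \<exists>c \<in> homog - P. c \<otimes> (a \<otimes> b' \<ominus> a' \<otimes> b) = \<zero>}"

definition frac_add ::
  "'a set \<Rightarrow> int \<Rightarrow> ('a \<times> 'a) set \<Rightarrow> ('a \<times> 'a) set \<Rightarrow> ('a \<times> 'a) set" where
  "frac_add P m X Y = (\<Union>(a, b) \<in> X. \<Union>(c, d) \<in> Y. frac P m (a \<otimes> d \<oplus> c \<otimes> b) (b \<otimes> d))"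

definition frac_mult ::
  "'a set \<Rightarrow> int \<Rightarrow> ('a \<times> 'a) set \<Rightarrow> ('a \<times> 'a) set \<Rightarrow> ('a \<times> 'a) set" where
  "frac_mult P m X Y = (\<Union>(a, b) \<in> X. \<Union>(c, d) \<in> Y. frac P m (a \<otimes> c) (b \<otimes> d))"

definition sections :: "int \<Rightarrow> 'a set set \<Rightarrow> ('a set \<Rightarrow> ('a \<times> 'a) set) set" where
  "sections m U = {s \<in> extensional U. \<forall>P \<in> U. \<exists>V a b d. zopen V \<and> P \<in> V \<and> V \<subseteq> U \<and>
     a \<in> G (d + m) \<and> b \<in> G d \<and> (\<forall>Q \<in> V. b \<notin> Q \<and> s Q = frac Q m a b)}"

definition struct_sheaf :: "'a set set \<Rightarrow> ('a set \<Rightarrow> ('a \<times> 'a) set) ring" where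
  "struct_sheaf U = \<lparr>carrier = sections 0 U,
     mult = (\<lambda>f g. \<lambda>P\<in>U. frac_mult P 0 (f P) (g P)),
     one = (\<lambda>P\<in>U. frac P 0 \<one> \<one>),
     zero = (\<lambda>P\<in>U. frac P 0 \<zero> \<one>),
     add = (\<lambda>f g. \<lambda>P\<in>U. frac_add P 0 (f P) (g P))\<rparr>"

text \<open>
  The sections of \<open>O(m)\<close>, a module over those of the structure sheaf; as usual for module records,
  the two multiplicative ring fields carry no meaning.
\<close>

definition twist ::
  "int \<Rightarrow> 'a set set \<Rightarrow>
   ('a set \<Rightarrow> ('a \<times> 'a) set, 'a set \<Rightarrow> ('a \<times> 'a) set) module" where
  "twist m U = \<lparr>carrier = sections m U,
     mult = undefined,
     one = undefined,
     zero = (\<lambda>P\<in>U. frac P m \<zero> \<one>),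
     add = (\<lambda>s t. \<lambda>P\<in>U. frac_add P m (s P) (t P)),
     smult = (\<lambda>f s. \<lambda>P\<in>U. frac_mult P m (f P) (s P))\<rparr>"

definition const_sec :: "complex \<Rightarrow> 'a set set \<Rightarrow> 'a set \<Rightarrow> ('a \<times> 'a) set" where
  "const_sec c U = (\<lambda>P\<in>U. frac P 0 (c \<odot> \<one>) \<one>)"

definition opens :: "'a set set \<Rightarrow> 'a set set set" where
  "opens U = {V. zopen V \<and> V \<subseteq> U}"

text \<open>
  The complex linear endomorphisms of the sheaf \<open>O(m)|\<^sub>U\<close>: families of linear maps indexed by the
  open subsets of \<open>U\<close> and compatible with restriction.  Families and maps are extensional, so
  that equality of endomorphisms is equality in HOL.
\<close>

definition sheaf_end ::
  "int \<Rightarrow> 'a set set \<Rightarrow>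
   ('a set set \<Rightarrow> ('a set \<Rightarrow> ('a \<times> 'a) set) \<Rightarrow> ('a set \<Rightarrow> ('a \<times> 'a) set)) set" where
  "sheaf_end m U = {\<phi> \<in> extensional (opens U).
     (\<forall>V \<in> opens U.
        \<phi> V \<in> carrier (twist m V) \<rightarrow>\<^sub>E carrier (twist m V) \<and>
        (\<forall>s \<in> carrier (twist m V). \<forall>t \<in> carrier (twist m V).
           \<phi> V (s \<oplus>\<^bsub>twist m V\<^esub> t) = \<phi> V s \<oplus>\<^bsub>twist m V\<^esub> \<phi> V t) \<and>
        (\<forall>c. \<forall>s \<in> carrier (twist m V).
           \<phi> V (const_sec c V \<odot>\<^bsub>twist m V\<^esub> s) = const_sec c V \<odot>\<^bsub>twist m V\<^esub> \<phi> V s)) \<and>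
     (\<forall>V \<in> opens U. \<forall>W \<in> opens V. \<forall>s \<in> carrier (twist m V).
        \<phi> W (restrict s W) = restrict (\<phi> V s) W)}"

definition commutator ::
  "int \<Rightarrow> 'a set set \<Rightarrow>
   ('a set set \<Rightarrow> ('a set \<Rightarrow> ('a \<times> 'a) set) \<Rightarrow> ('a set \<Rightarrow> ('a \<times> 'a) set)) \<Rightarrow>
   ('a set \<Rightarrow> ('a \<times> 'a) set) \<Rightarrow>
   ('a set set \<Rightarrow> ('a set \<Rightarrow> ('a \<times> 'a) set) \<Rightarrow> ('a set \<Rightarrow> ('a \<times> 'a) set))" where
  "commutator m U \<phi> f = (\<lambda>V \<in> opens U. \<lambda>s \<in> carrier (twist m V).
     \<phi> V (restrict f V \<odot>\<^bsub>twist m V\<^esub> s) \<ominus>\<^bsub>twist m V\<^esub> restrict f V \<odot>\<^bsub>twist m V\<^esub> \<phi> V s)"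

text \<open>Grothendieck's differential operators \<open>O(m)|\<^sub>U \<rightarrow> O(m)|\<^sub>U\<close> of order at most \<open>k\<close>.\<close>

primrec diffops_le ::
  "int \<Rightarrow> nat \<Rightarrow> 'a set set \<Rightarrow>
   ('a set set \<Rightarrow> ('a set \<Rightarrow> ('a \<times> 'a) set) \<Rightarrow> ('a set \<Rightarrow> ('a \<times> 'a) set)) set" where
  "diffops_le m 0 U = {\<phi> \<in> sheaf_end m U.
     \<forall>V \<in> opens U. \<forall>f \<in> carrier (struct_sheaf V). \<forall>s \<in> carrier (twist m V).
       \<phi> V (f \<odot>\<^bsub>twist m V\<^esub> s) = f \<odot>\<^bsub>twist m V\<^esub> \<phi> V s}"
| "diffops_le m (Suc k) U = {\<phi> \<in> sheaf_end m U.
     \<forall>V \<in> opens U. \<forall>f \<in> carrier (struct_sheaf V).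
       commutator m V (restrict \<phi> (opens V)) f \<in> diffops_le m k V}"

text \<open>
  The sections over \<open>U\<close> of the sheaf of differential operators, the union of the increasing
  sequence of sheaves of operators of order at most \<open>k\<close>: locally the order is bounded.
\<close>

definition diffops ::
  "int \<Rightarrow> 'a set set \<Rightarrow>
   ('a set set \<Rightarrow> ('a set \<Rightarrow> ('a \<times> 'a) set) \<Rightarrow> ('a set \<Rightarrow> ('a \<times> 'a) set)) set" where
  "diffops m U = {\<phi> \<in> sheaf_end m U.
     \<forall>P \<in> U. \<exists>V \<in> opens U. P \<in> V \<and> (\<exists>k. restrict \<phi> (opens V) \<in> diffops_le m k V)}"

definition diffop_alg ::
  "int \<Rightarrow> 'a set set \<Rightarrow>
   (complex, 'a set set \<Rightarrow> ('a set \<Rightarrow> ('a \<times> 'a) set) \<Rightarrow> ('a set \<Rightarrow> ('a \<times> 'a) set)) module" where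
  "diffop_alg m U = \<lparr>carrier = diffops m U,
     mult = (\<lambda>\<phi> \<psi>. \<lambda>V \<in> opens U. \<lambda>s \<in> carrier (twist m V). \<phi> V (\<psi> V s)),
     one = (\<lambda>V \<in> opens U. \<lambda>s \<in> carrier (twist m V). s),
     zero = (\<lambda>V \<in> opens U. \<lambda>s \<in> carrier (twist m V). \<zero>\<^bsub>twist m V\<^esub>),
     add = (\<lambda>\<phi> \<psi>. \<lambda>V \<in> opens U. \<lambda>s \<in> carrier (twist m V). \<phi> V s \<oplus>\<^bsub>twist m V\<^esub> \<psi> V s),
     smult = (\<lambda>c \<phi>. \<lambda>V \<in> opens U. \<lambda>s \<in> carrier (twist m V).
                const_sec c V \<odot>\<^bsub>twist m V\<^esub> \<phi> V s)\<rparr>"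

end


section \<open>The weighted projective space \<open>P(1,\<dots>,1,2)\<close>\<close>

text \<open>Polynomials in the variables \<open>Q\<^sub>1, \<dots>, Q\<^bsub>n+1\<^esub>\<close>, of which only \<open>Q\<^bsub>n+1\<^esub>\<close> has degree \<open>2\<close>.\<close>

definition wpoly_alg :: "nat \<Rightarrow> (complex, (nat \<Rightarrow>\<^sub>0 nat) \<Rightarrow>\<^sub>0 complex) module" where
  "wpoly_alg n = \<lparr>carrier = {f. \<forall>\<mu> \<in> Poly_Mapping.keys f. Poly_Mapping.keys \<mu> \<subseteq> {1..n+1}},
     mult = (*), one = 1, zero = 0, add = (+),
     smult = (\<lambda>c f. Poly_Mapping.single 0 c * f)\<rparr>"

definition wdeg :: "nat \<Rightarrow> (nat \<Rightarrow>\<^sub>0 nat) \<Rightarrow> nat" where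
  "wdeg n \<mu> = (\<Sum>i = 1..n. Poly_Mapping.lookup \<mu> i) + 2 * Poly_Mapping.lookup \<mu> (n + 1)"

definition wpoly_part :: "nat \<Rightarrow> int \<Rightarrow> ((nat \<Rightarrow>\<^sub>0 nat) \<Rightarrow>\<^sub>0 complex) set" where
  "wpoly_part n d = {f \<in> carrier (wpoly_alg n). \<forall>\<mu> \<in> Poly_Mapping.keys f. int (wdeg n \<mu>) = d}"

definition D_alg where
  "D_alg n l = proj.diffop_alg (wpoly_alg n) (wpoly_part n) l
     (proj.points (wpoly_alg n) (wpoly_part n))"

end

theory Submission
  imports Defs "HOL-Computational_Algebra.Fraction_Field"
begin

text \<open>
  Sections of \<open>O(l)\<close> are elements of the function field, so a global differential operator is one operator \<open>F\<close> on
  homogeneous fractions of degree \<open>l\<close>, and \<open>F\<close> is determined by its values on Laurent monomials.  On series in monomials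
  \<open>Q\<^sup>x\<close> with complex exponents, \<open>sp\<^bsub>2n\<^esub>\<close> acts through the oscillator representation by the quadratic expressions in
  \<open>a\<^sub>i = t \<partial>\<^sub>i\<close> and \<open>b\<^sub>i = t\<^bsup>-1\<^esup> Q\<^sub>i\<close> for \<open>i \<le> n\<close>, where \<open>t\<close> is the square root of the last variable \<open>q\<close>.  Writing the
  coefficient of \<open>Q\<^sup>x\<close> as a multiple of \<open>1 / \<Gamma>(c + 1)\<close>, \<open>c\<close> the exponent of \<open>q\<close>, turns \<open>b\<^sub>j a\<^sub>i\<close> and \<open>b\<^sub>i b\<^sub>j\<close> into the
  differential operators \<open>Q\<^sub>j \<partial>\<^sub>i\<close> and \<open>Q\<^sub>i Q\<^sub>j \<partial>\<^sub>q\<close>; in degree \<open>l\<close> the element \<open>z\<^sub>k\<close> with \<open>k = l + 2\<close> acts as \<open>c + 1\<close>,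
  which cancels the denominator of \<open>a\<^sub>i a\<^sub>j\<close> and makes \<open>a\<^sub>i a\<^sub>j z\<^sub>k\<close> the operator \<open>q \<partial>\<^sub>i \<partial>\<^sub>j\<close>.

  For surjectivity, write \<open>F(Q\<^sup>\<mu>) = \<Sum>\<^sub>\<nu> p\<^sub>\<nu>(\<mu>) Q\<^bsup>\<mu> + \<nu>\<^esup>\<close>.  Commutators with Laurent monomials of degree \<open>0\<close> lower the order of
  \<open>F\<close> and act as difference operators on the \<open>p\<^sub>\<nu>\<close>, so every \<open>p\<^sub>\<nu>\<close> is a polynomial.  Regularity on the charts \<open>Q\<^sub>1 \<noteq> 0\<close>
  and \<open>Q\<^sub>2 \<noteq> 0\<close> makes \<open>p\<^sub>\<nu>\<close> divisible by the falling factorials \<open>x\<^sub>j (x\<^sub>j - 1) \<dots> (x\<^sub>j + \<nu>\<^sub>j + 1)\<close> with \<open>\<nu>\<^sub>j < 0\<close>, whose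
  product is the symbol of a composition of the operators above.
\<close>

section \<open>Derivations and differential operators on fraction fields\<close>

text \<open>\<open>A_alg\<close> is not given by relations, so a homomorphism cannot be prescribed
  on generators. Nor can it be read off from an action of U(g) on fractions of degree l: t lies
  outside the function field, and a_i a_j alone would carry the denominator c + 1, which vanishes at
  c = -1. Therefore U(g) acts on all functions of complex exponent vectors, where nothing has to be
  divided, and the relation \<open>compat\<close> ties such an operator to a differential operator T
  on the function field. A suitable T exists for each generator, and this passes to sums and
  products; conversely the operator on coefficients determines T in degree l. This single-valuedness
  turns the choice of T into a homomorphism. The factor \<gamma> vanishes off the natural numbers,
  so the comparison sees only monomials with c in N. That is enough because the coefficients depend
  polynomially on the exponent. The same density drives surjectivity: a polynomial vanishing at
  enough lattice points of the degree l hyperplane, or of a slice of it, vanishes there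
  identically.\<close>

lemma poly_mapping_sum_single:
  fixes f :: "'a \<Rightarrow>\<^sub>0 'b::comm_monoid_add"
  shows "f = (\<Sum>k\<in>Poly_Mapping.keys f. Poly_Mapping.single k (Poly_Mapping.lookup f k))"
  by (rule poly_mapping_eqI)
    (simp add: lookup_sum lookup_single when_def sum.delta in_keys_iff)

text \<open>Identities that are additive in each factor are thereby checked on single terms, both
  for polynomials and in the free algebra.\<close>

lemma poly_mapping_add_induct [case_names single add]:
  fixes f :: "'a \<Rightarrow>\<^sub>0 'b::comm_monoid_add"
  assumes "\<And>k c. P (Poly_Mapping.single k c)" and "\<And>f g. P f \<Longrightarrow> P g \<Longrightarrow> P (f + g)"
  shows "P f"
proof -
  have "P (\<Sum>k\<in>A. Poly_Mapping.single k (Poly_Mapping.lookup f k))" if "finite A" for A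
    using that
  proof induction
    case empty
    show ?case using assms(1)[of undefined 0] by simp
  next
    case (insert x F)
    then show ?case using assms by simp
  qed
  from this[of "Poly_Mapping.keys f"] show ?thesis
    by (simp add: poly_mapping_sum_single[symmetric])
qed

type_synonym pol = "(nat \<Rightarrow>\<^sub>0 nat) \<Rightarrow>\<^sub>0 complex"
type_synonym rat_fun = "pol fract"

definition derivation :: "('a::comm_ring_1 \<Rightarrow> 'a) \<Rightarrow> bool" where
  "derivation \<delta> \<longleftrightarrow> (\<forall>a b. \<delta> (a + b) = \<delta> a + \<delta> b) \<and> (\<forall>a b. \<delta> (a * b) = \<delta> a * b + a * \<delta> b)"

lemma derivation_add: "derivation \<delta> \<Longrightarrow> \<delta> (a + b) = \<delta> a + \<delta> b"
  and derivation_mult: "derivation \<delta> \<Longrightarrow> \<delta> (a * b) = \<delta> a * b + a * \<delta> b"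
  by (auto simp: derivation_def)

lemma derivation_1: "derivation \<delta> \<Longrightarrow> \<delta> 1 = 0"
  using derivation_mult[of \<delta> 1 1] by simp

text \<open>The quotient rule applied to some representation of q; for a derivation the value does
  not depend on it, see \<open>fract_der_Fract\<close>.\<close>

definition fract_der :: "('a::idom \<Rightarrow> 'a) \<Rightarrow> 'a fract \<Rightarrow> 'a fract" where
  "fract_der \<delta> q = (SOME r. \<exists>a b. b \<noteq> 0 \<and> q = Fract a b \<and> r = Fract (\<delta> a * b - a * \<delta> b) (b * b))"

lemma fract_der_Fract:
  assumes d: "derivation \<delta>" and b: "b \<noteq> 0"
  shows "fract_der \<delta> (Fract a b) = Fract (\<delta> a * b - a * \<delta> b) (b * b)"
proof -
  have wd: "Fract (\<delta> a' * b' - a' * \<delta> b') (b' * b') = Fract (\<delta> a * b - a * \<delta> b) (b * b)"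
    if b': "b' \<noteq> 0" and e: "Fract a b = Fract a' b'" for a' b'
  proof -
    have 1: "a * b' = a' * b" using e b b' by (simp add: eq_fract)
    then have "\<delta> (a * b') = \<delta> (a' * b)" by simp
    then have 2: "\<delta> a * b' + a * \<delta> b' = \<delta> a' * b + a' * \<delta> b" by (simp add: derivation_mult[OF d])
    have "(\<delta> a' * b' - a' * \<delta> b') * (b * b) = (\<delta> a * b - a * \<delta> b) * (b' * b')"
    proof -
      have "(\<delta> a' * b' - a' * \<delta> b') * (b * b) = b' * b * (\<delta> a' * b) - (a' * b) * (\<delta> b' * b)"
        by (simp add: algebra_simps)
      also have "\<dots> = b' * b * (\<delta> a * b' + a * \<delta> b' - a' * \<delta> b) - (a * b') * (\<delta> b' * b)"
        using 1 2 by (simp add: algebra_simps)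
      also have "\<dots> = b' * b' * b * \<delta> a - (a' * b) * b' * \<delta> b" by (simp add: algebra_simps)
      also have "\<dots> = b' * b' * b * \<delta> a - (a * b') * b' * \<delta> b" by (simp only: 1)
      also have "\<dots> = (\<delta> a * b - a * \<delta> b) * (b' * b')" by (simp add: algebra_simps)
      finally show ?thesis .
    qed
    then show ?thesis using b b' by (simp add: eq_fract)
  qed
  show ?thesis unfolding fract_der_def
    using b wd by (intro some_equality) blast+
qed

lemma derivation_fract_der:
  assumes d: "derivation \<delta>" shows "derivation (fract_der \<delta>)"
  unfolding derivation_def
proof (intro conjI allI)
  fix x y :: "'a fract"
  obtain a b where x: "x = Fract a b" "b \<noteq> 0" by (cases x)
  obtain a' b' where y: "y = Fract a' b'" "b' \<noteq> 0" by (cases y)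
  show "fract_der \<delta> (x + y) = fract_der \<delta> x + fract_der \<delta> y"
    using x y by (simp add: fract_der_Fract[OF d] eq_fract derivation_mult[OF d] derivation_add[OF d])
      (simp add: algebra_simps)
  show "fract_der \<delta> (x * y) = fract_der \<delta> x * y + x * fract_der \<delta> y"
    using x y by (simp add: fract_der_Fract[OF d] eq_fract derivation_mult[OF d] derivation_add[OF d])
      (simp add: algebra_simps)
qed

text \<open>Negative exponents are reached by descending induction: the product rule for
  \<open>x powi (k - 1) * x\<close> is solved for the derivative of the first factor.\<close>

lemma derivation_powi:
  fixes x :: "'a::field"
  assumes d: "derivation \<delta>" and x: "x \<noteq> 0"
  shows "\<delta> (x powi k) = of_int k * x powi (k - 1) * \<delta> x"
proof -
  have up: "\<delta> (x powi (k + 1)) = of_int (k + 1) * x powi k * \<delta> x"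
    if "\<delta> (x powi k) = of_int k * x powi (k - 1) * \<delta> x" for k
  proof -
    have "x powi (k + 1) = x powi k * x" using x by (simp add: power_int_add)
    then have "\<delta> (x powi (k+1)) = of_int k * (x powi (k - 1) * x) * \<delta> x + x powi k * \<delta> x"
      using that by (simp add: derivation_mult[OF d] algebra_simps)
    also have "x powi (k - 1) * x = x powi k" using x by (simp add: power_int_diff)
    finally show ?thesis by (simp add: algebra_simps)
  qed
  have down: "\<delta> (x powi (k - 1)) = of_int (k - 1) * x powi (k - 2) * \<delta> x"
    if "\<delta> (x powi k) = of_int k * x powi (k - 1) * \<delta> x" for k
  proof -
    have e: "x powi k = x powi (k - 1) * x" using x by (simp add: power_int_diff)
    have e2: "x powi (k - 1) = x powi (k - 2) * x" using x by (simp add: power_int_diff power2_eq_square)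
    have "of_int k * x powi (k - 1) * \<delta> x = \<delta> (x powi (k - 1)) * x + x powi (k - 1) * \<delta> x"
      using that unfolding e by (simp add: derivation_mult[OF d])
    then have "\<delta> (x powi (k - 1)) * x = of_int (k - 1) * x powi (k - 1) * \<delta> x"
      by (simp add: algebra_simps)
    also have "\<dots> = of_int (k - 1) * x powi (k - 2) * \<delta> x * x" by (simp add: e2)
    finally show ?thesis using x by simp
  qed
  show ?thesis
  proof (induction k rule: int_induct[where k = 0])
    case base
    then show ?case by (simp add: derivation_1[OF d])
  next
    case (step1 i)
    then show ?case using up by simp
  next
    case (step2 i)
    then show ?case using down[of i] by simp
  qed
qed

lemma derivation_prod_zero:
  assumes d: "derivation \<delta>" and "\<And>i. i \<in> A \<Longrightarrow> \<delta> (f i) = 0"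
  shows "\<delta> (\<Prod>i\<in>A. f i) = 0"
  using assms(2)
  by (induction A rule: infinite_finite_induct) (auto simp: derivation_1[OF d] derivation_mult[OF d])

text \<open>Subtraction of exponents is truncated. This does no harm: it truncates only where the
  exponent of j is 0, and there the coefficient is 0 too.\<close>

definition pderiv_mp :: "nat \<Rightarrow> pol \<Rightarrow> pol" where
  "pderiv_mp j f = (\<Sum>\<mu>\<in>Poly_Mapping.keys f. Poly_Mapping.single (\<mu> - Poly_Mapping.single j 1) (of_nat (Poly_Mapping.lookup \<mu> j) * Poly_Mapping.lookup f \<mu>))"

lemma pderiv_mp_superset:
  assumes "finite A" "Poly_Mapping.keys f \<subseteq> A"
  shows "pderiv_mp j f = (\<Sum>\<mu>\<in>A. Poly_Mapping.single (\<mu> - Poly_Mapping.single j 1) (of_nat (Poly_Mapping.lookup \<mu> j) * Poly_Mapping.lookup f \<mu>))"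
  unfolding pderiv_mp_def using assms
  by (intro sum.mono_neutral_left) (auto simp: in_keys_iff)

lemma pderiv_mp_add: "pderiv_mp j (f + g) = pderiv_mp j f + pderiv_mp j g"
proof -
  let ?A = "Poly_Mapping.keys f \<union> Poly_Mapping.keys g"
  have "Poly_Mapping.keys (f + g) \<subseteq> ?A" by (rule Poly_Mapping.keys_add)
  then show ?thesis
    by (simp add: pderiv_mp_superset[of ?A] lookup_add algebra_simps single_add sum.distrib)
qed

lemma pderiv_mp_single:
  "pderiv_mp j (Poly_Mapping.single \<mu> c) = Poly_Mapping.single (\<mu> - Poly_Mapping.single j 1) (of_nat (Poly_Mapping.lookup \<mu> j) * c)"
  by (simp add: pderiv_mp_superset[of "{\<mu>}"])

text \<open>The Leibniz rule is checked on pairs of monomials and extended additively in each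
  factor. Truncated subtraction moves past an addition only if the exponent is nonzero; in the other
  case both sides have coefficient 0.\<close>

lemma derivation_pderiv_mp: "derivation (pderiv_mp j)"
  unfolding derivation_def
proof (intro conjI allI)
  fix f g show "pderiv_mp j (f + g) = pderiv_mp j f + pderiv_mp j g" by (rule pderiv_mp_add)
  have shift: "\<mu> - Poly_Mapping.single j 1 + \<nu> = \<mu> + \<nu> - Poly_Mapping.single j (1::nat)" if "Poly_Mapping.lookup \<mu> j \<noteq> 0" for \<mu> \<nu>
    using that by (intro poly_mapping_eqI) (auto simp: lookup_add lookup_minus lookup_single when_def)
  have ss: "pderiv_mp j (Poly_Mapping.single \<mu> c * Poly_Mapping.single \<nu> d) =
     pderiv_mp j (Poly_Mapping.single \<mu> c) * Poly_Mapping.single \<nu> d + Poly_Mapping.single \<mu> c * pderiv_mp j (Poly_Mapping.single \<nu> d)"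
    for \<mu> \<nu> c d
  proof -
    have "Poly_Mapping.single (\<mu> - Poly_Mapping.single j 1 + \<nu>) (of_nat (Poly_Mapping.lookup \<mu> j) * (c * d)) =
        Poly_Mapping.single (\<mu> + \<nu> - Poly_Mapping.single j 1) (of_nat (Poly_Mapping.lookup \<mu> j) * (c * d))"
      using shift[of \<mu> \<nu>] by (cases "Poly_Mapping.lookup \<mu> j = 0") auto
    moreover have "Poly_Mapping.single (\<mu> + (\<nu> - Poly_Mapping.single j 1)) (of_nat (Poly_Mapping.lookup \<nu> j) * (c * d)) =
        Poly_Mapping.single (\<mu> + \<nu> - Poly_Mapping.single j 1) (of_nat (Poly_Mapping.lookup \<nu> j) * (c * d))"
      using shift[of \<nu> \<mu>] by (cases "Poly_Mapping.lookup \<nu> j = 0") (auto simp: add.commute)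
    ultimately show ?thesis
      by (simp add: pderiv_mp_single mult_single lookup_add single_add[symmetric] algebra_simps)
  qed
  have s: "pderiv_mp j (Poly_Mapping.single \<mu> c * g) =
     pderiv_mp j (Poly_Mapping.single \<mu> c) * g + Poly_Mapping.single \<mu> c * pderiv_mp j g" for \<mu> c g
  proof (induction g rule: poly_mapping_add_induct)
    case (single k d)
    show ?case by (rule ss)
  next
    case (add g h)
    then show ?case by (simp add: distrib_left pderiv_mp_add)
  qed
  show "pderiv_mp j (f * g) = pderiv_mp j f * g + f * pderiv_mp j g"
  proof (induction f rule: poly_mapping_add_induct)
    case (single k d)
    show ?case by (rule s)
  next
    case (add f h)
    then show ?case by (simp add: distrib_right pderiv_mp_add)
  qed
qed

definition kder :: "nat \<Rightarrow> rat_fun \<Rightarrow> rat_fun" where "kder j = fract_der (pderiv_mp j)"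
definition emb :: "pol \<Rightarrow> rat_fun" where "emb a = Fract a 1"
definition kconst :: "complex \<Rightarrow> rat_fun" where "kconst c = emb (Poly_Mapping.single 0 c)"
definition varp :: "nat \<Rightarrow> pol" where "varp i = Poly_Mapping.single (Poly_Mapping.single i 1) 1"
definition kvar :: "nat \<Rightarrow> rat_fun" where "kvar i = emb (varp i)"

lemma derivation_kder: "derivation (kder j)"
  unfolding kder_def by (intro derivation_fract_der derivation_pderiv_mp)

lemmas kder_add = derivation_add[OF derivation_kder]
lemmas kder_mult = derivation_mult[OF derivation_kder]

lemma emb_add: "emb (a + b) = emb a + emb b" and emb_mult: "emb (a * b) = emb a * emb b"
  and emb_minus: "emb (a - b) = emb a - emb b"
  and emb_0 [simp]: "emb 0 = 0" and emb_1 [simp]: "emb 1 = 1"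
  and emb_eq_iff [simp]: "emb a = emb b \<longleftrightarrow> a = b"
  by (simp_all add: emb_def eq_fract fract_collapse)

lemma emb_eq_0_iff [simp]: "emb a = 0 \<longleftrightarrow> a = 0"
  using emb_eq_iff[of a 0] by (simp del: emb_eq_iff)

lemma emb_sum: "emb (\<Sum>i\<in>A. f i) = (\<Sum>i\<in>A. emb (f i))"
  by (induction A rule: infinite_finite_induct) (simp_all add: emb_add)

lemma emb_power: "emb (a ^ k) = emb a ^ k"
  by (induction k) (simp_all add: emb_mult)

lemma emb_prod: "emb (\<Prod>i\<in>A. f i) = (\<Prod>i\<in>A. emb (f i))"
  by (induction A rule: infinite_finite_induct) (simp_all add: emb_mult)

lemma Fract_eq_emb: "Fract a b = emb a / emb b"
  by (cases "b = 0") (simp_all add: emb_def fract_collapse)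

lemma kder_emb: "kder j (emb a) = emb (pderiv_mp j a)"
  by (simp add: kder_def emb_def fract_der_Fract derivation_pderiv_mp derivation_1)

lemma single_eq_0_iff: "Poly_Mapping.single k c = 0 \<longleftrightarrow> c = 0"
proof
  assume "Poly_Mapping.single k c = 0"
  then have "Poly_Mapping.lookup (Poly_Mapping.single k c) k = 0" by (simp only: lookup_zero)
  then show "c = 0" by simp
qed simp

lemma kconst_add: "kconst (a + b) = kconst a + kconst b"
  by (simp add: kconst_def single_add emb_add)

lemma kconst_mult: "kconst (a * b) = kconst a * kconst b"
  by (simp add: kconst_def emb_mult[symmetric] mult_single)

lemma kconst_minus: "kconst (a - b) = kconst a - kconst b"
  by (simp add: kconst_def single_diff emb_minus)

lemma kconst_0 [simp]: "kconst 0 = 0"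
  by (simp add: kconst_def)

lemma kconst_1 [simp]: "kconst 1 = 1"
  by (simp add: kconst_def)

lemma kconst_eq_0_iff [simp]: "kconst a = 0 \<longleftrightarrow> a = 0"
  by (simp add: kconst_def single_eq_0_iff)

lemma kconst_uminus: "kconst (- a) = - kconst a"
  using kconst_minus[of 0 a] by simp

lemma kconst_of_nat: "kconst (of_nat k) = of_nat k"
  by (induction k) (simp_all add: kconst_add)

lemma kconst_of_int: "kconst (of_int k) = of_int k"
  by (cases k) (simp_all add: kconst_of_nat kconst_uminus kconst_minus)

lemma kder_kconst: "kder j (kconst c) = 0"
  by (simp add: kconst_def kder_emb pderiv_mp_single)

lemma kder_kconst_mult: "kder j (kconst c * g) = kconst c * kder j g"
  by (simp add: kder_mult kder_kconst)

lemma kvar_nz [simp]: "kvar i \<noteq> 0"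
proof -
  have "Poly_Mapping.lookup (varp i) (Poly_Mapping.single i 1) \<noteq> 0" by (simp add: varp_def)
  then have "varp i \<noteq> 0" by (metis lookup_zero)
  then show ?thesis by (simp add: kvar_def)
qed

lemma kder_kvar: "kder j (kvar i) = (if i = j then 1 else 0)"
  by (auto simp: kvar_def kder_emb varp_def pderiv_mp_single lookup_single when_def)

definition mon :: "nat \<Rightarrow> (nat \<Rightarrow> int) \<Rightarrow> rat_fun" where
  "mon n \<mu> = (\<Prod>i\<in>{1..n+1}. kvar i powi \<mu> i)"

definition unit_at :: "nat \<Rightarrow> nat \<Rightarrow> int" where "unit_at j i = (if i = j then 1 else 0)"

lemma mon_nz [simp]: "mon n \<mu> \<noteq> 0"
  by (simp add: mon_def)

lemma mon_add: "mon n (\<lambda>i. \<mu> i + \<nu> i) = mon n \<mu> * mon n \<nu>"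
  by (simp add: mon_def power_int_add prod.distrib)

lemma mon_0: "mon n (\<lambda>_. 0) = 1"
  by (simp add: mon_def)

lemma mon_unit: "j \<in> {1..n+1} \<Longrightarrow> mon n (unit_at j) = kvar j"
proof -
  assume j: "j \<in> {1..n+1}"
  have "mon n (unit_at j) = (\<Prod>i\<in>{1..n+1}. if i = j then kvar i else 1)"
    unfolding mon_def by (intro prod.cong) (auto simp: unit_at_def)
  then show ?thesis using j by (simp add: prod.delta)
qed

lemma kder_mon:
  assumes j: "j \<in> {1..n+1}"
  shows "kder j (mon n \<mu>) = of_int (\<mu> j) * mon n (\<lambda>i. \<mu> i - unit_at j i)"
proof -
  define B where "B = {1..n+1} - {j}"
  have split: "mon n \<kappa> = kvar j powi \<kappa> j * (\<Prod>i\<in>B. kvar i powi \<kappa> i)" for \<kappa>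
    using j unfolding mon_def B_def by (subst prod.remove[of _ j]) auto
  have z: "kder j (\<Prod>i\<in>B. kvar i powi \<mu> i) = 0"
    by (rule derivation_prod_zero[OF derivation_kder])
      (auto simp: derivation_powi[OF derivation_kder] kder_kvar B_def)
  have e: "(\<Prod>i\<in>B. kvar i powi (\<mu> i - unit_at j i)) = (\<Prod>i\<in>B. kvar i powi \<mu> i)"
    by (rule prod.cong) (auto simp: unit_at_def B_def)
  have "kder j (mon n \<mu>) = of_int (\<mu> j) * kvar j powi (\<mu> j - 1) * (\<Prod>i\<in>B. kvar i powi \<mu> i)"
    unfolding split[of \<mu>] kder_mult z by (simp add: derivation_powi[OF derivation_kder] kder_kvar)
  also have "\<dots> = of_int (\<mu> j) * mon n (\<lambda>i. \<mu> i - unit_at j i)"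
    unfolding split[of "\<lambda>i. \<mu> i - unit_at j i"] e by (simp add: unit_at_def)
  finally show ?thesis .
qed

section \<open>Algebraic differential operators of finite order\<close>

text \<open>Grothendieck's recursion on a commutative ring. \<open>A\<close> and \<open>M\<close>
  are mere subsets, so that one notion covers operators on fractions of degree l over fractions of
  degree 0 and operators on the whole function field.\<close>

primrec dop :: "'a::comm_ring_1 set \<Rightarrow> 'a set \<Rightarrow> nat \<Rightarrow> ('a \<Rightarrow> 'a) \<Rightarrow> bool" where
  "dop A M 0 F \<longleftrightarrow> (\<forall>f\<in>A. \<forall>g\<in>M. F (f * g) = f * F g)"
| "dop A M (Suc k) F \<longleftrightarrow> (\<forall>f\<in>A. dop A M k (\<lambda>g. F (f * g) - f * F g))"

lemma dop_antimono: "dop A M k F \<Longrightarrow> B \<subseteq> A \<Longrightarrow> N \<subseteq> M \<Longrightarrow> dop B N k F"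
proof (induction k arbitrary: F)
  case 0
  then show ?case by auto
next
  case (Suc k)
  have "dop B N k (\<lambda>g. F (f * g) - f * F g)" if "f \<in> B" for f
    using Suc.IH[of "\<lambda>g. F (f * g) - f * F g"] Suc.prems that by auto
  then show ?case by simp
qed

lemma dop_zero: "dop A M k (\<lambda>g. 0)"
  by (induction k) auto

text \<open>In the base case the commutator with f has to be linear over \<open>A\<close>, and this
  involves the values of F at products f' g; hence the requirement that \<open>A\<close> maps
  \<open>M\<close> to itself.\<close>

lemma dop_Suc_on:
  assumes cl: "\<And>f g. f \<in> A \<Longrightarrow> g \<in> M \<Longrightarrow> f * g \<in> M"
  shows "dop A M k F \<Longrightarrow> dop A M (Suc k) F"
proof (induction k arbitrary: F)
  case 0
  have e: "F (f * g) = f * F g" if "f \<in> A" "g \<in> M" for f g using 0[unfolded dop.simps] that by blast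
  show ?case unfolding dop.simps
    by (intro ballI) (simp add: e cl)
next
  case (Suc k)
  show ?case unfolding dop.simps(2)[of _ _ "Suc k"]
    by (intro ballI) (rule Suc.IH, rule Suc.prems[unfolded dop.simps(2), rule_format])
qed

lemma dop_mono_on:
  assumes cl: "\<And>f g. f \<in> A \<Longrightarrow> g \<in> M \<Longrightarrow> f * g \<in> M" and "dop A M k F" "k \<le> m"
  shows "dop A M m F"
  using assms(3)
proof (induction m rule: dec_induct)
  case base
  show ?case by (rule assms(2))
next
  case (step m)
  show ?case by (rule dop_Suc_on[OF cl step.IH])
qed

lemma dop_mono: "dop UNIV UNIV k F \<Longrightarrow> k \<le> m \<Longrightarrow> dop UNIV UNIV m F"
  by (rule dop_mono_on) simp_all

lemma dop_add: "dop A M k F \<Longrightarrow> dop A M k G \<Longrightarrow> dop A M k (\<lambda>g. F g + G g)"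
proof (induction k arbitrary: F G)
  case 0
  then show ?case by (auto simp only: dop.simps distrib_left)
next
  case (Suc k)
  have "dop A M k (\<lambda>g. (F (f * g) - f * F g) + (G (f * g) - f * G g))" if "f \<in> A" for f
    using Suc.IH Suc.prems that by (simp only: dop.simps)
  moreover have "(F (f * g) - f * F g) + (G (f * g) - f * G g) = F (f * g) + G (f * g) - f * (F g + G g)" for f g
    by (simp add: algebra_simps)
  ultimately show ?case by (simp only: dop.simps) blast
qed

lemma dop_scale: "dop A M k F \<Longrightarrow> dop A M k (\<lambda>g. c * F g)"
proof (induction k arbitrary: F)
  case 0
  then show ?case by (auto simp only: dop.simps mult.left_commute)
next
  case (Suc k)
  have "dop A M k (\<lambda>g. c * (F (f * g) - f * F g))" if "f \<in> A" for f
    using Suc.IH Suc.prems that by (simp only: dop.simps)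
  moreover have "c * (F (f * g) - f * F g) = c * F (f * g) - f * (c * F g)" for f g
    by (simp add: algebra_simps)
  ultimately show ?case by (simp only: dop.simps) blast
qed

text \<open>The commutator of the composite with f is F [G, f] + [F, f] G. Each term has total order
  smaller by one, or vanishes if the commuted factor has order 0.\<close>

lemma dop_comp:
  assumes "dop UNIV UNIV j F" and "dop UNIV UNIV k G"
    and F: "\<And>x y. F (x - y) = F x - F y" and "\<And>x y. G (x - y) = G x - G y"
  shows "dop UNIV UNIV (j + k) (\<lambda>g. F (G g))"
  using assms
proof (induction "j + k" arbitrary: j k F G rule: less_induct)
  case less
  let ?c = "\<lambda>H f g. H (f * g) - f * H g"
  have z: "?c H f = (\<lambda>g. 0)" if "dop UNIV UNIV 0 H" for H :: "'a \<Rightarrow> 'a" and f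
    by (intro ext) (simp only: that[unfolded dop.simps, rule_format, OF UNIV_I UNIV_I] diff_self)
  have minus: "?c H f (x - y) = ?c H f x - ?c H f y" if "\<And>x y. H (x - y) = H x - H y"
    for H :: "'a \<Rightarrow> 'a" and f x y
    by (simp add: right_diff_distrib that)
  have split: "?c (\<lambda>g. F (G g)) f = (\<lambda>g. F (?c G f g) + ?c F f (G g))" for f
    by (rule ext) (simp add: less.prems(3))
  have F0: "F 0 = 0" using less.prems(3)[of 0 0] by simp
  have 1: "dop UNIV UNIV (j + k - 1) (\<lambda>g. F (?c G f g))" for f
  proof (cases k)
    case 0
    then have e: "?c G f = (\<lambda>g. 0)" using z[of G f] less.prems(2) by blast
    have "F (?c G f g) = 0" for g by (simp only: fun_cong[OF e, of g] F0)
    then show ?thesis by (simp only: dop_zero)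
  next
    case (Suc k')
    have "dop UNIV UNIV (j + k') (\<lambda>g. F (?c G f g))"
    proof (rule less.hyps[where j = j and k = k' and F = F and G = "?c G f"])
      show "j + k' < j + k" using Suc by simp
      show "dop UNIV UNIV k' (?c G f)"
        by (rule less.prems(2)[unfolded Suc dop.simps, rule_format, OF UNIV_I])
    qed (fact less.prems minus[OF less.prems(4)])+
    then show ?thesis by (simp only: Suc add_Suc_right diff_Suc_1)
  qed
  have 2: "dop UNIV UNIV (j + k - 1) (\<lambda>g. ?c F f (G g))" for f
  proof (cases j)
    case 0
    then have e: "?c F f = (\<lambda>g. 0)" using z[of F f] less.prems(1) by blast
    have "?c F f (G g) = 0" for g using fun_cong[OF e, of "G g"] .
    then show ?thesis by (simp only: dop_zero)
  next
    case (Suc j')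
    have "dop UNIV UNIV (j' + k) (\<lambda>g. ?c F f (G g))"
    proof (rule less.hyps[where j = j' and k = k and F = "?c F f" and G = G])
      show "j' + k < j + k" using Suc by simp
      show "dop UNIV UNIV j' (?c F f)"
        by (rule less.prems(1)[unfolded Suc dop.simps, rule_format, OF UNIV_I])
    qed (fact less.prems minus[OF less.prems(3)])+
    then show ?thesis by (simp only: Suc add_Suc diff_Suc_1)
  qed
  show ?case
  proof (cases "j + k")
    case 0
    then have j: "j = 0" and k: "k = 0" by auto
    note FG = less.prems(1)[unfolded j dop.simps, rule_format, OF UNIV_I UNIV_I]
      less.prems(2)[unfolded k dop.simps, rule_format, OF UNIV_I UNIV_I]
    show ?thesis unfolding 0 dop.simps by (intro ballI) (subst FG(2), rule FG(1))
  next
    case (Suc m)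
    have "dop UNIV UNIV m (?c (\<lambda>g. F (G g)) f)" for f
      unfolding split using dop_add[OF 1 2] by (simp only: Suc diff_Suc_1)
    then show ?thesis unfolding Suc dop.simps by (intro ballI)
  qed
qed

lemma dop_mult: "dop UNIV UNIV 0 (\<lambda>g. c * g)"
  by (simp add: dop.simps mult.left_commute)

lemma dop_derivation: "derivation \<delta> \<Longrightarrow> dop UNIV UNIV 1 \<delta>"
  by (simp add: dop.simps derivation_mult algebra_simps)

section \<open>The graded algebra and its points\<close>

abbreviation "wcar n \<equiv> carrier (wpoly_alg n)"

definition wvar :: "nat \<Rightarrow> nat \<Rightarrow> int" where "wvar n j = (if j = n + 1 then 2 else 1)"

lemma wcar_iff: "f \<in> wcar n \<longleftrightarrow> (\<forall>\<mu>\<in>Poly_Mapping.keys f. Poly_Mapping.keys \<mu> \<subseteq> {1..n+1})"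
  by (simp add: wpoly_alg_def)

lemma wpoly_alg_simps [simp]:
  "mult (wpoly_alg n) = (*)" "one (wpoly_alg n) = 1" "zero (wpoly_alg n) = 0"
  "add (wpoly_alg n) = (+)" "smult (wpoly_alg n) = (\<lambda>c f. Poly_Mapping.single 0 c * f)"
  by (simp_all add: wpoly_alg_def)

lemma keys_add_nat: "Poly_Mapping.keys (\<mu> + \<nu>) = Poly_Mapping.keys \<mu> \<union> Poly_Mapping.keys (\<nu> :: nat \<Rightarrow>\<^sub>0 nat)"
  by (auto simp: in_keys_iff lookup_add)

lemma wcar_0 [simp]: "0 \<in> wcar n" and wcar_1 [simp]: "1 \<in> wcar n"
  and wcar_const [simp]: "Poly_Mapping.single 0 c \<in> wcar n"
  by (auto simp: wcar_iff single_one[symmetric] simp del: single_one)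

lemma wcar_add: "f \<in> wcar n \<Longrightarrow> g \<in> wcar n \<Longrightarrow> f + g \<in> wcar n"
  using Poly_Mapping.keys_add[of f g] unfolding wcar_iff by blast

lemma wcar_mult: "f \<in> wcar n \<Longrightarrow> g \<in> wcar n \<Longrightarrow> f * g \<in> wcar n"
  using keys_mult[of f g] unfolding wcar_iff by (fastforce simp: keys_add_nat)

lemma wcar_uminus: "f \<in> wcar n \<Longrightarrow> - f \<in> wcar n"
  using wcar_mult[OF wcar_const[of "-1" n], of f] by (simp add: single_uminus)

lemma cring_wpoly: "cring (wpoly_alg n)"
proof (rule cringI)
  show "abelian_group (wpoly_alg n)"
  proof (rule abelian_groupI)
    fix x assume "x \<in> wcar n"
    then show "\<exists>y\<in>wcar n. y \<oplus>\<^bsub>wpoly_alg n\<^esub> x = \<zero>\<^bsub>wpoly_alg n\<^esub>"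
      using wcar_uminus by (intro bexI[of _ "- x"]) auto
  qed (auto simp: wcar_add add_ac)
  show "Group.comm_monoid (wpoly_alg n)"
    by (rule comm_monoidI) (auto simp: wcar_mult mult_ac)
qed (simp add: distrib_right)

lemma ring_wpoly: "ring (wpoly_alg n)"
  using cring_wpoly by (rule cring.axioms(1))

text \<open>The locale conditions are reduced to plain closure properties; additive inverses come
  from multiplication by the constant -1.\<close>

lemma ideal_wpoly_iff:
  "ideal J (wpoly_alg n) \<longleftrightarrow> J \<subseteq> wcar n \<and> 0 \<in> J \<and> (\<forall>a\<in>J. \<forall>b\<in>J. a + b \<in> J) \<and> (\<forall>a\<in>J. \<forall>s\<in>wcar n. s * a \<in> J)"
proof
  assume J: "ideal J (wpoly_alg n)"
  interpret ideal J "wpoly_alg n" by fact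
  show "J \<subseteq> wcar n \<and> 0 \<in> J \<and> (\<forall>a\<in>J. \<forall>b\<in>J. a + b \<in> J) \<and> (\<forall>a\<in>J. \<forall>s\<in>wcar n. s * a \<in> J)"
  proof (intro conjI ballI)
    show "J \<subseteq> wcar n" by (rule a_subset)
    show "0 \<in> J" using additive_subgroup.zero_closed[OF additive_subgroup_axioms] by (simp only: wpoly_alg_simps)
    fix a assume a: "a \<in> J"
    show "a + b \<in> J" if "b \<in> J" for b
      using additive_subgroup.a_closed[OF additive_subgroup_axioms a that] by (simp only: wpoly_alg_simps)
    show "s * a \<in> J" if "s \<in> wcar n" for s
      using I_l_closed[OF a that] by (simp only: wpoly_alg_simps)
  qed
next
  assume J: "J \<subseteq> wcar n \<and> 0 \<in> J \<and> (\<forall>a\<in>J. \<forall>b\<in>J. a + b \<in> J) \<and> (\<forall>a\<in>J. \<forall>s\<in>wcar n. s * a \<in> J)"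
  show "ideal J (wpoly_alg n)"
  proof (rule idealI)
    show "ring (wpoly_alg n)" by (rule ring_wpoly)
    interpret ring "wpoly_alg n" by (rule ring_wpoly)
    show "subgroup J (add_monoid (wpoly_alg n))"
    proof (rule group.subgroupI)
      show "Group.group (add_monoid (wpoly_alg n))" by (rule a_group)
      fix a assume a: "a \<in> J"
      have "\<ominus>\<^bsub>wpoly_alg n\<^esub> a = - a"
        by (rule minus_equality) (use a J wcar_uminus in auto)
      moreover have "- 1 * a \<in> J"
        using J a wcar_uminus[OF wcar_1] by blast
      ultimately show "inv\<^bsub>add_monoid (wpoly_alg n)\<^esub> a \<in> J"
        by (simp only: a_inv_def[symmetric] mult_minus1)
    qed (use J in auto)
  qed (use J in \<open>auto simp: mult.commute\<close>)
qed

lemma ideal_wpoly_add: "ideal J (wpoly_alg n) \<Longrightarrow> a \<in> J \<Longrightarrow> b \<in> J \<Longrightarrow> a + b \<in> J"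
  and ideal_wpoly_mult: "ideal J (wpoly_alg n) \<Longrightarrow> a \<in> J \<Longrightarrow> s \<in> wcar n \<Longrightarrow> s * a \<in> J"
  and ideal_wpoly_0: "ideal J (wpoly_alg n) \<Longrightarrow> 0 \<in> J"
  and ideal_wpoly_car: "ideal J (wpoly_alg n) \<Longrightarrow> J \<subseteq> wcar n"
  by (simp_all add: ideal_wpoly_iff)

lemma genideal_wpoly_le: "ideal J (wpoly_alg n) \<Longrightarrow> X \<subseteq> J \<Longrightarrow> Idl\<^bsub>wpoly_alg n\<^esub> X \<subseteq> J"
  by (auto simp: genideal_def)

lemma genideal_wpoly: "X \<subseteq> wcar n \<Longrightarrow> ideal (Idl\<^bsub>wpoly_alg n\<^esub> X) (wpoly_alg n)"
  by (rule ring.genideal_ideal[OF ring_wpoly])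

lemma genideal_wpoly_ge: "X \<subseteq> Idl\<^bsub>wpoly_alg n\<^esub> X"
  by (auto simp: genideal_def)

lemma ideal_wpoly_sum: "ideal J (wpoly_alg n) \<Longrightarrow> (\<And>i. i \<in> A \<Longrightarrow> f i \<in> J) \<Longrightarrow> (\<Sum>i\<in>A. f i) \<in> J"
  by (induction A rule: infinite_finite_induct) (simp_all add: ideal_wpoly_0 ideal_wpoly_add)

lemma ideal_wpoly_minus: "ideal J (wpoly_alg n) \<Longrightarrow> a \<in> J \<Longrightarrow> b \<in> J \<Longrightarrow> a - b \<in> J"
proof -
  assume J: "ideal J (wpoly_alg n)" "a \<in> J" "b \<in> J"
  have "a + - 1 * b \<in> J"
    by (intro ideal_wpoly_add[OF J(1,2)] ideal_wpoly_mult[OF J(1,3)] wcar_uminus wcar_1)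
  then show ?thesis by simp
qed

section \<open>The grading and homogeneous components\<close>

abbreviation "G \<equiv> wpoly_part"

lemma G_iff: "f \<in> G n d \<longleftrightarrow> f \<in> wcar n \<and> (\<forall>\<mu>\<in>Poly_Mapping.keys f. int (wdeg n \<mu>) = d)"
  by (simp add: wpoly_part_def)

lemma G_car: "f \<in> G n d \<Longrightarrow> f \<in> wcar n"
  by (simp add: G_iff)

lemma wdeg_add: "wdeg n (\<mu> + \<nu>) = wdeg n \<mu> + wdeg n \<nu>"
  by (simp add: wdeg_def lookup_add sum.distrib)

lemma G_0 [simp]: "0 \<in> G n d" by (simp add: G_iff)

lemma G_const [simp]: "Poly_Mapping.single 0 c \<in> G n 0"
  by (auto simp: G_iff wdeg_def)

lemma G_1 [simp]: "1 \<in> G n 0"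
  using G_const[of 1 n] by simp

lemma G_add: "f \<in> G n d \<Longrightarrow> g \<in> G n d \<Longrightarrow> f + g \<in> G n d"
  using Poly_Mapping.keys_add[of f g] by (auto simp: G_iff wcar_add)

lemma G_mult: "f \<in> G n d \<Longrightarrow> g \<in> G n e \<Longrightarrow> f * g \<in> G n (d + e)"
  using keys_mult[of f g] by (fastforce simp: G_iff wcar_mult wdeg_add)

lemma G_uminus: "f \<in> G n d \<Longrightarrow> - f \<in> G n d"
  using G_mult[OF G_const[of "-1" n], of f d] by (simp add: single_uminus)

lemma G_minus: "f \<in> G n d \<Longrightarrow> g \<in> G n d \<Longrightarrow> f - g \<in> G n d"
  using G_add[of f n d "- g"] G_uminus[of g n d] by simp

lemma G_sum: "(\<And>i. i \<in> A \<Longrightarrow> f i \<in> G n d) \<Longrightarrow> (\<Sum>i\<in>A. f i) \<in> G n d"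
  by (induction A rule: infinite_finite_induct) (auto simp: G_add)

lemma G_power: "f \<in> G n d \<Longrightarrow> f ^ k \<in> G n (int k * d)"
proof (induction k)
  case (Suc k)
  then show ?case using G_mult[of f n d "f ^ k" "int k * d"] by (simp add: algebra_simps)
qed simp

lemma wdeg_single: "j \<in> {1..n+1} \<Longrightarrow> int (wdeg n (Poly_Mapping.single j k)) = wvar n j * int k"
  by (auto simp: wdeg_def wvar_def lookup_single when_def sum.delta)

lemma varp_G: "j \<in> {1..n+1} \<Longrightarrow> varp j \<in> G n (wvar n j)"
  by (auto simp: G_iff wcar_iff varp_def wdeg_single simp del: One_nat_def)

lemma varp_nz [simp]: "varp j \<noteq> 0"
  by (simp add: varp_def single_eq_0_iff)

lemma pderiv_mp_G:
  assumes "f \<in> G n d" and j: "j \<in> {1..n+1}"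
  shows "pderiv_mp j f \<in> G n (d - wvar n j)"
  unfolding pderiv_mp_def
proof (rule G_sum)
  fix \<mu> assume m: "\<mu> \<in> Poly_Mapping.keys f"
  show "Poly_Mapping.single (\<mu> - Poly_Mapping.single j 1) (of_nat (Poly_Mapping.lookup \<mu> j) * Poly_Mapping.lookup f \<mu>) \<in> G n (d - wvar n j)"
  proof (cases "Poly_Mapping.lookup \<mu> j = 0")
    case False
    have e: "\<mu> - Poly_Mapping.single j 1 + Poly_Mapping.single j 1 = \<mu>"
      by (rule poly_mapping_eqI) (use False in \<open>auto simp: lookup_add lookup_minus lookup_single when_def\<close>)
    have "int (wdeg n (\<mu> - Poly_Mapping.single j 1)) + wvar n j = int (wdeg n \<mu>)"
      using arg_cong[OF e, of "\<lambda>x. int (wdeg n x)"] wdeg_single[OF j, of 1] by (simp add: wdeg_add)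
    moreover have "Poly_Mapping.keys (\<mu> - Poly_Mapping.single j 1) \<subseteq> Poly_Mapping.keys \<mu>"
      by (auto simp: in_keys_iff lookup_minus)
    ultimately show ?thesis using assms m by (auto simp: G_iff wcar_iff)
  qed simp
qed

definition hcomp :: "nat \<Rightarrow> int \<Rightarrow> pol \<Rightarrow> pol" where
  "hcomp n d f = (\<Sum>\<mu>\<in>{\<mu>\<in>Poly_Mapping.keys f. int (wdeg n \<mu>) = d}. Poly_Mapping.single \<mu> (Poly_Mapping.lookup f \<mu>))"

lemma lookup_hcomp: "Poly_Mapping.lookup (hcomp n d f) \<mu> = (if int (wdeg n \<mu>) = d then Poly_Mapping.lookup f \<mu> else 0)"
  by (auto simp: hcomp_def lookup_sum lookup_single when_def sum.delta in_keys_iff)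

lemma hcomp_add: "hcomp n d (f + g) = hcomp n d f + hcomp n d g"
  by (rule poly_mapping_eqI) (simp add: lookup_hcomp lookup_add)

lemma hcomp_0 [simp]: "hcomp n d 0 = 0"
  by (rule poly_mapping_eqI) (simp add: lookup_hcomp)

lemma hcomp_sum: "hcomp n d (\<Sum>i\<in>A. f i) = (\<Sum>i\<in>A. hcomp n d (f i))"
  by (induction A rule: infinite_finite_induct) (auto simp: hcomp_add)

lemma hcomp_G: "f \<in> wcar n \<Longrightarrow> hcomp n d f \<in> G n d"
  by (auto simp: G_iff wcar_iff in_keys_iff lookup_hcomp split: if_splits)

lemma hcomp_of_G: "f \<in> G n e \<Longrightarrow> hcomp n d f = (if d = e then f else 0)"
  by (rule poly_mapping_eqI) (auto simp: lookup_hcomp G_iff in_keys_iff)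

lemma hcomp_decomp:
  assumes "finite D" "(\<lambda>\<mu>. int (wdeg n \<mu>)) ` Poly_Mapping.keys f \<subseteq> D"
  shows "f = (\<Sum>d\<in>D. hcomp n d f)"
proof (rule poly_mapping_eqI)
  fix k
  have "int (wdeg n k) \<in> D" if "Poly_Mapping.lookup f k \<noteq> 0"
    using that assms(2) by (auto simp: in_keys_iff[symmetric])
  then show "Poly_Mapping.lookup f k = Poly_Mapping.lookup (\<Sum>d\<in>D. hcomp n d f) k"
    using assms(1) by (auto simp: lookup_sum lookup_hcomp sum.delta)
qed

lemma hcomp_mult_G:
  assumes s: "s \<in> G n e"
  shows "hcomp n d (s * b) = s * hcomp n (d - e) b"
proof (induction b rule: poly_mapping_add_induct)
  case (add f g)
  then show ?case by (simp add: distrib_left hcomp_add)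
next
  case (single k c)
  have ks: "Poly_Mapping.keys (s * Poly_Mapping.single k c) \<subseteq> {a + b |a b. a \<in> Poly_Mapping.keys s \<and> b \<in> Poly_Mapping.keys (Poly_Mapping.single k c)}"
    by (rule keys_mult)
  have 1: "hcomp n d (s * Poly_Mapping.single k c) = (if int (wdeg n k) + e = d then s * Poly_Mapping.single k c else 0)"
  proof (rule poly_mapping_eqI)
    fix \<mu>
    show "Poly_Mapping.lookup (hcomp n d (s * Poly_Mapping.single k c)) \<mu> =
      Poly_Mapping.lookup (if int (wdeg n k) + e = d then s * Poly_Mapping.single k c else 0) \<mu>"
    proof (cases "\<mu> \<in> Poly_Mapping.keys (s * Poly_Mapping.single k c)")
      case True
      then obtain a where "a \<in> Poly_Mapping.keys s" "\<mu> = a + k" using ks by (auto split: if_splits)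
      then have "int (wdeg n \<mu>) = int (wdeg n k) + e" using s by (auto simp: G_iff wdeg_add)
      then show ?thesis by (auto simp: lookup_hcomp)
    qed (auto simp: lookup_hcomp in_keys_iff)
  qed
  have 2: "hcomp n (d - e) (Poly_Mapping.single k c) = (if int (wdeg n k) + e = d then Poly_Mapping.single k c else 0)"
    by (rule poly_mapping_eqI) (auto simp: lookup_hcomp lookup_single when_def)
  show ?case unfolding 1 2 by simp
qed

section \<open>Homogeneous ideals and the points of Proj\<close>

text \<open>Closure under components is easy to verify for the ideals constructed below;
  \<open>hom_ideal_gen\<close> recovers generation by homogeneous elements, the form in which points
  are defined.\<close>

definition hom_ideal :: "nat \<Rightarrow> pol set \<Rightarrow> bool" where
  "hom_ideal n I \<longleftrightarrow> ideal I (wpoly_alg n) \<and> (\<forall>b\<in>I. \<forall>d. hcomp n d b \<in> I)"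

abbreviation "hmg n \<equiv> proj.homog (wpoly_part n)"
abbreviation "pts n \<equiv> proj.points (wpoly_alg n) (wpoly_part n)"
abbreviation "zop n \<equiv> proj.zopen (wpoly_alg n) (wpoly_part n)"

lemma hmg_iff: "f \<in> hmg n \<longleftrightarrow> (\<exists>d. f \<in> G n d)"
  by (simp add: proj.homog_def)

lemma hom_ideal_gen: "hom_ideal n I \<Longrightarrow> I = Idl\<^bsub>wpoly_alg n\<^esub> (I \<inter> hmg n)"
proof
  assume I: "hom_ideal n I"
  then have id: "ideal I (wpoly_alg n)" by (simp add: hom_ideal_def)
  show "Idl\<^bsub>wpoly_alg n\<^esub> (I \<inter> hmg n) \<subseteq> I" by (rule genideal_wpoly_le[OF id]) auto
  have id': "ideal (Idl\<^bsub>wpoly_alg n\<^esub> (I \<inter> hmg n)) (wpoly_alg n)"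
    by (rule genideal_wpoly) (use id in \<open>auto simp: ideal_wpoly_iff\<close>)
  show "I \<subseteq> Idl\<^bsub>wpoly_alg n\<^esub> (I \<inter> hmg n)"
  proof
    fix b assume b: "b \<in> I"
    let ?D = "(\<lambda>\<mu>. int (wdeg n \<mu>)) ` Poly_Mapping.keys b"
    have bc: "b \<in> wcar n" using b id by (auto simp: ideal_wpoly_iff)
    have "(\<Sum>d\<in>?D. hcomp n d b) \<in> Idl\<^bsub>wpoly_alg n\<^esub> (I \<inter> hmg n)"
    proof (rule ideal_wpoly_sum[OF id'])
      fix d
      have "hcomp n d b \<in> I \<inter> hmg n" using I b hcomp_G[OF bc] by (auto simp: hom_ideal_def hmg_iff)
      then show "hcomp n d b \<in> Idl\<^bsub>wpoly_alg n\<^esub> (I \<inter> hmg n)" using genideal_wpoly_ge by blast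
    qed
    then show "b \<in> Idl\<^bsub>wpoly_alg n\<^esub> (I \<inter> hmg n)" using hcomp_decomp[of ?D n b] by simp
  qed
qed

lemma irrelevant_subset: "(\<Union>d\<in>{0<..}. G n d) \<subseteq> Idl\<^bsub>wpoly_alg n\<^esub> (\<Union>d\<in>{0<..}. G n d)"
  by (rule genideal_wpoly_ge)

lemma hom_prime_point:
  assumes P: "primeideal P (wpoly_alg n)" "hom_ideal n P" and f: "f \<in> G n e" "e > 0" "f \<notin> P"
  shows "P \<in> pts n"
proof -
  have "f \<in> (\<Union>d\<in>{0<..}. G n d)" using f by auto
  then have "\<not> Idl\<^bsub>wpoly_alg n\<^esub> (\<Union>d\<in>{0<..}. G n d) \<subseteq> P"
    using irrelevant_subset[of n] f(3) by blast
  then show ?thesis unfolding proj.points_def using P(1) hom_ideal_gen[OF P(2)] by blast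
qed

text \<open>This is the generic point. The variable \<open>varp 1\<close>, of positive degree, shows
  that the irrelevant ideal is not contained in it.\<close>

lemma zero_point: "{0} \<in> pts n"
proof -
  have "primeideal {0} (wpoly_alg n)"
  proof (rule primeidealI)
    have "(1::pol) \<in> wcar n" by simp
    then show "wcar n \<noteq> {0}" by (metis singletonD zero_neq_one)
    show "ideal {0} (wpoly_alg n)" by (simp add: ideal_wpoly_iff)
    show "a \<in> {0} \<or> b \<in> {0}" if "a \<otimes>\<^bsub>wpoly_alg n\<^esub> b \<in> {0}" for a b
      using that by simp
  qed (rule cring_wpoly)
  moreover have "hom_ideal n {0}" by (simp add: hom_ideal_def ideal_wpoly_iff)
  moreover have "varp 1 \<in> G n (wvar n 1)" by (rule varp_G) simp
  moreover have "wvar n 1 > 0" by (simp add: wvar_def)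
  ultimately show ?thesis using hom_prime_point[of "{0}" n "varp 1" "wvar n 1"] by simp
qed

lemma point_prime: "P \<in> pts n \<Longrightarrow> primeideal P (wpoly_alg n)"
  unfolding proj.points_def by blast

lemma point_ideal: assumes "P \<in> pts n" shows "ideal P (wpoly_alg n)"
proof -
  interpret primeideal P "wpoly_alg n" using assms(1) by (rule point_prime)
  show ?thesis by (rule ideal_axioms)
qed

lemmas point_0 = ideal_wpoly_0[OF point_ideal]
lemma point_1: assumes "P \<in> pts n" shows "1 \<notin> P"
proof
  assume 1: "1 \<in> P"
  interpret primeideal P "wpoly_alg n" using assms(1) by (rule point_prime)
  from 1 have "\<one>\<^bsub>wpoly_alg n\<^esub> \<in> P" by (simp only: wpoly_alg_simps)
  from one_imp_carrier[OF this] I_notcarr show False by blast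
qed

lemma point_mult:
  assumes "P \<in> pts n" and a: "a \<in> wcar n" and b: "b \<in> wcar n"
  shows "a * b \<in> P \<longleftrightarrow> a \<in> P \<or> b \<in> P"
proof
  interpret primeideal P "wpoly_alg n" using assms(1) by (rule point_prime)
  show "a \<in> P \<or> b \<in> P" if "a * b \<in> P"
  proof (rule I_prime[OF a b])
    show "a \<otimes>\<^bsub>wpoly_alg n\<^esub> b \<in> P" using that by (simp only: wpoly_alg_simps)
  qed
  show "a * b \<in> P" if "a \<in> P \<or> b \<in> P"
    using that
  proof
    assume "a \<in> P" then show ?thesis
      using ideal_wpoly_mult[OF point_ideal[OF assms(1)] _ b] by (subst mult.commute)
  next
    assume "b \<in> P" then show ?thesis
      by (rule ideal_wpoly_mult[OF point_ideal[OF assms(1)] _ a])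
  qed
qed

text \<open>Any two elements lie in a common member of the chain. This provides the upper bounds for
  Zorn's lemma in \<open>exists_point_avoiding\<close>.\<close>

lemma hom_ideal_Union:
  assumes "\<C> \<noteq> {}" and chain: "\<And>I J. I \<in> \<C> \<Longrightarrow> J \<in> \<C> \<Longrightarrow> I \<subseteq> J \<or> J \<subseteq> I" and hom: "\<And>I. I \<in> \<C> \<Longrightarrow> hom_ideal n I"
  shows "hom_ideal n (\<Union>\<C>)"
proof -
  have id: "ideal I (wpoly_alg n)" if "I \<in> \<C>" for I using hom[OF that] by (simp add: hom_ideal_def)
  have "ideal (\<Union>\<C>) (wpoly_alg n)"
    unfolding ideal_wpoly_iff
  proof (intro conjI ballI)
    show "\<Union>\<C> \<subseteq> wcar n" using ideal_wpoly_car[OF id] by blast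
    show "0 \<in> \<Union>\<C>" using assms(1) ideal_wpoly_0[OF id] by blast
  next
    fix a b assume "a \<in> \<Union>\<C>" "b \<in> \<Union>\<C>"
    then obtain I J where IJ: "I \<in> \<C>" "J \<in> \<C>" "a \<in> I" "b \<in> J" by blast
    show "a + b \<in> \<Union>\<C>"
    proof (cases "I \<subseteq> J")
      case True
      then have "a + b \<in> J" using ideal_wpoly_add[OF id[OF IJ(2)]] IJ by blast
      then show ?thesis using IJ by blast
    next
      case False
      then have "a + b \<in> I" using ideal_wpoly_add[OF id[OF IJ(1)]] chain[OF IJ(1,2)] IJ by blast
      then show ?thesis using IJ by blast
    qed
  next
    fix a s assume "a \<in> \<Union>\<C>" "s \<in> wcar n"
    then show "s * a \<in> \<Union>\<C>" using ideal_wpoly_mult[OF id] by blast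
  qed
  then show ?thesis using hom unfolding hom_ideal_def by blast
qed

text \<open>This is the ideal P + (x), the enlargement against which maximality is played out in
  \<open>exists_point_avoiding\<close>.\<close>

lemma hom_ideal_extend:
  assumes P: "hom_ideal n P" and x: "x \<in> G n e"
  shows "hom_ideal n {p + s * x |p s. p \<in> P \<and> s \<in> wcar n}" (is "hom_ideal n ?P'")
proof -
  have id: "ideal P (wpoly_alg n)" using P by (simp add: hom_ideal_def)
  have xc: "x \<in> wcar n" by (rule G_car[OF x])
  have "ideal ?P' (wpoly_alg n)"
    unfolding ideal_wpoly_iff
  proof (intro conjI ballI)
    show "?P' \<subseteq> wcar n" using ideal_wpoly_car[OF id] xc by (auto intro!: wcar_add wcar_mult)
    show "0 \<in> ?P'" using ideal_wpoly_0[OF id] by (auto intro!: exI[of _ 0])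
  next
    fix a b assume "a \<in> ?P'" "b \<in> ?P'"
    then obtain p s q t where "p \<in> P" "s \<in> wcar n" "q \<in> P" "t \<in> wcar n" "a = p + s * x" "b = q + t * x" by blast
    moreover have "p + s * x + (q + t * x) = (p + q) + (s + t) * x" by (simp add: algebra_simps)
    ultimately show "a + b \<in> ?P'" using ideal_wpoly_add[OF id] wcar_add by blast
  next
    fix a t assume "a \<in> ?P'" and t: "t \<in> wcar n"
    then obtain p s where "p \<in> P" "s \<in> wcar n" "a = p + s * x" by blast
    moreover have "t * (p + s * x) = t * p + (t * s) * x" by (simp add: algebra_simps)
    ultimately show "t * a \<in> ?P'" using ideal_wpoly_mult[OF id] wcar_mult t by blast
  qed
  moreover have "hcomp n d b \<in> ?P'" if "b \<in> ?P'" for b d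
  proof -
    obtain p s where ps: "p \<in> P" "s \<in> wcar n" "b = p + s * x" using \<open>b \<in> ?P'\<close> by blast
    have "hcomp n d b = hcomp n d p + hcomp n (d - e) s * x"
      using hcomp_mult_G[OF x, of d s] ps(3) by (simp add: hcomp_add mult.commute)
    moreover have "hcomp n d p \<in> P" using P ps(1) by (simp add: hom_ideal_def)
    moreover have "hcomp n (d - e) s \<in> wcar n" using hcomp_G[OF ps(2)] by (rule G_car)
    ultimately show ?thesis by blast
  qed
  ultimately show ?thesis unfolding hom_ideal_def by blast
qed

text \<open>If x and y were outside P, take for each the largest degree whose component is outside
  P. In the sum of these degrees the component of x y is the product of the two components plus
  terms with a factor in P, which contradicts primality for homogeneous elements.\<close>

lemma hom_prime_of_homogeneous:
  assumes P: "hom_ideal n P"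
    and hp: "\<And>x y d e. x \<in> G n d \<Longrightarrow> y \<in> G n e \<Longrightarrow> x * y \<in> P \<Longrightarrow> x \<in> P \<or> y \<in> P"
    and x: "x \<in> wcar n" and y: "y \<in> wcar n" and xy: "x * y \<in> P"
  shows "x \<in> P \<or> y \<in> P"
proof (rule ccontr)
  assume "\<not> (x \<in> P \<or> y \<in> P)"
  then have nP: "x \<notin> P" "y \<notin> P" by auto
  have id: "ideal P (wpoly_alg n)" using P by (simp add: hom_ideal_def)
  define D where "D = (\<lambda>z. (\<lambda>\<mu>. int (wdeg n \<mu>)) ` Poly_Mapping.keys (z :: pol))"
  have fD: "finite (D z)" for z by (simp add: D_def)
  have dec: "z = (\<Sum>d\<in>D z. hcomp n d z)" for z
    by (rule hcomp_decomp) (auto simp: D_def)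
  \<comment> \<open>The maximum of this set is used, not the top degree of z, whose component may
    well lie in P.\<close>
  define B where "B = (\<lambda>z. {d \<in> D z. hcomp n d z \<notin> P})"
  have B_ne: "B z \<noteq> {}" if "z \<notin> P" for z
  proof
    assume "B z = {}"
    then have "\<And>d. d \<in> D z \<Longrightarrow> hcomp n d z \<in> P" by (auto simp: B_def)
    then have "(\<Sum>d\<in>D z. hcomp n d z) \<in> P" by (rule ideal_wpoly_sum[OF id])
    then show False using dec[of z] that by metis
  qed
  have fB: "finite (B z)" for z using fD[of z] by (simp add: B_def)
  define d where "d = Max (B x)"
  define e where "e = Max (B y)"
  have dB: "d \<in> B x" unfolding d_def by (rule Max_in[OF fB B_ne[OF nP(1)]])
  have eB: "e \<in> B y" unfolding e_def by (rule Max_in[OF fB B_ne[OF nP(2)]])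
  have big: "hcomp n i z \<in> P" if "i > Max (B z)" for i z
  proof (cases "i \<in> D z")
    case True
    then show ?thesis using that Max_ge[OF fB, of i z] by (auto simp: B_def)
  next
    case False
    have "hcomp n i z = 0"
      by (rule poly_mapping_eqI) (use False in \<open>auto simp: lookup_hcomp D_def in_keys_iff image_iff\<close>)
    then show ?thesis using ideal_wpoly_0[OF id] by simp
  qed
  have car: "hcomp n i z \<in> wcar n" if "z \<in> wcar n" for i z using hcomp_G[OF that] by (rule G_car)
  have "hcomp n (d + e) (x * y) = (\<Sum>i\<in>D x. hcomp n (d + e) (hcomp n i x * y))"
    by (subst dec[of x]) (simp only: sum_distrib_right hcomp_sum)
  also have "\<dots> = (\<Sum>i\<in>D x. hcomp n i x * hcomp n (d + e - i) y)"
    by (intro sum.cong refl hcomp_mult_G hcomp_G x)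
  also have "\<dots> = hcomp n d x * hcomp n e y + (\<Sum>i\<in>D x - {d}. hcomp n i x * hcomp n (d + e - i) y)"
    using dB fD by (subst sum.remove[of _ d]) (auto simp: B_def)
  finally have eq: "hcomp n d x * hcomp n e y =
      hcomp n (d + e) (x * y) - (\<Sum>i\<in>D x - {d}. hcomp n i x * hcomp n (d + e - i) y)" by simp
  have rest: "(\<Sum>i\<in>D x - {d}. hcomp n i x * hcomp n (d + e - i) y) \<in> P"
  proof (rule ideal_wpoly_sum[OF id])
    fix i assume "i \<in> D x - {d}"
    then consider "i > d" | "d + e - i > e" by fastforce
    then show "hcomp n i x * hcomp n (d + e - i) y \<in> P"
    proof cases
      case 1
      then have "hcomp n (d + e - i) y * hcomp n i x \<in> P"
        by (intro ideal_wpoly_mult[OF id] big car y) (simp add: d_def)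
      then show ?thesis by (simp add: mult.commute)
    next
      case 2
      then show ?thesis
        by (intro ideal_wpoly_mult[OF id] big car x) (simp add: e_def)
    qed
  qed
  have "hcomp n (d + e) (x * y) \<in> P" using P xy by (simp add: hom_ideal_def)
  then have "hcomp n d x * hcomp n e y \<in> P" unfolding eq by (rule ideal_wpoly_minus[OF id _ rest])
  then have "hcomp n d x \<in> P \<or> hcomp n e y \<in> P" by (rule hp[OF hcomp_G[OF x] hcomp_G[OF y]])
  then show False using dB eB by (auto simp: B_def)
qed

text \<open>A homogeneous ideal P that is maximal among those containing I and no power of f is
  prime: for homogeneous x and y outside P, powers of f lie in P + (x) and in P + (y), and their
  product would lie in P if x y did.\<close>

lemma exists_point_avoiding:
  assumes I: "hom_ideal n I" and f: "f \<in> G n e" "e > 0" and av: "\<And>k. f ^ k \<notin> I"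
  obtains P where "P \<in> pts n" "I \<subseteq> P" "f \<notin> P"
proof -
  define \<A> where "\<A> = {J. hom_ideal n J \<and> I \<subseteq> J \<and> (\<forall>k. f ^ k \<notin> J)}"
  have "\<exists>M\<in>\<A>. \<forall>X\<in>\<A>. M \<subseteq> X \<longrightarrow> X = M"
  proof (rule subset_Zorn_nonempty)
    show "\<A> \<noteq> {}" using I av by (auto simp: \<A>_def)
    fix \<C> assume C: "\<C> \<noteq> {}" "subset.chain \<A> \<C>"
    then have "\<C> \<subseteq> \<A>" and ch: "\<And>I J. I \<in> \<C> \<Longrightarrow> J \<in> \<C> \<Longrightarrow> I \<subseteq> J \<or> J \<subseteq> I"
      by (auto simp: subset_chain_def)
    then have "hom_ideal n (\<Union>\<C>)" by (intro hom_ideal_Union C ch) (auto simp: \<A>_def)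
    moreover have "I \<subseteq> \<Union>\<C>" using C(1) \<open>\<C> \<subseteq> \<A>\<close> by (auto simp: \<A>_def)
    moreover have "\<forall>k. f ^ k \<notin> \<Union>\<C>" using \<open>\<C> \<subseteq> \<A>\<close> by (auto simp: \<A>_def)
    ultimately show "\<Union>\<C> \<in> \<A>" by (simp add: \<A>_def)
  qed
  then obtain P where PA: "P \<in> \<A>" and max: "\<And>X. X \<in> \<A> \<Longrightarrow> P \<subseteq> X \<Longrightarrow> X = P" by blast
  have P: "hom_ideal n P" "I \<subseteq> P" "\<And>k. f ^ k \<notin> P" using PA by (auto simp: \<A>_def)
  have id: "ideal P (wpoly_alg n)" using P by (simp add: hom_ideal_def)
  have ext: "\<exists>k p s. p \<in> P \<and> s \<in> wcar n \<and> f ^ k = p + s * x" if x: "x \<in> G n d" "x \<notin> P" for x d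
  proof (rule ccontr)
    assume neg: "\<nexists>k p s. p \<in> P \<and> s \<in> wcar n \<and> f ^ k = p + s * x"
    let ?P' = "{p + s * x |p s. p \<in> P \<and> s \<in> wcar n}"
    have sub: "P \<subseteq> ?P'"
    proof
      fix p assume "p \<in> P"
      moreover have "p = p + 0 * x" by simp
      ultimately show "p \<in> ?P'" using wcar_0 by blast
    qed
    have "?P' \<in> \<A>" unfolding \<A>_def using hom_ideal_extend[OF P(1) x(1)] sub P(2) neg by blast
    then have "?P' = P" using max sub by blast
    moreover have "x = 0 + 1 * x" by simp
    then have "x \<in> ?P'" using ideal_wpoly_0[OF id] wcar_1 by blast
    ultimately show False using x(2) by blast
  qed
  have hp: "x \<in> P \<or> y \<in> P" if xy: "x \<in> G n d" "y \<in> G n e'" "x * y \<in> P" for x y d e'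
  proof (rule ccontr)
    assume "\<not> (x \<in> P \<or> y \<in> P)"
    then obtain k p s j q t where *: "p \<in> P" "s \<in> wcar n" "f ^ k = p + s * x"
        "q \<in> P" "t \<in> wcar n" "f ^ j = q + t * y"
      using ext[OF xy(1)] ext[OF xy(2)] by metis
    have "f ^ (k + j) = (p + s * x) * (q + t * y)" by (simp add: power_add *)
    also have "\<dots> = (q + t * y) * p + (s * x) * q + (s * t) * (x * y)" by (simp add: algebra_simps)
    also have "\<dots> \<in> P"
    proof (intro ideal_wpoly_add[OF id])
      have "q + t * y \<in> wcar n"
        using *(4,5) ideal_wpoly_car[OF id] by (intro wcar_add wcar_mult G_car[OF xy(2)]) auto
      then show "(q + t * y) * p \<in> P" by (rule ideal_wpoly_mult[OF id *(1)])
      show "s * x * q \<in> P"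
        by (rule ideal_wpoly_mult[OF id *(4)]) (intro wcar_mult *(2) G_car[OF xy(1)])
      show "s * t * (x * y) \<in> P"
        by (rule ideal_wpoly_mult[OF id xy(3)]) (intro wcar_mult *(2,5))
    qed
    finally show False using P(3) by blast
  qed
  have prime: "primeideal P (wpoly_alg n)"
  proof (rule primeidealI[OF id cring_wpoly])
    show "wcar n \<noteq> P" using P(3)[of 0] wcar_1[of n] by auto
    fix a b assume "a \<in> wcar n" "b \<in> wcar n" "a \<otimes>\<^bsub>wpoly_alg n\<^esub> b \<in> P"
    then show "a \<in> P \<or> b \<in> P" using hom_prime_of_homogeneous[OF P(1) hp] by simp
  qed
  have "f \<notin> P" using P(3)[of 1] by simp
  then show ?thesis using that hom_prime_point[OF prime P(1) f] P(2) by blast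
qed

section \<open>Stalks of the twisting sheaves inside the function field\<close>

abbreviation "frs n \<equiv> proj.fracs (wpoly_part n)"

text \<open>For a point P this is the stalk of O(m) at P, realised as a set of elements of the
  function field; denominators outside P are nonzero because P contains 0.\<close>

definition reg :: "nat \<Rightarrow> pol set \<Rightarrow> int \<Rightarrow> rat_fun set" where
  "reg n P m = {g. \<exists>(a, b)\<in>frs n P m. g = Fract a b}"

text \<open>The stalk at the generic point {0}, where a denominator only has to be nonzero.\<close>

definition homfrac :: "nat \<Rightarrow> int \<Rightarrow> rat_fun set" where "homfrac n m = reg n {0} m"

lemma frs_iff: "(a, b) \<in> frs n P m \<longleftrightarrow> (\<exists>d. a \<in> G n (d + m) \<and> b \<in> G n d \<and> b \<notin> P)"
  by (simp add: proj.fracs_def)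

lemma regI: "a \<in> G n (d + m) \<Longrightarrow> b \<in> G n d \<Longrightarrow> b \<notin> P \<Longrightarrow> Fract a b \<in> reg n P m"
  unfolding reg_def using frs_iff by blast

lemma regE:
  assumes "g \<in> reg n P m"
  obtains a b d where "a \<in> G n (d + m)" "b \<in> G n d" "b \<notin> P" "g = Fract a b"
  using assms unfolding reg_def by (auto simp: frs_iff)

lemma reg_emb: "P \<in> pts n \<Longrightarrow> a \<in> G n m \<Longrightarrow> emb a \<in> reg n P m"
  unfolding emb_def by (rule regI[of _ _ 0]) (auto simp: point_1)

lemma reg_mult:
  assumes P: "P \<in> pts n" and "g \<in> reg n P m" "h \<in> reg n P k"
  shows "g * h \<in> reg n P (m + k)"
proof -
  obtain a b d where g: "a \<in> G n (d + m)" "b \<in> G n d" "b \<notin> P" "g = Fract a b" using assms(2) by (rule regE)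
  obtain a' b' d' where h: "a' \<in> G n (d' + k)" "b' \<in> G n d'" "b' \<notin> P" "h = Fract a' b'" using assms(3) by (rule regE)
  have "a * a' \<in> G n ((d + d') + (m + k))" using G_mult[OF g(1) h(1)] by (simp add: algebra_simps)
  moreover have "b * b' \<notin> P" using point_mult[OF P] g h G_car by blast
  ultimately show ?thesis using regI[OF _ G_mult[OF g(2) h(2)]] g(4) h(4) by simp
qed

lemma reg_add:
  assumes P: "P \<in> pts n" and "g \<in> reg n P m" "h \<in> reg n P m"
  shows "g + h \<in> reg n P m"
proof -
  obtain a b d where g: "a \<in> G n (d + m)" "b \<in> G n d" "b \<notin> P" "g = Fract a b" using assms(2) by (rule regE)
  obtain a' b' d' where h: "a' \<in> G n (d' + m)" "b' \<in> G n d'" "b' \<notin> P" "h = Fract a' b'" using assms(3) by (rule regE)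
  have nz: "b \<noteq> 0" "b' \<noteq> 0" using g h point_0[OF P] by auto
  have "a * b' + a' * b \<in> G n ((d + d') + m)"
    using G_mult[OF g(1) h(2)] G_mult[OF h(1) g(2)] by (intro G_add) (simp_all add: algebra_simps)
  moreover have "b * b' \<notin> P" using point_mult[OF P] g h G_car by blast
  ultimately show ?thesis using regI[OF _ G_mult[OF g(2) h(2)]] g(4) h(4) nz by simp
qed

lemma reg_const: "P \<in> pts n \<Longrightarrow> kconst c \<in> reg n P 0"
  unfolding kconst_def by (rule reg_emb) auto

lemma reg_zero: "P \<in> pts n \<Longrightarrow> 0 \<in> reg n P m"
  using reg_emb[of P n 0 m] by simp

lemma reg_uminus: "P \<in> pts n \<Longrightarrow> g \<in> reg n P m \<Longrightarrow> - g \<in> reg n P m"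
  using reg_mult[of P n "kconst (-1)" 0 g m] reg_const[of P n "-1"] by (simp add: kconst_uminus)

lemma reg_diff: "P \<in> pts n \<Longrightarrow> g \<in> reg n P m \<Longrightarrow> h \<in> reg n P m \<Longrightarrow> g - h \<in> reg n P m"
  using reg_add[of P n g m "- h"] reg_uminus[of P n h m] by simp

lemma reg_kvar: "P \<in> pts n \<Longrightarrow> j \<in> {1..n+1} \<Longrightarrow> kvar j \<in> reg n P (wvar n j)"
  unfolding kvar_def by (intro reg_emb varp_G)

text \<open>The quotient rule produces the denominator b * b, which stays outside the prime
  P.\<close>

lemma reg_kder:
  assumes P: "P \<in> pts n" and j: "j \<in> {1..n+1}" and "g \<in> reg n P m"
  shows "kder j g \<in> reg n P (m - wvar n j)"
proof -
  obtain a b d where g: "a \<in> G n (d + m)" "b \<in> G n d" "b \<notin> P" "g = Fract a b" using assms(3) by (rule regE)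
  have nz: "b \<noteq> 0" using g point_0[OF P] by auto
  have "pderiv_mp j a * b - a * pderiv_mp j b \<in> G n ((d + d) + (m - wvar n j))"
    using G_mult[OF pderiv_mp_G[OF g(1) j] g(2)] G_mult[OF g(1) pderiv_mp_G[OF g(2) j]]
    by (intro G_minus) (simp_all add: algebra_simps)
  moreover have "b * b \<notin> P" using point_mult[OF P] g G_car by blast
  ultimately show ?thesis
    using regI[OF _ G_mult[OF g(2) g(2)]] g(4) nz
    by (simp add: kder_def fract_der_Fract derivation_pderiv_mp)
qed

lemma homfrac_mult: "g \<in> homfrac n m \<Longrightarrow> h \<in> homfrac n k \<Longrightarrow> g * h \<in> homfrac n (m + k)"
  and homfrac_add: "g \<in> homfrac n m \<Longrightarrow> h \<in> homfrac n m \<Longrightarrow> g + h \<in> homfrac n m"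
  and homfrac_const: "kconst c \<in> homfrac n 0"
  and homfrac_zero: "0 \<in> homfrac n m"
  unfolding homfrac_def by (intro reg_mult reg_add reg_const reg_zero zero_point; assumption)+

text \<open>Hartogs-type statement: the denominators of a fraction form a homogeneous ideal, and if it
  contains no power of \<open>f\<close>, it is contained in a point at which \<open>f\<close> does not vanish.\<close>

theorem regular_off_hypersurface:
  assumes f: "f \<in> G n e" "e > 0" and g: "\<And>P. P \<in> pts n \<Longrightarrow> f \<notin> P \<Longrightarrow> g \<in> reg n P m"
  obtains k a where "a \<in> G n (int k * e + m)" "emb (f ^ k) * g = emb a"
proof -
  define J where "J = (\<lambda>d. {b \<in> G n d. \<exists>a\<in>G n (d + m). emb b * g = emb a})"
  \<comment> \<open>Asking every component to be a denominator of its own degree makes I homogeneous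
    by construction.\<close>
  define I where "I = {b \<in> wcar n. \<forall>d. hcomp n d b \<in> J d}"
  have J_add: "a + b \<in> J d" if ab: "a \<in> J d" "b \<in> J d" for a b d
  proof -
    obtain a' b' where "a' \<in> G n (d + m)" "emb a * g = emb a'" "b' \<in> G n (d + m)" "emb b * g = emb b'"
      using ab unfolding J_def by blast
    then have "emb (a + b) * g = emb (a' + b')" "a' + b' \<in> G n (d + m)"
      by (simp_all add: emb_add distrib_right G_add)
    then show ?thesis using ab by (auto simp: J_def G_add)
  qed
  have J_0: "0 \<in> J d" for d using G_0 by (auto simp: J_def intro!: bexI[of _ 0])
  have J_mult: "s * b \<in> J (i + d)" if bs: "b \<in> J d" "s \<in> G n i" for s b d i
  proof -
    obtain b' where b': "b' \<in> G n (d + m)" "emb b * g = emb b'" using bs unfolding J_def by blast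
    then have "emb (s * b) * g = emb (s * b')" by (simp add: emb_mult mult.assoc)
    moreover have "s * b' \<in> G n (i + d + m)" using G_mult[OF bs(2) b'(1)] by (simp add: add.assoc)
    moreover have "s * b \<in> G n (i + d)" using bs by (auto simp: J_def intro: G_mult)
    ultimately show ?thesis by (auto simp: J_def)
  qed
  have J_sum: "(\<Sum>i\<in>A. h i) \<in> J d" if "\<And>i. i \<in> A \<Longrightarrow> h i \<in> J d" for A :: "int set" and h d
    using that by (induction A rule: infinite_finite_induct) (auto simp: J_0 J_add)
  have "ideal I (wpoly_alg n)"
    unfolding ideal_wpoly_iff
  proof (intro conjI ballI)
    show "I \<subseteq> wcar n" by (auto simp: I_def)
    show "0 \<in> I" by (simp add: I_def J_0)
    show "a + b \<in> I" if "a \<in> I" "b \<in> I" for a b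
      using that by (auto simp: I_def wcar_add hcomp_add J_add)
    fix a s assume a: "a \<in> I" and s: "s \<in> wcar n"
    have "hcomp n d (s * a) \<in> J d" for d
    proof -
      let ?D = "(\<lambda>\<mu>. int (wdeg n \<mu>)) ` Poly_Mapping.keys s"
      have "s = (\<Sum>i\<in>?D. hcomp n i s)" by (rule hcomp_decomp) auto
      then have "hcomp n d (s * a) = hcomp n d ((\<Sum>i\<in>?D. hcomp n i s) * a)" by simp
      also have "\<dots> = (\<Sum>i\<in>?D. hcomp n i s * hcomp n (d - i) a)"
        unfolding sum_distrib_right hcomp_sum by (intro sum.cong refl hcomp_mult_G hcomp_G s)
      also have "\<dots> \<in> J d"
      proof (rule J_sum)
        fix i
        have "hcomp n (d - i) a \<in> J (d - i)" using a by (simp add: I_def)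
        from J_mult[OF this hcomp_G[OF s]] show "hcomp n i s * hcomp n (d - i) a \<in> J d" by (metis add.commute diff_add_cancel)
      qed
      finally show ?thesis .
    qed
    then show "s * a \<in> I" using a s by (auto simp: I_def wcar_mult)
  qed
  moreover have hJ: "b \<in> I" if "b \<in> J d" for b d
  proof -
    have "b \<in> G n d" using that by (simp add: J_def)
    then show ?thesis using that by (auto simp: I_def hcomp_of_G J_0 G_car)
  qed
  moreover have "hcomp n d b \<in> I" if "b \<in> I" for b d
    using hJ[of "hcomp n d b" d] that by (simp add: I_def)
  ultimately have hI: "hom_ideal n I" by (simp add: hom_ideal_def)
  have "\<exists>k. f ^ k \<in> I"
  proof (rule ccontr)
    assume "\<nexists>k. f ^ k \<in> I"
    then obtain P where P: "P \<in> pts n" "I \<subseteq> P" "f \<notin> P"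
      using exists_point_avoiding[OF hI f] by blast
    from g[OF P(1,3)] obtain a b d where ab: "a \<in> G n (d + m)" "b \<in> G n d" "b \<notin> P" "g = Fract a b" by (rule regE)
    have "b \<noteq> 0" using ab(3) point_0[OF P(1)] by auto
    then have "emb b * g = emb a" using ab(4) by (simp add: Fract_eq_emb)
    then have "b \<in> J d" using ab by (auto simp: J_def)
    then show False using hJ P(2) ab(3) by blast
  qed
  then obtain k where k: "f ^ k \<in> I" by blast
  have "hcomp n (int k * e) (f ^ k) = f ^ k" using hcomp_of_G[OF G_power[OF f(1)]] by simp
  then have "f ^ k \<in> J (int k * e)" using k by (metis (no_types, lifting) I_def mem_Collect_eq)
  then show ?thesis using that by (auto simp: J_def)
qed

section \<open>Sections as elements of the function field\<close>

definition germ :: "nat \<Rightarrow> pol set \<Rightarrow> int \<Rightarrow> rat_fun \<Rightarrow> (pol \<times> pol) set" where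
  "germ n P m g = {(a, b). (a, b) \<in> frs n P m \<and> Fract a b = g}"

definition sec :: "nat \<Rightarrow> int \<Rightarrow> pol set set \<Rightarrow> rat_fun \<Rightarrow> pol set \<Rightarrow> (pol \<times> pol) set" where
  "sec n m U g = (\<lambda>P\<in>U. germ n P m g)"

definition regular_on :: "nat \<Rightarrow> int \<Rightarrow> pol set set \<Rightarrow> rat_fun set" where
  "regular_on n m U = {g. \<forall>P\<in>U. g \<in> reg n P m}"

abbreviation "pfrac n \<equiv> proj.frac (wpoly_alg n) (wpoly_part n)"
abbreviation "sects n \<equiv> proj.sections (wpoly_alg n) (wpoly_part n)"
abbreviation "tw n \<equiv> proj.twist (wpoly_alg n) (wpoly_part n)"
abbreviation "opns n \<equiv> proj.opens (wpoly_alg n) (wpoly_part n)"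

lemma germ_iff: "(a, b) \<in> germ n P m g \<longleftrightarrow> (a, b) \<in> frs n P m \<and> Fract a b = g"
  by (simp add: germ_def)

lemma frs_nz: "P \<in> pts n \<Longrightarrow> (a, b) \<in> frs n P m \<Longrightarrow> b \<noteq> 0"
  by (auto simp: frs_iff dest: point_0)

lemma frs_car: "(a, b) \<in> frs n P m \<Longrightarrow> a \<in> wcar n \<and> b \<in> wcar n"
  by (auto simp: frs_iff G_iff)

lemma germ_nonempty: "g \<in> reg n P m \<Longrightarrow> \<exists>a b. (a, b) \<in> germ n P m g"
  unfolding reg_def germ_iff by blast

lemma germ_inj: "g \<in> reg n P m \<Longrightarrow> germ n P m g = germ n P m h \<Longrightarrow> g = h"
  using germ_nonempty germ_iff by metis

lemma wpoly_minus: "a \<in> wcar n \<Longrightarrow> b \<in> wcar n \<Longrightarrow> a \<ominus>\<^bsub>wpoly_alg n\<^esub> b = a - b"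
proof -
  interpret cring "wpoly_alg n" by (rule cring_wpoly)
  assume ab: "a \<in> wcar n" "b \<in> wcar n"
  have "\<ominus>\<^bsub>wpoly_alg n\<^esub> b = - b"
    by (rule minus_equality) (use ab wcar_uminus in auto)
  then show ?thesis by (simp add: a_minus_def)
qed

lemma one_hmg: "1 \<in> hmg n"
  unfolding hmg_iff by (rule exI[of _ 0]) (rule G_1)

lemma hmg_car: "hmg n \<subseteq> wcar n"
  unfolding proj.homog_def using G_car by blast

text \<open>In a domain the factor c in the definition of \<open>frac\<close> can be cancelled, so
  an equivalence class of pairs is the set of all admissible representations of one element of the
  function field.\<close>

lemma frac_germ:
  assumes P: "P \<in> pts n" and ab: "(a, b) \<in> frs n P m"
  shows "pfrac n P m a b = germ n P m (Fract a b)"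
proof -
  have "(\<exists>c\<in>hmg n - P. c * (a \<ominus>\<^bsub>wpoly_alg n\<^esub> b) = 0) \<longleftrightarrow> a = b" if ab: "a \<in> wcar n" "b \<in> wcar n" for a b
  proof
    assume "\<exists>c\<in>hmg n - P. c * (a \<ominus>\<^bsub>wpoly_alg n\<^esub> b) = 0"
    then obtain c where "c \<notin> P" "c * (a - b) = 0" unfolding wpoly_minus[OF ab] by blast
    then show "a = b" using point_0[OF P] by auto
  next
    assume "a = b"
    moreover have "1 \<in> hmg n - P" using point_1[OF P] one_hmg by blast
    ultimately show "\<exists>c\<in>hmg n - P. c * (a \<ominus>\<^bsub>wpoly_alg n\<^esub> b) = 0"
      unfolding wpoly_minus[OF ab] by (intro bexI[of _ 1]) simp_all
  qed
  then have *: "(\<exists>c\<in>hmg n - P. c * (a * b' \<ominus>\<^bsub>wpoly_alg n\<^esub> (a' * b)) = 0) \<longleftrightarrow> Fract a' b' = Fract a b"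
    if "(a', b') \<in> frs n P m" for a' b'
    using that frs_car[OF that] frs_car[OF ab] frs_nz[OF P that] frs_nz[OF P ab]
    by (auto simp: wcar_mult eq_fract)
  show ?thesis unfolding proj.frac_def germ_def wpoly_alg_simps using * by blast
qed

lemma frac_add_germ:
  assumes P: "P \<in> pts n" and g: "g \<in> reg n P m" and h: "h \<in> reg n P m"
  shows "proj.frac_add (wpoly_alg n) (wpoly_part n) P m (germ n P m g) (germ n P m h) = germ n P m (g + h)"
proof -
  have *: "pfrac n P m (a * d + c * b) (b * d) = germ n P m (g + h)"
    if ab: "(a, b) \<in> germ n P m g" and cd: "(c, d) \<in> germ n P m h" for a b c d
  proof -
    obtain i where i: "a \<in> G n (i + m)" "b \<in> G n i" "b \<notin> P" "Fract a b = g" using ab by (auto simp: germ_iff frs_iff)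
    obtain j where j: "c \<in> G n (j + m)" "d \<in> G n j" "d \<notin> P" "Fract c d = h" using cd by (auto simp: germ_iff frs_iff)
    have "a * d + c * b \<in> G n ((i + j) + m)"
      using G_mult[OF i(1) j(2)] G_mult[OF j(1) i(2)] by (intro G_add) (simp_all add: algebra_simps)
    moreover have "b * d \<in> G n (i + j)" by (rule G_mult[OF i(2) j(2)])
    moreover have "b * d \<notin> P" using point_mult[OF P] i j G_car by blast
    ultimately have "(a * d + c * b, b * d) \<in> frs n P m" using frs_iff by blast
    from frac_germ[OF P this] show ?thesis
      using i j point_0[OF P] by (metis add_fract)
  qed
  obtain a b c d where "(a, b) \<in> germ n P m g" "(c, d) \<in> germ n P m h"
    using germ_nonempty[OF g] germ_nonempty[OF h] by blast
  then show ?thesis unfolding proj.frac_add_def wpoly_alg_simps using * by fast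
qed

lemma frac_mult_germ:
  assumes P: "P \<in> pts n" and g: "g \<in> reg n P 0" and h: "h \<in> reg n P m"
  shows "proj.frac_mult (wpoly_alg n) (wpoly_part n) P m (germ n P 0 g) (germ n P m h) = germ n P m (g * h)"
proof -
  have *: "pfrac n P m (a * c) (b * d) = germ n P m (g * h)"
    if ab: "(a, b) \<in> germ n P 0 g" and cd: "(c, d) \<in> germ n P m h" for a b c d
  proof -
    obtain i where i: "a \<in> G n (i + 0)" "b \<in> G n i" "b \<notin> P" "Fract a b = g" using ab unfolding germ_iff frs_iff by blast
    obtain j where j: "c \<in> G n (j + m)" "d \<in> G n j" "d \<notin> P" "Fract c d = h" using cd unfolding germ_iff frs_iff by blast
    have "a * c \<in> G n ((i + j) + m)"
      using G_mult[OF i(1) j(1)] by (simp add: algebra_simps)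
    moreover have "b * d \<in> G n (i + j)" by (rule G_mult[OF i(2) j(2)])
    moreover have "b * d \<notin> P" using point_mult[OF P] i j G_car by blast
    ultimately have "(a * c, b * d) \<in> frs n P m" using frs_iff by blast
    from frac_germ[OF P this] show ?thesis using i j by (metis mult_fract)
  qed
  obtain a b c d where "(a, b) \<in> germ n P 0 g" "(c, d) \<in> germ n P m h"
    using germ_nonempty[OF g] germ_nonempty[OF h] by blast
  then show ?thesis unfolding proj.frac_mult_def wpoly_alg_simps using * by fast
qed

lemma zop_subset: "zop n U \<Longrightarrow> U \<subseteq> pts n"
  unfolding proj.zopen_def by blast

text \<open>A point contains a set of homogeneous elements as soon as it contains the ideal
  generated by them, and conversely, so open sets may be described without mentioning
  ideals.\<close>

lemma zopenI:
  assumes "X \<subseteq> hmg n" "U = {P \<in> pts n. \<not> X \<subseteq> P}"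
  shows "zop n U"
proof -
  let ?I = "Idl\<^bsub>wpoly_alg n\<^esub> X"
  have Xc: "X \<subseteq> wcar n" using assms(1) hmg_car by blast
  have id: "ideal ?I (wpoly_alg n)" by (rule genideal_wpoly[OF Xc])
  have "?I \<inter> hmg n \<subseteq> wcar n" using ideal_wpoly_car[OF id] by blast
  from genideal_wpoly[OF this] have "?I \<subseteq> Idl\<^bsub>wpoly_alg n\<^esub> (?I \<inter> hmg n)"
    by (rule genideal_wpoly_le) (use assms(1) genideal_wpoly_ge[of X n] genideal_wpoly_ge[of "?I \<inter> hmg n" n] in blast)
  moreover have "Idl\<^bsub>wpoly_alg n\<^esub> (?I \<inter> hmg n) \<subseteq> ?I" by (rule genideal_wpoly_le[OF id]) auto
  ultimately have "?I = Idl\<^bsub>wpoly_alg n\<^esub> (?I \<inter> hmg n)" by (rule antisym)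
  moreover have "U = {P \<in> pts n. \<not> ?I \<subseteq> P}"
    unfolding assms(2) using genideal_wpoly_le[OF point_ideal, of _ n X] genideal_wpoly_ge[of X n] by blast
  ultimately show ?thesis unfolding proj.zopen_def using id by blast
qed

lemma zop_pts: "zop n (pts n)"
proof (rule zopenI)
  show "{1} \<subseteq> hmg n" using one_hmg by blast
  show "pts n = {P \<in> pts n. \<not> {1} \<subseteq> P}" using point_1 by blast
qed

text \<open>If the homogeneous elements of I cut out the complement of U, their products with f cut
  out the complement of the smaller set, by primality of the points.\<close>

lemma zop_Int_D:
  assumes U: "zop n U" and f: "f \<in> G n d"
  shows "zop n {P \<in> U. f \<notin> P}"
proof -
  obtain I where I: "ideal I (wpoly_alg n)" "I = Idl\<^bsub>wpoly_alg n\<^esub> (I \<inter> hmg n)" "U = {P \<in> pts n. \<not> I \<subseteq> P}"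
    using U unfolding proj.zopen_def by blast
  define X where "X = (\<lambda>x. f * x) ` (I \<inter> hmg n)"
  show ?thesis
  proof (rule zopenI[of X])
    show "X \<subseteq> hmg n" using f G_mult unfolding X_def by (auto simp: hmg_iff) blast
    have "\<not> X \<subseteq> P \<longleftrightarrow> f \<notin> P \<and> \<not> I \<subseteq> P" if P: "P \<in> pts n" for P
    proof -
      have 1: "I \<subseteq> P \<longleftrightarrow> I \<inter> hmg n \<subseteq> P"
        using genideal_wpoly_le[OF point_ideal[OF P], of "I \<inter> hmg n"] I(2) by blast
      have "f * x \<in> P \<longleftrightarrow> f \<in> P \<or> x \<in> P" if "x \<in> I" for x
        using point_mult[OF P G_car[OF f]] ideal_wpoly_car[OF I(1)] that by blast
      then show ?thesis unfolding 1 X_def by blast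
    qed
    then show "{P \<in> U. f \<notin> P} = {P \<in> pts n. \<not> X \<subseteq> P}" unfolding I(3) by blast
  qed
qed

text \<open>An ideal not contained in some point is nonzero, hence not contained in {0}. This
  irreducibility is what allows sections to be compared through one element of the function
  field.\<close>

lemma zop_zero:
  assumes "zop n U" "U \<noteq> {}" shows "{0} \<in> U"
proof -
  obtain I where I: "U = {P \<in> pts n. \<not> I \<subseteq> P}" using assms unfolding proj.zopen_def by blast
  obtain P where "P \<in> U" using assms(2) by blast
  then have "P \<in> pts n" "\<not> I \<subseteq> P" using I by auto
  then have "\<not> I \<subseteq> {0}" using point_0 by blast
  then show ?thesis using I zero_point by blast
qed

lemma opns_iff: "V \<in> opns n U \<longleftrightarrow> zop n V \<and> V \<subseteq> U"
  by (simp add: proj.opens_def)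

lemma regular_on_mono: "g \<in> regular_on n m U \<Longrightarrow> V \<subseteq> U \<Longrightarrow> g \<in> regular_on n m V"
  by (auto simp: regular_on_def)

lemma regular_on_homfrac: "zop n U \<Longrightarrow> U \<noteq> {} \<Longrightarrow> g \<in> regular_on n m U \<Longrightarrow> g \<in> homfrac n m"
  using zop_zero[of n U] by (auto simp: regular_on_def homfrac_def)

text \<open>Over the empty set \<open>sec\<close> forgets g altogether; equality of fractions can be
  asked, and in \<open>sec_inj\<close> concluded, over nonempty sets only.\<close>

lemma sec_cong: "(U \<noteq> {} \<Longrightarrow> g = h) \<Longrightarrow> sec n m U g = sec n m U h"
  by (cases "U = {}") (auto simp: sec_def)

lemma sec_inj:
  assumes "g \<in> regular_on n m U" "sec n m U g = sec n m U h" "U \<noteq> {}"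
  shows "g = h"
proof -
  obtain P where P: "P \<in> U" using assms by blast
  have "germ n P m g = germ n P m h" using fun_cong[OF assms(2), of P] P by (simp add: sec_def)
  then show ?thesis using germ_inj assms(1) P by (auto simp: regular_on_def)
qed

lemma restrict_sec: "V \<subseteq> U \<Longrightarrow> restrict (sec n m U g) V = sec n m V g"
  by (auto simp: sec_def fun_eq_iff)

text \<open>Every section over a nonempty open set is given by one element of the function field: its
  germ at the generic point \<open>{0}\<close>.\<close>

lemma sections_eq:
  assumes U: "zop n U"
  shows "sects n m U = sec n m U ` regular_on n m U"
proof
  show "sec n m U ` regular_on n m U \<subseteq> sects n m U"
  proof
    fix s assume "s \<in> sec n m U ` regular_on n m U"
    then obtain g where g: "g \<in> regular_on n m U" "s = sec n m U g" by blast
    show "s \<in> sects n m U"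
      unfolding proj.sections_def
    proof (intro CollectI conjI ballI)
      show "s \<in> extensional U" by (simp add: g sec_def)
      fix P assume P: "P \<in> U"
      then have "g \<in> reg n P m" using g by (simp add: regular_on_def)
      then obtain a b d where ab: "a \<in> G n (d + m)" "b \<in> G n d" "b \<notin> P" "g = Fract a b" by (rule regE)
      have "zop n {Q \<in> U. b \<notin> Q}" by (rule zop_Int_D[OF U ab(2)])
      moreover have "s Q = pfrac n Q m a b" if "Q \<in> U" "b \<notin> Q" for Q
        using frac_germ[of Q n a b m] that ab zop_subset[OF U] by (auto simp: g(2) sec_def frs_iff)
      ultimately show "\<exists>V a b d. zop n V \<and> P \<in> V \<and> V \<subseteq> U \<and> a \<in> G n (d + m) \<and> b \<in> G n d \<and>
          (\<forall>Q\<in>V. b \<notin> Q \<and> s Q = pfrac n Q m a b)"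
        using P ab by (intro exI[of _ "{Q \<in> U. b \<notin> Q}"] exI[of _ a] exI[of _ b] exI[of _ d]) auto
    qed
  qed
  show "sects n m U \<subseteq> sec n m U ` regular_on n m U"
  proof
    fix s assume s: "s \<in> sects n m U"
    have ext: "s \<in> extensional U" using s by (simp add: proj.sections_def)
    show "s \<in> sec n m U ` regular_on n m U"
    proof (cases "U = {}")
      case True
      then have "s = sec n m U 0" using ext by (auto simp: sec_def extensional_def)
      moreover have "0 \<in> regular_on n m U" using True by (simp add: regular_on_def)
      ultimately show ?thesis by blast
    next
      case False
      \<comment> \<open>The open set on which s is a fraction near P also contains {0}, so that
        fraction computes the germ at {0} as well; by \<open>germ_inj\<close> all local fractions
        coincide.\<close>
      have loc: "\<exists>g. g \<in> reg n P m \<and> s P = germ n P m g \<and> g \<in> reg n {0} m \<and> s {0} = germ n {0} m g"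
        if P: "P \<in> U" for P
      proof -
        have "\<forall>P\<in>U. \<exists>V a b d. zop n V \<and> P \<in> V \<and> V \<subseteq> U \<and> a \<in> G n (d + m) \<and> b \<in> G n d \<and>
            (\<forall>Q\<in>V. b \<notin> Q \<and> s Q = pfrac n Q m a b)"
          using s unfolding proj.sections_def mem_Collect_eq by (rule conjunct2)
        from bspec[OF this P] obtain V a b d where *: "zop n V \<and> P \<in> V \<and> V \<subseteq> U \<and> a \<in> G n (d + m) \<and> b \<in> G n d \<and>
            (\<forall>Q\<in>V. b \<notin> Q \<and> s Q = pfrac n Q m a b)" by (elim exE)
        then have V: "zop n V" "P \<in> V" "V \<subseteq> U" and ab: "a \<in> G n (d + m)" "b \<in> G n d" by simp_all
        have sV: "b \<notin> Q" "s Q = pfrac n Q m a b" if "Q \<in> V" for Q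
          using * that by simp_all
        have Q: "Fract a b \<in> reg n Q m \<and> s Q = germ n Q m (Fract a b)" if "Q \<in> V" for Q
        proof -
          have "Q \<in> pts n" using zop_subset[OF V(1)] that by blast
          moreover have "(a, b) \<in> frs n Q m" unfolding frs_iff using ab sV(1)[OF that] by blast
          ultimately show ?thesis
            using frac_germ[of Q n a b m] regI[OF ab sV(1)[OF that]] sV(2)[OF that] by simp
        qed
        have "{0} \<in> V" using zop_zero[OF V(1)] V(2) by blast
        then show ?thesis using Q[OF V(2)] Q[of "{0}"] by blast
      qed
      obtain g where g: "g \<in> reg n {0} m" "s {0} = germ n {0} m g" using loc zop_zero[OF U False] by blast
      have *: "g \<in> reg n P m \<and> s P = germ n P m g" if "P \<in> U" for P
        using loc[OF that] g germ_inj by metis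
      then have "s = sec n m U g" using ext by (auto simp: sec_def extensional_def fun_eq_iff)
      moreover have "g \<in> regular_on n m U" using * by (simp add: regular_on_def)
      ultimately show ?thesis by blast
    qed
  qed
qed

lemma sections_homfrac:
  assumes "zop n U" "s \<in> sects n m U"
  obtains g where "g \<in> regular_on n m U" "g \<in> homfrac n m" "s = sec n m U g"
proof (cases "U = {}")
  case True
  have "s = sec n m U 0" using assms(2) True by (auto simp: proj.sections_def sec_def extensional_def)
  moreover have "0 \<in> regular_on n m U" using True by (simp add: regular_on_def)
  ultimately show ?thesis using that homfrac_zero by blast
next
  case False
  then show ?thesis using that assms sections_eq[OF assms(1)] regular_on_homfrac[OF assms(1)] by blast
qed

lemma sec_in: "zop n U \<Longrightarrow> g \<in> regular_on n m U \<Longrightarrow> sec n m U g \<in> sects n m U"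
  using sections_eq by blast

lemma tw_carrier: "carrier (tw n m U) = sects n m U"
  by (simp add: proj.twist_def)

lemma tw_add:
  assumes "zop n U" "g \<in> regular_on n m U" "h \<in> regular_on n m U"
  shows "sec n m U g \<oplus>\<^bsub>tw n m U\<^esub> sec n m U h = sec n m U (g + h)"
  using assms zop_subset[OF assms(1)] frac_add_germ
  by (auto simp: proj.twist_def sec_def regular_on_def fun_eq_iff)

lemma tw_smult:
  assumes "zop n U" "f \<in> regular_on n 0 U" "h \<in> regular_on n m U"
  shows "sec n 0 U f \<odot>\<^bsub>tw n m U\<^esub> sec n m U h = sec n m U (f * h)"
  using assms zop_subset[OF assms(1)] frac_mult_germ
  by (auto simp: proj.twist_def sec_def regular_on_def fun_eq_iff)

lemma tw_zero:
  assumes "zop n U" shows "\<zero>\<^bsub>tw n m U\<^esub> = sec n m U 0"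
proof -
  have "pfrac n P m 0 1 = germ n P m 0" if "P \<in> U" for P
  proof -
    have P: "P \<in> pts n" using zop_subset[OF assms] that by blast
    have "(0, 1) \<in> frs n P m" using point_1[OF P] G_1[of n] by (auto simp: frs_iff intro!: exI[of _ 0])
    from frac_germ[OF P this] show ?thesis by (simp add: fract_collapse)
  qed
  then show ?thesis by (auto simp: proj.twist_def sec_def fun_eq_iff)
qed

lemma regular_on_closed:
  assumes "zop n U"
  shows "g \<in> regular_on n m U \<Longrightarrow> h \<in> regular_on n m U \<Longrightarrow> g + h \<in> regular_on n m U"
    and "g \<in> regular_on n m U \<Longrightarrow> h \<in> regular_on n m U \<Longrightarrow> g - h \<in> regular_on n m U"
    and "f \<in> regular_on n 0 U \<Longrightarrow> h \<in> regular_on n m U \<Longrightarrow> f * h \<in> regular_on n m U"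
    and "kconst c \<in> regular_on n 0 U" and "0 \<in> regular_on n m U"
proof -
  have P: "P \<in> pts n" if "P \<in> U" for P using zop_subset[OF assms] that by blast
  have m: "f * h \<in> reg n P m" if "P \<in> U" "f \<in> reg n P 0" "h \<in> reg n P m" for P
    using reg_mult[OF P[OF that(1)] that(2,3)] by simp
  show "g \<in> regular_on n m U \<Longrightarrow> h \<in> regular_on n m U \<Longrightarrow> g + h \<in> regular_on n m U"
    by (simp add: regular_on_def reg_add[OF P])
  show "g \<in> regular_on n m U \<Longrightarrow> h \<in> regular_on n m U \<Longrightarrow> g - h \<in> regular_on n m U"
    by (simp add: regular_on_def reg_diff[OF P])
  show "f \<in> regular_on n 0 U \<Longrightarrow> h \<in> regular_on n m U \<Longrightarrow> f * h \<in> regular_on n m U"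
    by (simp add: regular_on_def m)
  show "kconst c \<in> regular_on n 0 U" "0 \<in> regular_on n m U"
    by (simp_all add: regular_on_def reg_const[OF P] reg_zero[OF P])
qed

lemma const_sec_eq:
  assumes "zop n U" shows "proj.const_sec (wpoly_alg n) (wpoly_part n) c U = sec n 0 U (kconst c)"
proof -
  have "pfrac n P 0 (Poly_Mapping.single 0 c * 1) 1 = germ n P 0 (kconst c)" if "P \<in> U" for P
  proof -
    have P: "P \<in> pts n" using zop_subset[OF assms] that by blast
    have "(Poly_Mapping.single 0 c * 1, 1) \<in> frs n P 0" using point_1[OF P] by (auto simp: frs_iff intro!: exI[of _ 0])
    from frac_germ[OF P this] show ?thesis by (simp add: kconst_def emb_def)
  qed
  then show ?thesis by (auto simp: proj.const_sec_def sec_def fun_eq_iff)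
qed

text \<open>Subtraction in the record unfolds to a definite description of the additive inverse, so
  this inverse has to be exhibited and shown to be unique among the sections; over the empty set
  uniqueness comes from \<open>sec_cong\<close>.\<close>

lemma tw_minus:
  assumes U: "zop n U" and g: "g \<in> regular_on n m U" and h: "h \<in> regular_on n m U"
  shows "sec n m U g \<ominus>\<^bsub>tw n m U\<^esub> sec n m U h = sec n m U (g - h)"
proof -
  have h': "- h \<in> regular_on n m U" using regular_on_closed(2)[OF U regular_on_closed(5)[OF U] h] by simp
  have "\<ominus>\<^bsub>tw n m U\<^esub> sec n m U h = sec n m U (- h)"
    unfolding a_inv_def m_inv_def
  proof (rule the_equality)
    show "sec n m U (- h) \<in> carrier (add_monoid (tw n m U)) \<and>
      sec n m U h \<otimes>\<^bsub>add_monoid (tw n m U)\<^esub> sec n m U (- h) = \<one>\<^bsub>add_monoid (tw n m U)\<^esub> \<and>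
      sec n m U (- h) \<otimes>\<^bsub>add_monoid (tw n m U)\<^esub> sec n m U h = \<one>\<^bsub>add_monoid (tw n m U)\<^esub>"
      using tw_add[OF U h h'] tw_add[OF U h' h] tw_zero[OF U, of m] sec_in[OF U h'] by (simp add: tw_carrier)
    fix y assume y: "y \<in> carrier (add_monoid (tw n m U)) \<and>
      sec n m U h \<otimes>\<^bsub>add_monoid (tw n m U)\<^esub> y = \<one>\<^bsub>add_monoid (tw n m U)\<^esub> \<and>
      y \<otimes>\<^bsub>add_monoid (tw n m U)\<^esub> sec n m U h = \<one>\<^bsub>add_monoid (tw n m U)\<^esub>"
    have "y \<in> sects n m U" using conjunct1[OF y] by (simp add: tw_carrier)
    then have "y \<in> sec n m U ` regular_on n m U" by (simp only: sections_eq[OF U])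
    then obtain k where k: "k \<in> regular_on n m U" "y = sec n m U k" by (rule imageE)
    have "sec n m U h \<otimes>\<^bsub>add_monoid (tw n m U)\<^esub> y = \<one>\<^bsub>add_monoid (tw n m U)\<^esub>"
      by (rule conjunct1[OF conjunct2[OF y]])
    then have e: "sec n m U (h + k) = sec n m U 0"
      by (simp add: k(2) tw_add[OF U h k(1)] tw_zero[OF U])
    show "y = sec n m U (- h)" unfolding k(2)
    proof (rule sec_cong)
      assume "U \<noteq> {}"
      from sec_inj[OF regular_on_closed(1)[OF U h k(1)] e this] show "k = - h" by (rule add.inverse_unique[symmetric])
    qed
  qed
  then show ?thesis using tw_add[OF U g h'] by (simp add: a_minus_def)
qed

section \<open>Sheaf endomorphisms as operators on the function field\<close>

text \<open>The fraction behind a section. Over a nonempty set it is determined; over the empty set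
  the choice is arbitrary and \<open>sec\<close> does not see it.\<close>

definition gen_sec :: "nat \<Rightarrow> int \<Rightarrow> pol set set \<Rightarrow> (pol set \<Rightarrow> (pol \<times> pol) set) \<Rightarrow> rat_fun" where
  "gen_sec n m V s = (SOME g. g \<in> regular_on n m V \<and> s = sec n m V g)"

definition sheafify :: "nat \<Rightarrow> int \<Rightarrow> pol set set \<Rightarrow> (rat_fun \<Rightarrow> rat_fun) \<Rightarrow>
    pol set set \<Rightarrow> (pol set \<Rightarrow> (pol \<times> pol) set) \<Rightarrow> (pol set \<Rightarrow> (pol \<times> pol) set)" where
  "sheafify n m U F = (\<lambda>V\<in>opns n U. \<lambda>s\<in>sects n m V. sec n m V (F (gen_sec n m V s)))"

definition preserving :: "nat \<Rightarrow> int \<Rightarrow> pol set set \<Rightarrow> (rat_fun \<Rightarrow> rat_fun) \<Rightarrow> bool" where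
  "preserving n m U F \<longleftrightarrow> (\<forall>P\<in>U. \<forall>g\<in>reg n P m. F g \<in> reg n P m)"

text \<open>F is a total function on the function field, but only its values on fractions of degree
  m have a meaning for the sheaf, so linearity is asked there.\<close>

definition linear_op :: "nat \<Rightarrow> int \<Rightarrow> (rat_fun \<Rightarrow> rat_fun) \<Rightarrow> bool" where
  "linear_op n m F \<longleftrightarrow> (\<forall>g\<in>homfrac n m. \<forall>h\<in>homfrac n m. F (g + h) = F g + F h) \<and>
     (\<forall>c. \<forall>g\<in>homfrac n m. F (kconst c * g) = kconst c * F g)"

abbreviation "send n \<equiv> proj.sheaf_end (wpoly_alg n) (wpoly_part n)"
abbreviation "dle n \<equiv> proj.diffops_le (wpoly_alg n) (wpoly_part n)"
abbreviation "dops n \<equiv> proj.diffops (wpoly_alg n) (wpoly_part n)"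
abbreviation "comm n \<equiv> proj.commutator (wpoly_alg n) (wpoly_part n)"

lemma gen_sec:
  assumes "g \<in> regular_on n m V" "s = sec n m V g"
  shows "gen_sec n m V s \<in> regular_on n m V" "s = sec n m V (gen_sec n m V s)"
proof -
  have "gen_sec n m V s \<in> regular_on n m V \<and> s = sec n m V (gen_sec n m V s)"
    unfolding gen_sec_def
    by (rule someI[where P = "\<lambda>g. g \<in> regular_on n m V \<and> s = sec n m V g", OF conjI[OF assms]])
  then show "gen_sec n m V s \<in> regular_on n m V" "s = sec n m V (gen_sec n m V s)" by simp_all
qed

lemma sheafify_sec:
  assumes V: "V \<in> opns n U" and g: "g \<in> regular_on n m V"
  shows "sheafify n m U F V (sec n m V g) = sec n m V (F g)"
proof -
  have z: "zop n V" using V by (simp add: opns_iff)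
  have "V \<noteq> {} \<Longrightarrow> gen_sec n m V (sec n m V g) = g"
    using sec_inj[OF g gen_sec(2)[OF g refl]] by simp
  then have "sec n m V (F (gen_sec n m V (sec n m V g))) = sec n m V (F g)" by (intro sec_cong) simp
  then show ?thesis using V sec_in[OF z g] by (simp add: sheafify_def)
qed

lemma regular_on_preserving:
  "preserving n m U F \<Longrightarrow> V \<subseteq> U \<Longrightarrow> g \<in> regular_on n m V \<Longrightarrow> F g \<in> regular_on n m V"
  unfolding preserving_def regular_on_def by blast

lemma preserving_mono: "preserving n m U F \<Longrightarrow> V \<subseteq> U \<Longrightarrow> preserving n m V F"
  unfolding preserving_def by blast

lemma regular_basic_open:
  assumes g: "g \<in> homfrac n m"
  obtains a b d where "a \<in> G n (d + m)" "b \<in> G n d" "b \<noteq> 0" "g = Fract a b"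
  using g unfolding homfrac_def by (elim regE) auto

lemma regular_on_D:
  assumes U: "zop n U" and ab: "a \<in> G n (d + m)" "b \<in> G n d" "g = Fract a b" and W: "\<And>P. P \<in> W \<Longrightarrow> b \<notin> P"
  shows "g \<in> regular_on n m W"
  unfolding regular_on_def ab(3) using regI[OF ab(1,2)] W by blast

text \<open>Both denominators are inverted inside U; the generic point survives, so the result is
  not empty.\<close>

lemma common_domain:
  assumes U: "zop n U" "U \<noteq> {}" and g: "g \<in> homfrac n m" and h: "h \<in> homfrac n k"
  obtains V where "V \<in> opns n U" "V \<noteq> {}" "g \<in> regular_on n m V" "h \<in> regular_on n k V"
proof -
  obtain a b d where ab: "a \<in> G n (d + m)" "b \<in> G n d" "b \<noteq> 0" "g = Fract a b" using g by (rule regular_basic_open)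
  obtain a' b' d' where ab': "a' \<in> G n (d' + k)" "b' \<in> G n d'" "b' \<noteq> 0" "h = Fract a' b'" using h by (rule regular_basic_open)
  define W where "W = {P \<in> U. b \<notin> P}"
  define V where "V = {P \<in> W. b' \<notin> P}"
  have W: "zop n W" unfolding W_def by (rule zop_Int_D[OF U(1) ab(2)])
  have V: "zop n V" unfolding V_def by (rule zop_Int_D[OF W ab'(2)])
  have "{0} \<in> V" using zop_zero[OF U] ab(3) ab'(3) by (simp add: V_def W_def)
  moreover have "V \<subseteq> U" by (auto simp: V_def W_def)
  moreover have "g \<in> regular_on n m V" by (rule regular_on_D[OF U(1) ab(1,2,4)]) (simp add: V_def W_def)
  moreover have "h \<in> regular_on n k V" by (rule regular_on_D[OF U(1) ab'(1,2,4)]) (simp add: V_def W_def)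
  ultimately show ?thesis using that V by (auto simp: opns_iff)
qed

lemma point_domain:
  assumes U: "zop n U" and P: "P \<in> U" and g: "g \<in> reg n P m"
  obtains V where "V \<in> opns n U" "P \<in> V" "g \<in> regular_on n m V"
proof -
  obtain a b d where ab: "a \<in> G n (d + m)" "b \<in> G n d" "b \<notin> P" "g = Fract a b" using g by (rule regE)
  have "zop n {Q \<in> U. b \<notin> Q}" by (rule zop_Int_D[OF U ab(2)])
  moreover have "g \<in> regular_on n m {Q \<in> U. b \<notin> Q}" by (rule regular_on_D[OF U ab(1,2,4)]) simp
  ultimately show ?thesis using that P ab(3) by (auto simp: opns_iff)
qed

lemma sheafify_cong:
  assumes "\<And>g. g \<in> homfrac n m \<Longrightarrow> F g = H g"
  shows "sheafify n m U F = sheafify n m U H"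
  unfolding sheafify_def
proof (intro restrict_ext)
  fix V s assume V: "V \<in> opns n U" and s: "s \<in> sects n m V"
  have z: "zop n V" using V by (simp add: opns_iff)
  obtain g where g: "g \<in> regular_on n m V" "g \<in> homfrac n m" "s = sec n m V g"
    using sections_homfrac[OF z s] .
  have "gen_sec n m V s \<in> regular_on n m V" by (rule gen_sec(1)[OF g(1,3)])
  then show "sec n m V (F (gen_sec n m V s)) = sec n m V (H (gen_sec n m V s))"
    using regular_on_homfrac[OF z] assms by (intro sec_cong) blast
qed

lemma sheafify_mem: "V \<in> opns n U \<Longrightarrow> sheafify n m U F V \<in> extensional (sects n m V)"
  by (simp add: sheafify_def)

lemma restrict_sheafify: "V \<in> opns n U \<Longrightarrow> restrict (sheafify n m U F) (opns n V) = sheafify n m V F"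
  unfolding sheafify_def by (auto simp: fun_eq_iff opns_iff restrict_def)

lemma section_function_eqI:
  assumes "f \<in> extensional (sects n m V)" "f' \<in> extensional (sects n m V)" "zop n V"
    and "\<And>g. g \<in> regular_on n m V \<Longrightarrow> g \<in> homfrac n m \<Longrightarrow> f (sec n m V g) = f' (sec n m V g)"
  shows "f = f'"
proof (rule extensionalityI[OF assms(1,2)])
  fix s assume "s \<in> sects n m V"
  with assms(3) obtain g where "g \<in> regular_on n m V" "g \<in> homfrac n m" "s = sec n m V g" by (rule sections_homfrac)
  then show "f s = f' s" using assms(4) by simp
qed

lemma sheafify_in_sheaf_end:
  assumes U: "zop n U" and F: "preserving n m U F" "linear_op n m F"
  shows "sheafify n m U F \<in> send n m U"
  unfolding proj.sheaf_end_def mem_Collect_eq tw_carrier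
proof (intro conjI ballI allI)
  show "sheafify n m U F \<in> extensional (opns n U)" by (simp add: sheafify_def)
  fix V assume V: "V \<in> opns n U"
  have z: "zop n V" and VU: "V \<subseteq> U" using V by (auto simp: opns_iff)
  show "sheafify n m U F V \<in> sects n m V \<rightarrow>\<^sub>E sects n m V"
  proof (intro PiE_I)
    fix s assume "s \<in> sects n m V"
    with z obtain g where "g \<in> regular_on n m V" "g \<in> homfrac n m" "s = sec n m V g" by (rule sections_homfrac)
    then show "sheafify n m U F V s \<in> sects n m V"
      using sheafify_sec[OF V] sec_in[OF z regular_on_preserving[OF F(1) VU]] by simp
  next
    fix s assume "s \<notin> sects n m V"
    then show "sheafify n m U F V s = undefined" using sheafify_mem[OF V] by (auto simp: extensional_def)
  qed
  fix s assume "s \<in> sects n m V"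
  with z obtain g where g: "g \<in> regular_on n m V" "g \<in> homfrac n m" "s = sec n m V g" by (rule sections_homfrac)
  have Fg: "F g \<in> regular_on n m V" by (rule regular_on_preserving[OF F(1) VU g(1)])
  {
    fix t assume "t \<in> sects n m V"
    with z obtain h where h: "h \<in> regular_on n m V" "h \<in> homfrac n m" "t = sec n m V h" by (rule sections_homfrac)
    have Fh: "F h \<in> regular_on n m V" by (rule regular_on_preserving[OF F(1) VU h(1)])
    have "F (g + h) = F g + F h" using F(2) g(2) h(2) by (simp add: linear_op_def)
    then show "sheafify n m U F V (s \<oplus>\<^bsub>tw n m V\<^esub> t) = sheafify n m U F V s \<oplus>\<^bsub>tw n m V\<^esub> sheafify n m U F V t"
      by (simp add: g(3) h(3) tw_add[OF z g(1) h(1)] sheafify_sec[OF V] g(1) h(1) regular_on_closed(1)[OF z] tw_add[OF z Fg Fh])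
  }
  {
    fix c
    have k: "kconst c \<in> regular_on n 0 V" by (rule regular_on_closed(4)[OF z])
    have "F (kconst c * g) = kconst c * F g" using F(2) g(2) by (simp add: linear_op_def)
    then show "sheafify n m U F V (proj.const_sec (wpoly_alg n) (wpoly_part n) c V \<odot>\<^bsub>tw n m V\<^esub> s) =
        proj.const_sec (wpoly_alg n) (wpoly_part n) c V \<odot>\<^bsub>tw n m V\<^esub> sheafify n m U F V s"
      by (simp add: g(3) const_sec_eq[OF z] tw_smult[OF z k g(1)] sheafify_sec[OF V] g(1)
          regular_on_closed(3)[OF z k g(1)] tw_smult[OF z k Fg])
  }
  fix W assume W: "W \<in> opns n V"
  then have W': "W \<in> opns n U" "W \<subseteq> V" using VU by (auto simp: opns_iff)
  show "sheafify n m U F W (restrict s W) = restrict (sheafify n m U F V s) W"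
    by (simp add: g(3) restrict_sec[OF W'(2)] sheafify_sec[OF V g(1)] sheafify_sec[OF W'(1) regular_on_mono[OF g(1) W'(2)]])
qed

text \<open>Compatibility with restriction to nonempty smaller open sets forces the maps over
  different open sets to agree on the fraction behind a section, because all of them contain the
  generic point. So they are restrictions of one operator on fractions.\<close>

lemma sheaf_end_cases:
  assumes U: "zop n U" "U \<noteq> {}" and phi: "\<phi> \<in> send n m U"
  obtains F where "preserving n m U F" "linear_op n m F" "\<phi> = sheafify n m U F"
proof -
  have ext: "\<phi> \<in> extensional (opns n U)" and E: "\<And>V. V \<in> opns n U \<Longrightarrow> \<phi> V \<in> sects n m V \<rightarrow>\<^sub>E sects n m V"
    and add: "\<And>V s t. V \<in> opns n U \<Longrightarrow> s \<in> sects n m V \<Longrightarrow> t \<in> sects n m V \<Longrightarrow>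
        \<phi> V (s \<oplus>\<^bsub>tw n m V\<^esub> t) = \<phi> V s \<oplus>\<^bsub>tw n m V\<^esub> \<phi> V t"
    and sm: "\<And>V c s. V \<in> opns n U \<Longrightarrow> s \<in> sects n m V \<Longrightarrow>
        \<phi> V (proj.const_sec (wpoly_alg n) (wpoly_part n) c V \<odot>\<^bsub>tw n m V\<^esub> s) =
        proj.const_sec (wpoly_alg n) (wpoly_part n) c V \<odot>\<^bsub>tw n m V\<^esub> \<phi> V s"
    and res: "\<And>V W s. V \<in> opns n U \<Longrightarrow> W \<in> opns n V \<Longrightarrow> s \<in> sects n m V \<Longrightarrow> \<phi> W (restrict s W) = restrict (\<phi> V s) W"
  proof -
    note a = phi[unfolded proj.sheaf_end_def mem_Collect_eq tw_carrier]
    note b = bspec[OF conjunct1[OF conjunct2[OF a]]] and c = conjunct2[OF conjunct2[OF a]]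
    show "\<phi> \<in> extensional (opns n U)" by (rule conjunct1[OF a])
    show "\<phi> V \<in> sects n m V \<rightarrow>\<^sub>E sects n m V" if "V \<in> opns n U" for V
      by (rule conjunct1[OF b[OF that]])
    show "\<phi> V (s \<oplus>\<^bsub>tw n m V\<^esub> t) = \<phi> V s \<oplus>\<^bsub>tw n m V\<^esub> \<phi> V t"
      if "V \<in> opns n U" "s \<in> sects n m V" "t \<in> sects n m V" for V s t
      by (rule bspec[OF bspec[OF conjunct1[OF conjunct2[OF b[OF that(1)]]] that(2)] that(3)])
    show "\<phi> V (proj.const_sec (wpoly_alg n) (wpoly_part n) c V \<odot>\<^bsub>tw n m V\<^esub> s) =
        proj.const_sec (wpoly_alg n) (wpoly_part n) c V \<odot>\<^bsub>tw n m V\<^esub> \<phi> V s"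
      if "V \<in> opns n U" "s \<in> sects n m V" for V c s
      by (rule bspec[OF spec[OF conjunct2[OF conjunct2[OF b[OF that(1)]]]] that(2)])
    show "\<phi> W (restrict s W) = restrict (\<phi> V s) W"
      if "V \<in> opns n U" "W \<in> opns n V" "s \<in> sects n m V" for V W s
      by (rule bspec[OF bspec[OF bspec[OF c that(1)] that(2)] that(3)])
  qed
  define \<Phi> where "\<Phi> = (\<lambda>V g. gen_sec n m V (\<phi> V (sec n m V g)))"
  have \<Phi>: "\<Phi> V g \<in> regular_on n m V" "\<phi> V (sec n m V g) = sec n m V (\<Phi> V g)"
    if V: "V \<in> opns n U" and g: "g \<in> regular_on n m V" for V g
  proof -
    have z: "zop n V" using V by (simp add: opns_iff)
    have "\<phi> V (sec n m V g) \<in> sects n m V" using E[OF V] sec_in[OF z g] by blast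
    from sections_homfrac[OF z this] obtain h where "h \<in> regular_on n m V" "\<phi> V (sec n m V g) = sec n m V h" .
    from gen_sec[OF this] show "\<Phi> V g \<in> regular_on n m V" "\<phi> V (sec n m V g) = sec n m V (\<Phi> V g)"
      by (simp_all only: \<Phi>_def)
  qed
  have mono: "\<Phi> W g = \<Phi> V g" if V: "V \<in> opns n U" and W: "W \<in> opns n V" "W \<noteq> {}" and g: "g \<in> regular_on n m V" for V W g
  proof -
    have W': "W \<in> opns n U" "W \<subseteq> V" and z: "zop n V" using V W by (auto simp: opns_iff)
    have gW: "g \<in> regular_on n m W" by (rule regular_on_mono[OF g W'(2)])
    have "sec n m W (\<Phi> W g) = \<phi> W (restrict (sec n m V g) W)" by (simp add: restrict_sec[OF W'(2)] \<Phi>(2)[OF W'(1) gW])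
    also have "\<dots> = restrict (\<phi> V (sec n m V g)) W" by (rule res[OF V W(1) sec_in[OF z g]])
    also have "\<dots> = sec n m W (\<Phi> V g)" by (simp add: \<Phi>(2)[OF V g] restrict_sec[OF W'(2)])
    finally show ?thesis by (rule sec_inj[OF \<Phi>(1)[OF W'(1) gW] _ W(2)])
  qed
  have dom: "\<exists>V. V \<in> opns n U \<and> V \<noteq> {} \<and> g \<in> regular_on n m V" if "g \<in> homfrac n m" for g
    using common_domain[OF U that that] by metis
  define F where "F = (\<lambda>g. \<Phi> (SOME V. V \<in> opns n U \<and> V \<noteq> {} \<and> g \<in> regular_on n m V) g)"
  have F: "F g = \<Phi> V g" if V: "V \<in> opns n U" "V \<noteq> {}" and g: "g \<in> regular_on n m V" for V g
  proof -
    have z: "zop n V" using V by (simp add: opns_iff)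
    have hg: "g \<in> homfrac n m" by (rule regular_on_homfrac[OF z V(2) g])
    define V' where "V' = (SOME V. V \<in> opns n U \<and> V \<noteq> {} \<and> g \<in> regular_on n m V)"
    have V': "V' \<in> opns n U" "V' \<noteq> {}" "g \<in> regular_on n m V'"
      using someI_ex[OF dom[OF hg]] unfolding V'_def by blast+
    obtain a b d where ab: "a \<in> G n (d + m)" "b \<in> G n d" "b \<noteq> 0" "g = Fract a b" using hg by (rule regular_basic_open)
    \<comment> \<open>Two domains of g are compared through the open set where its denominator b
      does not vanish; the intersection with either domain contains {0}.\<close>
    have mid: "\<Phi> X g = \<Phi> {P \<in> U. b \<notin> P} g" if X: "X \<in> opns n U" "X \<noteq> {}" "g \<in> regular_on n m X" for X
    proof -
      have zX: "zop n X" "X \<subseteq> U" using X by (auto simp: opns_iff)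
      let ?W = "{P \<in> X. b \<notin> P}" and ?B = "{P \<in> U. b \<notin> P}"
      have zW: "zop n ?W" by (rule zop_Int_D[OF zX(1) ab(2)])
      have zB: "zop n ?B" by (rule zop_Int_D[OF U(1) ab(2)])
      have ne: "?W \<noteq> {}" using zop_zero[OF zX(1) X(2)] ab(3) by auto
      have gB: "g \<in> regular_on n m ?B" by (rule regular_on_D[OF U(1) ab(1,2,4)]) simp
      have "\<Phi> ?W g = \<Phi> X g" by (rule mono[OF X(1) _ ne X(3)]) (use zW in \<open>auto simp: opns_iff\<close>)
      moreover have "\<Phi> ?W g = \<Phi> ?B g" by (rule mono[OF _ _ ne gB]) (use zW zB zX in \<open>auto simp: opns_iff\<close>)
      ultimately show ?thesis by simp
    qed
    show ?thesis unfolding F_def V'_def[symmetric] using mid[OF V'] mid[OF V g] by simp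
  qed
  have "preserving n m U F"
    unfolding preserving_def
  proof (intro ballI)
    fix P g assume P: "P \<in> U" and g: "g \<in> reg n P m"
    obtain V where V: "V \<in> opns n U" "P \<in> V" "g \<in> regular_on n m V" using point_domain[OF U(1) P g] .
    then have "F g = \<Phi> V g" by (intro F) auto
    then show "F g \<in> reg n P m" using \<Phi>(1)[OF V(1,3)] V(2) by (simp add: regular_on_def)
  qed
  moreover have "linear_op n m F"
    unfolding linear_op_def
  proof (intro conjI ballI allI)
    fix g h assume gh: "g \<in> homfrac n m" "h \<in> homfrac n m"
    obtain V where V: "V \<in> opns n U" "V \<noteq> {}" and r: "g \<in> regular_on n m V" "h \<in> regular_on n m V"
      using common_domain[OF U gh] .
    have z: "zop n V" using V by (simp add: opns_iff)
    note s = regular_on_closed(1)[OF z r]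
    have "sec n m V (\<Phi> V (g + h)) = sec n m V (\<Phi> V g + \<Phi> V h)"
      using add[OF V(1) sec_in[OF z r(1)] sec_in[OF z r(2)]]
      by (simp add: tw_add[OF z r] \<Phi>(2)[OF V(1)] r s tw_add[OF z \<Phi>(1)[OF V(1) r(1)] \<Phi>(1)[OF V(1) r(2)]])
    from sec_inj[OF \<Phi>(1)[OF V(1) s] this V(2)]
    show "F (g + h) = F g + F h" by (simp add: F[OF V] r s)
  next
    fix c g assume g: "g \<in> homfrac n m"
    obtain V where V: "V \<in> opns n U" "V \<noteq> {}" and r: "g \<in> regular_on n m V"
      using common_domain[OF U g g] .
    have z: "zop n V" using V by (simp add: opns_iff)
    have k: "kconst c \<in> regular_on n 0 V" by (rule regular_on_closed(4)[OF z])
    note s = regular_on_closed(3)[OF z k r]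
    have "sec n m V (\<Phi> V (kconst c * g)) = sec n m V (kconst c * \<Phi> V g)"
      using sm[OF V(1) sec_in[OF z r], of c]
      by (simp add: const_sec_eq[OF z] tw_smult[OF z k r] \<Phi>(2)[OF V(1)] r s tw_smult[OF z k \<Phi>(1)[OF V(1) r]])
    from sec_inj[OF \<Phi>(1)[OF V(1) s] this V(2)]
    show "F (kconst c * g) = kconst c * F g" by (simp add: F[OF V] r s)
  qed
  moreover have "\<phi> = sheafify n m U F"
  proof (rule extensionalityI[OF ext])
    show "sheafify n m U F \<in> extensional (opns n U)" by (simp add: sheafify_def)
    fix V assume V: "V \<in> opns n U"
    have z: "zop n V" using V by (simp add: opns_iff)
    show "\<phi> V = sheafify n m U F V"
    proof (rule section_function_eqI[OF _ sheafify_mem[OF V] z])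
      show "\<phi> V \<in> extensional (sects n m V)" using E[OF V] by (simp add: PiE_def)
      fix g assume g: "g \<in> regular_on n m V"
      show "\<phi> V (sec n m V g) = sheafify n m U F V (sec n m V g)"
        unfolding sheafify_sec[OF V g] \<Phi>(2)[OF V g] by (intro sec_cong) (simp add: F[OF V _ g])
    qed
  qed
  ultimately show ?thesis using that by blast
qed

text \<open>Since F preserves regularity, both terms of the commutator are sections, and the
  subtraction in the record is the one of fractions.\<close>

lemma commutator_sheafify:
  assumes V: "V \<in> opns n U" and F: "preserving n m U F" and f: "f \<in> regular_on n 0 V"
  shows "comm n m V (restrict (sheafify n m U F) (opns n V)) (sec n 0 V f) =
     sheafify n m V (\<lambda>g. F (f * g) - f * F g)"
  unfolding restrict_sheafify[OF V]
proof (rule extensionalityI[of _ "opns n V"])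
  show "comm n m V (sheafify n m V F) (sec n 0 V f) \<in> extensional (opns n V)"
    by (simp add: proj.commutator_def)
  show "sheafify n m V (\<lambda>g. F (f * g) - f * F g) \<in> extensional (opns n V)" by (simp add: sheafify_def)
  fix W assume W: "W \<in> opns n V"
  have z: "zop n W" and WV: "W \<subseteq> V" and WU: "W \<subseteq> U" using V W by (auto simp: opns_iff)
  show "comm n m V (sheafify n m V F) (sec n 0 V f) W = sheafify n m V (\<lambda>g. F (f * g) - f * F g) W"
  proof (rule section_function_eqI[OF _ sheafify_mem[OF W] z])
    show "comm n m V (sheafify n m V F) (sec n 0 V f) W \<in> extensional (sects n m W)"
      by (simp add: proj.commutator_def W tw_carrier)
    fix g assume g: "g \<in> regular_on n m W"
    have fW: "f \<in> regular_on n 0 W" by (rule regular_on_mono[OF f WV])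
    note fg = regular_on_closed(3)[OF z fW g]
    have Fg: "F g \<in> regular_on n m W" by (rule regular_on_preserving[OF F WU g])
    have Ffg: "F (f * g) \<in> regular_on n m W" by (rule regular_on_preserving[OF F WU fg])
    show "comm n m V (sheafify n m V F) (sec n 0 V f) W (sec n m W g) =
        sheafify n m V (\<lambda>g. F (f * g) - f * F g) W (sec n m W g)"
      by (simp add: proj.commutator_def W tw_carrier sec_in[OF z g] restrict_sec[OF WV] tw_smult[OF z fW g]
        sheafify_sec[OF W fg] sheafify_sec[OF W g] tw_smult[OF z fW Fg]
        tw_minus[OF z Ffg regular_on_closed(3)[OF z fW Fg]])
  qed
qed

lemma preserving_commutator:
  assumes U: "zop n U" and F: "preserving n m U F" and f: "f \<in> regular_on n 0 U"
  shows "preserving n m U (\<lambda>g. F (f * g) - f * F g)"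
  unfolding preserving_def
proof (intro ballI)
  fix P g assume P: "P \<in> U" and g: "g \<in> reg n P m"
  have p: "P \<in> pts n" using zop_subset[OF U] P by blast
  have f: "f \<in> reg n P 0" using f P by (simp add: regular_on_def)
  have "f * g \<in> reg n P m" using reg_mult[OF p f g] by simp
  then have 1: "F (f * g) \<in> reg n P m" using F P by (simp add: preserving_def)
  have "F g \<in> reg n P m" using F P g by (simp add: preserving_def)
  then have "f * F g \<in> reg n P m" using reg_mult[OF p f, of "F g" m] by simp
  then show "F (f * g) - f * F g \<in> reg n P m" by (rule reg_diff[OF p 1])
qed

lemma linear_op_commutator:
  assumes F: "linear_op n m F" and f: "f \<in> homfrac n 0"
  shows "linear_op n m (\<lambda>g. F (f * g) - f * F g)"
proof -
  have fg: "f * g \<in> homfrac n m" if "g \<in> homfrac n m" for g using homfrac_mult[OF f that] by simp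
  have "F (f * (g + h)) = F (f * g) + F (f * h)" "F (g + h) = F g + F h" if "g \<in> homfrac n m" "h \<in> homfrac n m" for g h
    using F fg that by (simp_all add: linear_op_def distrib_left)
  moreover have "F (f * (kconst c * g)) = kconst c * F (f * g)" "F (kconst c * g) = kconst c * F g" if "g \<in> homfrac n m" for g c
    using F fg[OF that] that unfolding mult.left_commute[of f "kconst c" g] by (simp_all add: linear_op_def)
  ultimately show ?thesis by (simp add: linear_op_def algebra_simps)
qed

lemma sections0_homfrac:
  assumes "V \<in> opns n U" "f \<in> carrier (proj.struct_sheaf (wpoly_alg n) (wpoly_part n) V)"
  obtains f' where "f' \<in> regular_on n 0 V" "f' \<in> homfrac n 0" "f = sec n 0 V f'"
proof -
  have "f \<in> sects n 0 V" using assms(2) by (simp add: proj.struct_sheaf_def)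
  then show ?thesis using that assms(1) sections_homfrac[of n V f 0] by (auto simp: opns_iff)
qed

lemma dop_sheafify:
  assumes "zop n U" "preserving n m U F" "linear_op n m F" "dop (homfrac n 0) (homfrac n m) k F"
  shows "sheafify n m U F \<in> dle n m k U"
  using assms
proof (induction k arbitrary: U F)
  case 0
  show ?case unfolding proj.diffops_le.simps mem_Collect_eq tw_carrier
  proof (intro conjI ballI sheafify_in_sheaf_end 0)
    fix V f s assume V: "V \<in> opns n U" and f: "f \<in> carrier (proj.struct_sheaf (wpoly_alg n) (wpoly_part n) V)"
      and s: "s \<in> sects n m V"
    have z: "zop n V" and VU: "V \<subseteq> U" using V by (auto simp: opns_iff)
    obtain f' where f': "f' \<in> regular_on n 0 V" "f' \<in> homfrac n 0" "f = sec n 0 V f'" using sections0_homfrac[OF V f] .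
    obtain g where g: "g \<in> regular_on n m V" "g \<in> homfrac n m" "s = sec n m V g" using sections_homfrac[OF z s] .
    have Fg: "F g \<in> regular_on n m V" by (rule regular_on_preserving[OF 0(2) VU g(1)])
    have "F (f' * g) = f' * F g" using 0(4)[unfolded dop.simps] f'(2) g(2) by blast
    then show "sheafify n m U F V (f \<odot>\<^bsub>tw n m V\<^esub> s) = f \<odot>\<^bsub>tw n m V\<^esub> sheafify n m U F V s"
      by (simp add: f'(3) g(3) tw_smult[OF z f'(1) g(1)] sheafify_sec[OF V] g(1)
          regular_on_closed(3)[OF z f'(1) g(1)] tw_smult[OF z f'(1) Fg])
  qed
next
  case (Suc k)
  show ?case unfolding proj.diffops_le.simps mem_Collect_eq
  proof (intro conjI ballI sheafify_in_sheaf_end Suc.prems(1-3))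
    fix V f assume V: "V \<in> opns n U" and f: "f \<in> carrier (proj.struct_sheaf (wpoly_alg n) (wpoly_part n) V)"
    have z: "zop n V" and VU: "V \<subseteq> U" using V by (auto simp: opns_iff)
    obtain f' where f': "f' \<in> regular_on n 0 V" "f' \<in> homfrac n 0" "f = sec n 0 V f'" using sections0_homfrac[OF V f] .
    show "comm n m V (restrict (sheafify n m U F) (opns n V)) f \<in> dle n m k V"
      unfolding f'(3) commutator_sheafify[OF V Suc.prems(2) f'(1)]
    proof (rule Suc.IH[OF z])
      show "preserving n m V (\<lambda>g. F (f' * g) - f' * F g)"
        by (rule preserving_commutator[OF z preserving_mono[OF Suc.prems(2) VU] f'(1)])
      show "linear_op n m (\<lambda>g. F (f' * g) - f' * F g)"
        by (rule linear_op_commutator[OF Suc.prems(3) f'(2)])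
      show "dop (homfrac n 0) (homfrac n m) k (\<lambda>g. F (f' * g) - f' * F g)"
        using Suc.prems(4)[unfolded dop.simps] f'(2) by blast
    qed
  qed
qed

text \<open>Given fractions are regular on a common nonempty open set, and there the condition on
  sections becomes an identity in the function field.\<close>

lemma sheafify_dop:
  assumes "zop n U" "U \<noteq> {}" "preserving n m U F" "linear_op n m F" "sheafify n m U F \<in> dle n m k U"
  shows "dop (homfrac n 0) (homfrac n m) k F"
  using assms
proof (induction k arbitrary: U F)
  case 0
  show ?case unfolding dop.simps
  proof (intro ballI)
    fix f g assume f: "f \<in> homfrac n 0" and g: "g \<in> homfrac n m"
    obtain V where V: "V \<in> opns n U" "V \<noteq> {}" and r: "f \<in> regular_on n 0 V" "g \<in> regular_on n m V"
      using common_domain[OF 0(1,2) f g] .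
    have z: "zop n V" and VU: "V \<subseteq> U" using V by (auto simp: opns_iff)
    have Fg: "F g \<in> regular_on n m V" by (rule regular_on_preserving[OF 0(3) VU r(2)])
    have Ffg: "F (f * g) \<in> regular_on n m V"
      by (rule regular_on_preserving[OF 0(3) VU regular_on_closed(3)[OF z r]])
    have A: "\<forall>V\<in>opns n U. \<forall>f\<in>carrier (proj.struct_sheaf (wpoly_alg n) (wpoly_part n) V). \<forall>s\<in>sects n m V.
       sheafify n m U F V (f \<odot>\<^bsub>tw n m V\<^esub> s) = f \<odot>\<^bsub>tw n m V\<^esub> sheafify n m U F V s"
      using 0(5) unfolding proj.diffops_le.simps mem_Collect_eq tw_carrier by (rule conjunct2)
    have B: "sec n 0 V f \<in> carrier (proj.struct_sheaf (wpoly_alg n) (wpoly_part n) V)"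
      using sec_in[OF z r(1)] by (simp add: proj.struct_sheaf_def)
    have "sheafify n m U F V (sec n 0 V f \<odot>\<^bsub>tw n m V\<^esub> sec n m V g) = sec n 0 V f \<odot>\<^bsub>tw n m V\<^esub> sheafify n m U F V (sec n m V g)"
      by (rule bspec[OF bspec[OF bspec[OF A V(1)] B] sec_in[OF z r(2)]])
    then have "sec n m V (F (f * g)) = sec n m V (f * F g)"
      by (simp add: tw_smult[OF z r] sheafify_sec[OF V(1)] r regular_on_closed(3)[OF z r] tw_smult[OF z r(1) Fg])
    from sec_inj[OF Ffg this V(2)] show "F (f * g) = f * F g" .
  qed
next
  case (Suc k)
  show ?case unfolding dop.simps
  proof (intro ballI)
    fix f assume f: "f \<in> homfrac n 0"
    obtain V where V: "V \<in> opns n U" "V \<noteq> {}" and r: "f \<in> regular_on n 0 V"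
      using common_domain[OF Suc.prems(1,2) f f] .
    have z: "zop n V" and VU: "V \<subseteq> U" using V by (auto simp: opns_iff)
    have A: "\<forall>V\<in>opns n U. \<forall>f\<in>carrier (proj.struct_sheaf (wpoly_alg n) (wpoly_part n) V).
       comm n m V (restrict (sheafify n m U F) (opns n V)) f \<in> dle n m k V"
      using Suc.prems(5) unfolding proj.diffops_le.simps mem_Collect_eq by (rule conjunct2)
    have B: "sec n 0 V f \<in> carrier (proj.struct_sheaf (wpoly_alg n) (wpoly_part n) V)"
      using sec_in[OF z r(1)] by (simp add: proj.struct_sheaf_def)
    have "comm n m V (restrict (sheafify n m U F) (opns n V)) (sec n 0 V f) \<in> dle n m k V"
      by (rule bspec[OF bspec[OF A V(1)] B])
    then have d: "sheafify n m V (\<lambda>g. F (f * g) - f * F g) \<in> dle n m k V"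
      by (simp only: commutator_sheafify[OF V(1) Suc.prems(3) r])
    show "dop (homfrac n 0) (homfrac n m) k (\<lambda>g. F (f * g) - f * F g)"
      by (rule Suc.IH[OF z V(2) _ _ d])
        (rule preserving_commutator[OF z preserving_mono[OF Suc.prems(3) VU] r],
         rule linear_op_commutator[OF Suc.prems(4) f])
  qed
qed

lemma pts_open: "pts n \<in> opns n (pts n)"
  unfolding opns_iff by (intro conjI zop_pts subset_refl)

lemma pts_nonempty: "pts n \<noteq> {}"
  by (rule ex_in_conv[THEN iffD1], rule exI, rule zero_point)

lemma sheafify_diffop:
  assumes F: "preserving n m (pts n) F" "linear_op n m F" "dop (homfrac n 0) (homfrac n m) k F"
  shows "sheafify n m (pts n) F \<in> dops n m (pts n)"
proof -
  have "sheafify n m (pts n) F \<in> dle n m k (pts n)" by (rule dop_sheafify[OF zop_pts F])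
  then have "restrict (sheafify n m (pts n) F) (opns n (pts n)) \<in> dle n m k (pts n)"
    by (simp only: restrict_sheafify[OF pts_open])
  then show ?thesis unfolding proj.diffops_def mem_Collect_eq
    by (intro conjI ballI sheafify_in_sheaf_end[OF zop_pts F(1,2)] bexI[OF _ pts_open] exI[of _ k])
qed

text \<open>The order is bounded only locally, but a bound on one neighbourhood of the generic point
  is already a bound for the operator on all fractions. Hence global differential operators have
  finite order.\<close>

lemma diffop_cases:
  assumes "\<phi> \<in> dops n m (pts n)"
  obtains F k where "preserving n m (pts n) F" "linear_op n m F" "dop (homfrac n 0) (homfrac n m) k F"
    "\<phi> = sheafify n m (pts n) F"
proof -
  note a = assms[unfolded proj.diffops_def mem_Collect_eq]
  from conjunct1[OF a] obtain F where F: "preserving n m (pts n) F" "linear_op n m F" "\<phi> = sheafify n m (pts n) F"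
    by (rule sheaf_end_cases[OF zop_pts pts_nonempty])
  obtain V k where V: "V \<in> opns n (pts n)" "{0} \<in> V" "restrict \<phi> (opns n V) \<in> dle n m k V"
    using bspec[OF conjunct2[OF a] zero_point] by (elim bexE exE conjE)
  have z: "zop n V" "V \<subseteq> pts n" using V by (auto simp: opns_iff)
  have "dop (homfrac n 0) (homfrac n m) k F"
  proof (rule sheafify_dop[OF z(1) _ preserving_mono[OF F(1) z(2)] F(2)])
    show "V \<noteq> {}" using V(2) by blast
    show "sheafify n m V F \<in> dle n m k V" using V(3) unfolding F(3) restrict_sheafify[OF V(1)] .
  qed
  then show ?thesis using that F by blast
qed

section \<open>The algebra of global operators in terms of operators on fractions\<close>

lemma D_alg_simps:
  "carrier (D_alg n l) = dops n l (pts n)"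
  "mult (D_alg n l) = (\<lambda>\<phi> \<psi>. \<lambda>V\<in>opns n (pts n). \<lambda>s\<in>sects n l V. \<phi> V (\<psi> V s))"
  "one (D_alg n l) = (\<lambda>V\<in>opns n (pts n). \<lambda>s\<in>sects n l V. s)"
  "add (D_alg n l) = (\<lambda>\<phi> \<psi>. \<lambda>V\<in>opns n (pts n). \<lambda>s\<in>sects n l V. \<phi> V s \<oplus>\<^bsub>tw n l V\<^esub> \<psi> V s)"
  "smult (D_alg n l) = (\<lambda>c \<phi>. \<lambda>V\<in>opns n (pts n). \<lambda>s\<in>sects n l V.
     proj.const_sec (wpoly_alg n) (wpoly_part n) c V \<odot>\<^bsub>tw n l V\<^esub> \<phi> V s)"
  by (simp_all add: D_alg_def proj.diffop_alg_def tw_carrier)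

lemma family_eqI:
  assumes "\<phi> \<in> extensional (opns n U)" "\<psi> \<in> extensional (opns n U)"
    and "\<And>V. V \<in> opns n U \<Longrightarrow> \<phi> V \<in> extensional (sects n m V)"
    and "\<And>V. V \<in> opns n U \<Longrightarrow> \<psi> V \<in> extensional (sects n m V)"
    and "\<And>V g. V \<in> opns n U \<Longrightarrow> g \<in> regular_on n m V \<Longrightarrow> \<phi> V (sec n m V g) = \<psi> V (sec n m V g)"
  shows "\<phi> = \<psi>"
proof (rule extensionalityI[OF assms(1,2)])
  fix V assume V: "V \<in> opns n U"
  then have "zop n V" by (simp add: opns_iff)
  from section_function_eqI[OF assms(3,4)[OF V] this] assms(5)[OF V] show "\<phi> V = \<psi> V" by blast
qed

lemma sheafify_ext: "sheafify n m U F \<in> extensional (opns n U)"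
  by (simp add: sheafify_def)

lemma opns_zop: "V \<in> opns n U \<Longrightarrow> zop n V" and opns_sub: "V \<in> opns n U \<Longrightarrow> V \<subseteq> U"
  by (simp_all add: opns_iff)

lemma D_alg_mult:
  assumes "preserving n l (pts n) H"
  shows "sheafify n l (pts n) F \<otimes>\<^bsub>D_alg n l\<^esub> sheafify n l (pts n) H = sheafify n l (pts n) (\<lambda>g. F (H g))"
  unfolding D_alg_simps
proof (rule family_eqI[OF _ sheafify_ext _ sheafify_mem])
  fix V g assume V: "V \<in> opns n (pts n)" and g: "g \<in> regular_on n l V"
  have "H g \<in> regular_on n l V" by (rule regular_on_preserving[OF assms opns_sub[OF V] g])
  then show "(\<lambda>V\<in>opns n (pts n). \<lambda>s\<in>sects n l V. sheafify n l (pts n) F V (sheafify n l (pts n) H V s)) V (sec n l V g) =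
      sheafify n l (pts n) (\<lambda>g. F (H g)) V (sec n l V g)"
    using V by (simp add: sec_in[OF opns_zop[OF V] g] sheafify_sec[OF V] g)
qed auto

lemma D_alg_one: "\<one>\<^bsub>D_alg n l\<^esub> = sheafify n l (pts n) (\<lambda>g. g)"
  unfolding D_alg_simps
proof (rule family_eqI[OF _ sheafify_ext _ sheafify_mem])
  fix V g assume V: "V \<in> opns n (pts n)" and g: "g \<in> regular_on n l V"
  then show "(\<lambda>V\<in>opns n (pts n). \<lambda>s\<in>sects n l V. s) V (sec n l V g) = sheafify n l (pts n) (\<lambda>g. g) V (sec n l V g)"
    by (simp add: sec_in[OF opns_zop[OF V] g] sheafify_sec[OF V])
qed auto

lemma D_alg_add:
  assumes "preserving n l (pts n) F" "preserving n l (pts n) H"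
  shows "sheafify n l (pts n) F \<oplus>\<^bsub>D_alg n l\<^esub> sheafify n l (pts n) H = sheafify n l (pts n) (\<lambda>g. F g + H g)"
  unfolding D_alg_simps
proof (rule family_eqI[OF _ sheafify_ext _ sheafify_mem])
  fix V g assume V: "V \<in> opns n (pts n)" and g: "g \<in> regular_on n l V"
  have "F g \<in> regular_on n l V" "H g \<in> regular_on n l V"
    by (rule regular_on_preserving[OF assms(1) opns_sub[OF V] g], rule regular_on_preserving[OF assms(2) opns_sub[OF V] g])
  note s = tw_add[OF opns_zop[OF V] this]
  show "(\<lambda>V\<in>opns n (pts n). \<lambda>s\<in>sects n l V. sheafify n l (pts n) F V s \<oplus>\<^bsub>tw n l V\<^esub> sheafify n l (pts n) H V s) V (sec n l V g) =
      sheafify n l (pts n) (\<lambda>g. F g + H g) V (sec n l V g)"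
    using V by (simp add: sec_in[OF opns_zop[OF V] g] sheafify_sec[OF V] g s)
qed auto

lemma D_alg_smult:
  assumes "preserving n l (pts n) F"
  shows "c \<odot>\<^bsub>D_alg n l\<^esub> sheafify n l (pts n) F = sheafify n l (pts n) (\<lambda>g. kconst c * F g)"
  unfolding D_alg_simps
proof (rule family_eqI[OF _ sheafify_ext _ sheafify_mem])
  fix V g assume V: "V \<in> opns n (pts n)" and g: "g \<in> regular_on n l V"
  note z = opns_zop[OF V]
  have "F g \<in> regular_on n l V" by (rule regular_on_preserving[OF assms(1) opns_sub[OF V] g])
  note s = tw_smult[OF z regular_on_closed(4)[OF z, of c] this]
  show "(\<lambda>V\<in>opns n (pts n). \<lambda>s\<in>sects n l V. proj.const_sec (wpoly_alg n) (wpoly_part n) c V \<odot>\<^bsub>tw n l V\<^esub> sheafify n l (pts n) F V s) V (sec n l V g) =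
      sheafify n l (pts n) (\<lambda>g. kconst c * F g) V (sec n l V g)"
    using V by (simp add: sec_in[OF z g] sheafify_sec[OF V] g s const_sec_eq[OF z])
qed auto

section \<open>Polynomial functions on lattices\<close>

text \<open>A set of functions rather than of formal polynomials, so that substitution is
  composition; a formal polynomial is formed in one variable only, in
  \<open>polyfun_one_variable\<close>. Coordinates outside 1..n+1 do not matter, see
  \<open>polyfun_local\<close>.\<close>

inductive_set polyfun :: "nat \<Rightarrow> ((nat \<Rightarrow> complex) \<Rightarrow> complex) set" for n where
  const: "(\<lambda>x. c) \<in> polyfun n"
| coord: "i \<in> {1..n+1} \<Longrightarrow> (\<lambda>x. x i) \<in> polyfun n"
| add: "p \<in> polyfun n \<Longrightarrow> q \<in> polyfun n \<Longrightarrow> (\<lambda>x. p x + q x) \<in> polyfun n"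
| mult: "p \<in> polyfun n \<Longrightarrow> q \<in> polyfun n \<Longrightarrow> (\<lambda>x. p x * q x) \<in> polyfun n"

lemma polyfun_diff: "p \<in> polyfun n \<Longrightarrow> q \<in> polyfun n \<Longrightarrow> (\<lambda>x. p x - q x) \<in> polyfun n"
  using polyfun.add[OF _ polyfun.mult[OF polyfun.const[of "-1"]], of p n q] by simp

lemma polyfun_sum: "(\<And>i. i \<in> A \<Longrightarrow> p i \<in> polyfun n) \<Longrightarrow> (\<lambda>x. \<Sum>i\<in>A. p i x) \<in> polyfun n"
  by (induction A rule: infinite_finite_induct) (auto intro: polyfun.intros)

lemma polyfun_prod: "(\<And>i. i \<in> A \<Longrightarrow> p i \<in> polyfun n) \<Longrightarrow> (\<lambda>x. \<Prod>i\<in>A. p i x) \<in> polyfun n"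
  by (induction A rule: infinite_finite_induct) (auto intro: polyfun.intros)

lemma polyfun_local:
  assumes "p \<in> polyfun n" "\<And>i. i \<in> {1..n+1} \<Longrightarrow> x i = y i"
  shows "p x = p y"
  using assms by induction simp_all

lemma polyfun_subst:
  assumes "p \<in> polyfun n" and "\<And>i. i \<in> {1..n+1} \<Longrightarrow> (\<lambda>x. \<sigma> x i) \<in> polyfun n"
  shows "(\<lambda>x. p (\<sigma> x)) \<in> polyfun n"
  using assms by induction (auto intro: polyfun.intros)

lemma polyfun_one_variable:
  assumes "p \<in> polyfun n"
  shows "\<exists>q :: complex poly. \<forall>t. p (x(i := t)) = poly q t"
  using assms
proof induction
  case (const c)
  then show ?case by (intro exI[of _ "[:c:]"]) simp
next
  case (coord k)
  then show ?case by (intro exI[of _ "if k = i then [:0, 1:] else [:x k:]"]) simp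
next
  case (add p q)
  then obtain P Q where *: "\<And>t. p (x(i := t)) = poly P t" "\<And>t. q (x(i := t)) = poly Q t" by blast
  show ?case by (intro exI[of _ "P + Q"] allI) (simp only: * poly_add)
next
  case (mult p q)
  then obtain P Q where *: "\<And>t. p (x(i := t)) = poly P t" "\<And>t. q (x(i := t)) = poly Q t" by blast
  show ?case by (intro exI[of _ "P * Q"] allI) (simp only: * poly_mult)
qed

text \<open>The coordinates in J are freed one at a time: as a function of one coordinate, p is a
  polynomial with all natural numbers among its roots.\<close>

lemma polyfun_zero_of_Nats:
  fixes x :: "nat \<Rightarrow> complex"
  assumes p: "p \<in> polyfun n" and "finite J" and "\<And>x :: nat \<Rightarrow> complex. (\<And>i. i \<in> J \<Longrightarrow> x i \<in> \<nat>) \<Longrightarrow> p x = 0"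
  shows "p x = 0"
  using assms(2,3)
proof (induction J arbitrary: x)
  case empty
  then show ?case by simp
next
  case (insert j J)
  show ?case
  proof (rule insert.IH)
    fix y :: "nat \<Rightarrow> complex" assume y: "\<And>i. i \<in> J \<Longrightarrow> y i \<in> \<nat>"
    obtain q where q: "\<forall>t. p (y(j := t)) = poly q t" using polyfun_one_variable[OF p] by blast
    have "poly q (of_nat k) = 0" for k
    proof -
      have "p (y(j := of_nat k)) = 0" by (rule insert.prems) (use y in auto)
      then show ?thesis using q by simp
    qed
    then have "range (of_nat :: nat \<Rightarrow> complex) \<subseteq> {t. poly q t = 0}" by auto
    moreover have "infinite (range (of_nat :: nat \<Rightarrow> complex))"
      by (simp add: finite_image_iff inj_of_nat)
    ultimately have "q = 0" using poly_roots_finite finite_subset by blast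
    then have "p (y(j := y j)) = 0" using q[rule_format, of "y j"] by (simp only: poly_0)
    then show "p y = 0" by (simp only: fun_upd_triv)
  qed
qed

text \<open>If \<kappa>_j = 1, the argument of the second p is the projection of x along \<kappa> to
  the slice x_j = c. So this is division by x_j - c whose remainder is the value of p at the
  projected point.\<close>

lemma polyfun_divide:
  assumes p: "p \<in> polyfun n" and j: "j \<in> {1..n+1}"
  shows "\<exists>q\<in>polyfun n. \<forall>x. p x - p (\<lambda>k. x k + (c - x j) * \<kappa> k) = (x j - c) * q x"
  using p
proof induction
  case (const a)
  show ?case by (intro bexI[of _ "\<lambda>x. 0"]) (auto intro: polyfun.const)
next
  case (coord i)
  show ?case by (intro bexI[of _ "\<lambda>x. \<kappa> i"]) (auto intro: polyfun.const simp: algebra_simps)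
next
  case (add p1 p2)
  then obtain q1 q2 where q: "q1 \<in> polyfun n" "\<forall>x. p1 x - p1 (\<lambda>k. x k + (c - x j) * \<kappa> k) = (x j - c) * q1 x"
      "q2 \<in> polyfun n" "\<forall>x. p2 x - p2 (\<lambda>k. x k + (c - x j) * \<kappa> k) = (x j - c) * q2 x" by blast
  have "p1 x + p2 x - (p1 (\<lambda>k. x k + (c - x j) * \<kappa> k) + p2 (\<lambda>k. x k + (c - x j) * \<kappa> k)) = (x j - c) * (q1 x + q2 x)" for x
    using q(2,4)[rule_format, of x] by (simp add: algebra_simps)
  then show ?case using q by (intro bexI[of _ "\<lambda>x. q1 x + q2 x"]) (auto intro: polyfun.add)
next
  case (mult p1 p2)
  let ?s = "\<lambda>x k. x k + (c - x j) * \<kappa> k"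
  obtain q1 q2 where q: "q1 \<in> polyfun n" "\<forall>x. p1 x - p1 (?s x) = (x j - c) * q1 x"
      "q2 \<in> polyfun n" "\<forall>x. p2 x - p2 (?s x) = (x j - c) * q2 x" using mult.IH by blast
  have 1: "(\<lambda>x. ?s x i) \<in> polyfun n" if "i \<in> {1..n+1}" for i
    by (intro polyfun.add polyfun.mult polyfun.coord polyfun.const polyfun_diff that j)
  have "p1 x * p2 x - p1 (?s x) * p2 (?s x) = (x j - c) * (q1 x * p2 x + p1 (?s x) * q2 x)" for x
  proof -
    have "p1 x * p2 x - p1 (?s x) * p2 (?s x) = (p1 x - p1 (?s x)) * p2 x + p1 (?s x) * (p2 x - p2 (?s x))"
      by (simp add: algebra_simps)
    also have "\<dots> = ((x j - c) * q1 x) * p2 x + p1 (?s x) * ((x j - c) * q2 x)"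
      by (simp only: q(2,4)[rule_format])
    finally show ?thesis by (simp add: algebra_simps)
  qed
  moreover have "(\<lambda>x. q1 x * p2 x + p1 (?s x) * q2 x) \<in> polyfun n"
    by (intro polyfun.add polyfun.mult q(1,3) mult.hyps polyfun_subst[OF mult.hyps(1)] 1)
  ultimately show ?case by (intro bexI[of _ "\<lambda>x. q1 x * p2 x + p1 (?s x) * q2 x"]) auto
qed

text \<open>Newton expansions in the direction \<open>\<kappa>\<close>: sums of a \<open>\<kappa>\<close>-invariant polynomial times a binomial
  coefficient of the \<open>j\<close>-th coordinate, which are easy to sum.\<close>

inductive_set newton :: "nat \<Rightarrow> nat \<Rightarrow> (nat \<Rightarrow> complex) \<Rightarrow> ((nat \<Rightarrow> complex) \<Rightarrow> complex) set" for n j \<kappa> where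
  base: "a \<in> polyfun n \<Longrightarrow> (\<And>x. a (\<lambda>k. x k + \<kappa> k) = a x) \<Longrightarrow> (\<lambda>x. a x * (x j gchoose d)) \<in> newton n j \<kappa>"
| add: "p \<in> newton n j \<kappa> \<Longrightarrow> q \<in> newton n j \<kappa> \<Longrightarrow> (\<lambda>x. p x + q x) \<in> newton n j \<kappa>"

lemma newton_invariant_mult:
  assumes "s \<in> newton n j \<kappa>" and b: "b \<in> polyfun n" "\<And>x. b (\<lambda>k. x k + \<kappa> k) = b x"
  shows "(\<lambda>x. b x * s x) \<in> newton n j \<kappa>"
  using assms(1)
proof induction
  case (base a d)
  have "(\<lambda>x. (b x * a x) * (x j gchoose d)) \<in> newton n j \<kappa>"
    by (rule newton.base) (rule polyfun.mult[OF b(1) base(1)], simp only: b(2) base(2))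
  then show ?case by (simp add: mult.assoc)
next
  case (add p q)
  then show ?case using newton.add[OF add.IH] by (simp add: distrib_left)
qed

text \<open>The identity x C(x, d) = d C(x, d) + (d + 1) C(x, d + 1) keeps the shape of the
  expansion.\<close>

lemma newton_coord_mult:
  assumes "s \<in> newton n j \<kappa>"
  shows "(\<lambda>x. x j * s x) \<in> newton n j \<kappa>"
  using assms
proof induction
  case (base a d)
  have "(\<lambda>x. (of_nat d * a x) * (x j gchoose d) + (of_nat (Suc d) * a x) * (x j gchoose (Suc d))) \<in> newton n j \<kappa>"
    by (intro newton.add newton.base) (rule polyfun.mult[OF polyfun.const base(1)], simp only: base(2))+
  moreover have "(of_nat d * a x) * (x j gchoose d) + (of_nat (Suc d) * a x) * (x j gchoose (Suc d)) = x j * (a x * (x j gchoose d))" for x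
    using arg_cong[OF gbinomial_mult_1[of "x j" d], of "\<lambda>t. a x * t"] by (simp add: algebra_simps)
  ultimately show ?case by simp
next
  case (add p q)
  then show ?case using newton.add[OF add.IH] by (simp add: distrib_left)
qed

text \<open>The coordinate x_i is split as (x_i - \<kappa>_i x_j) + \<kappa>_i x_j, a
  \<kappa>-invariant function plus a multiple of x_j.\<close>

lemma newton_polyfun_mult:
  assumes p: "p \<in> polyfun n" and j: "j \<in> {1..n+1}" "\<kappa> j = 1" and "s \<in> newton n j \<kappa>"
  shows "(\<lambda>x. p x * s x) \<in> newton n j \<kappa>"
  using p \<open>s \<in> newton n j \<kappa>\<close>
proof (induction arbitrary: s)
  case (const c)
  then show ?case by (intro newton_invariant_mult polyfun.const) auto
next
  case (coord i)
  have "(\<lambda>x. (x i - \<kappa> i * x j) * s x + \<kappa> i * (x j * s x)) \<in> newton n j \<kappa>"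
    by (intro newton.add newton_invariant_mult newton_coord_mult polyfun.const polyfun.coord polyfun.mult
        polyfun_diff coord j) (auto simp: j algebra_simps)
  then show ?case by (simp add: algebra_simps)
next
  case (add p q)
  then show ?case using newton.add[OF add.IH(1)[OF add.prems] add.IH(2)[OF add.prems]] by (simp add: distrib_right)
next
  case (mult p q)
  then show ?case using mult.IH(1)[OF mult.IH(2)[OF mult.prems]] by (simp add: mult.assoc)
qed

lemma polyfun_gbinomial: "j \<in> {1..n+1} \<Longrightarrow> (\<lambda>x. x j gchoose d) \<in> polyfun n"
proof -
  assume j: "j \<in> {1..n+1}"
  have "(\<lambda>x. inverse (fact d) * (\<Prod>i = 0..<d. x j - of_nat i)) \<in> polyfun n"
    by (intro polyfun.mult polyfun.const polyfun_prod polyfun_diff polyfun.coord j)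
  then show ?thesis by (simp add: gbinomial_prod_rev field_simps)
qed

text \<open>By Pascal's rule, raising d by one in each term gives a function with the required
  difference; the invariant factor passes through.\<close>

lemma newton_indefinite_sum:
  assumes "s \<in> newton n j \<kappa>" and j: "j \<in> {1..n+1}" "\<kappa> j = 1"
  shows "\<exists>q\<in>polyfun n. \<forall>x. q (\<lambda>k. x k + \<kappa> k) - q x = s x"
  using assms(1)
proof induction
  case (base a d)
  have "a (\<lambda>k. x k + \<kappa> k) * (x j + \<kappa> j gchoose Suc d) - a x * (x j gchoose Suc d) = a x * (x j gchoose d)" for x
    unfolding base(2) j(2) gbinomial_Suc_Suc by (simp add: algebra_simps)
  then show ?case
    by (intro bexI[of _ "\<lambda>x. a x * (x j gchoose Suc d)"] polyfun.mult base polyfun_gbinomial j) auto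
next
  case (add p q)
  then obtain P Q where *: "P \<in> polyfun n" "\<forall>x. P (\<lambda>k. x k + \<kappa> k) - P x = p x"
    "Q \<in> polyfun n" "\<forall>x. Q (\<lambda>k. x k + \<kappa> k) - Q x = q x" by blast
  have "P (\<lambda>k. x k + \<kappa> k) + Q (\<lambda>k. x k + \<kappa> k) - (P x + Q x) = p x + q x" for x
    using *(2,4)[rule_format, of x] by (simp add: algebra_simps)
  then show ?case by (intro bexI[of _ "\<lambda>x. P x + Q x"] polyfun.add *) auto
qed

lemma polyfun_indefinite_sum:
  assumes "p \<in> polyfun n" and j: "j \<in> {1..n+1}" "\<kappa> j = 1"
  shows "\<exists>q\<in>polyfun n. \<forall>x. q (\<lambda>k. x k + \<kappa> k) - q x = p x"
proof -
  have "(\<lambda>x. 1 * (x j gchoose 0)) \<in> newton n j \<kappa>"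
    by (rule newton.base) (auto intro: polyfun.const)
  from newton_indefinite_sum[OF newton_polyfun_mult[OF assms(1) j this] j] show ?thesis by simp
qed

section \<open>Exponent lattices and functions with polynomial differences\<close>

definition wt :: "nat \<Rightarrow> (nat \<Rightarrow> int) \<Rightarrow> int" where "wt n \<mu> = (\<Sum>i\<in>{1..n+1}. wvar n i * \<mu> i)"

text \<open>The condition outside 1..n+1 makes an exponent vector, which is a total function,
  determined by its monomial.\<close>

definition lat :: "nat \<Rightarrow> int \<Rightarrow> (nat \<Rightarrow> int) set" where
  "lat n m = {\<mu>. (\<forall>i. i \<notin> {1..n+1} \<longrightarrow> \<mu> i = 0) \<and> wt n \<mu> = m}"

definition cvec :: "(nat \<Rightarrow> int) \<Rightarrow> nat \<Rightarrow> complex" where "cvec \<mu> = (\<lambda>i. of_int (\<mu> i))"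

text \<open>The exponent of Q_j divided by the power of Q_i of the same degree, for i \<le> n. With
  i = 1 and j from 2 to n + 1 these vectors form a basis of the lattice of degree 0.\<close>

definition hdir :: "nat \<Rightarrow> nat \<Rightarrow> nat \<Rightarrow> nat \<Rightarrow> int" where
  "hdir n i j = (\<lambda>k. unit_at j k - wvar n j * unit_at i k)"

lemma wt_add: "wt n (\<lambda>k. \<mu> k + \<nu> k) = wt n \<mu> + wt n \<nu>"
  by (simp add: wt_def distrib_left sum.distrib)

lemma wt_scale: "wt n (\<lambda>k. c * \<mu> k) = c * wt n \<mu>"
  by (simp only: wt_def sum_distrib_left mult.left_commute[of c])

lemma wt_unit: "j \<in> {1..n+1} \<Longrightarrow> wt n (unit_at j) = wvar n j"
  by (simp add: wt_def unit_at_def if_distrib[of "\<lambda>x. wvar n _ * x"] cong: if_cong)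

lemma lat_add: "\<mu> \<in> lat n a \<Longrightarrow> \<nu> \<in> lat n b \<Longrightarrow> (\<lambda>k. \<mu> k + \<nu> k) \<in> lat n (a + b)"
  by (simp add: lat_def wt_add)

lemma lat_scale: "\<mu> \<in> lat n a \<Longrightarrow> (\<lambda>k. c * \<mu> k) \<in> lat n (c * a)"
  by (simp add: lat_def wt_scale)

lemma lat_unit: "j \<in> {1..n+1} \<Longrightarrow> unit_at j \<in> lat n (wvar n j)"
  by (auto simp: lat_def wt_unit) (auto simp: unit_at_def)

lemma hdir_lat:
  assumes "i \<in> {1..n}" "j \<in> {1..n+1}" shows "hdir n i j \<in> lat n 0"
proof -
  have w: "wvar n i = 1" using assms by (auto simp: wvar_def)
  have "(\<lambda>k. unit_at j k + (- wvar n j) * unit_at i k) \<in> lat n (wvar n j + (- wvar n j) * wvar n i)"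
    by (intro lat_add lat_scale lat_unit) (use assms in auto)
  then show ?thesis by (simp add: hdir_def w)
qed

text \<open>For each j an indefinite sum of the difference polynomial is subtracted from f; what is
  left is invariant in direction j, so coordinate j may be moved to 0. After all j only the value at
  (l, 0, ..., 0) remains.\<close>

lemma polyfun_of_differences:
  fixes f :: "(nat \<Rightarrow> int) \<Rightarrow> complex"
  assumes n: "n \<ge> 1"
    and diff: "\<And>j. j \<in> {2..n+1} \<Longrightarrow> \<exists>p\<in>polyfun n. \<forall>\<mu>\<in>lat n l. f (\<lambda>k. \<mu> k + hdir n 1 j k) - f \<mu> = p (cvec \<mu>)"
  shows "\<exists>p\<in>polyfun n. \<forall>\<mu>\<in>lat n l. f \<mu> = p (cvec \<mu>)"
proof -
  \<comment> \<open>The coordinates in J are set to 0 and their weighted total is put on coordinate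
    1, of weight 1, so the degree is kept. \<open>prc\<close> is the same map on complex vectors;
    through it the correction terms are seen to be polynomial.\<close>
  define pr where "pr = (\<lambda>J (\<mu> :: nat \<Rightarrow> int) i. if i \<in> J then 0 else if i = 1 then \<mu> 1 + (\<Sum>k\<in>J. wvar n k * \<mu> k) else \<mu> i)"
  define prc where "prc = (\<lambda>J (x :: nat \<Rightarrow> complex) i. if i \<in> J then 0 else if i = 1 then x 1 + (\<Sum>k\<in>J. of_int (wvar n k) * x k) else x i)"
  have pr_cvec: "cvec (pr J \<mu>) = prc J (cvec \<mu>)" for J \<mu>
    by (auto simp: pr_def prc_def cvec_def fun_eq_iff)
  have prc_poly: "(\<lambda>x. prc J x i) \<in> polyfun n" if "J \<subseteq> {2..n+1}" "i \<in> {1..n+1}" for J i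
  proof (cases "i \<in> J")
    case True
    then show ?thesis by (simp add: prc_def polyfun.const)
  next
    case iJ: False
    show ?thesis
    proof (cases "i = 1")
      case True
      have "(\<lambda>x. x 1 + (\<Sum>k\<in>J. of_int (wvar n k) * x k)) \<in> polyfun n"
        by (intro polyfun.add polyfun.coord polyfun_sum polyfun.mult polyfun.const) (use that in auto)
      then show ?thesis using iJ True by (simp add: prc_def)
    next
      case False
      then show ?thesis using iJ that by (simp add: prc_def polyfun.coord)
    qed
  qed
  have main: "\<exists>r\<in>polyfun n. \<forall>\<mu>\<in>lat n l. pr J \<mu> \<in> lat n l \<and> f \<mu> = f (pr J \<mu>) + r (cvec \<mu>)"
    if "finite J" "J \<subseteq> {2..n+1}" for J
    using that
  proof induction
    case empty
    have "pr {} \<mu> = \<mu>" for \<mu> by (auto simp: pr_def)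
    then show ?case by (intro bexI[of _ "\<lambda>x. 0"]) (auto intro: polyfun.const)
  next
    case (insert j J)
    then have j: "j \<in> {2..n+1}" "j \<in> {1..n+1}" and J: "J \<subseteq> {2..n+1}" by auto
    obtain r where r: "r \<in> polyfun n" "\<And>\<mu>. \<mu> \<in> lat n l \<Longrightarrow> pr J \<mu> \<in> lat n l"
      "\<And>\<mu>. \<mu> \<in> lat n l \<Longrightarrow> f \<mu> = f (pr J \<mu>) + r (cvec \<mu>)"
      using insert.IH[OF J] by blast
    obtain p where p: "p \<in> polyfun n" "\<And>\<mu>. \<mu> \<in> lat n l \<Longrightarrow> f (\<lambda>k. \<mu> k + hdir n 1 j k) - f \<mu> = p (cvec \<mu>)"
      using diff[OF j(1)] by blast
    have h1: "cvec (hdir n 1 j) j = 1" using j by (simp add: cvec_def hdir_def unit_at_def)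
    obtain Q where Q: "Q \<in> polyfun n" "\<And>x. Q (\<lambda>k. x k + cvec (hdir n 1 j) k) - Q x = p x"
      using polyfun_indefinite_sum[OF p(1) j(2), of "cvec (hdir n 1 j)", OF h1] by blast
    have hl: "hdir n 1 j \<in> lat n 0" by (rule hdir_lat) (use n j in auto)
    define g where "g = (\<lambda>\<mu>. f \<mu> - Q (cvec \<mu>))"
    have shl: "(\<lambda>k. \<mu> k + t * hdir n 1 j k) \<in> lat n l" if "\<mu> \<in> lat n l" for \<mu> t
      using lat_add[OF that lat_scale[OF hl, of t]] by simp
    have step: "g (\<lambda>k. \<mu> k + hdir n 1 j k) = g \<mu>" if "\<mu> \<in> lat n l" for \<mu>
    proof -
      have "cvec (\<lambda>k. \<mu> k + hdir n 1 j k) = (\<lambda>k. cvec \<mu> k + cvec (hdir n 1 j) k)" by (simp add: cvec_def)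
      then have "Q (cvec (\<lambda>k. \<mu> k + hdir n 1 j k)) = Q (cvec \<mu>) + p (cvec \<mu>)"
        using Q(2)[of "cvec \<mu>"] by (simp add: algebra_simps)
      then show ?thesis using p(2)[OF that] by (simp add: g_def algebra_simps)
    qed
    have inv: "g (\<lambda>k. \<mu> k + t * hdir n 1 j k) = g \<mu>" if "\<mu> \<in> lat n l" for \<mu> t
    proof (induction t rule: int_induct[where k = 0])
      case base
      show ?case by simp
    next
      case (step1 i)
      have e: "(\<lambda>k. \<mu> k + (i + 1) * hdir n 1 j k) = (\<lambda>k. (\<mu> k + i * hdir n 1 j k) + hdir n 1 j k)"
        by (simp add: algebra_simps)
      show ?case unfolding e using step[OF shl[OF that, of i]] step1(2) by simp
    next
      case (step2 i)
      have e: "(\<lambda>k. \<mu> k + i * hdir n 1 j k) = (\<lambda>k. (\<mu> k + (i - 1) * hdir n 1 j k) + hdir n 1 j k)"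
        by (simp add: algebra_simps)
      show ?case using step[OF shl[OF that, of "i - 1"]] step2(2) unfolding e by simp
    qed
    have prins: "pr (insert j J) \<mu> = (\<lambda>k. pr J \<mu> k + (- \<mu> j) * hdir n 1 j k)" for \<mu>
    proof
      fix k
      have "1 \<notin> J" "j \<noteq> 1" using J j by auto
      then show "pr (insert j J) \<mu> k = pr J \<mu> k + (- \<mu> j) * hdir n 1 j k"
        using insert.hyps by (auto simp: pr_def hdir_def unit_at_def)
    qed
    have "pr (insert j J) \<mu> \<in> lat n l \<and>
        f \<mu> = f (pr (insert j J) \<mu>) + (r (cvec \<mu>) + (Q (prc J (cvec \<mu>)) - Q (prc (insert j J) (cvec \<mu>))))"
      if m: "\<mu> \<in> lat n l" for \<mu>
    proof
      show "pr (insert j J) \<mu> \<in> lat n l" unfolding prins by (rule shl[OF r(2)[OF m]])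
      have "g (pr (insert j J) \<mu>) = g (pr J \<mu>)" unfolding prins by (rule inv[OF r(2)[OF m]])
      then show "f \<mu> = f (pr (insert j J) \<mu>) + (r (cvec \<mu>) + (Q (prc J (cvec \<mu>)) - Q (prc (insert j J) (cvec \<mu>))))"
        using r(3)[OF m] by (simp add: g_def pr_cvec algebra_simps)
    qed
    note * = this
    have "(\<lambda>x. r x + (Q (prc J x) - Q (prc (insert j J) x))) \<in> polyfun n"
      by (intro polyfun.add polyfun_diff r(1) polyfun_subst[OF Q(1)] prc_poly insert.prems J)
    then show ?case by (rule bexI[rotated]) (intro ballI *)
  qed
  obtain r where r: "r \<in> polyfun n" "\<And>\<mu>. \<mu> \<in> lat n l \<Longrightarrow> f \<mu> = f (pr {2..n+1} \<mu>) + r (cvec \<mu>)"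
    using main[of "{2..n+1}"] by auto
  have "pr {2..n+1} \<mu> = (\<lambda>k. if k = 1 then l else 0)" if "\<mu> \<in> lat n l" for \<mu>
  proof
    fix k
    have w: "wvar n 1 = 1" using n by (simp add: wvar_def)
    have "{1..n+1} = insert 1 {2..n+1}" by auto
    then have "l = \<mu> 1 + (\<Sum>k\<in>{2..n+1}. wvar n k * \<mu> k)" using that w by (simp add: lat_def wt_def)
    then show "pr {2..n+1} \<mu> k = (if k = 1 then l else 0)" using that by (auto simp: pr_def lat_def)
  qed
  then have *: "f \<mu> = f (\<lambda>k. if k = 1 then l else 0) + r (cvec \<mu>)" if "\<mu> \<in> lat n l" for \<mu>
    using r(2)[OF that] that by metis
  have "(\<lambda>x. f (\<lambda>k. if k = 1 then l else 0) + r x) \<in> polyfun n"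
    by (intro polyfun.add polyfun.const r(1))
  then show ?thesis by (rule bexI[rotated]) (intro ballI *)
qed

section \<open>Representations of enveloping algebras\<close>

definition lin_end :: "(('x \<Rightarrow> complex) \<Rightarrow> ('x \<Rightarrow> complex)) \<Rightarrow> bool" where
  "lin_end T \<longleftrightarrow> (\<forall>v w. T (\<lambda>x. v x + w x) = (\<lambda>x. T v x + T w x)) \<and> (\<forall>c v. T (\<lambda>x. c * v x) = (\<lambda>x. c * T v x))"

lemma lin_end_add: "lin_end T \<Longrightarrow> T (\<lambda>x. v x + w x) = (\<lambda>x. T v x + T w x)"
  and lin_end_scale: "lin_end T \<Longrightarrow> T (\<lambda>x. c * v x) = (\<lambda>x. c * T v x)"
  by (simp_all add: lin_end_def)

lemma lin_end_sum:
  assumes "lin_end T" shows "T (\<lambda>x. \<Sum>i\<in>A. v i x) = (\<lambda>x. \<Sum>i\<in>A. T (v i) x)"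
proof (induction A rule: infinite_finite_induct)
  case (insert i A)
  then show ?case by (simp add: lin_end_add[OF assms])
qed (use lin_end_scale[OF assms, of 0 "\<lambda>x. 0"] in simp_all)

definition word_op :: "('m \<Rightarrow> ('x \<Rightarrow> complex) \<Rightarrow> ('x \<Rightarrow> complex)) \<Rightarrow> 'm word \<Rightarrow> ('x \<Rightarrow> complex) \<Rightarrow> ('x \<Rightarrow> complex)" where
  "word_op \<rho> w = foldr (\<lambda>x T. \<rho> x \<circ> T) (letters w) id"

text \<open>The extension of \<rho> from letters to the free algebra; it is multiplicative by
  \<open>eval_op_mult\<close> when every \<open>\<rho> x\<close> is linear.\<close>

definition eval_op :: "('m \<Rightarrow> ('x \<Rightarrow> complex) \<Rightarrow> ('x \<Rightarrow> complex)) \<Rightarrow> ('m word \<Rightarrow>\<^sub>0 complex) \<Rightarrow> ('x \<Rightarrow> complex) \<Rightarrow> ('x \<Rightarrow> complex)" where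
  "eval_op \<rho> f v = (\<lambda>x. \<Sum>w\<in>Poly_Mapping.keys f. Poly_Mapping.lookup f w * word_op \<rho> w v x)"

lemma word_op_0: "word_op \<rho> 0 = id"
  by (simp add: word_op_def zero_word_def)

lemma word_op_add: "word_op \<rho> (u + w) = word_op \<rho> u \<circ> word_op \<rho> w"
proof -
  have "foldr (\<lambda>x T. \<rho> x \<circ> T) (xs @ ys) id = foldr (\<lambda>x T. \<rho> x \<circ> T) xs id \<circ> foldr (\<lambda>x T. \<rho> x \<circ> T) ys id" for xs ys
    by (induction xs) (simp_all add: comp_assoc)
  then show ?thesis by (simp add: word_op_def plus_word_def)
qed

lemma lin_end_word_op:
  assumes "\<And>x. lin_end (\<rho> x)" shows "lin_end (word_op \<rho> w)"
proof -
  have "lin_end (foldr (\<lambda>x T. \<rho> x \<circ> T) xs id)" for xs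
  proof (induction xs)
    case Nil
    then show ?case by (simp add: lin_end_def)
  next
    case (Cons x xs)
    show ?case
      using lin_end_add[OF Cons] lin_end_scale[OF Cons] lin_end_add[OF assms[of x]] lin_end_scale[OF assms[of x]]
      by (simp add: lin_end_def)
  qed
  then show ?thesis by (simp add: word_op_def)
qed

lemma eval_op_superset:
  assumes "finite A" "Poly_Mapping.keys f \<subseteq> A"
  shows "eval_op \<rho> f v = (\<lambda>x. \<Sum>w\<in>A. Poly_Mapping.lookup f w * word_op \<rho> w v x)"
  unfolding eval_op_def
  by (intro ext sum.mono_neutral_left) (use assms in \<open>auto simp: in_keys_iff\<close>)

lemma eval_op_add: "eval_op \<rho> (f + g) v = (\<lambda>x. eval_op \<rho> f v x + eval_op \<rho> g v x)"
proof -
  let ?A = "Poly_Mapping.keys f \<union> Poly_Mapping.keys g"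
  have "Poly_Mapping.keys (f + g) \<subseteq> ?A" by (rule Poly_Mapping.keys_add)
  then show ?thesis
    by (simp add: eval_op_superset[of ?A] lookup_add distrib_right sum.distrib)
qed

lemma eval_op_single: "eval_op \<rho> (Poly_Mapping.single w c) v = (\<lambda>x. c * word_op \<rho> w v x)"
  by (simp add: eval_op_superset[of "{w}"])

lemma eval_op_0: "eval_op \<rho> 0 v = (\<lambda>x. 0)"
  by (simp add: eval_op_def)

lemma eval_op_1: "eval_op \<rho> 1 v = v"
  unfolding single_one[symmetric] eval_op_single by (simp add: word_op_0)

lemma lin_end_eval_op:
  assumes "\<And>x. lin_end (\<rho> x)" shows "lin_end (eval_op \<rho> f)"
proof -
  note w = lin_end_word_op[of \<rho>, OF assms]
  show ?thesis unfolding lin_end_def eval_op_def lin_end_add[OF w] lin_end_scale[OF w]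
    by (simp add: distrib_left sum.distrib sum_distrib_left mult.left_commute)
qed

lemma eval_op_mult:
  fixes \<rho> :: "'m \<Rightarrow> ('x \<Rightarrow> complex) \<Rightarrow> ('x \<Rightarrow> complex)"
  assumes lin: "\<And>x. lin_end (\<rho> x)"
  shows "eval_op \<rho> (f * g) v = eval_op \<rho> f (eval_op \<rho> g v)"
proof -
  have ss: "eval_op \<rho> (Poly_Mapping.single u c * Poly_Mapping.single w d) v =
      eval_op \<rho> (Poly_Mapping.single u c) (eval_op \<rho> (Poly_Mapping.single w d) v)" for u w c d
    by (simp add: mult_single eval_op_single word_op_add lin_end_scale[OF lin_end_word_op[OF lin]] mult.assoc)
  have s: "eval_op \<rho> (Poly_Mapping.single u c * g) v = eval_op \<rho> (Poly_Mapping.single u c) (eval_op \<rho> g v)" for u c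
  proof (induction g rule: poly_mapping_add_induct)
    case (single k d)
    show ?case by (rule ss)
  next
    case (add g h)
    then show ?case
      by (simp add: distrib_left eval_op_add lin_end_add[OF lin_end_eval_op[OF lin]])
  qed
  show ?thesis
  proof (induction f rule: poly_mapping_add_induct)
    case (single k d)
    show ?case by (rule s)
  next
    case (add f h)
    then show ?case by (simp add: distrib_right eval_op_add)
  qed
qed

lemma eval_op_uminus: "eval_op \<rho> (- f) v = (\<lambda>x. - eval_op \<rho> f v x)"
proof
  fix x
  have "eval_op \<rho> (- f + f) v x = 0" by (simp add: eval_op_0)
  then show "eval_op \<rho> (- f) v x = - eval_op \<rho> f v x" unfolding eval_op_add by (simp add: add_eq_0_iff)
qed

lemma eval_op_minus: "eval_op \<rho> (f - g) v = (\<lambda>x. eval_op \<rho> f v x - eval_op \<rho> g v x)"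
  using eval_op_add[of \<rho> f "- g" v] by (simp add: eval_op_uminus)

lemma eval_op_gen: "eval_op \<rho> (gen x) v = \<rho> x v"
  by (simp add: gen_def eval_op_single word_op_def)

section \<open>The free algebra, its quotient and induced representations\<close>

lemma free_alg_simps [simp]:
  "mult (free_alg L) = (*)" "one (free_alg L) = 1" "zero (free_alg L) = 0"
  "add (free_alg L) = (+)" "smult (free_alg L) = (\<lambda>c f. Poly_Mapping.single 0 c * f)"
  by (simp_all add: free_alg_def)

lemma free_car_iff: "f \<in> carrier (free_alg L) \<longleftrightarrow> (\<forall>w\<in>Poly_Mapping.keys f. set (letters w) \<subseteq> L)"
  by (simp add: free_alg_def)

lemma free_car_single: "set (letters w) \<subseteq> L \<Longrightarrow> Poly_Mapping.single w c \<in> carrier (free_alg L)"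
  by (simp add: free_car_iff)

lemma free_car_const: "Poly_Mapping.single 0 c \<in> carrier (free_alg L)"
  by (rule free_car_single) (simp add: zero_word_def)

lemma free_car_0: "0 \<in> carrier (free_alg L)" by (simp add: free_car_iff)

lemma free_car_1: "1 \<in> carrier (free_alg L)"
  using free_car_const[of 1 L] by simp

lemma free_car_gen: "x \<in> L \<Longrightarrow> gen x \<in> carrier (free_alg L)"
  unfolding gen_def by (rule free_car_single) simp

lemma free_car_add: "f \<in> carrier (free_alg L) \<Longrightarrow> g \<in> carrier (free_alg L) \<Longrightarrow> f + g \<in> carrier (free_alg L)"
  using Poly_Mapping.keys_add[of f g] unfolding free_car_iff by blast

lemma free_car_mult: "f \<in> carrier (free_alg L) \<Longrightarrow> g \<in> carrier (free_alg L) \<Longrightarrow> f * g \<in> carrier (free_alg L)"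
  using keys_mult[of f g] unfolding free_car_iff by (fastforce simp: plus_word_def)

lemma free_car_uminus: "f \<in> carrier (free_alg L) \<Longrightarrow> - f \<in> carrier (free_alg L)"
  using free_car_mult[OF free_car_const[of "-1" L], of f] by (simp add: single_uminus)

lemma free_car_minus: "f \<in> carrier (free_alg L) \<Longrightarrow> g \<in> carrier (free_alg L) \<Longrightarrow> f - g \<in> carrier (free_alg L)"
  using free_car_add[of f L "- g"] free_car_uminus[of g L] by simp

lemma ring_free_alg: "ring (free_alg L)"
proof (rule ringI)
  show "abelian_group (free_alg L)"
  proof (rule abelian_groupI)
    fix x assume "x \<in> carrier (free_alg L)"
    then show "\<exists>y\<in>carrier (free_alg L). y \<oplus>\<^bsub>free_alg L\<^esub> x = \<zero>\<^bsub>free_alg L\<^esub>"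
      by (intro bexI[of _ "- x"]) (simp_all add: free_car_uminus)
  qed (simp_all add: free_car_add free_car_0 add_ac)
  show "Group.monoid (free_alg L)"
    by (rule monoidI) (simp_all add: free_car_mult free_car_1 mult.assoc)
qed (simp_all add: distrib_right distrib_left)

lemma free_alg_minus: "f \<in> carrier (free_alg L) \<Longrightarrow> g \<in> carrier (free_alg L) \<Longrightarrow> f \<ominus>\<^bsub>free_alg L\<^esub> g = f - g"
proof -
  interpret ring "free_alg L" by (rule ring_free_alg)
  assume fg: "f \<in> carrier (free_alg L)" "g \<in> carrier (free_alg L)"
  have "\<ominus>\<^bsub>free_alg L\<^esub> g = - g"
    by (rule minus_equality) (simp_all add: fg free_car_uminus)
  then show ?thesis by (simp add: a_minus_def)
qed

text \<open>Linearity of \<open>\<rho> x\<close> is asked for every matrix x, in L or not, so that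
  the evaluation of arbitrary words is linear without side conditions.\<close>

locale lie_rep =
  fixes L :: "complex mat set" and \<rho> :: "complex mat \<Rightarrow> ('x \<Rightarrow> complex) \<Rightarrow> ('x \<Rightarrow> complex)"
  assumes L_add: "x \<in> L \<Longrightarrow> y \<in> L \<Longrightarrow> x + y \<in> L"
    and L_smult: "x \<in> L \<Longrightarrow> c \<cdot>\<^sub>m x \<in> L"
    and L_lie: "x \<in> L \<Longrightarrow> y \<in> L \<Longrightarrow> lie x y \<in> L"
    and lin: "lin_end (\<rho> x)"
    and rho_add: "x \<in> L \<Longrightarrow> y \<in> L \<Longrightarrow> \<rho> (x + y) v = (\<lambda>t. \<rho> x v t + \<rho> y v t)"
    and rho_smult: "x \<in> L \<Longrightarrow> \<rho> (c \<cdot>\<^sub>m x) v = (\<lambda>t. c * \<rho> x v t)"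
    and rho_lie: "x \<in> L \<Longrightarrow> y \<in> L \<Longrightarrow> \<rho> (lie x y) v = (\<lambda>t. \<rho> x (\<rho> y v) t - \<rho> y (\<rho> x v) t)"
begin

abbreviation "F \<equiv> free_alg L"
abbreviation "I \<equiv> env_ideal L"
abbreviation "E \<equiv> env_alg L"

lemma env_gens_car:
  "({gen (x + y) - gen x - gen y | x y. x \<in> L \<and> y \<in> L} \<union>
      {gen (c \<cdot>\<^sub>m x) - Poly_Mapping.single 0 c * gen x | c x. x \<in> L} \<union>
      {gen x * gen y - gen y * gen x - gen (lie x y) | x y. x \<in> L \<and> y \<in> L}) \<subseteq> carrier F"
  by (auto intro!: free_car_minus free_car_mult free_car_gen free_car_const L_add L_smult L_lie)

lemma ideal_I: "ideal I F"
  unfolding env_ideal_def by (rule ring.genideal_ideal[OF ring_free_alg env_gens_car])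

sublocale Id: ideal I F by (rule ideal_I)

lemma ideal_kernel: "ideal {f \<in> carrier F. \<forall>v. eval_op \<rho> f v = (\<lambda>x. 0)} F"
proof (rule idealI[OF ring_free_alg])
  let ?K = "{f \<in> carrier F. \<forall>v. eval_op \<rho> f v = (\<lambda>x. 0)}"
  have ze: "eval_op \<rho> f (\<lambda>x. 0) = (\<lambda>x. 0)" for f
    using lin_end_scale[OF lin_end_eval_op[of \<rho> f, OF lin], of 0 "\<lambda>x. 0"] by simp
  show "subgroup ?K (add_monoid F)"
  proof (rule group.subgroupI)
    show "Group.group (add_monoid F)" by (rule Id.a_group)
    show "?K \<subseteq> carrier (add_monoid F)" by auto
    show "?K \<noteq> {}" using free_car_0[of L] eval_op_0[of \<rho>] by (intro ex_in_conv[THEN iffD1] exI[of _ 0]) simp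
    fix a assume a: "a \<in> ?K"
    have "\<ominus>\<^bsub>F\<^esub> a = - a"
      by (rule Id.minus_equality) (use a free_car_uminus in auto)
    then show "inv\<^bsub>add_monoid F\<^esub> a \<in> ?K" using a unfolding a_inv_def[symmetric]
      by (simp add: free_car_uminus eval_op_uminus)
    fix b assume "b \<in> ?K"
    then show "a \<otimes>\<^bsub>add_monoid F\<^esub> b \<in> ?K" using a by (simp add: free_car_add eval_op_add)
  qed
  fix a x assume "a \<in> ?K" and "x \<in> carrier F"
  then show "x \<otimes>\<^bsub>F\<^esub> a \<in> ?K" "a \<otimes>\<^bsub>F\<^esub> x \<in> ?K"
    by (simp_all add: free_car_mult eval_op_mult[OF lin] ze)
qed

text \<open>The kernel of the evaluation is a two-sided ideal, and it contains the defining
  relations because \<rho> respects sums, scalars and brackets.\<close>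

lemma eval_op_ideal:
  assumes "f \<in> I" shows "eval_op \<rho> f v = (\<lambda>x. 0)"
proof -
  let ?X = "{gen (x + y) - gen x - gen y | x y. x \<in> L \<and> y \<in> L} \<union>
      {gen (c \<cdot>\<^sub>m x) - Poly_Mapping.single 0 c * gen x | c x. x \<in> L} \<union>
      {gen x * gen y - gen y * gen x - gen (lie x y) | x y. x \<in> L \<and> y \<in> L}"
  have "eval_op \<rho> f v = (\<lambda>x. 0)" if "f \<in> ?X" for f v
    using that
    by (auto simp: eval_op_minus eval_op_gen eval_op_mult[OF lin] rho_add rho_smult rho_lie eval_op_single word_op_0)
  then have "?X \<subseteq> {f \<in> carrier F. \<forall>v. eval_op \<rho> f v = (\<lambda>x. 0)}" using env_gens_car by blast
  then have "I \<subseteq> {f \<in> carrier F. \<forall>v. eval_op \<rho> f v = (\<lambda>x. 0)}"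
    unfolding env_ideal_def genideal_def using ideal_kernel by blast
  then show ?thesis using assms by blast
qed

definition cls where "cls f = I +>\<^bsub>F\<^esub> f"

lemma env_simps:
  "carrier E = a_rcosets\<^bsub>F\<^esub> I" "mult E = rcoset_mult F I" "one E = cls 1" "zero E = I" "add E = set_add F"
  "smult E = (\<lambda>c X. \<Union>f\<in>X. cls (Poly_Mapping.single 0 c * f))"
  by (simp_all add: env_alg_def ring.extend_def module.fields_def FactRing_def cls_def)

lemma env_car_iff: "u \<in> carrier E \<longleftrightarrow> (\<exists>f\<in>carrier F. u = cls f)"
  by (auto simp: env_simps A_RCOSETS_def RCOSETS_def a_r_coset_def cls_def)

lemma cls_car: "f \<in> carrier F \<Longrightarrow> cls f \<in> carrier E"
  using env_car_iff by blast

lemma cls_mult: "f \<in> carrier F \<Longrightarrow> g \<in> carrier F \<Longrightarrow> cls f \<otimes>\<^bsub>E\<^esub> cls g = cls (f * g)"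
  using Id.rcoset_mult_add[of f g] by (simp add: env_simps cls_def)

lemma cls_add: "f \<in> carrier F \<Longrightarrow> g \<in> carrier F \<Longrightarrow> cls f \<oplus>\<^bsub>E\<^esub> cls g = cls (f + g)"
  using Id.a_rcos_sum[of f g] by (simp add: env_simps cls_def)

lemma cls_eq: "f \<in> carrier F \<Longrightarrow> g \<in> carrier F \<Longrightarrow> cls f = cls g \<longleftrightarrow> f - g \<in> I"
  using Id.quotient_eq_iff_same_a_r_cos[OF ideal_I, of f g] by (simp add: cls_def free_alg_minus)

lemma env_zero: "\<zero>\<^bsub>E\<^esub> = cls 0"
  by (simp add: env_simps cls_def a_r_coset_def r_coset_def)

lemma env_one: "\<one>\<^bsub>E\<^esub> = cls 1"
  by (simp add: env_simps)

lemma ring_E: "ring E"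
proof (rule ringI)
  note cl = cls_mult cls_add free_car_mult free_car_add free_car_0 free_car_1 env_zero env_one cls_car
  show "abelian_group E"
  proof (rule abelian_groupI)
    fix x assume "x \<in> carrier E"
    then obtain f where f: "f \<in> carrier F" "x = cls f" by (auto simp: env_car_iff)
    then show "\<exists>y\<in>carrier E. y \<oplus>\<^bsub>E\<^esub> x = \<zero>\<^bsub>E\<^esub>"
      by (intro bexI[of _ "cls (- f)"]) (simp_all add: cl free_car_uminus)
    show "\<zero>\<^bsub>E\<^esub> \<oplus>\<^bsub>E\<^esub> x = x" using f by (simp add: cl)
    fix y assume "y \<in> carrier E"
    then obtain g where g: "g \<in> carrier F" "y = cls g" by (auto simp: env_car_iff)
    show "x \<oplus>\<^bsub>E\<^esub> y \<in> carrier E" "x \<oplus>\<^bsub>E\<^esub> y = y \<oplus>\<^bsub>E\<^esub> x" using f g by (simp_all add: cl add.commute)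
    fix z assume "z \<in> carrier E"
    then obtain h where h: "h \<in> carrier F" "z = cls h" by (auto simp: env_car_iff)
    show "x \<oplus>\<^bsub>E\<^esub> y \<oplus>\<^bsub>E\<^esub> z = x \<oplus>\<^bsub>E\<^esub> (y \<oplus>\<^bsub>E\<^esub> z)" using f g h by (simp add: cl add.assoc)
  qed (simp add: cl)
  show "Group.monoid E"
  proof (rule monoidI)
    fix x y z assume "x \<in> carrier E" "y \<in> carrier E" "z \<in> carrier E"
    then obtain f g h where "f \<in> carrier F" "x = cls f" "g \<in> carrier F" "y = cls g" "h \<in> carrier F" "z = cls h"
      unfolding env_car_iff by blast
    then show "x \<otimes>\<^bsub>E\<^esub> y \<otimes>\<^bsub>E\<^esub> z = x \<otimes>\<^bsub>E\<^esub> (y \<otimes>\<^bsub>E\<^esub> z)" by (simp add: cl mult.assoc)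
  next
    fix x y assume "x \<in> carrier E" "y \<in> carrier E"
    then obtain f g where "f \<in> carrier F" "x = cls f" "g \<in> carrier F" "y = cls g"
      unfolding env_car_iff by blast
    then show "x \<otimes>\<^bsub>E\<^esub> y \<in> carrier E" by (simp add: cl)
  next
    fix x assume "x \<in> carrier E"
    then obtain f where "f \<in> carrier F" "x = cls f" unfolding env_car_iff by blast
    then show "\<one>\<^bsub>E\<^esub> \<otimes>\<^bsub>E\<^esub> x = x" "x \<otimes>\<^bsub>E\<^esub> \<one>\<^bsub>E\<^esub> = x" by (simp_all add: cl)
  qed (simp add: cl)
  fix x y z assume "x \<in> carrier E" "y \<in> carrier E" "z \<in> carrier E"
  then obtain f g h where "f \<in> carrier F" "x = cls f" "g \<in> carrier F" "y = cls g" "h \<in> carrier F" "z = cls h"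
    unfolding env_car_iff by blast
  then show "(x \<oplus>\<^bsub>E\<^esub> y) \<otimes>\<^bsub>E\<^esub> z = x \<otimes>\<^bsub>E\<^esub> z \<oplus>\<^bsub>E\<^esub> y \<otimes>\<^bsub>E\<^esub> z"
    "z \<otimes>\<^bsub>E\<^esub> (x \<oplus>\<^bsub>E\<^esub> y) = z \<otimes>\<^bsub>E\<^esub> x \<oplus>\<^bsub>E\<^esub> z \<otimes>\<^bsub>E\<^esub> y" by (simp_all add: cl distrib_left distrib_right)
qed

text \<open>The scalar action on a coset is a union over its representatives; all of them yield the
  same coset because I absorbs constants.\<close>

lemma cls_smult:
  assumes f: "f \<in> carrier F" shows "c \<odot>\<^bsub>E\<^esub> cls f = cls (Poly_Mapping.single 0 c * f)"
proof -
  have mem: "f \<in> cls f"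
    unfolding cls_def by (rule Id.a_rcos_self[OF f])
  have "cls (Poly_Mapping.single 0 c * g) = cls (Poly_Mapping.single 0 c * f)" if g: "g \<in> cls f" for g
  proof -
    obtain h where h: "h \<in> I" "g = h + f" using g by (auto simp: cls_def a_r_coset_def r_coset_def)
    have hc: "h \<in> carrier F" using h(1) Id.a_subset by auto
    have "Poly_Mapping.single 0 c \<otimes>\<^bsub>F\<^esub> h \<in> I" by (rule Id.I_l_closed[OF h(1) free_car_const])
    then have "Poly_Mapping.single 0 c * h \<in> I" by simp
    moreover have "Poly_Mapping.single 0 c * g - Poly_Mapping.single 0 c * f = Poly_Mapping.single 0 c * h"
      by (simp add: h distrib_left)
    ultimately show ?thesis
      using cls_eq[of "Poly_Mapping.single 0 c * g" "Poly_Mapping.single 0 c * f"] f hc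
      by (simp add: h(2) free_car_mult free_car_add free_car_const)
  qed
  then show ?thesis unfolding env_simps using mem by blast
qed

definition rep where "rep u = eval_op \<rho> (SOME f. f \<in> carrier F \<and> u = cls f)"

text \<open>Scalars act through the constants c 1, which are among the ring generators of
  \<open>A_alg\<close>; this makes that subring closed under scalar multiplication.\<close>

lemma smult_eq_mult:
  assumes "u \<in> carrier E" shows "c \<odot>\<^bsub>E\<^esub> u = (c \<odot>\<^bsub>E\<^esub> \<one>\<^bsub>E\<^esub>) \<otimes>\<^bsub>E\<^esub> u"
proof -
  obtain f where f: "f \<in> carrier F" "u = cls f" using assms env_car_iff by blast
  show ?thesis unfolding f(2) env_one
    by (simp add: cls_smult[OF f(1)] cls_smult[OF free_car_1] cls_mult free_car_const f(1))
qed

lemma rep_cls: assumes f: "f \<in> carrier F" shows "rep (cls f) = eval_op \<rho> f"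
proof -
  define g where "g = (SOME g. g \<in> carrier F \<and> cls f = cls g)"
  have g: "g \<in> carrier F \<and> cls f = cls g"
    unfolding g_def by (rule someI[where P = "\<lambda>g. g \<in> carrier F \<and> cls f = cls g", of f]) (simp add: f)
  then have d: "f - g \<in> I" using cls_eq[OF f, of g] by blast
  have "eval_op \<rho> f v = eval_op \<rho> g v" for v
    using eval_op_ideal[OF d, of v] by (simp add: eval_op_minus fun_eq_iff)
  then show ?thesis unfolding rep_def g_def[symmetric] by (simp add: fun_eq_iff)
qed

lemma env_incl_cls: "env_incl L x = cls (gen x)"
  by (simp add: env_incl_def cls_def)

lemma env_incl_car: "x \<in> L \<Longrightarrow> env_incl L x \<in> carrier E"
  unfolding env_incl_cls by (intro cls_car free_car_gen)

lemma rep_env_incl: "x \<in> L \<Longrightarrow> rep (env_incl L x) = \<rho> x"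
  unfolding env_incl_cls by (simp add: rep_cls free_car_gen eval_op_gen fun_eq_iff)

lemma rep_one: "rep \<one>\<^bsub>E\<^esub> v = v"
  unfolding env_one by (simp add: rep_cls free_car_1 eval_op_1)

lemma rep_mult: "u \<in> carrier E \<Longrightarrow> w \<in> carrier E \<Longrightarrow> rep (u \<otimes>\<^bsub>E\<^esub> w) v = rep u (rep w v)"
  unfolding env_car_iff by (auto simp: cls_mult rep_cls free_car_mult eval_op_mult[OF lin])

lemma rep_add: "u \<in> carrier E \<Longrightarrow> w \<in> carrier E \<Longrightarrow> rep (u \<oplus>\<^bsub>E\<^esub> w) v = (\<lambda>x. rep u v x + rep w v x)"
  unfolding env_car_iff by (auto simp: cls_add rep_cls free_car_add eval_op_add)

lemma smult_car: "u \<in> carrier E \<Longrightarrow> c \<odot>\<^bsub>E\<^esub> u \<in> carrier E"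
  unfolding env_car_iff[of u] by (auto simp: cls_smult intro!: cls_car free_car_mult free_car_const)

lemma rep_smult: "u \<in> carrier E \<Longrightarrow> rep (c \<odot>\<^bsub>E\<^esub> u) v = (\<lambda>x. c * rep u v x)"
  unfolding env_car_iff
  by (auto simp: cls_smult rep_cls free_car_mult free_car_const eval_op_mult[OF lin] eval_op_single word_op_0)

lemma rep_uminus:
  assumes "u \<in> carrier E" shows "rep (\<ominus>\<^bsub>E\<^esub> u) v = (\<lambda>x. - rep u v x)"
proof -
  interpret R: ring E by (rule ring_E)
  have "rep (\<ominus>\<^bsub>E\<^esub> u \<oplus>\<^bsub>E\<^esub> u) v = (\<lambda>x. 0)"
    using assms by (simp add: R.l_neg env_zero rep_cls free_car_0 eval_op_0)
  then show ?thesis using rep_add[of "\<ominus>\<^bsub>E\<^esub> u" u v] assms by (simp add: fun_eq_iff add_eq_0_iff)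
qed

end

section \<open>The oscillator representation\<close>

text \<open>With indices counted from 0, \<open>bar\<close> exchanges the dual basis vectors i and i
  + n: row i of the symplectic form J has its only nonzero entry, \<open>sg n i\<close>, in column
  \<open>bar n i\<close>.\<close>

definition bar :: "nat \<Rightarrow> nat \<Rightarrow> nat" where "bar n i = (if i < n then i + n else i - n)"
definition sg :: "nat \<Rightarrow> nat \<Rightarrow> complex" where "sg n i = (if i < n then 1 else - 1)"

lemma bar_lt: "i < 2 * n \<Longrightarrow> bar n i < 2 * n"
  and bar_bar: "i < 2 * n \<Longrightarrow> bar n (bar n i) = i"
  and sg_bar: "i < 2 * n \<Longrightarrow> sg n (bar n i) = - sg n i"
  and sg_sq: "sg n i * sg n i = 1"
  by (auto simp: bar_def sg_def)

lemma eq_bar_iff: "K < 2 * n \<Longrightarrow> I < 2 * n \<Longrightarrow> K = bar n I \<longleftrightarrow> I = bar n K"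
  by (auto simp: bar_def)

lemma sum_bar: "(\<Sum>i<2*n. f (bar n i)) = (\<Sum>i<2*n. f i)"
  by (rule sum.reindex_bij_witness[of _ "bar n" "bar n"]) (auto simp: bar_lt bar_bar)

lemma symp_form_index: "i < 2 * n \<Longrightarrow> j < 2 * n \<Longrightarrow> symp_form n $$ (i, j) = (if j = bar n i then sg n i else 0)"
  by (auto simp: symp_form_def bar_def sg_def)

lemma symp_form_dim: "symp_form n \<in> carrier_mat (2*n) (2*n)"
proof -
  have "symp_form n \<in> carrier_mat (n + n) (n + n)" unfolding symp_form_def
    by (rule four_block_carrier_mat) simp_all
  then show ?thesis by (simp add: mult_2)
qed

lemma mult_mat_index:
  fixes A B :: "complex mat"
  assumes "A \<in> carrier_mat N N" "B \<in> carrier_mat N N" "i < N" "j < N"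
  shows "(A * B) $$ (i, j) = (\<Sum>k<N. A $$ (i, k) * B $$ (k, j))"
  using assms by (auto simp: scalar_prod_def atLeast0LessThan intro!: sum.cong)

text \<open>The (i, j) entry of J X is \<open>sg n i * X $$ (bar n i, j)\<close>. As J is skew, the
  defining equation says that J X is symmetric.\<close>

lemma sp_iff:
  "X \<in> sp n \<longleftrightarrow> X \<in> carrier_mat (2*n) (2*n) \<and>
     (\<forall>i<2*n. \<forall>j<2*n. sg n i * X $$ (bar n i, j) = sg n j * X $$ (bar n j, i))"
proof (cases "X \<in> carrier_mat (2*n) (2*n)")
  case X: True
  have XT: "transpose_mat X \<in> carrier_mat (2*n) (2*n)" using X by simp
  note J = symp_form_dim[of n]
  have entry: "(transpose_mat X * symp_form n + symp_form n * X) $$ (i, j) =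
      sg n i * X $$ (bar n i, j) - sg n j * X $$ (bar n j, i)" if ij: "i < 2*n" "j < 2*n" for i j
  proof -
    have "(transpose_mat X * symp_form n) $$ (i, j) = (\<Sum>k<2*n. X $$ (k, i) * (if k = bar n j then - sg n j else 0))"
      unfolding mult_mat_index[OF XT J ij]
    proof (rule sum.cong)
      fix k assume k: "k \<in> {..<2*n}"
      have "j = bar n k \<longleftrightarrow> k = bar n j" using bar_bar ij k by auto
      then show "transpose_mat X $$ (i, k) * symp_form n $$ (k, j) = X $$ (k, i) * (if k = bar n j then - sg n j else 0)"
        using k ij X by (auto simp: symp_form_index sg_bar)
    qed simp
    also have "\<dots> = - sg n j * X $$ (bar n j, i)"
      using bar_lt[OF ij(2)] by (simp add: if_distrib[of "\<lambda>x. _ * x"] sum.delta cong: if_cong)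
    finally have 1: "(transpose_mat X * symp_form n) $$ (i, j) = - sg n j * X $$ (bar n j, i)" .
    have "(symp_form n * X) $$ (i, j) = (\<Sum>k<2*n. (if k = bar n i then sg n i else 0) * X $$ (k, j))"
      unfolding mult_mat_index[OF J X ij] using ij by (intro sum.cong) (auto simp: symp_form_index)
    also have "\<dots> = sg n i * X $$ (bar n i, j)"
      using bar_lt[OF ij(1)] by (simp add: if_distrib[of "\<lambda>x. x * _"] sum.delta cong: if_cong)
    finally show ?thesis using 1 ij X J by simp
  qed
  have "transpose_mat X * symp_form n + symp_form n * X = 0\<^sub>m (2*n) (2*n) \<longleftrightarrow>
     (\<forall>i<2*n. \<forall>j<2*n. (transpose_mat X * symp_form n + symp_form n * X) $$ (i, j) = 0)"
  proof
    assume "transpose_mat X * symp_form n + symp_form n * X = 0\<^sub>m (2*n) (2*n)"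
    then show "\<forall>i<2*n. \<forall>j<2*n. (transpose_mat X * symp_form n + symp_form n * X) $$ (i, j) = 0" by simp
  next
    assume "\<forall>i<2*n. \<forall>j<2*n. (transpose_mat X * symp_form n + symp_form n * X) $$ (i, j) = 0"
    then show "transpose_mat X * symp_form n + symp_form n * X = 0\<^sub>m (2*n) (2*n)"
      using X J by (intro eq_matI) auto
  qed
  then show ?thesis using X by (simp add: sp_def entry)
qed (simp add: sp_def)

lemma sp_dim: "X \<in> sp n \<Longrightarrow> X \<in> carrier_mat (2*n) (2*n)"
  by (simp add: sp_iff)

lemma sp_entry: "X \<in> sp n \<Longrightarrow> i < 2*n \<Longrightarrow> j < 2*n \<Longrightarrow> sg n i * X $$ (bar n i, j) = sg n j * X $$ (bar n j, i)"
  by (simp add: sp_iff)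

lemma sp_add: "X \<in> sp n \<Longrightarrow> Y \<in> sp n \<Longrightarrow> X + Y \<in> sp n"
  unfolding sp_iff by (auto simp: bar_lt distrib_left)

lemma sp_smult: "X \<in> sp n \<Longrightarrow> c \<cdot>\<^sub>m X \<in> sp n"
  unfolding sp_iff by (auto simp: bar_lt mult.left_commute)

lemma lie_dim: "X \<in> carrier_mat N N \<Longrightarrow> Y \<in> carrier_mat N N \<Longrightarrow> lie X Y \<in> carrier_mat N N"
  unfolding lie_def by (intro minus_carrier_mat mult_carrier_mat)

lemma lie_index:
  assumes "X \<in> carrier_mat N N" "Y \<in> carrier_mat N N" "i < N" "j < N"
  shows "lie X Y $$ (i, j) = (\<Sum>k<N. X $$ (i, k) * Y $$ (k, j)) - (\<Sum>k<N. Y $$ (i, k) * X $$ (k, j))"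
  unfolding lie_def mult_mat_index[OF assms, symmetric] mult_mat_index[OF assms(2,1,3,4), symmetric] using assms by simp

text \<open>In matrix form J X Y = - (J Y X)^T, from the symmetry of J X and J Y. Together with the
  same relation for Y and X it shows that J [X, Y] is symmetric.\<close>

lemma sp_product:
  assumes X: "X \<in> sp n" and Y: "Y \<in> sp n" and ij: "i < 2*n" "j < 2*n"
  shows "sg n i * (\<Sum>k<2*n. X $$ (bar n i, k) * Y $$ (k, j)) = - sg n j * (\<Sum>k<2*n. Y $$ (bar n j, k) * X $$ (k, i))"
proof -
  have "sg n i * (\<Sum>k<2*n. X $$ (bar n i, k) * Y $$ (k, j)) = (\<Sum>k<2*n. - sg n j * (Y $$ (bar n j, bar n k) * X $$ (bar n k, i)))"
    unfolding sum_distrib_left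
  proof (rule sum.cong)
    fix k assume "k \<in> {..<2*n}"
    then have k: "k < 2*n" by simp
    have "sg n i * (X $$ (bar n i, k) * Y $$ (k, j)) = sg n k * X $$ (bar n k, i) * Y $$ (k, j)"
      using sp_entry[OF X ij(1) k] by (simp add: mult.assoc[symmetric])
    also have "\<dots> = X $$ (bar n k, i) * (sg n k * Y $$ (k, j))" by (simp only: mult_ac)
    also have "sg n k * Y $$ (k, j) = - sg n j * Y $$ (bar n j, bar n k)"
    proof -
      have "- (sg n k * Y $$ (k, j)) = sg n j * Y $$ (bar n j, bar n k)"
        using sp_entry[OF Y bar_lt[OF k] ij(2)] by (simp add: bar_bar[OF k] sg_bar[OF k])
      from arg_cong[OF this, of uminus] show ?thesis by simp
    qed
    also have "X $$ (bar n k, i) * (- sg n j * Y $$ (bar n j, bar n k)) =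
        - sg n j * (Y $$ (bar n j, bar n k) * X $$ (bar n k, i))" by (simp only: mult_ac)
    finally show "sg n i * (X $$ (bar n i, k) * Y $$ (k, j)) = - sg n j * (Y $$ (bar n j, bar n k) * X $$ (bar n k, i))" .
  qed simp
  also have "\<dots> = - sg n j * (\<Sum>k<2*n. Y $$ (bar n j, k) * X $$ (k, i))"
    unfolding sum_bar[of "\<lambda>k. - sg n j * (Y $$ (bar n j, k) * X $$ (k, i))" n] sum_distrib_left ..
  finally show ?thesis .
qed

lemma sp_lie:
  assumes X: "X \<in> sp n" and Y: "Y \<in> sp n" shows "lie X Y \<in> sp n"
  unfolding sp_iff
proof (intro conjI allI impI)
  note d = sp_dim[OF X] sp_dim[OF Y]
  show "lie X Y \<in> carrier_mat (2*n) (2*n)" by (rule lie_dim[OF d])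
  fix i j assume ij: "i < 2*n" "j < 2*n"
  show "sg n i * lie X Y $$ (bar n i, j) = sg n j * lie X Y $$ (bar n j, i)"
    unfolding lie_index[OF d bar_lt[OF ij(1)] ij(2)] lie_index[OF d bar_lt[OF ij(2)] ij(1)] right_diff_distrib
      sp_product[OF X Y ij] sp_product[OF Y X ij] by simp
qed

text \<open>The square root t counts as one half in coordinate n + 1. A single a_i or b_i therefore
  leaves the integral exponents, and only quadratic expressions return to them; the weighted degree
  is kept in any case.\<close>

definition osc_shift :: "nat \<Rightarrow> nat \<Rightarrow> complex \<Rightarrow> (nat \<Rightarrow> complex) \<Rightarrow> nat \<Rightarrow> complex" where
  "osc_shift n i s x = (\<lambda>k. x k + s * of_int (unit_at i k) - s / 2 * of_int (unit_at (n + 1) k))"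

text \<open>On the coefficients \<open>w\<close> of a formal series in monomials with complex exponents, \<open>osc n I\<close> is \<open>t \<partial>\<^bsub>I+1\<^esub>\<close> for
  \<open>I < n\<close> and multiplication by \<open>t\<^bsup>-1\<^esup> Q\<^bsub>I-n+1\<^esub>\<close> for \<open>n \<le> I < 2n\<close>, where \<open>t\<close> is the square root of \<open>Q\<^bsub>n+1\<^esub>\<close>.\<close>

definition osc :: "nat \<Rightarrow> nat \<Rightarrow> ((nat \<Rightarrow> complex) \<Rightarrow> complex) \<Rightarrow> (nat \<Rightarrow> complex) \<Rightarrow> complex" where
  "osc n I w = (\<lambda>x. if I < n then (x (I + 1) + 1) * w (osc_shift n (I + 1) 1 x)
     else w (osc_shift n (I - n + 1) (- 1) x))"

definition osc_form :: "nat \<Rightarrow> nat \<Rightarrow> nat \<Rightarrow> complex" where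
  "osc_form n I K = (if K = bar n I then sg n I else 0)"

lemma osc_shift_commute: "osc_shift n i s (osc_shift n j t x) = osc_shift n j t (osc_shift n i s x)"
  by (auto simp: osc_shift_def fun_eq_iff algebra_simps)

lemma osc_shift_inverse: "osc_shift n i s (osc_shift n i (- s) x) = x"
  by (auto simp: osc_shift_def fun_eq_iff algebra_simps)

lemma osc_shift_at: "j \<in> {1..n} \<Longrightarrow> osc_shift n i s x j = x j + (if i = j then s else 0)"
  by (auto simp: osc_shift_def unit_at_def)

lemma lin_end_osc: "lin_end (osc n I)"
  by (auto simp: lin_end_def osc_def fun_eq_iff algebra_simps)

text \<open>These are the canonical commutation relations. The powers of t do not interfere, since
  no derivative is taken in the last variable.\<close>

lemma osc_commute:
  assumes I: "I < 2*n" and K: "K < 2*n"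
  shows "osc n I (osc n K w) x = osc n K (osc n I w) x + osc_form n I K * w x"
proof -
  consider "I < n" "K < n" | "I < n" "\<not> K < n" | "\<not> I < n" "K < n" | "\<not> I < n" "\<not> K < n" by blast
  then show ?thesis
  proof cases
    case 1
    then show ?thesis
      by (simp add: osc_def osc_form_def bar_def osc_shift_at osc_shift_commute[of n "Suc I" 1 "Suc K" 1 x] algebra_simps)
  next
    case 2
    then have "osc_form n I K = (if K - n = I then 1 else 0)" using K by (auto simp: osc_form_def bar_def sg_def)
    then show ?thesis using 2 K osc_shift_inverse[of n "I + 1" "- 1" x] osc_shift_inverse[of n "I + 1" 1 x]
      by (simp add: osc_def osc_shift_at osc_shift_commute[of n "Suc I" 1 "Suc (K - n)" "- 1" x] algebra_simps)
  next
    case 3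
    then have "osc_form n I K = (if I - n = K then - 1 else 0)" using I by (auto simp: osc_form_def bar_def sg_def)
    then show ?thesis using 3 I osc_shift_inverse[of n "K + 1" "- 1" x] osc_shift_inverse[of n "K + 1" 1 x]
      by (simp add: osc_def osc_shift_at osc_shift_commute[of n "Suc K" 1 "Suc (I - n)" "- 1" x] algebra_simps)
  next
    case 4
    then have "K \<noteq> I - n" using I by linarith
    then show ?thesis using 4
      by (simp add: osc_def osc_form_def bar_def osc_shift_commute[of n "Suc (I - n)" "- 1" "Suc (K - n)" "- 1" x])
  qed
qed

definition half_sg :: "nat \<Rightarrow> nat \<Rightarrow> complex" where "half_sg n K = - sg n K / 2"

lemma half_sg_sg: "half_sg n K * sg n K = - 1 / 2" "half_sg n K * - sg n K = 1 / 2"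
  by (simp_all add: half_sg_def sg_sq)

text \<open>The quadratic element attached to X. Its signs and the factor 1/2 are chosen so that the
  bracket with the operators \<open>osc\<close> is the natural action of X on their span, see
  \<open>osc_rep_osc\<close>.\<close>

definition osc_rep :: "nat \<Rightarrow> complex mat \<Rightarrow> ((nat \<Rightarrow> complex) \<Rightarrow> complex) \<Rightarrow> (nat \<Rightarrow> complex) \<Rightarrow> complex" where
  "osc_rep n X w = (\<lambda>x. \<Sum>I<2*n. \<Sum>K<2*n. half_sg n K * X $$ (I, K) * osc n I (osc n (bar n K) w) x)"

lemma lin_end_comp: "lin_end S \<Longrightarrow> lin_end T \<Longrightarrow> lin_end (\<lambda>v. S (T v))"
  by (simp add: lin_end_def)

lemma lin_end_osc_rep: "lin_end (osc_rep n X)"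
proof -
  have o: "lin_end (\<lambda>w. osc n I (osc n K w))" for I K by (rule lin_end_comp[OF lin_end_osc lin_end_osc])
  show ?thesis unfolding lin_end_def osc_rep_def lin_end_add[OF o] lin_end_scale[OF o]
    by (simp add: distrib_left sum.distrib sum_distrib_left mult.left_commute)
qed

lemma osc_lincomb: "osc n M (\<lambda>x. \<Sum>I\<in>A. c I * v I x) = (\<lambda>x. \<Sum>I\<in>A. c I * osc n M (v I) x)"
  by (simp add: lin_end_sum[OF lin_end_osc] lin_end_scale[OF lin_end_osc])

lemma osc_rep_lincomb: "osc_rep n X (\<lambda>x. \<Sum>I\<in>A. c I * v I x) = (\<lambda>x. \<Sum>I\<in>A. c I * osc_rep n X (v I) x)"
  by (simp add: lin_end_sum[OF lin_end_osc_rep] lin_end_scale[OF lin_end_osc_rep])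

text \<open>The operator \<open>osc n M\<close> is moved past each of the two factors. Each passage
  contributes half of the final sum, one of them directly and the other after the symmetry
  \<open>sp_entry\<close> of X.\<close>

lemma osc_rep_osc:
  assumes X: "X \<in> sp n" and M: "M < 2*n"
  shows "osc_rep n X (osc n M w) = (\<lambda>x. osc n M (osc_rep n X w) x + (\<Sum>I<2*n. X $$ (I, M) * osc n I w x))"
proof
  fix x
  let ?a = "\<lambda>I K. half_sg n K * X $$ (I, K)"
  have 3: "osc n I (osc n (bar n K) (osc n M w)) x = osc n M (osc n I (osc n (bar n K) w)) x +
      osc_form n I M * osc n (bar n K) w x + osc_form n (bar n K) M * osc n I w x"
    if I: "I < 2*n" and K: "K < 2*n" for I K
  proof -
    have "osc n (bar n K) (osc n M w) = (\<lambda>y. osc n M (osc n (bar n K) w) y + osc_form n (bar n K) M * w y)"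
      by (rule ext) (rule osc_commute[OF bar_lt[OF K] M])
    then show ?thesis
      by (simp add: lin_end_add[OF lin_end_osc] lin_end_scale[OF lin_end_osc] osc_commute[OF I M])
  qed
  have "osc_rep n X (osc n M w) x = (\<Sum>I<2*n. \<Sum>K<2*n. ?a I K * (osc n M (osc n I (osc n (bar n K) w)) x +
      osc_form n I M * osc n (bar n K) w x + osc_form n (bar n K) M * osc n I w x))"
    unfolding osc_rep_def by (intro sum.cong refl) (simp add: 3)
  also have "\<dots> = (\<Sum>I<2*n. \<Sum>K<2*n. ?a I K * osc n M (osc n I (osc n (bar n K) w)) x) +
      (\<Sum>I<2*n. \<Sum>K<2*n. ?a I K * osc_form n I M * osc n (bar n K) w x) +
      (\<Sum>I<2*n. \<Sum>K<2*n. ?a I K * osc_form n (bar n K) M * osc n I w x)"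
    by (simp add: distrib_left sum.distrib mult.assoc)
  also have "(\<Sum>I<2*n. \<Sum>K<2*n. ?a I K * osc n M (osc n I (osc n (bar n K) w)) x) = osc n M (osc_rep n X w) x"
  proof -
    have "osc n M (osc_rep n X w) x = osc n M (\<lambda>x. \<Sum>I<2*n. 1 * (\<Sum>K<2*n. ?a I K * osc n I (osc n (bar n K) w) x)) x"
      by (simp add: osc_rep_def)
    also have "\<dots> = (\<Sum>I<2*n. \<Sum>K<2*n. ?a I K * osc n M (osc n I (osc n (bar n K) w)) x)"
      unfolding osc_lincomb by simp
    finally show ?thesis by simp
  qed
  also have "(\<Sum>I<2*n. \<Sum>K<2*n. ?a I K * osc_form n (bar n K) M * osc n I w x) = (\<Sum>I<2*n. 1 / 2 * X $$ (I, M) * osc n I w x)"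
  proof (intro sum.cong refl)
    fix I
    have "(\<Sum>K<2*n. ?a I K * osc_form n (bar n K) M * osc n I w x) =
        (\<Sum>K<2*n. if K = M then 1 / 2 * X $$ (I, M) * osc n I w x else 0)"
    proof (rule sum.cong[OF refl])
      fix K assume "K \<in> {..<2*n}"
      then have K: "bar n (bar n K) = K" by (simp add: bar_bar)
      show "?a I K * osc_form n (bar n K) M * osc n I w x = (if K = M then 1 / 2 * X $$ (I, M) * osc n I w x else 0)"
      proof (cases "K = M")
        case True
        have "osc_form n (bar n M) M = - sg n M" using M by (simp add: osc_form_def bar_bar sg_bar)
        then have "?a I M * osc_form n (bar n M) M * osc n I w x = (half_sg n M * - sg n M) * X $$ (I, M) * osc n I w x"
          by (simp only: mult_ac)
        then show ?thesis unfolding half_sg_sg by (simp add: True)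
      next
        case False
        then show ?thesis by (simp add: osc_form_def K)
      qed
    qed
    then show "(\<Sum>K<2*n. ?a I K * osc_form n (bar n K) M * osc n I w x) = 1 / 2 * X $$ (I, M) * osc n I w x"
      using M by (simp add: sum.delta)
  qed
  also have "(\<Sum>I<2*n. \<Sum>K<2*n. ?a I K * osc_form n I M * osc n (bar n K) w x) = (\<Sum>I<2*n. 1 / 2 * X $$ (I, M) * osc n I w x)"
  proof -
    have "(\<Sum>I<2*n. \<Sum>K<2*n. ?a I K * osc_form n I M * osc n (bar n K) w x) =
        (\<Sum>K<2*n. \<Sum>I<2*n. if I = bar n M then 1 / 2 * (sg n M * sg n K * X $$ (bar n M, K)) * osc n (bar n K) w x else 0)"
      by (subst sum.swap, intro sum.cong refl) (use M in \<open>auto simp: osc_form_def bar_bar sg_bar half_sg_def sum.delta' eq_bar_iff[OF M]\<close>)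
    also have "\<dots> = (\<Sum>K<2*n. 1 / 2 * (sg n M * sg n K * X $$ (bar n M, K)) * osc n (bar n K) w x)"
      using bar_lt[OF M] by (simp add: sum.delta)
    also have "\<dots> = (\<Sum>K<2*n. 1 / 2 * X $$ (bar n K, M) * osc n (bar n K) w x)"
    proof (intro sum.cong refl)
      fix K assume "K \<in> {..<2*n}"
      then have "sg n M * X $$ (bar n M, K) = sg n K * X $$ (bar n K, M)" using sp_entry[OF X M] by simp
      then have "sg n M * sg n K * X $$ (bar n M, K) = (sg n K * sg n K) * X $$ (bar n K, M)"
        by (simp add: mult_ac)
      then show "1 / 2 * (sg n M * sg n K * X $$ (bar n M, K)) * osc n (bar n K) w x = 1 / 2 * X $$ (bar n K, M) * osc n (bar n K) w x"
        by (simp add: sg_sq)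
    qed
    also have "\<dots> = (\<Sum>I<2*n. 1 / 2 * X $$ (I, M) * osc n I w x)"
      by (rule sum_bar[of "\<lambda>I. 1 / 2 * X $$ (I, M) * osc n I w x"])
    finally show ?thesis .
  qed
  finally have "osc_rep n X (osc n M w) x = osc n M (osc_rep n X w) x +
      (\<Sum>I<2*n. 1 / 2 * X $$ (I, M) * osc n I w x + 1 / 2 * X $$ (I, M) * osc n I w x)"
    by (simp only: sum.distrib add.assoc)
  then show "osc_rep n X (osc n M w) x = osc n M (osc_rep n X w) x + (\<Sum>I<2*n. X $$ (I, M) * osc n I w x)"
    by simp
qed

text \<open>By \<open>osc_rep_osc\<close> the commutator with \<open>osc_rep n X\<close> acts as a
  derivation on the products that make up \<open>osc_rep n Y\<close>. The first factor contributes
  the entries of X Y, the second one, after \<open>sp_entry\<close>, those of - Y X.\<close>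

lemma osc_rep_lie:
  assumes X: "X \<in> sp n" and Y: "Y \<in> sp n"
  shows "osc_rep n (lie X Y) w = (\<lambda>x. osc_rep n X (osc_rep n Y w) x - osc_rep n Y (osc_rep n X w) x)"
proof
  fix x
  note d = sp_dim[OF X] sp_dim[OF Y]
  let ?b = "\<lambda>M K. half_sg n K * Y $$ (M, K)"
  have 1: "osc_rep n X (osc n M (osc n (bar n K) w)) x = osc n M (osc n (bar n K) (osc_rep n X w)) x +
      (\<Sum>I<2*n. X $$ (I, bar n K) * osc n M (osc n I w) x) + (\<Sum>I<2*n. X $$ (I, M) * osc n I (osc n (bar n K) w) x)"
    if M: "M < 2*n" and K: "K < 2*n" for M K
    unfolding osc_rep_osc[OF X M] osc_rep_osc[OF X bar_lt[OF K]] lin_end_add[OF lin_end_osc] osc_lincomb by simp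
  have "osc_rep n X (osc_rep n Y w) x = osc_rep n X (\<lambda>x. \<Sum>M<2*n. 1 * (\<Sum>K<2*n. ?b M K * osc n M (osc n (bar n K) w) x)) x"
    by (simp add: osc_rep_def[of n Y])
  also have "\<dots> = (\<Sum>M<2*n. \<Sum>K<2*n. ?b M K * osc_rep n X (osc n M (osc n (bar n K) w)) x)"
    unfolding osc_rep_lincomb by simp
  also have "\<dots> = (\<Sum>M<2*n. \<Sum>K<2*n. ?b M K * (osc n M (osc n (bar n K) (osc_rep n X w)) x +
      (\<Sum>I<2*n. X $$ (I, bar n K) * osc n M (osc n I w) x) + (\<Sum>I<2*n. X $$ (I, M) * osc n I (osc n (bar n K) w) x)))"
    by (intro sum.cong refl) (simp add: 1)
  also have "\<dots> = osc_rep n Y (osc_rep n X w) x +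
      (\<Sum>M<2*n. \<Sum>K<2*n. ?b M K * (\<Sum>I<2*n. X $$ (I, bar n K) * osc n M (osc n I w) x)) +
      (\<Sum>M<2*n. \<Sum>K<2*n. ?b M K * (\<Sum>I<2*n. X $$ (I, M) * osc n I (osc n (bar n K) w) x))"
    by (simp only: osc_rep_def[of n Y "osc_rep n X w"] distrib_left sum.distrib)
  also have "(\<Sum>M<2*n. \<Sum>K<2*n. ?b M K * (\<Sum>I<2*n. X $$ (I, M) * osc n I (osc n (bar n K) w) x)) =
      (\<Sum>I<2*n. \<Sum>K<2*n. half_sg n K * (\<Sum>M<2*n. X $$ (I, M) * Y $$ (M, K)) * osc n I (osc n (bar n K) w) x)"
  proof -
    have "(\<Sum>M<2*n. \<Sum>K<2*n. ?b M K * (\<Sum>I<2*n. X $$ (I, M) * osc n I (osc n (bar n K) w) x)) =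
      (\<Sum>M<2*n. \<Sum>I<2*n. \<Sum>K<2*n. ?b M K * (X $$ (I, M) * osc n I (osc n (bar n K) w) x))"
      unfolding sum_distrib_left by (intro sum.cong refl sum.swap)
    also have "\<dots> = (\<Sum>I<2*n. \<Sum>K<2*n. \<Sum>M<2*n. ?b M K * (X $$ (I, M) * osc n I (osc n (bar n K) w) x))"
      by (subst sum.swap, intro sum.cong refl sum.swap)
    finally show ?thesis by (simp add: sum_distrib_left sum_distrib_right mult_ac)
  qed
  also have "(\<Sum>M<2*n. \<Sum>K<2*n. ?b M K * (\<Sum>I<2*n. X $$ (I, bar n K) * osc n M (osc n I w) x)) =
      (\<Sum>M<2*n. \<Sum>L<2*n. - (half_sg n L * (\<Sum>K<2*n. Y $$ (M, K) * X $$ (K, L)) * osc n M (osc n (bar n L) w) x))"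
  proof (rule sum.cong[OF refl])
    fix M assume "M \<in> {..<2*n}"
    have "(\<Sum>K<2*n. ?b M K * (\<Sum>I<2*n. X $$ (I, bar n K) * osc n M (osc n I w) x)) =
        (\<Sum>K<2*n. ?b M K * (\<Sum>L<2*n. X $$ (bar n L, bar n K) * osc n M (osc n (bar n L) w) x))"
      using sum_bar[of "\<lambda>I. X $$ (I, bar n _) * osc n M (osc n I w) x" n] by simp
    also have "\<dots> = (\<Sum>K<2*n. \<Sum>L<2*n. - half_sg n L * (Y $$ (M, K) * X $$ (K, L)) * osc n M (osc n (bar n L) w) x)"
      unfolding sum_distrib_left
    proof (intro sum.cong refl)
      fix K L assume "K \<in> {..<2*n}" "L \<in> {..<2*n}"
      then have K: "K < 2*n" and L: "L < 2*n" by auto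
      have e: "sg n K * X $$ (bar n L, bar n K) = - (sg n L * X $$ (K, L))"
      proof -
        have "sg n L * X $$ (bar n L, bar n K) = - (sg n K * X $$ (K, L))"
          using sp_entry[OF X L bar_lt[OF K]] by (simp add: sg_bar[OF K] bar_bar[OF K])
        then show ?thesis by (auto simp: sg_def split: if_splits)
      qed
      have "?b M K * (X $$ (bar n L, bar n K) * osc n M (osc n (bar n L) w) x) =
          - 1 / 2 * Y $$ (M, K) * (sg n K * X $$ (bar n L, bar n K)) * osc n M (osc n (bar n L) w) x"
        by (simp add: half_sg_def)
      then show "?b M K * (X $$ (bar n L, bar n K) * osc n M (osc n (bar n L) w) x) =
          - half_sg n L * (Y $$ (M, K) * X $$ (K, L)) * osc n M (osc n (bar n L) w) x"
        unfolding e by (simp add: half_sg_def)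
    qed
    also have "\<dots> = (\<Sum>L<2*n. \<Sum>K<2*n. - half_sg n L * (Y $$ (M, K) * X $$ (K, L)) * osc n M (osc n (bar n L) w) x)"
      by (rule sum.swap)
    finally show "(\<Sum>K<2*n. ?b M K * (\<Sum>I<2*n. X $$ (I, bar n K) * osc n M (osc n I w) x)) =
        (\<Sum>L<2*n. - (half_sg n L * (\<Sum>K<2*n. Y $$ (M, K) * X $$ (K, L)) * osc n M (osc n (bar n L) w) x))"
      by (simp add: sum_distrib_left sum_distrib_right sum_negf)
  qed
  finally have main: "osc_rep n X (osc_rep n Y w) x - osc_rep n Y (osc_rep n X w) x =
      (\<Sum>I<2*n. \<Sum>K<2*n. half_sg n K * (\<Sum>M<2*n. X $$ (I, M) * Y $$ (M, K)) * osc n I (osc n (bar n K) w) x) -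
      (\<Sum>M<2*n. \<Sum>L<2*n. half_sg n L * (\<Sum>K<2*n. Y $$ (M, K) * X $$ (K, L)) * osc n M (osc n (bar n L) w) x)"
    by (simp add: sum_negf)
  have "osc_rep n (lie X Y) w x = (\<Sum>I<2*n. \<Sum>K<2*n. half_sg n K *
      ((\<Sum>M<2*n. X $$ (I, M) * Y $$ (M, K)) - (\<Sum>M<2*n. Y $$ (I, M) * X $$ (M, K))) * osc n I (osc n (bar n K) w) x)"
    unfolding osc_rep_def by (intro sum.cong refl) (simp add: lie_index[OF d])
  also have "\<dots> = osc_rep n X (osc_rep n Y w) x - osc_rep n Y (osc_rep n X w) x"
    unfolding main by (simp only: right_diff_distrib left_diff_distrib sum_subtractf)
  finally show "osc_rep n (lie X Y) w x = osc_rep n X (osc_rep n Y w) x - osc_rep n Y (osc_rep n X w) x" .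
qed

lemma lie_rep_osc: "lie_rep (sp n) (osc_rep n)"
proof
  show "lin_end (osc_rep n x)" for x by (rule lin_end_osc_rep)
  show "osc_rep n (x + y) v = (\<lambda>t. osc_rep n x v t + osc_rep n y v t)" if xy: "x \<in> sp n" "y \<in> sp n" for x y v
  proof
    fix t
    have "osc_rep n (x + y) v t = (\<Sum>I<2*n. \<Sum>K<2*n. half_sg n K * x $$ (I, K) * osc n I (osc n (bar n K) v) t +
        half_sg n K * y $$ (I, K) * osc n I (osc n (bar n K) v) t)"
      unfolding osc_rep_def using sp_dim[OF xy(1)] sp_dim[OF xy(2)]
      by (intro sum.cong refl) (simp add: distrib_left distrib_right)
    then show "osc_rep n (x + y) v t = osc_rep n x v t + osc_rep n y v t"
      by (simp only: sum.distrib osc_rep_def)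
  qed
  show "osc_rep n (c \<cdot>\<^sub>m x) v = (\<lambda>t. c * osc_rep n x v t)" if x: "x \<in> sp n" for c x v
  proof
    fix t
    have "osc_rep n (c \<cdot>\<^sub>m x) v t = (\<Sum>I<2*n. \<Sum>K<2*n. c * (half_sg n K * x $$ (I, K) * osc n I (osc n (bar n K) v) t))"
      unfolding osc_rep_def using sp_dim[OF x] by (intro sum.cong refl) simp
    then show "osc_rep n (c \<cdot>\<^sub>m x) v t = c * osc_rep n x v t"
      by (simp only: sum_distrib_left osc_rep_def)
  qed
qed (rule sp_add sp_smult sp_lie osc_rep_lie; assumption)+

section \<open>The parabolic decomposition\<close>

lemma module_mat_module: "Module.module class_ring (module_mat TYPE(complex) N N)"
proof (rule moduleI)
  show "cring (class_ring :: complex ring)" by (rule domain.axioms(1)[OF field.axioms(1)[OF class_field]])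
  show "abelian_group (module_mat TYPE(complex) N N)" by (rule abelian_group_mat)
qed (auto simp: module_mat_simps class_ring_simps add_smult_distrib_left_mat add_smult_distrib_right_mat)

lemma mat_span_ge: "S \<subseteq> carrier_mat (2*n) (2*n) \<Longrightarrow> S \<subseteq> mat_span n S"
  using LinearCombinations.module.in_own_span[OF module_mat_module[of "2*n"], of S] by (simp add: module_mat_simps)

lemma mat_span_le:
  assumes "S \<subseteq> N" "N \<subseteq> carrier_mat (2*n) (2*n)" "0\<^sub>m (2*n) (2*n) \<in> N"
    and "\<And>x y. x \<in> N \<Longrightarrow> y \<in> N \<Longrightarrow> x + y \<in> N" "\<And>c x. x \<in> N \<Longrightarrow> c \<cdot>\<^sub>m x \<in> N"
  shows "mat_span n S \<subseteq> N"
proof (rule LinearCombinations.module.span_is_subset[OF module_mat_module assms(1)])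
  show "submodule class_ring N (module_mat TYPE(complex) (2*n) (2*n))"
    by (rule submodule.intro[OF module_mat_module]) (use assms in \<open>auto simp: module_mat_simps\<close>)
qed

definition grade :: "nat \<Rightarrow> nat \<Rightarrow> nat \<Rightarrow> int" where
  "grade n i j = (if i < n then 1 else 0) - (if j < n then 1 else 0)"

text \<open>The \<open>k\<close>-eigenspace of the bracket with \<open>diag(1, \<dots>, 1, -1, \<dots>, -1) / 2\<close>.\<close>

definition sp_graded :: "nat \<Rightarrow> int \<Rightarrow> complex mat set" where
  "sp_graded n k = {X \<in> sp n. \<forall>i<2*n. \<forall>j<2*n. X $$ (i, j) \<noteq> 0 \<longrightarrow> grade n i j = k}"

definition cdiag :: "nat \<Rightarrow> (nat \<Rightarrow> complex) \<Rightarrow> complex mat" where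
  "cdiag n h = mat (2*n) (2*n) (\<lambda>(i, j). if i = j then (if i < n then h i else - h (i - n)) else 0)"

lemma cdiag_index: "i < 2*n \<Longrightarrow> j < 2*n \<Longrightarrow> cdiag n h $$ (i, j) = (if i = j then (if i < n then h i else - h (i - n)) else 0)"
  by (simp add: cdiag_def)

lemma cdiag_dim: "cdiag n h \<in> carrier_mat (2*n) (2*n)"
  by (simp add: cdiag_def)

lemma cdiag_sp: "cdiag n h \<in> sp n"
  unfolding sp_iff using cdiag_dim by (auto simp: cdiag_index bar_lt bar_def sg_def)

lemma cdiag_cartan: "cdiag n h \<in> cartan n"
  unfolding cartan_def diagonal_mat_def using cdiag_sp by (auto simp: cdiag_def)

lemma lie_diag:
  assumes H: "H \<in> carrier_mat N N" "diagonal_mat H" and X: "X \<in> carrier_mat N N" and ij: "i < N" "j < N"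
  shows "lie H X $$ (i, j) = (H $$ (i, i) - H $$ (j, j)) * X $$ (i, j)"
proof -
  have d: "H $$ (a, b) = 0" if "a \<noteq> b" "a < N" "b < N" for a b using H that by (auto simp: diagonal_mat_def)
  have "(\<Sum>k<N. H $$ (i, k) * X $$ (k, j)) = (\<Sum>k<N. if k = i then H $$ (i, i) * X $$ (i, j) else 0)"
    by (rule sum.cong) (use d ij in auto)
  moreover have "(\<Sum>k<N. X $$ (i, k) * H $$ (k, j)) = (\<Sum>k<N. if k = j then X $$ (i, j) * H $$ (j, j) else 0)"
    by (rule sum.cong) (use d ij in auto)
  ultimately show ?thesis unfolding lie_index[OF H(1) X ij] using ij by (simp add: sum.delta algebra_simps)
qed

lemma cartan_diag: "H \<in> cartan n \<Longrightarrow> H \<in> sp n \<and> diagonal_mat H"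
  by (simp add: cartan_def)

lemma sp_bar_diag: "H \<in> sp n \<Longrightarrow> i < n \<Longrightarrow> H $$ (i + n, i + n) = - H $$ (i, i)"
  using sp_entry[of H n i "i + n"] by (simp add: bar_def sg_def)

text \<open>The matrix diag(1, ..., 1, -1, ..., -1) is killed by the short simple roots and has
  value 2 under the long one, so it reads off the coefficient of \<alpha>_n.\<close>

lemma root_comb_grading: "n \<ge> 1 \<Longrightarrow> root_comb n c (cdiag n (\<lambda>_. 1)) = 2 * of_int (c n)"
proof -
  assume n: "n \<ge> 1"
  have "simple_root n i (cdiag n (\<lambda>_. 1)) = (if i = n then 2 else 0)" if "i \<in> {1..n}" for i
    using that by (auto simp: simple_root_def eps_def cdiag_index)
  then have "root_comb n c (cdiag n (\<lambda>_. 1)) = (\<Sum>i\<in>{1..n}. if i = n then 2 * of_int (c n) else 0)"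
    unfolding root_comb_def by (intro sum.cong) auto
  then show ?thesis using n by (simp add: sum.delta)
qed

lemma root_vectors_graded:
  assumes n: "n \<ge> 1" shows "root_vectors n k \<subseteq> sp_graded n k"
proof
  fix X assume "X \<in> root_vectors n k"
  then obtain c where X: "X \<in> root_space n (root_comb n c)" and c: "c n = k" unfolding root_vectors_def by blast
  have Xs: "X \<in> sp n" using X by (simp add: root_space_def)
  have "lie (cdiag n (\<lambda>_. 1)) X = root_comb n c (cdiag n (\<lambda>_. 1)) \<cdot>\<^sub>m X"
    using X cdiag_cartan unfolding root_space_def by blast
  then have e: "lie (cdiag n (\<lambda>_. 1)) X = (2 * of_int k) \<cdot>\<^sub>m X" by (simp only: root_comb_grading[OF n] c)
  have "grade n i j = k" if ij: "i < 2*n" "j < 2*n" and nz: "X $$ (i, j) \<noteq> 0" for i j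
  proof -
    have "lie (cdiag n (\<lambda>_. 1)) X $$ (i, j) = 2 * of_int (grade n i j) * X $$ (i, j)"
      using lie_diag[OF cdiag_dim _ sp_dim[OF Xs] ij, of "\<lambda>_. 1"] cartan_diag[OF cdiag_cartan] ij
      by (simp add: cdiag_index grade_def)
    moreover have "((2 * of_int k) \<cdot>\<^sub>m X) $$ (i, j) = 2 * of_int k * X $$ (i, j)" using ij sp_dim[OF Xs] by simp
    ultimately show ?thesis using e nz by simp
  qed
  then show "X \<in> sp_graded n k" using Xs by (simp add: sp_graded_def)
qed

lemma cartan_graded: "cartan n \<subseteq> sp_graded n 0"
proof
  fix H assume H: "H \<in> cartan n"
  then have "H \<in> carrier_mat (2*n) (2*n)" "diagonal_mat H" using cartan_diag[OF H] sp_dim by auto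
  then have eq: "i = j" if "i < 2*n" "j < 2*n" "H $$ (i, j) \<noteq> 0" for i j using that by (auto simp: diagonal_mat_def)
  have "grade n i j = 0" if "i < 2*n" "j < 2*n" "H $$ (i, j) \<noteq> 0" for i j
    using eq[OF that] by (simp add: grade_def)
  then show "H \<in> sp_graded n 0" using cartan_diag[OF H] by (simp add: sp_graded_def)
qed

lemma mat_span_graded: "S \<subseteq> sp_graded n k \<Longrightarrow> mat_span n S \<subseteq> sp_graded n k"
proof (rule mat_span_le)
  show "sp_graded n k \<subseteq> carrier_mat (2*n) (2*n)" by (auto simp: sp_graded_def dest: sp_dim)
  show "0\<^sub>m (2*n) (2*n) \<in> sp_graded n k"
    unfolding sp_graded_def mem_Collect_eq sp_iff by (intro conjI allI impI) (simp_all add: bar_lt)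
  show "x + y \<in> sp_graded n k" if "x \<in> sp_graded n k" "y \<in> sp_graded n k" for x y
  proof -
    have d: "x \<in> carrier_mat (2*n) (2*n)" "y \<in> carrier_mat (2*n) (2*n)" "x + y \<in> sp n"
      using that sp_dim sp_add by (auto simp: sp_graded_def)
    have "grade n i j = k" if ij: "i < 2*n" "j < 2*n" "(x + y) $$ (i, j) \<noteq> 0" for i j
    proof -
      have "x $$ (i, j) \<noteq> 0 \<or> y $$ (i, j) \<noteq> 0" using ij d by auto
      then show ?thesis using \<open>x \<in> sp_graded n k\<close> \<open>y \<in> sp_graded n k\<close> ij(1,2) by (auto simp: sp_graded_def)
    qed
    then show ?thesis using d(3) by (simp add: sp_graded_def)
  qed
  show "c \<cdot>\<^sub>m x \<in> sp_graded n k" if "x \<in> sp_graded n k" for c x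
    using that by (auto simp: sp_graded_def sp_smult dest: sp_dim)
qed

lemma levi_graded: "n \<ge> 1 \<Longrightarrow> levi n \<subseteq> sp_graded n 0"
  unfolding levi_def by (rule mat_span_graded) (use cartan_graded root_vectors_graded in blast)

lemma r_plus_graded: "n \<ge> 1 \<Longrightarrow> r_plus n \<subseteq> sp_graded n 1"
  unfolding r_plus_def by (rule mat_span_graded) (rule root_vectors_graded)

lemma r_minus_graded: "n \<ge> 1 \<Longrightarrow> r_minus n \<subseteq> sp_graded n (- 1)"
  unfolding r_minus_def by (rule mat_span_graded) (rule root_vectors_graded)

lemma sp_graded_dim: "X \<in> sp_graded n k \<Longrightarrow> X \<in> carrier_mat (2*n) (2*n)"
  by (auto simp: sp_graded_def dest: sp_dim)

lemma simple_root_abel: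
  fixes w :: "nat \<Rightarrow> int"
  assumes "m < n"
  shows "(\<Sum>i = 1..m. of_int (\<Sum>k = 1..i. w k) * simple_root n i H) =
     (\<Sum>i = 1..m. of_int (w i) * eps i H) - of_int (\<Sum>k = 1..m. w k) * eps (m + 1) H"
  using assms
proof (induction m)
  case (Suc m)
  then have e: "simple_root n (Suc m) H = eps (Suc m) H - eps (Suc (Suc m)) H" by (simp add: simple_root_def)
  have IH: "(\<Sum>i = 1..m. of_int (\<Sum>k = 1..i. w k) * simple_root n i H) =
     (\<Sum>i = 1..m. of_int (w i) * eps i H) - of_int (\<Sum>k = 1..m. w k) * eps (Suc m) H"
    using Suc by simp
  have "(\<Sum>i = 1..Suc m. of_int (\<Sum>k = 1..i. w k) * simple_root n i H) =
     (\<Sum>i = 1..m. of_int (\<Sum>k = 1..i. w k) * simple_root n i H) +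
     (of_int (\<Sum>k = 1..m. w k) + of_int (w (Suc m))) * simple_root n (Suc m) H" by simp
  also have "\<dots> = ((\<Sum>i = 1..m. of_int (w i) * eps i H) + of_int (w (Suc m)) * eps (Suc m) H) -
      (of_int (\<Sum>k = 1..m. w k) + of_int (w (Suc m))) * eps (Suc (Suc m)) H"
    unfolding IH e by (simp only: algebra_simps)
  finally show ?case by simp
qed simp

text \<open>Inverting \<alpha>_i = \<epsilon>_i - \<epsilon>_(i+1) makes the coefficients partial
  sums of w, by the Abel summation \<open>simple_root_abel\<close>. As \<alpha>_n = 2 \<epsilon>_n,
  the last partial sum is halved, so the total has to be even.\<close>

lemma root_comb_weight:
  fixes w :: "nat \<Rightarrow> int"
  assumes n: "n \<ge> 1" and w: "(\<Sum>k = 1..n. w k) = 2 * d"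
  shows "\<exists>c. c n = d \<and> (\<forall>H. root_comb n c H = (\<Sum>i = 1..n. of_int (w i) * eps i H))"
proof -
  define c where "c = (\<lambda>i. if i = n then d else \<Sum>k = 1..i. w k)"
  have cn: "c n = d" by (simp add: c_def)
  obtain m where m: "n = Suc m" using n by (cases n) auto
  have wm: "(\<Sum>k = 1..m. w k) + w n = 2 * d" using w by (simp add: m)
  have "root_comb n c H = (\<Sum>i = 1..n. of_int (w i) * eps i H)" for H
  proof -
  have "root_comb n c H = (\<Sum>i = 1..m. of_int (c i) * simple_root n i H) + of_int (c n) * simple_root n n H"
    by (simp add: root_comb_def m)
  also have "(\<Sum>i = 1..m. of_int (c i) * simple_root n i H) = (\<Sum>i = 1..m. of_int (\<Sum>k = 1..i. w k) * simple_root n i H)"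
    by (rule sum.cong) (auto simp: c_def m)
  also have "\<dots> = (\<Sum>i = 1..m. of_int (w i) * eps i H) - of_int (\<Sum>k = 1..m. w k) * eps n H"
    using simple_root_abel[of m n w H] by (simp add: m)
  also have "of_int (c n) * simple_root n n H = of_int (2 * d) * eps n H"
    by (simp add: c_def simple_root_def)
  also have "of_int (2 * d) * eps n H = of_int (\<Sum>k = 1..m. w k) * eps n H + of_int (w n) * eps n H"
    unfolding wm[symmetric] by (simp only: of_int_add distrib_right)
  finally show "root_comb n c H = (\<Sum>i = 1..n. of_int (w i) * eps i H)" by (simp add: m)
  qed
  then show ?thesis using cn by (intro exI[of _ c]) simp
qed

text \<open>The weight is given in \<epsilon>-coordinates and rewritten in simple roots by
  \<open>root_comb_weight\<close>. The matrix H witnesses that the weight is not zero, and the entry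
  of X that its weight space is not.\<close>

lemma root_vectorI:
  fixes w :: "nat \<Rightarrow> int"
  assumes n: "n \<ge> 1" and X: "X \<in> sp n" and nz: "i0 < 2*n" "j0 < 2*n" "X $$ (i0, j0) \<noteq> 0"
    and w: "(\<Sum>k = 1..n. w k) = 2 * d"
    and wt: "\<And>H i j. H \<in> cartan n \<Longrightarrow> i < 2*n \<Longrightarrow> j < 2*n \<Longrightarrow> X $$ (i, j) \<noteq> 0 \<Longrightarrow>
        H $$ (i, i) - H $$ (j, j) = (\<Sum>k = 1..n. of_int (w k) * eps k H)"
    and H: "H \<in> cartan n" "(\<Sum>k = 1..n. of_int (w k) * eps k H) \<noteq> 0"
  shows "X \<in> root_vectors n d"
proof -
  obtain c where "c n = d \<and> (\<forall>H. root_comb n c H = (\<Sum>i = 1..n. of_int (w i) * eps i H))"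
    using root_comb_weight[OF n w] by (rule exE)
  then have c: "c n = d" "root_comb n c H = (\<Sum>i = 1..n. of_int (w i) * eps i H)" for H by simp_all
  have "lie H X = root_comb n c H \<cdot>\<^sub>m X" if H: "H \<in> cartan n" for H
  proof (rule eq_matI)
    have d: "H \<in> carrier_mat (2*n) (2*n)" "diagonal_mat H" using cartan_diag[OF H] sp_dim by auto
    note Xd = sp_dim[OF X]
    show "dim_row (lie H X) = dim_row (root_comb n c H \<cdot>\<^sub>m X)" "dim_col (lie H X) = dim_col (root_comb n c H \<cdot>\<^sub>m X)"
      using lie_dim[OF d(1) Xd] Xd by auto
    fix i j assume "i < dim_row (root_comb n c H \<cdot>\<^sub>m X)" "j < dim_col (root_comb n c H \<cdot>\<^sub>m X)"
    then have ij: "i < 2*n" "j < 2*n" using Xd by auto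
    show "lie H X $$ (i, j) = (root_comb n c H \<cdot>\<^sub>m X) $$ (i, j)"
      unfolding lie_diag[OF d Xd ij] using wt[OF H ij] ij Xd by (cases "X $$ (i, j) = 0") (auto simp: c(2))
  qed
  then have rs: "X \<in> root_space n (root_comb n c)" using X by (simp add: root_space_def)
  have "X \<noteq> 0\<^sub>m (2*n) (2*n)" using nz by auto
  then have "is_root n (root_comb n c)" unfolding is_root_def
    by (intro conjI bexI[OF _ H(1)] bexI[OF _ rs]) (simp_all only: c(2) H(2) not_False_eq_True)
  then show ?thesis unfolding root_vectors_def using rs c(1) by blast
qed

text \<open>The matrix unit E_ab completed to an element of \<open>sp n\<close>. If b is
  \<open>bar n a\<close>, both terms sit at the same place and add up to 2 E_ab.\<close>

definition sp_unit :: "nat \<Rightarrow> nat \<Rightarrow> nat \<Rightarrow> complex mat" where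
  "sp_unit n a b = mat (2*n) (2*n) (\<lambda>(i, j). (if i = a \<and> j = b then 1 else 0) -
     (if i = bar n b \<and> j = bar n a then sg n a * sg n b else 0))"

lemma sp_unit_index: "i < 2*n \<Longrightarrow> j < 2*n \<Longrightarrow> sp_unit n a b $$ (i, j) = (if i = a \<and> j = b then 1 else 0) -
     (if i = bar n b \<and> j = bar n a then sg n a * sg n b else 0)"
  by (simp add: sp_unit_def)

lemma bar_eq_iff: "i < 2*n \<Longrightarrow> a < 2*n \<Longrightarrow> bar n i = a \<longleftrightarrow> i = bar n a"
  using bar_bar by auto

lemma sp_unit_sp: assumes ab: "a < 2*n" "b < 2*n" shows "sp_unit n a b \<in> sp n"
  unfolding sp_iff
proof (intro conjI allI impI)
  show "sp_unit n a b \<in> carrier_mat (2*n) (2*n)" by (simp add: sp_unit_def)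
  fix i j assume ij: "i < 2*n" "j < 2*n"
  have bb: "bar n i = bar n b \<longleftrightarrow> i = b" "bar n j = bar n b \<longleftrightarrow> j = b" using ij ab bar_bar by metis+
  have s: "sg n b * (sg n a * sg n b) = sg n a" using sg_sq[of n b] by (simp add: mult.left_commute)
  have h: "sg n p * (if p = bar n a \<and> q = b then 1 else 0) = - (sg n q * (if q = b \<and> p = bar n a then sg n a * sg n b else 0))"
    for p q using sg_bar[OF ab(1)] s by simp
  have "sg n i * sp_unit n a b $$ (bar n i, j) = sg n i * (if i = bar n a \<and> j = b then 1 else 0) -
      sg n i * (if i = b \<and> j = bar n a then sg n a * sg n b else 0)"
    unfolding sp_unit_index[OF bar_lt[OF ij(1)] ij(2)] bb bar_eq_iff[OF ij(1) ab(1)] by (simp only: right_diff_distrib)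
  moreover have "sg n j * sp_unit n a b $$ (bar n j, i) = sg n j * (if j = bar n a \<and> i = b then 1 else 0) -
      sg n j * (if j = b \<and> i = bar n a then sg n a * sg n b else 0)"
    unfolding sp_unit_index[OF bar_lt[OF ij(2)] ij(1)] bb bar_eq_iff[OF ij(2) ab(1)] by (simp only: right_diff_distrib)
  ultimately show "sg n i * sp_unit n a b $$ (bar n i, j) = sg n j * sp_unit n a b $$ (bar n j, i)"
    unfolding h[of i j] h[of j i] by simp
qed

lemma sum_weight:
  fixes i n :: nat
  assumes "i < n" shows "(\<Sum>k = 1..n. (if k = i + 1 then s else 0) * f k) = (s * f (i + 1) :: 'a :: comm_ring_1)"
proof -
  have "(\<Sum>k = 1..n. (if k = i + 1 then s else 0) * f k) = (\<Sum>k = 1..n. if k = i + 1 then s * f k else 0)"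
    by (rule sum.cong) auto
  also have "\<dots> = (if i + 1 \<in> {1..n} then s * f (i + 1) else 0)" by (rule sum.delta) simp
  finally show ?thesis using assms by simp
qed

lemma cartan_eps: "H \<in> cartan n \<Longrightarrow> i < 2*n \<Longrightarrow> H $$ (i, i) = sg n i * eps ((if i < n then i else i - n) + 1) H"
  using sp_bar_diag[of H n "i - n"] cartan_diag[of H n] by (auto simp: eps_def sg_def)

lemma sp_unit_root:
  assumes n: "n \<ge> 1" and ab: "a < 2*n" "b < 2*n" "a \<noteq> b"
    and nz: "sp_unit n a b $$ (a, b) \<noteq> 0"
  shows "sp_unit n a b \<in> root_vectors n (grade n a b)"
proof -
  define a' where "a' = (if a < n then a else a - n)"
  define b' where "b' = (if b < n then b else b - n)"
  define sa where "sa = (if a < n then 1 else - 1 :: int)"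
  define sb where "sb = (if b < n then 1 else - 1 :: int)"
  have a': "a' < n" and b': "b' < n" using ab by (auto simp: a'_def b'_def)
  \<comment> \<open>The weight of E_ab is the weight of basis vector a minus that of b; the second
    half of the basis carries the negatives of the weights of the first half.\<close>
  define w where "w = (\<lambda>k. (if k = a' + 1 then sa else 0) - (if k = b' + 1 then sb else 0))"
  have wsum: "(\<Sum>k = 1..n. of_int (w k) * eps k H) = of_int sa * eps (a' + 1) H - of_int sb * eps (b' + 1) H" for H
  proof -
    have "(\<Sum>k = 1..n. of_int (w k) * eps k H) =
        (\<Sum>k = 1..n. (if k = a' + 1 then of_int sa else 0) * eps k H) - (\<Sum>k = 1..n. (if k = b' + 1 then of_int sb else 0) * eps k H)"
      by (simp only: sum_subtractf[symmetric] left_diff_distrib[symmetric]) (auto simp: w_def intro!: sum.cong)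
    then show ?thesis by (simp only: sum_weight[OF a'] sum_weight[OF b'])
  qed
  have Hab: "H $$ (a, a) - H $$ (b, b) = (\<Sum>k = 1..n. of_int (w k) * eps k H)" if "H \<in> cartan n" for H
    unfolding wsum cartan_eps[OF that ab(1)] cartan_eps[OF that ab(2)]
    by (simp add: a'_def b'_def sa_def sb_def sg_def)
  have Hbar: "H $$ (bar n i, bar n i) = - H $$ (i, i)" if "H \<in> cartan n" "i < 2*n" for H i
    using sp_bar_diag[of H n i] sp_bar_diag[of H n "i - n"] cartan_diag[OF that(1)] that(2) by (auto simp: bar_def)
  show ?thesis
  proof (rule root_vectorI[OF n sp_unit_sp[OF ab(1,2)] ab(1,2) nz, of w])
    have "(\<Sum>k = 1..n. w k) = (\<Sum>k = 1..n. (if k = a' + 1 then sa else 0)) - (\<Sum>k = 1..n. (if k = b' + 1 then sb else 0))"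
      by (simp add: w_def sum_subtractf)
    then show "(\<Sum>k = 1..n. w k) = 2 * grade n a b"
      using a' b' by (simp add: sum.delta sa_def sb_def grade_def)
    fix H i j assume H: "H \<in> cartan n" and ij: "i < 2*n" "j < 2*n" and nz: "sp_unit n a b $$ (i, j) \<noteq> 0"
    then consider "i = a" "j = b" | "i = bar n b" "j = bar n a" by (auto simp: sp_unit_index split: if_splits)
    then show "H $$ (i, i) - H $$ (j, j) = (\<Sum>k = 1..n. of_int (w k) * eps k H)"
      using Hab[OF H] Hbar[OF H ab(1)] Hbar[OF H ab(2)] by cases auto
  next
    \<comment> \<open>The weight is evaluated on the diagonal matrix with the same coefficients; the
      value is a sum of squares and nonzero because a \<noteq> b.\<close>
    show "cdiag n (\<lambda>i. (if i = a' then of_int sa else 0) - (if i = b' then of_int sb else 0)) \<in> cartan n"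
      by (rule cdiag_cartan)
    have "a' = b' \<Longrightarrow> sa \<noteq> sb" using ab by (auto simp: a'_def b'_def sa_def sb_def split: if_splits)
    then show "(\<Sum>k = 1..n. of_int (w k) * eps k (cdiag n (\<lambda>i. (if i = a' then of_int sa else 0) - (if i = b' then of_int sb else 0)))) \<noteq> 0"
      unfolding wsum using a' b'
      by (auto simp: eps_def cdiag_index sa_def sb_def)
  qed
qed

lemma root_vectors_dim: "n \<ge> 1 \<Longrightarrow> root_vectors n k \<subseteq> carrier_mat (2*n) (2*n)"
  using root_vectors_graded sp_graded_dim by blast

lemma sp_unit_diag: "a < 2*n \<Longrightarrow> sp_unit n a a \<in> cartan n"
  unfolding cartan_def diagonal_mat_def using sp_unit_sp[of a n a] by (auto simp: sp_unit_def)

lemma sp_unit_entry: "a < 2*n \<Longrightarrow> b < 2*n \<Longrightarrow> a \<noteq> b \<Longrightarrow> sp_unit n a b $$ (a, b) \<noteq> 0"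
proof -
  assume ab: "a < 2*n" "b < 2*n"
  have m: "sg n a * sg n (bar n a) = - 1" using sg_bar[OF ab(1)] sg_sq[of n a] by simp
  show "sp_unit n a b $$ (a, b) \<noteq> 0"
  proof (cases "a = bar n b \<and> b = bar n a")
    case True
    have "sg n a * sg n b = - 1" using m by (subst conjunct2[OF True])
    then show ?thesis unfolding sp_unit_index[OF ab] if_P[OF True] by simp
  next
    case False
    then show ?thesis unfolding sp_unit_index[OF ab] if_not_P[OF False] by simp
  qed
qed

lemma cartan_levi: "n \<ge> 1 \<Longrightarrow> cartan n \<subseteq> levi n"
proof -
  assume n: "n \<ge> 1"
  have "cartan n \<union> root_vectors n 0 \<subseteq> carrier_mat (2*n) (2*n)"
    using root_vectors_dim[OF n] cartan_graded sp_graded_dim by blast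
  from mat_span_ge[OF this] show ?thesis unfolding levi_def by blast
qed

lemma root_vectors_span:
  assumes n: "n \<ge> 1"
  shows "root_vectors n 0 \<subseteq> levi n" "root_vectors n 1 \<subseteq> r_plus n" "root_vectors n (- 1) \<subseteq> r_minus n"
proof -
  have "cartan n \<union> root_vectors n 0 \<subseteq> carrier_mat (2*n) (2*n)"
    using root_vectors_dim[OF n] cartan_graded sp_graded_dim by blast
  from mat_span_ge[OF this] show "root_vectors n 0 \<subseteq> levi n" unfolding levi_def by blast
  show "root_vectors n 1 \<subseteq> r_plus n" unfolding r_plus_def by (rule mat_span_ge[OF root_vectors_dim[OF n]])
  show "root_vectors n (- 1) \<subseteq> r_minus n" unfolding r_minus_def by (rule mat_span_ge[OF root_vectors_dim[OF n]])
qed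

lemma sp_unit_levi: "n \<ge> 1 \<Longrightarrow> i < n \<Longrightarrow> j < n \<Longrightarrow> sp_unit n i j \<in> levi n"
proof (cases "i = j")
  case True
  assume "n \<ge> 1" "i < n"
  then show ?thesis using sp_unit_diag[of i n] cartan_levi[of n] True by auto
next
  case False
  assume a: "n \<ge> 1" "i < n" "j < n"
  then have ij: "i < 2*n" "j < 2*n" by auto
  have "sp_unit n i j \<in> root_vectors n (grade n i j)"
    by (rule sp_unit_root[OF a(1) ij False sp_unit_entry[OF ij False]])
  then show ?thesis using a root_vectors_span(1)[OF a(1)] by (auto simp: grade_def)
qed

lemma sp_unit_r_plus: "n \<ge> 1 \<Longrightarrow> i < n \<Longrightarrow> j < n \<Longrightarrow> sp_unit n i (j + n) \<in> r_plus n"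
proof -
  assume a: "n \<ge> 1" "i < n" "j < n"
  then have ij: "i < 2*n" "j + n < 2*n" "i \<noteq> j + n" by auto
  have "sp_unit n i (j + n) \<in> root_vectors n (grade n i (j + n))"
    by (rule sp_unit_root[OF a(1) ij sp_unit_entry[OF ij]])
  then show ?thesis using a root_vectors_span(2)[OF a(1)] by (auto simp: grade_def)
qed

lemma sp_unit_r_minus: "n \<ge> 1 \<Longrightarrow> i < n \<Longrightarrow> j < n \<Longrightarrow> sp_unit n (i + n) j \<in> r_minus n"
proof -
  assume a: "n \<ge> 1" "i < n" "j < n"
  then have ij: "i + n < 2*n" "j < 2*n" "i + n \<noteq> j" by auto
  have "sp_unit n (i + n) j \<in> root_vectors n (grade n (i + n) j)"
    by (rule sp_unit_root[OF a(1) ij sp_unit_entry[OF ij]])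
  then show ?thesis using a root_vectors_span(3)[OF a(1)] by (auto simp: grade_def)
qed

lemma lie_half_grading:
  assumes x: "x \<in> sp_graded n k"
  shows "lie (cdiag n (\<lambda>_. 1 / 2)) x = of_int k \<cdot>\<^sub>m x"
proof (rule eq_matI)
  note xd = sp_graded_dim[OF x]
  have d: "diagonal_mat (cdiag n (\<lambda>_. 1 / 2))" using cartan_diag[OF cdiag_cartan] by blast
  show "dim_row (lie (cdiag n (\<lambda>_. 1 / 2)) x) = dim_row (of_int k \<cdot>\<^sub>m x)"
    "dim_col (lie (cdiag n (\<lambda>_. 1 / 2)) x) = dim_col (of_int k \<cdot>\<^sub>m x)"
    using lie_dim[OF cdiag_dim xd] xd by auto
  fix i j assume "i < dim_row (of_int k \<cdot>\<^sub>m x)" "j < dim_col (of_int k \<cdot>\<^sub>m x)"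
  then have ij: "i < 2*n" "j < 2*n" using xd by auto
  have "lie (cdiag n (\<lambda>_. 1 / 2)) x $$ (i, j) = of_int (grade n i j) * x $$ (i, j)"
    unfolding lie_diag[OF cdiag_dim d xd ij] using ij by (simp add: cdiag_index grade_def)
  also have "\<dots> = of_int k * x $$ (i, j)" using x ij by (auto simp: sp_graded_def)
  finally show "lie (cdiag n (\<lambda>_. 1 / 2)) x $$ (i, j) = (of_int k \<cdot>\<^sub>m x) $$ (i, j)" using ij xd by simp
qed

text \<open>Existence is \<open>lie_half_grading\<close>. For uniqueness, commuting with one
  suitable diagonal matrix makes z diagonal, and the bracket with 2 E_(i,i+n) fixes its entries,
  since z_(i+n) = - z_i.\<close>

lemma z_elt_eq:
  assumes n: "n \<ge> 1" shows "z_elt n = cdiag n (\<lambda>_. 1 / 2)"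
  unfolding z_elt_def
proof (rule the_equality)
  let ?z = "cdiag n (\<lambda>_. 1 / 2)"
  show "?z \<in> levi n \<and> (\<forall>x\<in>levi n. lie ?z x = 0\<^sub>m (2*n) (2*n)) \<and>
     (\<forall>x\<in>r_plus n. lie ?z x = x) \<and> (\<forall>y\<in>r_minus n. lie ?z y = - y)"
  proof (intro conjI ballI)
    show "?z \<in> levi n" using cartan_levi[OF n] cdiag_cartan by blast
    fix x
    show "lie ?z x = 0\<^sub>m (2*n) (2*n)" if "x \<in> levi n"
    proof -
      have x: "x \<in> sp_graded n 0" using levi_graded[OF n] that by blast
      show ?thesis unfolding lie_half_grading[OF x] using sp_graded_dim[OF x] by auto
    qed
    show "lie ?z x = x" if "x \<in> r_plus n"
    proof -
      have x: "x \<in> sp_graded n 1" using r_plus_graded[OF n] that by blast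
      show ?thesis unfolding lie_half_grading[OF x] using sp_graded_dim[OF x] by auto
    qed
    show "lie ?z x = - x" if "x \<in> r_minus n"
    proof -
      have x: "x \<in> sp_graded n (- 1)" using r_minus_graded[OF n] that by blast
      show ?thesis unfolding lie_half_grading[OF x] using sp_graded_dim[OF x] by auto
    qed
  qed
  fix z assume z: "z \<in> levi n \<and> (\<forall>x\<in>levi n. lie z x = 0\<^sub>m (2*n) (2*n)) \<and>
     (\<forall>x\<in>r_plus n. lie z x = x) \<and> (\<forall>y\<in>r_minus n. lie z y = - y)"
  have zg: "z \<in> sp_graded n 0" using levi_graded[OF n] z by blast
  note zd = sp_graded_dim[OF zg]
  \<comment> \<open>The diagonal entries of H are distinct within each of the two blocks; entries of
    z between the blocks vanish already because z has grade 0.\<close>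
  define H where "H = cdiag n (\<lambda>i. of_nat (i + 1))"
  have Hc: "H \<in> cartan n" unfolding H_def by (rule cdiag_cartan)
  have Hd: "H \<in> carrier_mat (2*n) (2*n)" "diagonal_mat H" using cartan_diag[OF Hc] sp_dim by auto
  have zH: "lie z H = 0\<^sub>m (2*n) (2*n)" using z Hc cartan_levi[OF n] by blast
  have diag: "z $$ (i, j) = 0" if ij: "i < 2*n" "j < 2*n" "i \<noteq> j" for i j
  proof (rule ccontr)
    assume nz: "z $$ (i, j) \<noteq> 0"
    then have g: "grade n i j = 0" using zg ij by (simp add: sp_graded_def)
    have "lie H z $$ (i, j) = - (lie z H $$ (i, j))"
      unfolding lie_index[OF Hd(1) zd ij(1,2)] lie_index[OF zd Hd(1) ij(1,2)] by simp
    then have "(H $$ (i, i) - H $$ (j, j)) * z $$ (i, j) = 0"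
      using lie_diag[OF Hd zd ij(1,2)] zH ij by simp
    then have e: "H $$ (i, i) = H $$ (j, j)" using nz by simp
    have "of_nat (i + 1) \<noteq> (of_nat (j + 1) :: complex)" "of_nat (i - n + 1) \<noteq> (of_nat (j - n + 1) :: complex)" if "\<not> i < n" "\<not> j < n"
      using ij that unfolding of_nat_eq_iff by auto
    moreover have "of_nat (i + 1) \<noteq> (of_nat (j + 1) :: complex)" using ij unfolding of_nat_eq_iff by auto
    ultimately show False using e g ij by (auto simp: H_def cdiag_index grade_def split: if_splits)
  qed
  then have zdiag: "diagonal_mat z" using zd by (auto simp: diagonal_mat_def)
  have zs: "z \<in> sp n" using zg by (simp add: sp_graded_def)
  have val: "z $$ (i, i) = 1 / 2" if i: "i < n" for i
  proof -
    let ?x = "sp_unit n i (i + n)"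
    have x: "?x \<in> r_plus n" by (rule sp_unit_r_plus[OF n i i])
    have ii: "i < 2*n" "i + n < 2*n" "i \<noteq> i + n" using i by auto
    have xd: "?x \<in> carrier_mat (2*n) (2*n)" by (simp add: sp_unit_def)
    have "lie z ?x = ?x" using z x by blast
    then have "(z $$ (i, i) - z $$ (i + n, i + n)) * ?x $$ (i, i + n) = ?x $$ (i, i + n)"
      using lie_diag[OF zd zdiag xd ii(1,2)] by simp
    then have "z $$ (i, i) - z $$ (i + n, i + n) = 1" using sp_unit_entry[OF ii] by simp
    then have "z $$ (i, i) + z $$ (i, i) = 1" using sp_bar_diag[OF zs i] by simp
    then show ?thesis by (simp add: field_simps)
  qed
  show "z = ?z"
  proof (rule eq_matI)
    show "dim_row z = dim_row ?z" "dim_col z = dim_col ?z" using zd cdiag_dim[of n "\<lambda>_. 1 / 2"] by auto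
    fix i j assume "i < dim_row ?z" "j < dim_col ?z"
    then have ij: "i < 2*n" "j < 2*n" using cdiag_dim[of n "\<lambda>_. 1 / 2"] by auto
    show "z $$ (i, j) = ?z $$ (i, j)"
    proof (cases "i = j")
      case True
      show ?thesis
      proof (cases "i < n")
        case i: True
        then show ?thesis using val[OF i] ij True by (simp add: cdiag_index)
      next
        case False
        then have "z $$ (i, i) = - z $$ (i - n, i - n)" using sp_bar_diag[OF zs, of "i - n"] ij by auto
        then show ?thesis using val[of "i - n"] ij True False by (simp add: cdiag_index)
      qed
    next
      case False
      then show ?thesis using diag[OF ij] ij by (simp add: cdiag_index)
    qed
  qed
qed

text \<open>The two entries of \<open>sp_unit n a b\<close> contribute the two orderings of one
  product, whence the symmetrised form.\<close>

lemma osc_rep_sp_unit: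
  assumes ab: "a < 2*n" "b < 2*n"
  shows "osc_rep n (sp_unit n a b) w x = half_sg n b * (osc n a (osc n (bar n b) w) x + osc n (bar n b) (osc n a w) x)"
proof -
  let ?o = "\<lambda>I K. osc n I (osc n (bar n K) w) x"
  have pick: "(\<Sum>I<2*n. \<Sum>K<2*n. if I = p \<and> K = q then f I K else 0) = (f p q :: complex)" if "p < 2*n" "q < 2*n" for p q f
  proof -
    have "(\<Sum>I<2*n. \<Sum>K<2*n. if I = p \<and> K = q then f I K else 0) = (\<Sum>I<2*n. if I = p then f I q else 0)"
      by (rule sum.cong) (use that in \<open>auto simp: sum.delta\<close>)
    then show ?thesis using that by (simp add: sum.delta)
  qed
  have "osc_rep n (sp_unit n a b) w x = (\<Sum>I<2*n. \<Sum>K<2*n. (if I = a \<and> K = b then half_sg n K * ?o I K else 0) -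
      (if I = bar n b \<and> K = bar n a then half_sg n K * (sg n a * sg n b) * ?o I K else 0))"
    unfolding osc_rep_def
  proof (intro sum.cong refl)
    have e: "h * ((if P then 1 else 0) - (if Q then s else 0)) * t = (if P then h * t else 0) - (if Q then h * s * t else 0)"
      for h s t :: complex and P Q by (simp add: algebra_simps)
    fix I K assume "I \<in> {..<2*n}" "K \<in> {..<2*n}"
    then have IK: "I < 2*n" "K < 2*n" by simp_all
    show "half_sg n K * sp_unit n a b $$ (I, K) * ?o I K = (if I = a \<and> K = b then half_sg n K * ?o I K else 0) -
      (if I = bar n b \<and> K = bar n a then half_sg n K * (sg n a * sg n b) * ?o I K else 0)"
      unfolding sp_unit_index[OF IK] by (rule e)
  qed
  also have "\<dots> = half_sg n b * ?o a b - half_sg n (bar n a) * (sg n a * sg n b) * ?o (bar n b) (bar n a)"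
    unfolding sum_subtractf pick[OF ab] pick[OF bar_lt[OF ab(2)] bar_lt[OF ab(1)]] ..
  also have "half_sg n (bar n a) * (sg n a * sg n b) = - half_sg n b"
    using sg_bar[OF ab(1)] sg_sq[of n a] by (simp add: half_sg_def mult.assoc[symmetric])
  finally show ?thesis using bar_bar[OF ab(1)] by (simp add: distrib_left)
qed

lemma osc_mult_der:
  assumes i: "i < n" shows "osc n (i + n) (osc n i w) x = x (i + 1) * w x"
proof -
  have "osc_shift n (i + 1) (- 1) x (i + 1) = x (i + 1) - 1" using i by (subst osc_shift_at) auto
  then show ?thesis using i osc_shift_inverse[of n "i + 1" 1 x] by (simp add: osc_def)
qed

lemma osc_der_mult:
  assumes i: "i < n" shows "osc n i (osc n (i + n) w) x = (x (i + 1) + 1) * w x"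
  using i osc_shift_inverse[of n "i + 1" "- 1" x] by (simp add: osc_def)

text \<open>For each i the symmetrised product of b_i and a_i acts by x_i + 1/2. These halves are
  the origin of the summand n/4 in \<open>zk_elt\<close>.\<close>

lemma osc_rep_z:
  assumes n: "n \<ge> 1"
  shows "osc_rep n (z_elt n) w x = - (1 / 2) * (\<Sum>i = 1..n. x i + 1 / 2) * w x"
proof -
  have "osc_rep n (z_elt n) w x = (\<Sum>I<2*n. \<Sum>K<2*n. if K = I then half_sg n I * cdiag n (\<lambda>_. 1 / 2) $$ (I, I) * osc n I (osc n (bar n I) w) x else 0)"
    unfolding osc_rep_def z_elt_eq[OF n] by (intro sum.cong refl) (auto simp: cdiag_index)
  also have "\<dots> = (\<Sum>I<2*n. - (1 / 4) * osc n I (osc n (bar n I) w) x)"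
    by (intro sum.cong refl) (auto simp: sum.delta cdiag_index half_sg_def sg_def)
  also have "\<dots> = (\<Sum>I<n. - (1 / 4) * osc n I (osc n (bar n I) w) x) + (\<Sum>I<n. - (1 / 4) * osc n (I + n) (osc n (bar n (I + n)) w) x)"
  proof -
    have "(\<Sum>I<n + m. f I) = (\<Sum>I<n. f I) + (\<Sum>I<m. f (I + n))" for f :: "nat \<Rightarrow> complex" and m
      by (induction m) (simp_all add: add.assoc add.commute[of n])
    then show ?thesis by (simp only: mult_2)
  qed
  also have "\<dots> = (\<Sum>I<n. - (1 / 2) * (x (I + 1) + 1 / 2) * w x)"
  proof -
    have t: "- (1 / 4) * osc n I (osc n (bar n I) w) x + - (1 / 4) * osc n (I + n) (osc n (bar n (I + n)) w) x =
        - (1 / 2) * (x (I + 1) + 1 / 2) * w x" if I: "I < n" for I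
    proof -
      have b: "bar n I = I + n" "bar n (I + n) = I" using I by (simp_all add: bar_def)
      show ?thesis unfolding b osc_mult_der[OF I] osc_der_mult[OF I] by (simp add: field_simps)
    qed
    show ?thesis
      by (rule trans[OF sum.distrib[symmetric] sum.cong[OF refl]]) (rule t, simp only: lessThan_iff)
  qed
  also have "\<dots> = - (1 / 2) * (\<Sum>i = 1..n. x i + 1 / 2) * w x"
  proof -
    have "(\<Sum>i = 1..n. x i + 1 / 2) = (\<Sum>I<n. x (I + 1) + 1 / 2)"
      by (rule sum.reindex_bij_witness[of _ "\<lambda>I. I + 1" "\<lambda>i. i - 1"]) auto
    then show ?thesis by (simp only: sum_distrib_left sum_distrib_right)
  qed
  finally show ?thesis .
qed

section \<open>Laurent polynomials\<close>

definition torus_lin :: "nat \<Rightarrow> (nat \<Rightarrow> int) set \<Rightarrow> ((nat \<Rightarrow> int) \<Rightarrow> complex) \<Rightarrow> rat_fun" where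
  "torus_lin n A c = (\<Sum>\<mu>\<in>A. kconst (c \<mu>) * mon n \<mu>)"

text \<open>Laurent polynomials are kept inside the function field: they are the fractions g for
  which such a c exists, and c is then unique by \<open>is_coef_unique\<close>.\<close>

definition is_coef :: "nat \<Rightarrow> int \<Rightarrow> rat_fun \<Rightarrow> ((nat \<Rightarrow> int) \<Rightarrow> complex) \<Rightarrow> bool" where
  "is_coef n m g c \<longleftrightarrow> finite {\<mu>. c \<mu> \<noteq> 0} \<and> {\<mu>. c \<mu> \<noteq> 0} \<subseteq> lat n m \<and> g = torus_lin n {\<mu>. c \<mu> \<noteq> 0} c"

lemma torus_lin_superset:
  assumes "finite A" "{\<mu>. c \<mu> \<noteq> 0} \<subseteq> A" shows "torus_lin n {\<mu>. c \<mu> \<noteq> 0} c = torus_lin n A c"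
  unfolding torus_lin_def using assms by (intro sum.mono_neutral_left) auto

lemma is_coefI:
  assumes "finite A" "A \<subseteq> lat n m" "\<And>\<mu>. \<mu> \<notin> A \<Longrightarrow> c \<mu> = 0" "g = torus_lin n A c"
  shows "is_coef n m g c"
proof -
  have s: "{\<mu>. c \<mu> \<noteq> 0} \<subseteq> A" using assms(3) by blast
  show ?thesis unfolding is_coef_def assms(4) torus_lin_superset[OF assms(1) s]
    using finite_subset[OF s assms(1)] s assms(2) by blast
qed

lemma is_coef_superset:
  assumes "is_coef n m g c" "finite A" "{\<mu>. c \<mu> \<noteq> 0} \<subseteq> A" shows "g = torus_lin n A c"
  using assms torus_lin_superset[of A c n] by (simp add: is_coef_def)

lemma is_coef_add:
  assumes "is_coef n m g c" "is_coef n m h d" shows "is_coef n m (g + h) (\<lambda>\<mu>. c \<mu> + d \<mu>)"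
proof (rule is_coefI)
  let ?A = "{\<mu>. c \<mu> \<noteq> 0} \<union> {\<mu>. d \<mu> \<noteq> 0}"
  show f: "finite ?A" "?A \<subseteq> lat n m" using assms by (auto simp: is_coef_def)
  show "g + h = torus_lin n ?A (\<lambda>\<mu>. c \<mu> + d \<mu>)"
    unfolding is_coef_superset[OF assms(1) f(1) Un_upper1] is_coef_superset[OF assms(2) f(1) Un_upper2]
    by (simp add: torus_lin_def kconst_add distrib_right sum.distrib)
qed auto

lemma is_coef_scale:
  assumes "is_coef n m g c" shows "is_coef n m (kconst a * g) (\<lambda>\<mu>. a * c \<mu>)"
proof (rule is_coefI)
  let ?A = "{\<mu>. c \<mu> \<noteq> 0}"
  show f: "finite ?A" "?A \<subseteq> lat n m" using assms by (auto simp: is_coef_def)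
  show "kconst a * g = torus_lin n ?A (\<lambda>\<mu>. a * c \<mu>)"
    unfolding is_coef_superset[OF assms f(1) order_refl]
    by (simp add: torus_lin_def kconst_mult sum_distrib_left mult.assoc)
qed auto

lemma is_coef_diff:
  assumes "is_coef n m g c" "is_coef n m h d" shows "is_coef n m (g - h) (\<lambda>\<mu>. c \<mu> - d \<mu>)"
  using is_coef_add[OF assms(1) is_coef_scale[OF assms(2), of "- 1"]] by (simp add: kconst_uminus)

lemma is_coef_0: "is_coef n m 0 (\<lambda>_. 0)"
  by (simp add: is_coef_def torus_lin_def)

lemma is_coef_shift:
  assumes c: "is_coef n m g c" and k: "\<kappa> \<in> lat n d"
  shows "is_coef n (d + m) (mon n \<kappa> * g) (\<lambda>\<mu>. c (\<lambda>k. \<mu> k - \<kappa> k))"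
proof (rule is_coefI)
  let ?A = "{\<mu>. c \<mu> \<noteq> 0}" and ?s = "\<lambda>\<mu> k. \<kappa> k + \<mu> k"
  have f: "finite ?A" "?A \<subseteq> lat n m" using c by (auto simp: is_coef_def)
  show "finite (?s ` ?A)" using f by simp
  show "?s ` ?A \<subseteq> lat n (d + m)" using f lat_add[OF k] by blast
  show "c (\<lambda>k. \<mu> k - \<kappa> k) = 0" if "\<mu> \<notin> ?s ` ?A" for \<mu>
  proof (rule ccontr)
    assume "c (\<lambda>k. \<mu> k - \<kappa> k) \<noteq> 0"
    then have "(\<lambda>k. \<mu> k - \<kappa> k) \<in> ?A" by simp
    from imageI[OF this, of ?s] show False using that by simp
  qed
  have inj: "inj_on ?s ?A" by (auto simp: inj_on_def fun_eq_iff)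
  show "mon n \<kappa> * g = torus_lin n (?s ` ?A) (\<lambda>\<mu>. c (\<lambda>k. \<mu> k - \<kappa> k))"
    unfolding is_coef_superset[OF c f(1) order_refl] torus_lin_def sum.reindex[OF inj] o_def mon_add
    by (simp add: sum_distrib_left mult.left_commute)
qed

definition exp_pm :: "nat \<Rightarrow> (nat \<Rightarrow> int) \<Rightarrow> nat \<Rightarrow>\<^sub>0 nat" where
  "exp_pm n \<mu> = (\<Sum>i\<in>{1..n+1}. Poly_Mapping.single i (nat (\<mu> i)))"

lemma lookup_exp_pm: "Poly_Mapping.lookup (exp_pm n \<mu>) i = (if i \<in> {1..n+1} then nat (\<mu> i) else 0)"
  unfolding exp_pm_def lookup_sum lookup_single when_def by (subst sum.delta) simp_all

lemma varp_power: "varp i ^ k = Poly_Mapping.single (Poly_Mapping.single i k) 1"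
  by (induction k) (simp_all add: varp_def mult_single single_add[symmetric])

lemma prod_single: "(\<Prod>i\<in>A. Poly_Mapping.single (f i) 1) = Poly_Mapping.single (\<Sum>i\<in>A. f i :: nat \<Rightarrow>\<^sub>0 nat) (1 :: complex)"
  by (induction A rule: infinite_finite_induct) (simp_all add: mult_single)

lemma mon_nonneg:
  assumes "\<And>i. i \<in> {1..n+1} \<Longrightarrow> \<mu> i \<ge> 0"
  shows "mon n \<mu> = emb (Poly_Mapping.single (exp_pm n \<mu>) 1)"
proof -
  have "mon n \<mu> = (\<Prod>i\<in>{1..n+1}. emb (varp i ^ nat (\<mu> i)))"
    unfolding mon_def by (intro prod.cong refl) (use assms in \<open>simp add: kvar_def emb_power power_int_def\<close>)
  then show ?thesis unfolding emb_prod[symmetric] varp_power prod_single exp_pm_def .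
qed

lemma kconst_mon_nonneg:
  assumes "\<And>i. i \<in> {1..n+1} \<Longrightarrow> \<mu> i \<ge> 0"
  shows "kconst c * mon n \<mu> = emb (Poly_Mapping.single (exp_pm n \<mu>) c)"
  by (subst mon_nonneg[of n \<mu>, OF assms]) (simp_all add: kconst_def emb_mult[symmetric] mult_single)

lemma exp_pm_inj:
  assumes "\<mu> \<in> lat n m" "\<nu> \<in> lat n m'" "\<And>i. i \<in> {1..n+1} \<Longrightarrow> \<mu> i \<ge> 0" "\<And>i. i \<in> {1..n+1} \<Longrightarrow> \<nu> i \<ge> 0"
    and e: "exp_pm n \<mu> = exp_pm n \<nu>"
  shows "\<mu> = \<nu>"
proof
  fix i
  show "\<mu> i = \<nu> i"
  proof (cases "i \<in> {1..n+1}")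
    case True
    have "Poly_Mapping.lookup (exp_pm n \<mu>) i = Poly_Mapping.lookup (exp_pm n \<nu>) i" by (simp only: e)
    then show ?thesis using True assms(3,4)[OF True] unfolding lookup_exp_pm by simp
  next
    case False
    then show ?thesis using assms(1,2) by (simp add: lat_def)
  qed
qed

text \<open>Linear independence of Laurent monomials: multiplication by one monomial with large
  exponents clears all poles, and then the coefficients of a polynomial are compared.\<close>

lemma is_coef_zero_unique:
  assumes c: "is_coef n m 0 c" shows "c \<mu> = 0"
proof (rule ccontr)
  assume nz: "c \<mu> \<noteq> 0"
  let ?A = "{\<mu>. c \<mu> \<noteq> 0}"
  have fA: "finite ?A" "?A \<subseteq> lat n m" using c by (auto simp: is_coef_def)
  define B where "B = Max (insert 0 ((\<lambda>(\<mu>, i). - \<mu> i) ` (?A \<times> {1..n+1})))"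
  have fin: "finite (insert 0 ((\<lambda>(\<mu>, i). - \<mu> i) ` (?A \<times> {1..n+1})))" using fA by simp
  have B: "- \<nu> i \<le> B" if "c \<nu> \<noteq> 0" "i \<in> {1..n+1}" for \<nu> i
    unfolding B_def by (rule Max_ge[OF fin]) (use that in \<open>auto intro!: image_eqI[of _ _ "(\<nu>, i)"]\<close>)
  define \<kappa> where "\<kappa> = (\<lambda>i. if i \<in> {1..n+1} then B else 0)"
  have \<kappa>: "\<kappa> \<in> lat n (wt n \<kappa>)" by (simp add: lat_def \<kappa>_def)
  define d where "d = (\<lambda>\<mu>. c (\<lambda>k. \<mu> k - \<kappa> k))"
  have d: "is_coef n (wt n \<kappa> + m) 0 d" using is_coef_shift[OF c \<kappa>] by (simp add: d_def)
  let ?D = "{\<mu>. d \<mu> \<noteq> 0}"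
  have fD: "finite ?D" "?D \<subseteq> lat n (wt n \<kappa> + m)" using d by (auto simp: is_coef_def)
  have pos: "\<nu> i \<ge> 0" if "\<nu> \<in> ?D" "i \<in> {1..n+1}" for \<nu> i
    using B[of "\<lambda>k. \<nu> k - \<kappa> k" i] that by (simp add: d_def \<kappa>_def)
  have "0 = torus_lin n ?D d" by (rule is_coef_superset[OF d fD(1) order_refl])
  also have "\<dots> = emb (\<Sum>\<nu>\<in>?D. Poly_Mapping.single (exp_pm n \<nu>) (d \<nu>))"
    unfolding torus_lin_def emb_sum by (intro sum.cong refl kconst_mon_nonneg pos)
  finally have z: "(\<Sum>\<nu>\<in>?D. Poly_Mapping.single (exp_pm n \<nu>) (d \<nu>)) = 0" by simp
  define \<mu>' where "\<mu>' = (\<lambda>k. \<mu> k + \<kappa> k)"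
  have m': "\<mu>' \<in> ?D" using nz by (simp add: d_def \<mu>'_def)
  have "0 = Poly_Mapping.lookup (\<Sum>\<nu>\<in>?D. Poly_Mapping.single (exp_pm n \<nu>) (d \<nu>)) (exp_pm n \<mu>')"
    unfolding z by simp
  also have "\<dots> = (\<Sum>\<nu>\<in>?D. if \<nu> = \<mu>' then d \<mu>' else 0)"
    unfolding lookup_sum lookup_single when_def
  proof (intro sum.cong refl)
    fix \<nu> assume n: "\<nu> \<in> ?D"
    have "exp_pm n \<nu> = exp_pm n \<mu>' \<longleftrightarrow> \<nu> = \<mu>'"
    proof
      assume e: "exp_pm n \<nu> = exp_pm n \<mu>'"
      have "\<nu> \<in> lat n (wt n \<kappa> + m)" "\<mu>' \<in> lat n (wt n \<kappa> + m)" using fD(2) n m' by blast+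
      then show "\<nu> = \<mu>'" by (rule exp_pm_inj[OF _ _ pos[OF n] pos[OF m'] e])
    qed simp
    then show "(if exp_pm n \<nu> = exp_pm n \<mu>' then d \<nu> else 0) = (if \<nu> = \<mu>' then d \<mu>' else 0)" by simp
  qed
  also have "\<dots> = d \<mu>'" using fD(1) m' by (simp add: sum.delta)
  finally show False using m' by simp
qed

lemma is_coef_unique: "is_coef n m g c \<Longrightarrow> is_coef n m g d \<Longrightarrow> c = d"
  using is_coef_zero_unique[of n m "\<lambda>\<mu>. c \<mu> - d \<mu>"] is_coef_diff[of n m g c g d] by (simp add: fun_eq_iff)

lemma emb_is_coef:
  assumes a: "a \<in> G n e"
  shows "\<exists>c. is_coef n e (emb a) c \<and> (\<forall>\<mu>. c \<mu> \<noteq> 0 \<longrightarrow> (\<forall>i. \<mu> i \<ge> 0))"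
proof -
  define ex where "ex = (\<lambda>(\<alpha> :: nat \<Rightarrow>\<^sub>0 nat) i. int (Poly_Mapping.lookup \<alpha> i))"
  have inj: "inj ex"
    by (rule injI) (auto simp: ex_def fun_eq_iff intro: poly_mapping_eqI)
  have car: "Poly_Mapping.keys \<alpha> \<subseteq> {1..n+1}" if "\<alpha> \<in> Poly_Mapping.keys a" for \<alpha> using a that by (simp add: G_iff wcar_iff)
  have ex_pm: "exp_pm n (ex \<alpha>) = \<alpha>" if "\<alpha> \<in> Poly_Mapping.keys a" for \<alpha>
  proof (rule poly_mapping_eqI)
    fix i
    have "Poly_Mapping.lookup \<alpha> i = 0" if "i \<notin> {1..n+1}" using car[OF \<open>\<alpha> \<in> _\<close>] that by (auto simp: in_keys_iff)
    then show "Poly_Mapping.lookup (exp_pm n (ex \<alpha>)) i = Poly_Mapping.lookup \<alpha> i"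
      unfolding lookup_exp_pm by (auto simp: ex_def)
  qed
  have wt: "wt n (ex \<alpha>) = int (wdeg n \<alpha>)" for \<alpha>
  proof -
    have "{1..n+1} = insert (n+1) {1..n}" by auto
    then show ?thesis by (simp add: wt_def wdeg_def ex_def wvar_def)
  qed
  define c where "c = (\<lambda>\<mu>. if \<mu> \<in> range ex then Poly_Mapping.lookup a (the_inv ex \<mu>) else 0)"
  have cex: "c (ex \<alpha>) = Poly_Mapping.lookup a \<alpha>" for \<alpha> by (simp add: c_def the_inv_f_f[OF inj])
  have "is_coef n e (emb a) c"
  proof (rule is_coefI)
    let ?A = "ex ` Poly_Mapping.keys a"
    show "finite ?A" by simp
    show "?A \<subseteq> lat n e"
    proof
      fix \<mu> assume "\<mu> \<in> ?A"
      then obtain \<alpha> where \<alpha>: "\<alpha> \<in> Poly_Mapping.keys a" "\<mu> = ex \<alpha>" by blast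
      have "wt n (ex \<alpha>) = e" using a \<alpha>(1) by (simp add: wt G_iff)
      moreover have "ex \<alpha> i = 0" if "i \<notin> {1..n+1}" for i
      proof -
        have "i \<notin> Poly_Mapping.keys \<alpha>" using car[OF \<alpha>(1)] that by blast
        then show ?thesis by (simp add: ex_def in_keys_iff)
      qed
      ultimately show "\<mu> \<in> lat n e" by (simp add: lat_def \<alpha>(2))
    qed
    show "c \<mu> = 0" if "\<mu> \<notin> ?A" for \<mu>
    proof (cases "\<mu> \<in> range ex")
      case True
      then obtain \<alpha> where "\<mu> = ex \<alpha>" by blast
      then show ?thesis using that by (auto simp: cex in_keys_iff)
    qed (simp add: c_def)
    have "emb a = emb (\<Sum>\<alpha>\<in>Poly_Mapping.keys a. Poly_Mapping.single \<alpha> (Poly_Mapping.lookup a \<alpha>))"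
      using poly_mapping_sum_single[of a] by simp
    also have "\<dots> = (\<Sum>\<alpha>\<in>Poly_Mapping.keys a. kconst (c (ex \<alpha>)) * mon n (ex \<alpha>))"
      unfolding emb_sum
    proof (intro sum.cong refl)
      fix \<alpha> assume \<alpha>: "\<alpha> \<in> Poly_Mapping.keys a"
      have "kconst (c (ex \<alpha>)) * mon n (ex \<alpha>) = emb (Poly_Mapping.single (exp_pm n (ex \<alpha>)) (c (ex \<alpha>)))"
        by (rule kconst_mon_nonneg) (simp add: ex_def)
      then show "emb (Poly_Mapping.single \<alpha> (Poly_Mapping.lookup a \<alpha>)) = kconst (c (ex \<alpha>)) * mon n (ex \<alpha>)"
        by (simp add: ex_pm[OF \<alpha>] cex)
    qed
    also have "\<dots> = torus_lin n ?A c"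
      unfolding torus_lin_def by (subst sum.reindex[OF inj_on_subset[OF inj subset_UNIV]]) simp
    finally show "emb a = torus_lin n ?A c" .
  qed
  moreover have "\<mu> i \<ge> 0" if nz: "c \<mu> \<noteq> 0" for \<mu> i
  proof -
    obtain \<alpha> where "\<mu> = ex \<alpha>" using nz by (auto simp: c_def split: if_splits)
    then show ?thesis by (simp add: ex_def)
  qed
  ultimately show ?thesis by blast
qed

lemma linear_op_torus_lin:
  assumes F: "linear_op n m F" and A: "A \<subseteq> lat n m" and mem: "\<And>\<mu>. \<mu> \<in> lat n m \<Longrightarrow> mon n \<mu> \<in> homfrac n m"
  shows "F (torus_lin n A c) = (\<Sum>\<mu>\<in>A. kconst (c \<mu>) * F (mon n \<mu>)) \<and> torus_lin n A c \<in> homfrac n m"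
  using A
proof (induction A rule: infinite_finite_induct)
  case (insert \<mu> A)
  have s: "kconst a * g \<in> homfrac n m" if "g \<in> homfrac n m" for a g
    using homfrac_mult[OF homfrac_const[of a n] that] by simp
  have t: "torus_lin n (insert \<mu> A) c = kconst (c \<mu>) * mon n \<mu> + torus_lin n A c"
    using insert.hyps by (simp add: torus_lin_def)
  have "mon n \<mu> \<in> homfrac n m" using mem insert.prems by blast
  then show ?case
    unfolding t using F s insert homfrac_add by (simp add: linear_op_def)
next
  case empty
  have "F (kconst 0 * 0) = kconst 0 * F 0" using F homfrac_zero[of n m] unfolding linear_op_def by blast
  then have "F 0 = 0" by simp
  then show ?case by (simp add: torus_lin_def homfrac_zero)
next
  case (infinite A)
  have "F (kconst 0 * 0) = kconst 0 * F 0" using F homfrac_zero[of n m] unfolding linear_op_def by blast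
  then have "F 0 = 0" by simp
  then show ?case using infinite by (simp add: torus_lin_def homfrac_zero)
qed

text \<open>The positive and negative parts of the exponent give a numerator and a denominator that
  are monomials of S.\<close>

lemma mon_homfrac:
  assumes "\<mu> \<in> lat n m" shows "mon n \<mu> \<in> homfrac n m"
proof -
  define p where "p = (\<lambda>i. max 0 (\<mu> i))"
  define q where "q = (\<lambda>i. max 0 (- \<mu> i))"
  have z: "\<mu> i = 0" if "i \<notin> {1..n+1}" for i using assms that by (simp add: lat_def)
  have pq: "p = (\<lambda>i. \<mu> i + q i)" by (auto simp: p_def q_def fun_eq_iff)
  have G: "Poly_Mapping.single (exp_pm n r) 1 \<in> G n (wt n r)" if "\<And>i. i \<in> {1..n+1} \<Longrightarrow> r i \<ge> 0" for r
  proof -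
    have "wt n r = int (wdeg n (exp_pm n r))"
    proof -
      have "{1..n+1} = insert (n+1) {1..n}" by auto
      moreover have "(\<Sum>i\<in>{1..n}. wvar n i * r i) = (\<Sum>i\<in>{1..n}. int (Poly_Mapping.lookup (exp_pm n r) i))"
        by (intro sum.cong refl) (use that in \<open>auto simp: wvar_def lookup_exp_pm\<close>)
      ultimately show ?thesis using that[of "n+1"] by (simp add: wt_def wdeg_def wvar_def lookup_exp_pm)
    qed
    moreover have "Poly_Mapping.keys (exp_pm n r) \<subseteq> {1..n+1}" by (auto simp: in_keys_iff lookup_exp_pm split: if_splits)
    ultimately show ?thesis by (simp add: G_iff wcar_iff)
  qed
  have "wt n p = m + wt n q" using assms unfolding pq wt_add by (simp add: lat_def)
  then have Gp: "Poly_Mapping.single (exp_pm n p) 1 \<in> G n (wt n q + m)" using G[of p] by (simp add: p_def add.commute)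
  have Gq: "Poly_Mapping.single (exp_pm n q) 1 \<in> G n (wt n q)" by (rule G) (simp add: q_def)
  have nzq: "Poly_Mapping.single (exp_pm n q) (1::complex) \<notin> {0}" by (simp add: single_eq_0_iff)
  have "mon n p = mon n \<mu> * mon n q" unfolding pq by (rule mon_add)
  then have "mon n \<mu> = mon n p / mon n q" by (simp add: field_simps)
  also have "\<dots> = Fract (Poly_Mapping.single (exp_pm n p) 1) (Poly_Mapping.single (exp_pm n q) 1)"
    using mon_nonneg[of n p] mon_nonneg[of n q] by (simp add: p_def q_def Fract_eq_emb)
  finally show ?thesis unfolding homfrac_def using regI[OF Gp Gq nzq] by simp
qed

text \<open>Multiplying by a denominator turns every homogeneous fraction into a Laurent polynomial.\<close>

theorem dop_zero_of_torus:
  assumes n: "n \<ge> 1" and F: "linear_op n m F" "dop (homfrac n 0) (homfrac n m) k F"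
    and z: "\<And>\<mu>. \<mu> \<in> lat n m \<Longrightarrow> F (mon n \<mu>) = 0" and g: "g \<in> homfrac n m"
  shows "F g = 0"
  using F z g
proof (induction k arbitrary: F g)
  have laur_zero: "F h = 0" if "linear_op n m F" "\<And>\<mu>. \<mu> \<in> lat n m \<Longrightarrow> F (mon n \<mu>) = 0" "is_coef n m h c" for F h c
  proof -
    have "h = torus_lin n {\<mu>. c \<mu> \<noteq> 0} c" "{\<mu>. c \<mu> \<noteq> 0} \<subseteq> lat n m" using that(3) by (auto simp: is_coef_def)
    then have "F h = (\<Sum>\<mu>\<in>{\<mu>. c \<mu> \<noteq> 0}. kconst (c \<mu>) * F (mon n \<mu>))"
      using linear_op_torus_lin[OF that(1) _ mon_homfrac] by simp
    also have "\<dots> = 0" using \<open>_ \<subseteq> lat n m\<close> that(2) by (intro sum.neutral) auto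
    finally show ?thesis .
  qed
  have clear: "\<exists>f c. f \<in> homfrac n 0 \<and> f \<noteq> 0 \<and> is_coef n m (f * g) c \<and>
      (\<forall>\<mu>\<in>lat n m. \<exists>c. is_coef n m (f * mon n \<mu>) c)" if g: "g \<in> homfrac n m" for g
  proof -
    obtain a b d where ab: "a \<in> G n (d + m)" "b \<in> G n d" "b \<noteq> 0" "g = Fract a b" using g by (rule regular_basic_open)
    \<comment> \<open>The denominator b, of degree d, is brought to degree 0 by the power -d of Q_1,
      which has weight 1 because n \<ge> 1.\<close>
    define \<kappa> where "\<kappa> = (\<lambda>i. (- d) * unit_at 1 i)"
    have w1: "wvar n 1 = 1" using n by (simp add: wvar_def)
    have "unit_at 1 \<in> lat n 1" using lat_unit[of 1 n] w1 by simp
    from lat_scale[OF this, of "- d"] have \<kappa>: "\<kappa> \<in> lat n (- d)" by (simp add: \<kappa>_def)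
    define f where "f = mon n \<kappa> * emb b"
    have "emb b \<in> homfrac n d" unfolding homfrac_def by (rule reg_emb[OF zero_point ab(2)])
    from homfrac_mult[OF mon_homfrac[OF \<kappa>] this] have f0: "f \<in> homfrac n 0" by (simp add: f_def)
    have fnz: "f \<noteq> 0" using ab(3) by (simp add: f_def)
    have "f * g = mon n \<kappa> * emb a" using ab(3,4) by (simp add: f_def Fract_eq_emb)
    moreover obtain c where "is_coef n (d + m) (emb a) c" using emb_is_coef[OF ab(1)] by blast
    ultimately have 1: "\<exists>c. is_coef n m (f * g) c" using is_coef_shift[OF _ \<kappa>] by fastforce
    obtain c' where c': "is_coef n d (emb b) c'" using emb_is_coef[OF ab(2)] by blast
    have "\<exists>c. is_coef n m (f * mon n \<mu>) c" if "\<mu> \<in> lat n m" for \<mu>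
    proof -
      have e: "f * mon n \<mu> = mon n \<kappa> * (mon n \<mu> * emb b)" by (simp add: f_def mult_ac)
      have "is_coef n (- d + (m + d)) (mon n \<kappa> * (mon n \<mu> * emb b)) (\<lambda>\<nu>. (\<lambda>\<nu>. c' (\<lambda>k. \<nu> k - \<mu> k)) (\<lambda>k. \<nu> k - \<kappa> k))"
        by (rule is_coef_shift[OF is_coef_shift[OF c' that] \<kappa>])
      then show ?thesis unfolding e by auto
    qed
    then show ?thesis using f0 fnz 1 by blast
  qed
  {
    case 0
    obtain f c where f: "f \<in> homfrac n 0" "f \<noteq> 0" "is_coef n m (f * g) c" using clear[OF 0(4)] by blast
    have "f * F g = F (f * g)" using 0(2)[unfolded dop.simps] f(1) 0(4) by simp
    also have "\<dots> = 0" by (rule laur_zero[OF 0(1) 0(3) f(3)])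
    finally show ?case using f(2) by simp
  next
    case (Suc k)
    obtain f c where f: "f \<in> homfrac n 0" "f \<noteq> 0" "is_coef n m (f * g) c"
      and fm: "\<And>\<mu>. \<mu> \<in> lat n m \<Longrightarrow> \<exists>c. is_coef n m (f * mon n \<mu>) c" using clear[OF Suc.prems(4)] by blast
    \<comment> \<open>The commutator with f has smaller order and again kills all Laurent monomials,
      since f times a Laurent monomial is a Laurent polynomial.\<close>
    have "F (f * g) - f * F g = 0"
    proof (rule Suc.IH[where F = "\<lambda>g. F (f * g) - f * F g" and g = g])
      show "linear_op n m (\<lambda>g. F (f * g) - f * F g)" by (rule linear_op_commutator[OF Suc.prems(1) f(1)])
      show "dop (homfrac n 0) (homfrac n m) k (\<lambda>g. F (f * g) - f * F g)"
        by (rule bspec[OF Suc.prems(2)[unfolded dop.simps] f(1)])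
      show "g \<in> homfrac n m" by (rule Suc.prems(4))
      fix \<mu> assume m: "\<mu> \<in> lat n m"
      then obtain c where "is_coef n m (f * mon n \<mu>) c" using fm by blast
      from laur_zero[of F, OF Suc.prems(1) Suc.prems(3) this] show "F (f * mon n \<mu>) - f * F (mon n \<mu>) = 0"
        using Suc.prems(3)[OF m] by simp
    qed
    moreover have "F (f * g) = 0" by (rule laur_zero[of F, OF Suc.prems(1) Suc.prems(3) f(3)])
    ultimately show ?case using f(2) by simp
  }
qed

section \<open>Operators on Laurent monomials\<close>

text \<open>A pair (\<nu>, p) stands for Q^\<mu> -> p(\<mu>) Q^(\<mu> + \<nu>). The same \<nu> may
  occur several times in a list; \<open>op_coef\<close> adds up its coefficients.\<close>

type_synonym shift_ops = "((nat \<Rightarrow> int) \<times> ((nat \<Rightarrow> complex) \<Rightarrow> complex)) list"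

definition good_ops :: "nat \<Rightarrow> shift_ops \<Rightarrow> bool" where
  "good_ops n ops \<longleftrightarrow> (\<forall>(\<nu>, p)\<in>set ops. \<nu> \<in> lat n 0 \<and> p \<in> polyfun n)"

definition act_mon :: "nat \<Rightarrow> shift_ops \<Rightarrow> (nat \<Rightarrow> int) \<Rightarrow> rat_fun" where
  "act_mon n ops \<mu> = (\<Sum>(\<nu>, p)\<leftarrow>ops. kconst (p (cvec \<mu>)) * mon n (\<lambda>k. \<mu> k + \<nu> k))"

text \<open>The same operators seen on the coefficients of a formal series with complex exponents:
  the coefficient at x collects what is shifted there from x - \<nu>.\<close>

definition act_ser :: "shift_ops \<Rightarrow> ((nat \<Rightarrow> complex) \<Rightarrow> complex) \<Rightarrow> (nat \<Rightarrow> complex) \<Rightarrow> complex" where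
  "act_ser ops v x = (\<Sum>(\<nu>, p)\<leftarrow>ops. p (\<lambda>k. x k - cvec \<nu> k) * v (\<lambda>k. x k - cvec \<nu> k))"

definition hyper :: "nat \<Rightarrow> int \<Rightarrow> (nat \<Rightarrow> complex) set" where
  "hyper n l = {x. (\<Sum>i\<in>{1..n+1}. of_int (wvar n i) * x i) = of_int l}"

text \<open>The function \<open>1 / c!\<close> of \<open>c \<in> \<nat>\<close>, extended by zero so that \<open>\<gamma>(c) = (c + 1) \<gamma>(c + 1)\<close> everywhere;
  multiplication by it makes the derivative in the last variable a pure shift.\<close>

definition gam :: "complex \<Rightarrow> complex" where
  "gam c = (if c \<in> \<nat> then 1 / fact (nat \<lfloor>Re c\<rfloor>) else 0)"

text \<open>Linearity and finite order are asked on the whole function field and not only in degree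
  l, so that \<open>dop_comp\<close> applies directly to composites.\<close>

definition good_op :: "nat \<Rightarrow> int \<Rightarrow> (rat_fun \<Rightarrow> rat_fun) \<Rightarrow> bool" where
  "good_op n l T \<longleftrightarrow> (\<forall>g h. T (g + h) = T g + T h) \<and> (\<forall>c g. T (kconst c * g) = kconst c * T g) \<and>
     (\<exists>k. dop UNIV UNIV k T) \<and> preserving n l (pts n) T"

text \<open>The same shift operators describe \<open>T\<close> on monomials and, conjugated by \<open>\<gamma>\<close>, the operator \<open>R\<close> on coefficients of
  series.\<close>

definition compat :: "nat \<Rightarrow> int \<Rightarrow> (((nat \<Rightarrow> complex) \<Rightarrow> complex) \<Rightarrow> (nat \<Rightarrow> complex) \<Rightarrow> complex) \<Rightarrow> (rat_fun \<Rightarrow> rat_fun) \<Rightarrow> bool" where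
  "compat n l R T \<longleftrightarrow> good_op n l T \<and> (\<exists>ops. good_ops n ops \<and> (\<forall>\<mu>\<in>lat n l. T (mon n \<mu>) = act_mon n ops \<mu>) \<and>
     (\<forall>w. \<forall>x\<in>hyper n l. act_ser ops (\<lambda>x. gam (x (n + 1)) * w x) x = gam (x (n + 1)) * R w x))"

lemma gam_of_nat: "gam (of_nat k) = 1 / fact k"
  by (simp add: gam_def)

text \<open>This is the recursion of the factorial where c is a natural number. At c = -1 the factor
  c + 1 vanishes, and elsewhere both values of \<gamma> are 0.\<close>

lemma gam_Suc: "gam c = (c + 1) * gam (c + 1)"
proof (cases "c \<in> \<nat>")
  case True
  then obtain k where k: "c = of_nat k" by (auto simp: Nats_def)
  have "gam (c + 1) = 1 / fact (Suc k)" using gam_of_nat[of "Suc k"] by (simp add: k add.commute)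
  then show ?thesis using of_nat_neq_0[where 'a = complex, of k] by (simp add: k gam_of_nat add.commute)
next
  case False
  show ?thesis
  proof (cases "c + 1 \<in> \<nat>")
    case True
    then obtain k where k: "c + 1 = of_nat k" by (auto simp: Nats_def)
    show ?thesis
    proof (cases k)
      case 0
      then show ?thesis using k False by (simp add: gam_def)
    next
      case (Suc j)
      then have "c = of_nat j" using k by simp
      then show ?thesis using False by simp
    qed
  next
    case f: False
    then show ?thesis using False by (simp add: gam_def)
  qed
qed

lemma hyper_cvec: "\<mu> \<in> lat n l \<Longrightarrow> cvec \<mu> \<in> hyper n l"
proof -
  assume "\<mu> \<in> lat n l"
  then have "(\<Sum>i\<in>{1..n+1}. wvar n i * \<mu> i) = l" by (simp add: lat_def wt_def)
  from arg_cong[OF this, of "of_int :: int \<Rightarrow> complex"] show ?thesis by (simp only: hyper_def cvec_def mem_Collect_eq of_int_sum of_int_mult)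
qed

lemma hyper_shift: "x \<in> hyper n l \<Longrightarrow> \<nu> \<in> lat n 0 \<Longrightarrow> (\<lambda>k. x k - cvec \<nu> k) \<in> hyper n l"
  using hyper_cvec[of \<nu> n 0] by (simp only: hyper_def mem_Collect_eq right_diff_distrib sum_subtractf) simp

lemma hyper_shift_add: "x \<in> hyper n l \<Longrightarrow> \<nu> \<in> lat n 0 \<Longrightarrow> (\<lambda>k. x k + cvec \<nu> k) \<in> hyper n l"
  using hyper_cvec[of \<nu> n 0] by (simp only: hyper_def mem_Collect_eq distrib_left sum.distrib) simp

lemma good_op_diff: "good_op n l T \<Longrightarrow> T (g - h) = T g - T h"
proof -
  assume T: "good_op n l T"
  then have add: "T (a + b) = T a + T b" for a b by (simp add: good_op_def)
  have "T (g - h) + T h = T g" unfolding add[symmetric] by simp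
  then show ?thesis by (simp add: eq_diff_eq)
qed

lemma good_op_linear: "good_op n l T \<Longrightarrow> linear_op n l T"
  by (simp add: good_op_def linear_op_def)

lemma good_op_id: "good_op n l (\<lambda>g. g)"
  unfolding good_op_def preserving_def by (intro conjI exI[of _ 0]) (simp_all add: dop.simps)

lemma preserving_add: "preserving n l (pts n) S \<Longrightarrow> preserving n l (pts n) T \<Longrightarrow> preserving n l (pts n) (\<lambda>g. S g + T g)"
  by (simp add: preserving_def reg_add)

lemma preserving_scale: "preserving n l (pts n) T \<Longrightarrow> preserving n l (pts n) (\<lambda>g. kconst c * T g)"
  unfolding preserving_def using reg_mult[OF _ reg_const, of _ n _ l] by fastforce

lemma good_op_add:
  assumes S: "good_op n l S" and T: "good_op n l T" shows "good_op n l (\<lambda>g. S g + T g)"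
proof -
  obtain j k where j: "dop UNIV UNIV j S" and k: "dop UNIV UNIV k T" using S T by (auto simp: good_op_def)
  have "dop UNIV UNIV (max j k) (\<lambda>g. S g + T g)"
    by (rule dop_add[OF dop_mono[OF j max.cobounded1] dop_mono[OF k max.cobounded2]])
  then show ?thesis using S T preserving_add[of n l S T] unfolding good_op_def by (auto simp: algebra_simps)
qed

lemma good_op_scale:
  assumes T: "good_op n l T" shows "good_op n l (\<lambda>g. kconst c * T g)"
proof -
  obtain k where k: "dop UNIV UNIV k T" using T by (auto simp: good_op_def)
  have "dop UNIV UNIV k (\<lambda>g. kconst c * T g)" by (rule dop_scale[OF k])
  then show ?thesis using T preserving_scale[of n l T c] unfolding good_op_def by (auto simp: algebra_simps)
qed

lemma good_op_comp:
  assumes S: "good_op n l S" and T: "good_op n l T" shows "good_op n l (\<lambda>g. S (T g))"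
proof -
  obtain j k where j: "dop UNIV UNIV j S" and k: "dop UNIV UNIV k T" using S T by (auto simp: good_op_def)
  have "dop UNIV UNIV (j + k) (\<lambda>g. S (T g))"
    by (rule dop_comp[OF j k good_op_diff[OF S] good_op_diff[OF T]])
  then show ?thesis using S T unfolding good_op_def preserving_def by auto
qed

lemma act_mon_simps: "act_mon n [] \<mu> = 0" "act_mon n ((\<nu>, p) # ops) \<mu> = kconst (p (cvec \<mu>)) * mon n (\<lambda>k. \<mu> k + \<nu> k) + act_mon n ops \<mu>"
  by (simp_all add: act_mon_def)

lemma act_ser_simps: "act_ser [] v x = 0" "act_ser ((\<nu>, p) # ops) v x = p (\<lambda>k. x k - cvec \<nu> k) * v (\<lambda>k. x k - cvec \<nu> k) + act_ser ops v x"
  by (simp_all add: act_ser_def)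

lemma act_append: "act_mon n (ops @ ops') \<mu> = act_mon n ops \<mu> + act_mon n ops' \<mu>"
  "act_ser (ops @ ops') v x = act_ser ops v x + act_ser ops' v x"
  by (simp_all add: act_mon_def act_ser_def)

lemma compat_id: "compat n l (\<lambda>w. w) (\<lambda>g. g)"
  unfolding compat_def
proof (intro conjI exI ballI allI)
  show "good_ops n [(\<lambda>_. 0, \<lambda>_. 1)]"
    by (simp add: good_ops_def polyfun.const lat_def wt_def)
qed (simp_all add: good_op_id act_mon_simps act_ser_simps cvec_def)

lemma compat_add:
  assumes "compat n l R S" "compat n l R' T" shows "compat n l (\<lambda>w x. R w x + R' w x) (\<lambda>g. S g + T g)"
proof -
  obtain ops where o: "good_ops n ops" "\<And>\<mu>. \<mu> \<in> lat n l \<Longrightarrow> S (mon n \<mu>) = act_mon n ops \<mu>"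
    "\<And>w x. x \<in> hyper n l \<Longrightarrow> act_ser ops (\<lambda>x. gam (x (n + 1)) * w x) x = gam (x (n + 1)) * R w x"
    using assms(1) unfolding compat_def by blast
  obtain ops' where o': "good_ops n ops'" "\<And>\<mu>. \<mu> \<in> lat n l \<Longrightarrow> T (mon n \<mu>) = act_mon n ops' \<mu>"
    "\<And>w x. x \<in> hyper n l \<Longrightarrow> act_ser ops' (\<lambda>x. gam (x (n + 1)) * w x) x = gam (x (n + 1)) * R' w x"
    using assms(2) unfolding compat_def by blast
  have g: "good_op n l (\<lambda>g. S g + T g)" using assms good_op_add by (simp add: compat_def)
  show ?thesis unfolding compat_def
  proof (intro conjI exI ballI allI g)
    show "good_ops n (ops @ ops')" using o(1) o'(1) by (auto simp: good_ops_def)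
    show "S (mon n \<mu>) + T (mon n \<mu>) = act_mon n (ops @ ops') \<mu>" if "\<mu> \<in> lat n l" for \<mu>
      by (simp only: act_append o(2)[OF that] o'(2)[OF that])
    show "act_ser (ops @ ops') (\<lambda>x. gam (x (n + 1)) * w x) x = gam (x (n + 1)) * (R w x + R' w x)"
      if "x \<in> hyper n l" for w x
      by (simp only: act_append o(3)[OF that] o'(3)[OF that] distrib_left)
  qed
qed

lemma compat_scale:
  assumes "compat n l R T" shows "compat n l (\<lambda>w x. c * R w x) (\<lambda>g. kconst c * T g)"
proof -
  obtain ops where o: "good_ops n ops" "\<And>\<mu>. \<mu> \<in> lat n l \<Longrightarrow> T (mon n \<mu>) = act_mon n ops \<mu>"
    "\<And>w x. x \<in> hyper n l \<Longrightarrow> act_ser ops (\<lambda>x. gam (x (n + 1)) * w x) x = gam (x (n + 1)) * R w x"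
    using assms(1) unfolding compat_def by blast
  let ?o = "map (\<lambda>(\<nu>, p). (\<nu>, \<lambda>x. c * p x)) ops"
  have m: "act_mon n ?o \<mu> = kconst c * act_mon n ops \<mu>" for \<mu>
    by (induction ops) (auto simp: act_mon_simps kconst_mult distrib_left mult.assoc)
  have s: "act_ser ?o v x = c * act_ser ops v x" for v x
    by (induction ops) (auto simp: act_ser_simps distrib_left mult.assoc)
  have g: "good_op n l (\<lambda>g. kconst c * T g)" using assms good_op_scale by (simp add: compat_def)
  show ?thesis unfolding compat_def
  proof (intro conjI exI ballI allI g)
    show "good_ops n ?o" using o(1) by (auto simp: good_ops_def intro: polyfun.mult polyfun.const)
    show "kconst c * T (mon n \<mu>) = act_mon n ?o \<mu>" if "\<mu> \<in> lat n l" for \<mu>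
      by (simp only: m o(2)[OF that])
    show "act_ser ?o (\<lambda>x. gam (x (n + 1)) * w x) x = gam (x (n + 1)) * (c * R w x)"
      if "x \<in> hyper n l" for w x
      by (simp only: s o(3)[OF that] mult.left_commute)
  qed
qed

text \<open>\<open>ops'\<close> acts first, so the symbols of \<open>ops\<close> are evaluated at
  exponents already shifted by \<nu>'.\<close>

definition shift_comp :: "shift_ops \<Rightarrow> shift_ops \<Rightarrow> shift_ops" where
  "shift_comp ops ops' = concat (map (\<lambda>(\<nu>', p'). map (\<lambda>(\<nu>, p). (\<lambda>k. \<nu>' k + \<nu> k, \<lambda>x. p (\<lambda>k. x k + cvec \<nu>' k) * p' x)) ops) ops')"

lemma good_shift_comp:
  assumes "good_ops n ops" "good_ops n ops'" shows "good_ops n (shift_comp ops ops')"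
proof -
  have "(\<lambda>k. \<nu>' k + \<nu> k) \<in> lat n 0 \<and> (\<lambda>x. p (\<lambda>k. x k + cvec \<nu>' k) * p' x) \<in> polyfun n"
    if "\<nu> \<in> lat n 0" "\<nu>' \<in> lat n 0" "p \<in> polyfun n" "p' \<in> polyfun n" for \<nu> \<nu>' p p'
  proof
    show "(\<lambda>k. \<nu>' k + \<nu> k) \<in> lat n 0" using lat_add[OF that(2,1)] by simp
    have "(\<lambda>x. p (\<lambda>k. x k + cvec \<nu>' k)) \<in> polyfun n"
      by (rule polyfun_subst[OF that(3)]) (intro polyfun.add polyfun.coord polyfun.const)
    then show "(\<lambda>x. p (\<lambda>k. x k + cvec \<nu>' k) * p' x) \<in> polyfun n" by (rule polyfun.mult[OF _ that(4)])
  qed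
  then show ?thesis using assms unfolding good_ops_def shift_comp_def by fastforce
qed

lemma act_ser_shift_comp: "act_ser (shift_comp ops ops') v x = act_ser ops (act_ser ops' v) x"
proof -
  have 1: "act_ser (map (\<lambda>(\<nu>, p). (\<lambda>k. \<nu>' k + \<nu> k, \<lambda>x. p (\<lambda>k. x k + cvec \<nu>' k) * p' x)) ops) v x =
      act_ser ops (\<lambda>x. p' (\<lambda>k. x k - cvec \<nu>' k) * v (\<lambda>k. x k - cvec \<nu>' k)) x" for \<nu>' p'
  proof (induction ops)
    case (Cons a ops)
    have e: "(\<lambda>k. x k - cvec (\<lambda>k. \<nu>' k + \<nu> k) k) = (\<lambda>k. x k - cvec \<nu> k - cvec \<nu>' k)"
      "(\<lambda>k. x k - cvec (\<lambda>k. \<nu>' k + \<nu> k) k + cvec \<nu>' k) = (\<lambda>k. x k - cvec \<nu> k)" for \<nu>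
      by (simp_all add: cvec_def fun_eq_iff)
    obtain \<nu> p where a: "a = (\<nu>, p)" by (cases a)
    show ?case using Cons by (simp add: a act_ser_simps e mult.assoc)
  qed (simp add: act_ser_simps)
  have add: "act_ser ops (\<lambda>x. f x + g x) x = act_ser ops f x + act_ser ops g x" for f g
    by (induction ops) (auto simp: act_ser_simps algebra_simps)
  have zero: "act_ser ops (\<lambda>x. 0) x = 0" by (induction ops) (auto simp: act_ser_simps)
  show ?thesis
  proof (induction ops')
    case Nil
    have "act_ser [] v = (\<lambda>x. 0)" by (simp add: act_ser_simps fun_eq_iff)
    then show ?case by (simp add: shift_comp_def act_ser_simps zero)
  next
    case (Cons a ops')
    obtain \<nu>' p' where a: "a = (\<nu>', p')" by (cases a)
    have "act_ser (a # ops') v = (\<lambda>x. p' (\<lambda>k. x k - cvec \<nu>' k) * v (\<lambda>k. x k - cvec \<nu>' k) + act_ser ops' v x)"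
      by (simp add: a act_ser_simps fun_eq_iff)
    then show ?case using Cons by (simp add: shift_comp_def a act_append 1 add)
  qed
qed

lemma act_mon_shift_comp:
  assumes T: "good_op n l T" "\<And>\<mu>. \<mu> \<in> lat n l \<Longrightarrow> T (mon n \<mu>) = act_mon n ops \<mu>"
    and o': "good_ops n ops'" and \<mu>: "\<mu> \<in> lat n l"
  shows "T (act_mon n ops' \<mu>) = act_mon n (shift_comp ops ops') \<mu>"
  using o'
proof (induction ops')
  case Nil
  then show ?case using good_op_diff[OF T(1), of 0 0] by (simp add: act_mon_simps shift_comp_def)
next
  case (Cons a ops')
  obtain \<nu>' p' where a: "a = (\<nu>', p')" by (cases a)
  have \<nu>': "\<nu>' \<in> lat n 0" and g: "good_ops n ops'" using Cons.prems by (auto simp: a good_ops_def)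
  have l: "(\<lambda>k. \<mu> k + \<nu>' k) \<in> lat n l" using lat_add[OF \<mu> \<nu>'] by simp
  have 1: "kconst (p' (cvec \<mu>)) * act_mon n ops (\<lambda>k. \<mu> k + \<nu>' k) =
      act_mon n (map (\<lambda>(\<nu>, p). (\<lambda>k. \<nu>' k + \<nu> k, \<lambda>x. p (\<lambda>k. x k + cvec \<nu>' k) * p' x)) ops) \<mu>"
  proof (induction ops)
    case (Cons b ops)
    obtain \<nu> p where b: "b = (\<nu>, p)" by (cases b)
    have "cvec (\<lambda>k. \<mu> k + \<nu>' k) = (\<lambda>k. cvec \<mu> k + cvec \<nu>' k)" by (simp add: cvec_def fun_eq_iff)
    then show ?case using Cons by (simp add: b act_mon_simps kconst_mult distrib_left mult_ac add.assoc)
  qed (simp add: act_mon_simps)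
  have lin: "T (kconst c * g + h) = kconst c * T g + T h" for c g h using T(1) by (simp add: good_op_def)
  show ?case using Cons.IH[OF g] by (simp add: a act_mon_simps lin T(2)[OF l] 1 shift_comp_def act_append)
qed

lemma act_ser_cong:
  assumes "good_ops n ops" "x \<in> hyper n l" "\<And>y. y \<in> hyper n l \<Longrightarrow> v y = v' y"
  shows "act_ser ops v x = act_ser ops v' x"
  using assms(1)
proof (induction ops)
  case (Cons a ops)
  obtain \<nu> p where a: "a = (\<nu>, p)" by (cases a)
  have "\<nu> \<in> lat n 0" "good_ops n ops" using Cons.prems by (auto simp: a good_ops_def)
  then show ?case using Cons.IH assms(3)[OF hyper_shift[OF assms(2)]] by (simp add: a act_ser_simps)
qed (simp add: act_ser_simps)

text \<open>The inner operator returns \<gamma> times the coefficient function R' w, to which the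
  identity of the outer one applies. As this is known on the hyperplane only,
  \<open>act_ser_cong\<close> intervenes.\<close>

lemma compat_comp:
  assumes "compat n l R S" "compat n l R' T" shows "compat n l (\<lambda>w. R (R' w)) (\<lambda>g. S (T g))"
proof -
  obtain ops where o: "good_ops n ops" "\<And>\<mu>. \<mu> \<in> lat n l \<Longrightarrow> S (mon n \<mu>) = act_mon n ops \<mu>"
    "\<And>w x. x \<in> hyper n l \<Longrightarrow> act_ser ops (\<lambda>x. gam (x (n + 1)) * w x) x = gam (x (n + 1)) * R w x"
    using assms(1) unfolding compat_def by blast
  obtain ops' where o': "good_ops n ops'" "\<And>\<mu>. \<mu> \<in> lat n l \<Longrightarrow> T (mon n \<mu>) = act_mon n ops' \<mu>"
    "\<And>w x. x \<in> hyper n l \<Longrightarrow> act_ser ops' (\<lambda>x. gam (x (n + 1)) * w x) x = gam (x (n + 1)) * R' w x"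
    using assms(2) unfolding compat_def by blast
  have gS: "good_op n l S" using assms by (simp add: compat_def)
  have g: "good_op n l (\<lambda>g. S (T g))" using assms good_op_comp by (simp add: compat_def)
  show ?thesis unfolding compat_def
  proof (intro conjI exI ballI allI g)
    show "good_ops n (shift_comp ops ops')" by (rule good_shift_comp[OF o(1) o'(1)])
    show "S (T (mon n \<mu>)) = act_mon n (shift_comp ops ops') \<mu>" if "\<mu> \<in> lat n l" for \<mu>
      unfolding o'(2)[OF that] by (rule act_mon_shift_comp[OF gS o(2) o'(1) that])
    fix w x assume x: "x \<in> hyper n l"
    have "act_ser (shift_comp ops ops') (\<lambda>x. gam (x (n + 1)) * w x) x =
        act_ser ops (\<lambda>x. gam (x (n + 1)) * R' w x) x"
      unfolding act_ser_shift_comp by (rule act_ser_cong[OF o(1) x o'(3)])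
    then show "act_ser (shift_comp ops ops') (\<lambda>x. gam (x (n + 1)) * w x) x = gam (x (n + 1)) * R (R' w) x"
      by (simp only: o(3)[OF x])
  qed
qed

section \<open>Uniqueness of the compatible operator\<close>

definition op_coef :: "shift_ops \<Rightarrow> (nat \<Rightarrow> int) \<Rightarrow> (nat \<Rightarrow> complex) \<Rightarrow> complex" where
  "op_coef ops \<kappa> x = (\<Sum>(\<nu>, p)\<leftarrow>ops. if \<nu> = \<kappa> then p x else 0)"

lemma op_coef_simps: "op_coef [] \<kappa> x = 0" "op_coef ((\<nu>, p) # ops) \<kappa> x = (if \<nu> = \<kappa> then p x else 0) + op_coef ops \<kappa> x"
  by (simp_all add: op_coef_def)

lemma op_coef_polyfun: "good_ops n ops \<Longrightarrow> op_coef ops \<kappa> \<in> polyfun n"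
proof (induction ops)
  case Nil
  have "op_coef [] \<kappa> = (\<lambda>x. 0)" by (simp add: op_coef_simps fun_eq_iff)
  then show ?case by (simp add: polyfun.const)
next
  case (Cons a ops)
  obtain \<nu> p where a: "a = (\<nu>, p)" by (cases a)
  have "op_coef (a # ops) \<kappa> = (\<lambda>x. (if \<nu> = \<kappa> then p x else 0) + op_coef ops \<kappa> x)" by (simp add: a op_coef_simps fun_eq_iff)
  moreover have "(\<lambda>x. if \<nu> = \<kappa> then p x else 0) \<in> polyfun n"
    by (cases "\<nu> = \<kappa>") (use Cons.prems in \<open>auto simp: a good_ops_def polyfun.const\<close>)
  ultimately show ?case using Cons polyfun.add by (auto simp: good_ops_def)
qed

lemma act_mon_op_coef:
  assumes "finite K" "fst ` set ops \<subseteq> K"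
  shows "act_mon n ops \<mu> = (\<Sum>\<kappa>\<in>K. kconst (op_coef ops \<kappa> (cvec \<mu>)) * mon n (\<lambda>k. \<mu> k + \<kappa> k))"
  using assms(2)
proof (induction ops)
  case (Cons a ops)
  obtain \<nu> p where a: "a = (\<nu>, p)" by (cases a)
  have "(\<Sum>\<kappa>\<in>K. kconst (if \<nu> = \<kappa> then p (cvec \<mu>) else 0) * mon n (\<lambda>k. \<mu> k + \<kappa> k)) =
      (\<Sum>\<kappa>\<in>K. if \<nu> = \<kappa> then kconst (p (cvec \<mu>)) * mon n (\<lambda>k. \<mu> k + \<nu> k) else 0)"
    by (intro sum.cong refl) auto
  also have "\<dots> = kconst (p (cvec \<mu>)) * mon n (\<lambda>k. \<mu> k + \<nu> k)"
    using Cons.prems assms(1) by (simp add: a sum.delta')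
  finally show ?case using Cons by (simp add: a act_mon_simps op_coef_simps kconst_add distrib_right sum.distrib)
qed (simp add: act_mon_simps op_coef_simps)

text \<open>The coefficient function of a single monomial isolates one coefficient of the operator,
  up to the value of \<gamma> at the source.\<close>

lemma act_ser_delta:
  "act_ser ops (\<lambda>x. gam (x (n + 1)) * (if x = x0 then 1 else 0)) (\<lambda>k. x0 k + cvec \<kappa> k) = gam (x0 (n + 1)) * op_coef ops \<kappa> x0"
proof (induction ops)
  case (Cons a ops)
  obtain \<nu> p where a: "a = (\<nu>, p)" by (cases a)
  have e: "(\<lambda>k. x0 k + cvec \<kappa> k - cvec \<nu> k) = x0 \<longleftrightarrow> \<nu> = \<kappa>"
    by (auto simp: fun_eq_iff cvec_def)
  show ?case
  proof (cases "\<nu> = \<kappa>")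
    case True
    then show ?thesis using Cons by (simp add: a act_ser_simps op_coef_simps algebra_simps)
  next
    case False
    then show ?thesis using Cons e by (simp add: a act_ser_simps op_coef_simps)
  qed
qed (simp add: act_ser_simps op_coef_simps)

text \<open>A retraction onto the hyperplane that solves for the first coordinate, of weight 1 when
  n \<ge> 1. Composed with it, a polynomial on the hyperplane can be tested at freely chosen values
  of the other coordinates.\<close>

definition hyper_proj :: "nat \<Rightarrow> int \<Rightarrow> (nat \<Rightarrow> complex) \<Rightarrow> nat \<Rightarrow> complex" where
  "hyper_proj n l y = (\<lambda>i. if i = 1 then of_int l - (\<Sum>i\<in>{2..n+1}. of_int (wvar n i) * y i) else y i)"

lemma sum_split_first: "n \<ge> 1 \<Longrightarrow> (\<Sum>i\<in>{1..n+1}. of_int (wvar n i) * x i) = x 1 + (\<Sum>i\<in>{2..n+1}. of_int (wvar n i) * (x i :: complex))"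
proof -
  assume n: "n \<ge> 1"
  have "{1..n+1} = insert 1 {2..n+1}" by auto
  then show ?thesis using n by (simp add: wvar_def)
qed

lemma hyper_proj_hyper: "n \<ge> 1 \<Longrightarrow> hyper_proj n l y \<in> hyper n l"
proof -
  assume n: "n \<ge> 1"
  have "(\<Sum>i\<in>{2..n+1}. of_int (wvar n i) * hyper_proj n l y i) = (\<Sum>i\<in>{2..n+1}. of_int (wvar n i) * y i)"
    by (intro sum.cong) (auto simp: hyper_proj_def)
  then show ?thesis unfolding hyper_def mem_Collect_eq sum_split_first[OF n] by (simp add: hyper_proj_def)
qed

lemma hyper_proj_id: "n \<ge> 1 \<Longrightarrow> x \<in> hyper n l \<Longrightarrow> hyper_proj n l x = x"
  unfolding hyper_def mem_Collect_eq using sum_split_first[of n x] by (auto simp: hyper_proj_def fun_eq_iff algebra_simps)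

text \<open>Delta functions show that S and T have equal coefficients wherever the last exponent is
  a natural number, as \<gamma> is nonzero there. Polynomiality extends this to the hyperplane, and
  \<open>dop_zero_of_torus\<close> passes from Laurent monomials to all fractions of degree
  l.\<close>

lemma compat_unique:
  assumes n: "n \<ge> 1" and c: "compat n l R S" "compat n l R T" and g: "g \<in> homfrac n l"
  shows "S g = T g"
proof -
  obtain ops where o: "good_ops n ops" "\<And>\<mu>. \<mu> \<in> lat n l \<Longrightarrow> S (mon n \<mu>) = act_mon n ops \<mu>"
    "\<And>w x. x \<in> hyper n l \<Longrightarrow> act_ser ops (\<lambda>x. gam (x (n + 1)) * w x) x = gam (x (n + 1)) * R w x"
    using c(1) unfolding compat_def by blast
  obtain ops' where o': "good_ops n ops'" "\<And>\<mu>. \<mu> \<in> lat n l \<Longrightarrow> T (mon n \<mu>) = act_mon n ops' \<mu>"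
    "\<And>w x. x \<in> hyper n l \<Longrightarrow> act_ser ops' (\<lambda>x. gam (x (n + 1)) * w x) x = gam (x (n + 1)) * R w x"
    using c(2) unfolding compat_def by blast
  have gS: "good_op n l S" and gT: "good_op n l T" using c by (simp_all add: compat_def)
  have nat_eq: "op_coef ops \<kappa> x = op_coef ops' \<kappa> x" if x: "x \<in> hyper n l" "x (n + 1) \<in> \<nat>" and \<kappa>: "\<kappa> \<in> lat n 0" for x \<kappa>
  proof -
    have "gam (x (n + 1)) * op_coef ops \<kappa> x = gam (x (n + 1)) * op_coef ops' \<kappa> x"
      unfolding act_ser_delta[symmetric] o(3)[OF hyper_shift_add[OF x(1) \<kappa>]] o'(3)[OF hyper_shift_add[OF x(1) \<kappa>]] ..
    moreover have "gam (x (n + 1)) \<noteq> 0" using x(2) by (simp add: gam_def)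
    ultimately show ?thesis by simp
  qed
  have eq: "op_coef ops \<kappa> x = op_coef ops' \<kappa> x" if x: "x \<in> hyper n l" and \<kappa>: "\<kappa> \<in> lat n 0" for x \<kappa>
  proof -
    define d where "d = (\<lambda>y. op_coef ops \<kappa> (hyper_proj n l y) - op_coef ops' \<kappa> (hyper_proj n l y))"
    have hp: "(\<lambda>y. hyper_proj n l y i) \<in> polyfun n" if "i \<in> {1..n+1}" for i
    proof (cases "i = 1")
      case True
      have "(\<lambda>y. of_int l - (\<Sum>i\<in>{2..n+1}. of_int (wvar n i) * y i)) \<in> polyfun n"
        by (intro polyfun_diff polyfun.const polyfun_sum polyfun.mult polyfun.coord) auto
      then show ?thesis by (simp add: hyper_proj_def True)
    next
      case False
      then show ?thesis using that by (simp add: hyper_proj_def polyfun.coord)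
    qed
    have dp: "d \<in> polyfun n" unfolding d_def
      by (intro polyfun_diff polyfun_subst[OF op_coef_polyfun[OF o(1)] hp] polyfun_subst[OF op_coef_polyfun[OF o'(1)] hp])
    have "d x = 0"
    \<comment> \<open>Only the last coordinate has to be natural, and \<open>hyper_proj\<close>
      leaves it alone because n + 1 \<noteq> 1.\<close>
    proof (rule polyfun_zero_of_Nats[OF dp, of "{n + 1}"])
      fix y :: "nat \<Rightarrow> complex" assume "\<And>i. i \<in> {n + 1} \<Longrightarrow> y i \<in> \<nat>"
      then have "hyper_proj n l y (n + 1) \<in> \<nat>" using n by (simp add: hyper_proj_def)
      from nat_eq[OF hyper_proj_hyper[OF n] this \<kappa>] show "d y = 0" by (simp add: d_def)
    qed simp
    then show ?thesis by (simp add: d_def hyper_proj_id[OF n x])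
  qed
  have "S (mon n \<mu>) - T (mon n \<mu>) = 0" if \<mu>: "\<mu> \<in> lat n l" for \<mu>
  proof -
    let ?K = "fst ` set ops \<union> fst ` set ops'"
    have K: "\<kappa> \<in> lat n 0" if "\<kappa> \<in> ?K" for \<kappa> using that o(1) o'(1) by (auto simp: good_ops_def)
    have "act_mon n ops \<mu> = act_mon n ops' \<mu>"
      unfolding act_mon_op_coef[of ?K ops, OF _ Un_upper1, simplified] act_mon_op_coef[of ?K ops', OF _ Un_upper2, simplified]
      by (intro sum.cong refl) (simp add: eq[OF hyper_cvec[OF \<mu>] K])
    then show ?thesis by (simp add: o(2)[OF \<mu>] o'(2)[OF \<mu>])
  qed
  moreover have D: "good_op n l (\<lambda>g. S g - T g)"
    using good_op_add[OF gS good_op_scale[OF gT, of "- 1"]] by (simp add: kconst_uminus)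
  moreover obtain k where "dop UNIV UNIV k (\<lambda>g. S g - T g)" using D by (auto simp: good_op_def)
  then have "dop (homfrac n 0) (homfrac n l) k (\<lambda>g. S g - T g)" by (rule dop_antimono) auto
  ultimately have "S g - T g = 0"
    using dop_zero_of_torus[OF n good_op_linear[OF D] _ _ g] by blast
  then show ?thesis by simp
qed

section \<open>The action on Laurent monomials\<close>

lemma compat_cong:
  assumes "compat n l R T" "\<And>w x. x \<in> hyper n l \<Longrightarrow> R w x = R' w x"
  shows "compat n l R' T"
proof -
  obtain ops where o: "good_ops n ops" "\<And>\<mu>. \<mu> \<in> lat n l \<Longrightarrow> T (mon n \<mu>) = act_mon n ops \<mu>"
    "\<And>w x. x \<in> hyper n l \<Longrightarrow> act_ser ops (\<lambda>x. gam (x (n + 1)) * w x) x = gam (x (n + 1)) * R w x"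
    using assms(1) unfolding compat_def by blast
  show ?thesis unfolding compat_def
  proof (intro conjI exI ballI allI)
    show "good_op n l T" using assms(1) by (simp add: compat_def)
    show "good_ops n ops" by (rule o(1))
    show "T (mon n \<mu>) = act_mon n ops \<mu>" if "\<mu> \<in> lat n l" for \<mu> by (rule o(2)[OF that])
    show "act_ser ops (\<lambda>x. gam (x (n + 1)) * w x) x = gam (x (n + 1)) * R' w x" if "x \<in> hyper n l" for w x
      unfolding o(3)[OF that] assms(2)[OF that] ..
  qed
qed

lemma compat_zero: "\<exists>T. compat n l (\<lambda>w x. 0) T"
  using compat_scale[OF compat_id, of n l 0] by auto

lemma compat_sum:
  assumes "finite A" "\<And>i. i \<in> A \<Longrightarrow> \<exists>T. compat n l (R i) T"
  shows "\<exists>T. compat n l (\<lambda>w x. \<Sum>i\<in>A. R i w x) T"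
  using assms
proof (induction A)
  case empty
  then show ?case using compat_zero by simp
next
  case (insert i A)
  obtain S where S: "compat n l (R i) S" using insert.prems by blast
  obtain T where T: "compat n l (\<lambda>w x. \<Sum>i\<in>A. R i w x) T" using insert.IH insert.prems by blast
  have "compat n l (\<lambda>w x. \<Sum>i\<in>insert i A. R i w x) (\<lambda>g. S g + T g)"
    by (rule compat_cong[OF compat_add[OF S T]]) (use insert.hyps in simp)
  then show ?case by blast
qed

lemma compat_single:
  assumes T: "good_op n l T" and nu: "\<nu> \<in> lat n 0" and p: "p \<in> polyfun n"
    and mon: "\<And>\<mu>. \<mu> \<in> lat n l \<Longrightarrow> T (mon n \<mu>) = kconst (p (cvec \<mu>)) * mon n (\<lambda>k. \<mu> k + \<nu> k)"
    and ser: "\<And>w x. x \<in> hyper n l \<Longrightarrow> p (\<lambda>k. x k - cvec \<nu> k) * (gam (x (n + 1) - cvec \<nu> (n + 1)) * w (\<lambda>k. x k - cvec \<nu> k)) = gam (x (n + 1)) * R w x"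
  shows "compat n l R T"
  unfolding compat_def
proof (intro conjI exI ballI allI T)
  show "good_ops n [(\<nu>, p)]" using nu p by (simp add: good_ops_def)
  show "T (mon n \<mu>) = act_mon n [(\<nu>, p)] \<mu>" if "\<mu> \<in> lat n l" for \<mu> using mon[OF that] by (simp add: act_mon_simps)
  show "act_ser [(\<nu>, p)] (\<lambda>x. gam (x (n + 1)) * w x) x = gam (x (n + 1)) * R w x" if "x \<in> hyper n l" for w x
    using ser[OF that, of w] by (simp add: act_ser_simps)
qed

lemma kder_diff: "kder j (g - h) = kder j g - kder j h"
proof -
  have "kder j (g - h) + kder j h = kder j g" unfolding kder_add[symmetric] by simp
  then show ?thesis by (simp add: eq_diff_eq)
qed

text \<open>Stalks of degree l are preserved because the degrees of the factors cancel: -1 + 1 here,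
  -2 + 1 + 1 in \<open>good_op_lower\<close> and -1 - 1 + 2 in \<open>good_op_raise\<close>.\<close>

lemma good_op_first_order:
  assumes ij: "i \<in> {1..n}" "j \<in> {1..n}"
  shows "good_op n l (\<lambda>g. kvar j * kder i g)"
proof -
  have "dop UNIV UNIV (0 + 1) (\<lambda>g. kvar j * kder i g)"
    by (rule dop_comp[OF dop_mult dop_derivation[OF derivation_kder]]) (simp_all add: right_diff_distrib kder_diff)
  moreover have "preserving n l (pts n) (\<lambda>g. kvar j * kder i g)"
    unfolding preserving_def
  proof (intro ballI)
    fix P g assume P: "P \<in> pts n" and g: "g \<in> reg n P l"
    have w: "wvar n i = 1" "wvar n j = 1" "i \<in> {1..n+1}" "j \<in> {1..n+1}" using ij by (auto simp: wvar_def)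
    from reg_mult[OF P reg_kvar[OF P w(4)] reg_kder[OF P w(3) g]] show "kvar j * kder i g \<in> reg n P l" by (simp add: w)
  qed
  ultimately show ?thesis unfolding good_op_def
    by (intro conjI allI exI[of _ "0 + 1"]) (simp_all add: kder_add kder_kconst_mult distrib_left mult.left_commute del: dop.simps)
qed

lemma good_op_lower:
  assumes ij: "i \<in> {1..n}" "j \<in> {1..n}"
  shows "good_op n l (\<lambda>g. kvar i * (kvar j * kder (n + 1) g))"
proof -
  have "dop UNIV UNIV (0 + (0 + 1)) (\<lambda>g. kvar i * (kvar j * kder (n + 1) g))"
    by (rule dop_comp[OF dop_mult dop_comp[OF dop_mult dop_derivation[OF derivation_kder]]])
      (simp_all add: right_diff_distrib kder_diff)
  moreover have "preserving n l (pts n) (\<lambda>g. kvar i * (kvar j * kder (n + 1) g))"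
    unfolding preserving_def
  proof (intro ballI)
    fix P g assume P: "P \<in> pts n" and g: "g \<in> reg n P l"
    have w: "wvar n i = 1" "wvar n j = 1" "wvar n (n + 1) = 2" "i \<in> {1..n+1}" "j \<in> {1..n+1}" "n + 1 \<in> {1..n+1}"
      using ij by (auto simp: wvar_def)
    from reg_mult[OF P reg_kvar[OF P w(4)] reg_mult[OF P reg_kvar[OF P w(5)] reg_kder[OF P w(6) g]]]
    show "kvar i * (kvar j * kder (n + 1) g) \<in> reg n P l" unfolding w by simp
  qed
  ultimately show ?thesis unfolding good_op_def
    by (intro conjI allI exI[of _ "0 + (0 + 1)"]) (simp_all add: kder_add kder_kconst_mult distrib_left mult.left_commute del: dop.simps)
qed

lemma good_op_raise:
  assumes ij: "i \<in> {1..n}" "j \<in> {1..n}"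
  shows "good_op n l (\<lambda>g. kvar (n + 1) * kder i (kder j g))"
proof -
  have "dop UNIV UNIV (0 + (1 + 1)) (\<lambda>g. kvar (n + 1) * kder i (kder j g))"
    by (rule dop_comp[OF dop_mult dop_comp[OF dop_derivation[OF derivation_kder] dop_derivation[OF derivation_kder]]])
      (simp_all add: right_diff_distrib kder_diff)
  moreover have "preserving n l (pts n) (\<lambda>g. kvar (n + 1) * kder i (kder j g))"
    unfolding preserving_def
  proof (intro ballI)
    fix P g assume P: "P \<in> pts n" and g: "g \<in> reg n P l"
    have w: "wvar n i = 1" "wvar n j = 1" "wvar n (n + 1) = 2" "i \<in> {1..n+1}" "j \<in> {1..n+1}" "n + 1 \<in> {1..n+1}"
      using ij by (auto simp: wvar_def)
    from reg_mult[OF P reg_kvar[OF P w(6)] reg_kder[OF P w(4) reg_kder[OF P w(5) g]]]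
    show "kvar (n + 1) * kder i (kder j g) \<in> reg n P l" unfolding w by simp
  qed
  ultimately show ?thesis unfolding good_op_def
    by (intro conjI allI exI[of _ "0 + (1 + 1)"]) (simp_all add: kder_add kder_kconst_mult distrib_left mult.left_commute del: dop.simps)
qed

lemma lat0_diff: "\<mu> \<in> lat n a \<Longrightarrow> \<nu> \<in> lat n b \<Longrightarrow> (\<lambda>k. \<mu> k - \<nu> k) \<in> lat n (a - b)"
  using lat_add[of \<mu> n a "\<lambda>k. - 1 * \<nu> k" "- 1 * b"] lat_scale[of \<nu> n b "- 1"] by simp

lemma lat_unit1: "i < n \<Longrightarrow> unit_at (i + 1) \<in> lat n 1"
  using lat_unit[of "i + 1" n] by (simp add: wvar_def)

lemma lat_unit2: "unit_at (n + 1) \<in> lat n 2"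
  using lat_unit[of "n + 1" n] by (simp add: wvar_def)

text \<open>The exponent shift of Q_(j+1) d_(i+1), where d_k is the derivative in Q_k;
  \<open>nu_low\<close> belongs to Q_(i+1) Q_(j+1) d_(n+1) and \<open>nu_up\<close> to Q_(n+1)
  d_(i+1) d_(j+1). The indices i and j are matrix indices counted from 0, the variables are counted
  from 1.\<close>

definition nu_gl :: "nat \<Rightarrow> nat \<Rightarrow> nat \<Rightarrow> int" where "nu_gl i j = (\<lambda>k. unit_at (j + 1) k - unit_at (i + 1) k)"
definition nu_low :: "nat \<Rightarrow> nat \<Rightarrow> nat \<Rightarrow> nat \<Rightarrow> int" where
  "nu_low n i j = (\<lambda>k. unit_at (i + 1) k + unit_at (j + 1) k - unit_at (n + 1) k)"
definition nu_up :: "nat \<Rightarrow> nat \<Rightarrow> nat \<Rightarrow> nat \<Rightarrow> int" where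
  "nu_up n i j = (\<lambda>k. unit_at (n + 1) k - (unit_at (i + 1) k + unit_at (j + 1) k))"

lemma nu_lat:
  assumes "i < n" "j < n" shows "nu_gl i j \<in> lat n 0" "nu_low n i j \<in> lat n 0" "nu_up n i j \<in> lat n 0"
  unfolding nu_gl_def nu_low_def nu_up_def
  using lat0_diff[OF lat_unit1[OF assms(2)] lat_unit1[OF assms(1)]]
    lat0_diff[OF lat_add[OF lat_unit1[OF assms(1)] lat_unit1[OF assms(2)]] lat_unit2]
    lat0_diff[OF lat_unit2 lat_add[OF lat_unit1[OF assms(1)] lat_unit1[OF assms(2)]]] by simp_all

lemma gl_mon:
  assumes "i < n" "j < n"
  shows "kvar (j + 1) * kder (i + 1) (mon n \<mu>) = kconst (cvec \<mu> (i + 1)) * mon n (\<lambda>k. \<mu> k + nu_gl i j k)"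
proof -
  have r: "j + 1 \<in> {1..n+1}" "i + 1 \<in> {1..n+1}" using assms by auto
  have "(\<lambda>k. \<mu> k + nu_gl i j k) = (\<lambda>k. unit_at (j + 1) k + (\<mu> k - unit_at (i + 1) k))" by (simp add: nu_gl_def fun_eq_iff)
  then show ?thesis unfolding kder_mon[OF r(2)] mon_unit[OF r(1), symmetric]
    by (simp only: mon_add cvec_def kconst_of_int mult.left_commute)
qed

lemma low_mon:
  assumes "i < n" "j < n"
  shows "kvar (i + 1) * (kvar (j + 1) * kder (n + 1) (mon n \<mu>)) = kconst (cvec \<mu> (n + 1)) * mon n (\<lambda>k. \<mu> k + nu_low n i j k)"
proof -
  have r: "j + 1 \<in> {1..n+1}" "i + 1 \<in> {1..n+1}" "n + 1 \<in> {1..n+1}" using assms by auto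
  have "(\<lambda>k. \<mu> k + nu_low n i j k) = (\<lambda>k. unit_at (i + 1) k + (unit_at (j + 1) k + (\<mu> k - unit_at (n + 1) k)))"
    by (simp add: nu_low_def fun_eq_iff)
  then show ?thesis unfolding kder_mon[OF r(3)] mon_unit[OF r(1), symmetric] mon_unit[OF r(2), symmetric]
    by (simp only: mon_add cvec_def kconst_of_int mult.left_commute)
qed

text \<open>The correction \<open>unit_at (j + 1) (i + 1)\<close> accounts for a repeated
  derivative: for i = j the coefficient is of the form x (x - 1).\<close>

lemma up_mon:
  assumes "i < n" "j < n"
  shows "kvar (n + 1) * kder (i + 1) (kder (j + 1) (mon n \<mu>)) =
    kconst (cvec \<mu> (j + 1) * (cvec \<mu> (i + 1) - of_int (unit_at (j + 1) (i + 1)))) * mon n (\<lambda>k. \<mu> k + nu_up n i j k)"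
proof -
  have r: "j + 1 \<in> {1..n+1}" "i + 1 \<in> {1..n+1}" "n + 1 \<in> {1..n+1}" using assms by auto
  have e: "(\<lambda>k. \<mu> k + nu_up n i j k) = (\<lambda>k. unit_at (n + 1) k + (\<mu> k - unit_at (j + 1) k - unit_at (i + 1) k))"
    by (simp add: nu_up_def fun_eq_iff)
  have c: "kconst (cvec \<mu> (j + 1) * (cvec \<mu> (i + 1) - of_int (unit_at (j + 1) (i + 1)))) =
      of_int (\<mu> (j + 1)) * of_int (\<mu> (i + 1) - unit_at (j + 1) (i + 1))"
    by (simp only: cvec_def kconst_mult kconst_of_int of_int_diff[symmetric])
  have "kder (i + 1) (of_int a * g) = of_int a * kder (i + 1) g" for a g
    unfolding kconst_of_int[symmetric] by (rule kder_kconst_mult)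
  then have "kder (i + 1) (kder (j + 1) (mon n \<mu>)) = of_int (\<mu> (j + 1)) * (of_int (\<mu> (i + 1) - unit_at (j + 1) (i + 1)) *
      mon n (\<lambda>k. \<mu> k - unit_at (j + 1) k - unit_at (i + 1) k))"
    by (simp only: kder_mon[OF r(1)] kder_mon[OF r(2)])
  then show ?thesis unfolding e c mon_unit[OF r(3), symmetric] mon_add by (simp only: mult_ac)
qed

lemma compat_gl:
  assumes ij: "i < n" "j < n"
  shows "compat n l (\<lambda>w. osc n (j + n) (osc n i w)) (\<lambda>g. kvar (j + 1) * kder (i + 1) g)"
proof (rule compat_single[of n l _ "nu_gl i j" "\<lambda>x. x (i + 1)"])
  show "good_op n l (\<lambda>g. kvar (j + 1) * kder (i + 1) g)" by (rule good_op_first_order) (use ij in auto)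
  show "nu_gl i j \<in> lat n 0" by (rule nu_lat[OF ij])
  show "(\<lambda>x. x (i + 1)) \<in> polyfun n" by (rule polyfun.coord) (use ij in auto)
  fix \<mu> show "kvar (j + 1) * kder (i + 1) (mon n \<mu>) = kconst (cvec \<mu> (i + 1)) * mon n (\<lambda>k. \<mu> k + nu_gl i j k)"
    by (rule gl_mon[OF ij])
next
  fix w x
  have e: "(\<lambda>k. x k - cvec (nu_gl i j) k) = osc_shift n (i + 1) 1 (osc_shift n (j + 1) (- 1) x)"
    by (simp add: osc_shift_def cvec_def nu_gl_def fun_eq_iff)
  have "x (i + 1) - cvec (nu_gl i j) (i + 1) = osc_shift n (j + 1) (- 1) x (i + 1) + 1"
    using ij by (simp add: osc_shift_def cvec_def nu_gl_def unit_at_def)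
  moreover have "cvec (nu_gl i j) (n + 1) = 0" using ij by (simp add: cvec_def nu_gl_def unit_at_def)
  ultimately show "(x (i + 1) - cvec (nu_gl i j) (i + 1)) * (gam (x (n + 1) - cvec (nu_gl i j) (n + 1)) * w (\<lambda>k. x k - cvec (nu_gl i j) k)) =
      gam (x (n + 1)) * osc n (j + n) (osc n i w) x"
    unfolding e using ij by (simp add: osc_def)
qed

text \<open>The derivative in the last variable multiplies by the exponent of the source, which is
  x_(n+1) + 1 for the target x. By \<open>gam_Suc\<close> this factor is absorbed into \<gamma>, and
  a pure shift is left.\<close>

lemma compat_low:
  assumes ij: "i < n" "j < n"
  shows "compat n l (\<lambda>w. osc n (i + n) (osc n (j + n) w)) (\<lambda>g. kvar (i + 1) * (kvar (j + 1) * kder (n + 1) g))"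
proof (rule compat_single[of n l _ "nu_low n i j" "\<lambda>x. x (n + 1)"])
  show "good_op n l (\<lambda>g. kvar (i + 1) * (kvar (j + 1) * kder (n + 1) g))" by (rule good_op_lower) (use ij in auto)
  show "nu_low n i j \<in> lat n 0" by (rule nu_lat[OF ij])
  show "(\<lambda>x. x (n + 1)) \<in> polyfun n" by (rule polyfun.coord) auto
  fix \<mu> show "kvar (i + 1) * (kvar (j + 1) * kder (n + 1) (mon n \<mu>)) = kconst (cvec \<mu> (n + 1)) * mon n (\<lambda>k. \<mu> k + nu_low n i j k)"
    by (rule low_mon[OF ij])
next
  fix w x
  have e: "(\<lambda>k. x k - cvec (nu_low n i j) k) = osc_shift n (j + 1) (- 1) (osc_shift n (i + 1) (- 1) x)"
    by (simp add: osc_shift_def cvec_def nu_low_def fun_eq_iff)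
  have c: "cvec (nu_low n i j) (n + 1) = - 1" using ij by (simp add: cvec_def nu_low_def unit_at_def)
  show "(x (n + 1) - cvec (nu_low n i j) (n + 1)) * (gam (x (n + 1) - cvec (nu_low n i j) (n + 1)) * w (\<lambda>k. x k - cvec (nu_low n i j) k)) =
      gam (x (n + 1)) * osc n (i + n) (osc n (j + n) w) x"
    unfolding e c gam_Suc[of "x (n + 1)"] using ij by (simp add: osc_def)
qed

text \<open>The last exponent now rises to x_(n+1), and \<gamma>(c - 1) = c \<gamma>(c) calls for a
  factor x_(n+1). It is supplied by Z, which acts before the shift and multiplies by the source
  exponent plus 1.\<close>

lemma compat_up:
  assumes ij: "i < n" "j < n" and Z: "\<And>w y. y \<in> hyper n l \<Longrightarrow> Z w y = (y (n + 1) + 1) * w y"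
  shows "compat n l (\<lambda>w. osc n i (osc n j (Z w))) (\<lambda>g. kvar (n + 1) * kder (i + 1) (kder (j + 1) g))"
proof (rule compat_single[of n l _ "nu_up n i j" "\<lambda>x. x (j + 1) * (x (i + 1) - of_int (unit_at (j + 1) (i + 1)))"])
  show "good_op n l (\<lambda>g. kvar (n + 1) * kder (i + 1) (kder (j + 1) g))" by (rule good_op_raise) (use ij in auto)
  show nl: "nu_up n i j \<in> lat n 0" by (rule nu_lat[OF ij])
  show "(\<lambda>x. x (j + 1) * (x (i + 1) - of_int (unit_at (j + 1) (i + 1)))) \<in> polyfun n"
    by (intro polyfun.mult polyfun_diff polyfun.const polyfun.coord) (use ij in auto)
  fix \<mu> show "kvar (n + 1) * kder (i + 1) (kder (j + 1) (mon n \<mu>)) =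
    kconst (cvec \<mu> (j + 1) * (cvec \<mu> (i + 1) - of_int (unit_at (j + 1) (i + 1)))) * mon n (\<lambda>k. \<mu> k + nu_up n i j k)"
    by (rule up_mon[OF ij])
next
  fix w x assume x: "x \<in> hyper n l"
  have nl: "nu_up n i j \<in> lat n 0" by (rule nu_lat[OF ij])
  let ?y = "\<lambda>k. x k - cvec (nu_up n i j) k"
  have e: "?y = osc_shift n (j + 1) 1 (osc_shift n (i + 1) 1 x)"
    by (simp add: osc_shift_def cvec_def nu_up_def fun_eq_iff)
  have c: "cvec (nu_up n i j) (n + 1) = 1" using ij by (simp add: cvec_def nu_up_def unit_at_def)
  have Zy: "Z w ?y = x (n + 1) * w ?y" using Z[OF hyper_shift[OF x nl], of w] unfolding c by simp
  have 1: "x (i + 1) - cvec (nu_up n i j) (i + 1) - of_int (unit_at (j + 1) (i + 1)) = x (i + 1) + 1"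
    using ij by (simp add: cvec_def nu_up_def unit_at_def)
  have 2: "x (j + 1) - cvec (nu_up n i j) (j + 1) = osc_shift n (i + 1) 1 x (j + 1) + 1"
    using ij by (simp add: cvec_def nu_up_def unit_at_def osc_shift_def)
  have g: "gam (x (n + 1) - 1) = x (n + 1) * gam (x (n + 1))" using gam_Suc[of "x (n + 1) - 1"] by simp
  have "osc n i (osc n j (Z w)) x = (x (i + 1) + 1) * ((osc_shift n (i + 1) 1 x (j + 1) + 1) * Z w ?y)"
    unfolding e using ij by (simp add: osc_def)
  then show "(x (j + 1) - cvec (nu_up n i j) (j + 1)) * (x (i + 1) - cvec (nu_up n i j) (i + 1) - of_int (unit_at (j + 1) (i + 1))) *
      (gam (x (n + 1) - cvec (nu_up n i j) (n + 1)) * w ?y) = gam (x (n + 1)) * osc n i (osc n j (Z w)) x"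
    unfolding 1 2 c g Zy by (simp only: mult_ac)
qed

text \<open>Z is carried along so that one reduction to pairs of indices serves all grades: it is
  the action of z_k in grade 1 and the identity in grades 0 and -1.\<close>

lemma graded_compat:
  assumes X: "X \<in> sp_graded n k"
    and pair: "\<And>I K. I < 2*n \<Longrightarrow> K < 2*n \<Longrightarrow> grade n I K = k \<Longrightarrow> \<exists>T. compat n l (\<lambda>w. osc n I (osc n (bar n K) (Z w))) T"
  shows "\<exists>T. compat n l (\<lambda>w. osc_rep n X (Z w)) T"
  unfolding osc_rep_def
proof (intro compat_sum finite_lessThan)
  fix I K assume "I \<in> {..<2*n}" "K \<in> {..<2*n}"
  then have IK: "I < 2*n" "K < 2*n" by auto
  show "\<exists>T. compat n l (\<lambda>w x. half_sg n K * X $$ (I, K) * osc n I (osc n (bar n K) (Z w)) x) T"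
  proof (cases "X $$ (I, K) = 0")
    case True
    then show ?thesis using compat_zero by simp
  next
    case False
    then have "grade n I K = k" using X IK by (simp add: sp_graded_def)
    from pair[OF IK this] obtain T where "compat n l (\<lambda>w. osc n I (osc n (bar n K) (Z w))) T" by blast
    from compat_scale[OF this] show ?thesis by blast
  qed
qed

text \<open>The opposite order of the two factors differs from \<open>compat_gl\<close> by the
  constant of the commutation relation.\<close>

lemma compat_gl':
  assumes ij: "i < n" "j < n"
  shows "\<exists>T. compat n l (\<lambda>w. osc n i (osc n (j + n) w)) T"
proof -
  have "compat n l (\<lambda>w. osc n i (osc n (j + n) w)) (\<lambda>g. kvar (j + 1) * kder (i + 1) g + kconst (osc_form n i (j + n)) * g)"
    by (rule compat_cong[OF compat_add[OF compat_gl[OF ij] compat_scale[OF compat_id]]])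
      (use ij in \<open>simp add: osc_commute[of i n "j + n"]\<close>)
  then show ?thesis by blast
qed

text \<open>In grade 0 both indices lie in the same half of the basis, so each product consists of
  one a and one b, in either order.\<close>

lemma levi_compat: "X \<in> sp_graded n 0 \<Longrightarrow> \<exists>T. compat n l (osc_rep n X) T"
proof (rule graded_compat[where Z = "\<lambda>w. w"])
  fix I K assume IK: "I < 2*n" "K < 2*n" and g: "grade n I K = 0"
  show "\<exists>T. compat n l (\<lambda>w. osc n I (osc n (bar n K) w)) T"
  proof (cases "I < n")
    case True
    then have K: "K < n" using g by (simp add: grade_def split: if_splits)
    then show ?thesis using compat_gl'[OF True K] by (simp add: bar_def)
  next
    case False
    then have K: "\<not> K < n" using g by (simp add: grade_def split: if_splits)
    have ij: "K - n < n" "I - n < n" using IK False K by auto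
    have "I - n + n = I" using False by simp
    then show ?thesis using compat_gl[OF ij, of l] K by (auto simp: bar_def)
  qed
qed

lemma r_minus_compat: "X \<in> sp_graded n (- 1) \<Longrightarrow> \<exists>T. compat n l (osc_rep n X) T"
proof (rule graded_compat[where Z = "\<lambda>w. w"])
  fix I K assume IK: "I < 2*n" "K < 2*n" and g: "grade n I K = - 1"
  then have "\<not> I < n" "K < n" by (auto simp: grade_def split: if_splits)
  then have ij: "I - n < n" "K < n" "I - n + n = I" "bar n K = K + n" using IK by (auto simp: bar_def)
  show "\<exists>T. compat n l (\<lambda>w. osc n I (osc n (bar n K) w)) T"
    using compat_low[OF ij(1,2), of l] unfolding ij(3,4) by blast
qed

lemma r_plus_compat:
  assumes Z: "\<And>w y. y \<in> hyper n l \<Longrightarrow> Z w y = (y (n + 1) + 1) * w y"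
  shows "X \<in> sp_graded n 1 \<Longrightarrow> \<exists>T. compat n l (\<lambda>w. osc_rep n X (Z w)) T"
proof (rule graded_compat)
  fix I K assume IK: "I < 2*n" "K < 2*n" and g: "grade n I K = 1"
  then have IK': "I < n" "\<not> K < n" by (auto simp: grade_def split: if_splits)
  then have ij: "I < n" "K - n < n" "bar n K = K - n" using IK by (auto simp: bar_def)
  show "\<exists>T. compat n l (\<lambda>w. osc n I (osc n (bar n K) (Z w))) T"
    using compat_up[of I n "K - n" l Z, OF ij(1,2) Z] unfolding ij(3) by blast
qed

section \<open>The algebra A_k in the oscillator representation\<close>

abbreviation "urep n \<equiv> lie_rep.rep (sp n) (osc_rep n)"
abbreviation "env n \<equiv> env_alg (sp n)"

lemma A_alg_simps:
  "carrier (A_alg n k) = generate_ring (env n) ({c \<odot>\<^bsub>env n\<^esub> \<one>\<^bsub>env n\<^esub> | c. True} \<union> (env_incl (sp n) ` levi n \<union> env_incl (sp n) ` r_minus n \<union>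
      {env_incl (sp n) x \<otimes>\<^bsub>env n\<^esub> zk_elt n k | x. x \<in> r_plus n}))"
  "mult (A_alg n k) = mult (env n)" "add (A_alg n k) = add (env n)" "one (A_alg n k) = one (env n)" "smult (A_alg n k) = smult (env n)"
  by (simp_all add: A_alg_def subalgebra_gen_def)

lemma levi_sp: "n \<ge> 1 \<Longrightarrow> levi n \<subseteq> sp n"
  using levi_graded[of n] unfolding sp_graded_def by blast

lemma r_plus_sp: "n \<ge> 1 \<Longrightarrow> r_plus n \<subseteq> sp n"
  using r_plus_graded[of n] unfolding sp_graded_def by blast

lemma r_minus_sp: "n \<ge> 1 \<Longrightarrow> r_minus n \<subseteq> sp n"
  using r_minus_graded[of n] unfolding sp_graded_def by blast

lemma z_sp: "n \<ge> 1 \<Longrightarrow> z_elt n \<in> sp n"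
  by (simp add: z_elt_eq cdiag_sp)

lemma zk_car: "n \<ge> 1 \<Longrightarrow> zk_elt n k \<in> carrier (env n)"
proof -
  interpret U: lie_rep "sp n" "osc_rep n" by (rule lie_rep_osc)
  interpret R: ring "env n" by (rule U.ring_E)
  assume "n \<ge> 1"
  then show ?thesis unfolding zk_elt_def by (intro R.a_closed U.env_incl_car U.smult_car R.one_closed z_sp)
qed

text \<open>On the hyperplane the first n coordinates add up to l - 2 c, with c the last one. By
  \<open>osc_rep_z\<close> the element z acts as c - l/2 - n/4, and the added constant (l + 2)/2 +
  n/4 leaves c + 1.\<close>

lemma urep_zk:
  assumes n: "n \<ge> 1" and y: "y \<in> hyper n l"
  shows "urep n (zk_elt n (l + 2)) w y = (y (n + 1) + 1) * w y"
proof -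
  interpret U: lie_rep "sp n" "osc_rep n" by (rule lie_rep_osc)
  interpret R: ring "env n" by (rule U.ring_E)
  have i: "{1..n+1} = insert (n + 1) {1..n}" by auto
  have "(\<Sum>i\<in>{1..n}. of_int (wvar n i) * y i) = (\<Sum>i\<in>{1..n}. y i)"
    by (intro sum.cong) (auto simp: wvar_def)
  moreover have "of_int (wvar n (n + 1)) = (2 :: complex)" by (simp add: wvar_def)
  moreover have "n + 1 \<notin> {1..n}" by simp
  moreover have "(\<Sum>i\<in>insert (n + 1) {1..n}. of_int (wvar n i) * y i) = of_int l"
    using y unfolding hyper_def i[symmetric] by simp
  ultimately have "2 * y (n + 1) + (\<Sum>i\<in>{1..n}. y i) = of_int l"
    by (simp only: sum.insert[OF finite_atLeastAtMost] not_False_eq_True)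
  then have h: "(\<Sum>i\<in>{1..n}. y i) = of_int l - 2 * y (n + 1)" by (metis add_diff_cancel_left')
  have s: "(\<Sum>i = 1..n. y i + 1 / 2) = of_int l - 2 * y (n + 1) + of_nat n / 2"
    unfolding sum.distrib h by simp
  have "urep n (zk_elt n (l + 2)) w y = osc_rep n (z_elt n) w y + (of_int (l + 2) / 2 + of_nat n / 4) * w y"
    unfolding zk_elt_def
    by (simp add: U.rep_add U.rep_smult U.rep_one U.rep_env_incl[OF z_sp[OF n]] U.env_incl_car[OF z_sp[OF n]] U.smult_car)
  also have "\<dots> = (y (n + 1) + 1) * w y"
    unfolding osc_rep_z[OF n] s by (simp add: field_simps)
  finally show ?thesis .
qed

lemma A_car:
  assumes n: "n \<ge> 1" shows "carrier (A_alg n k) \<subseteq> carrier (env n)"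
proof -
  interpret U: lie_rep "sp n" "osc_rep n" by (rule lie_rep_osc)
  interpret R: ring "env n" by (rule U.ring_E)
  show ?thesis unfolding A_alg_simps
  proof (rule R.generate_ring_incl)
    show "{c \<odot>\<^bsub>env n\<^esub> \<one>\<^bsub>env n\<^esub> | c. True} \<union> (env_incl (sp n) ` levi n \<union> env_incl (sp n) ` r_minus n \<union>
      {env_incl (sp n) x \<otimes>\<^bsub>env n\<^esub> zk_elt n k | x. x \<in> r_plus n}) \<subseteq> carrier (env n)"
      using levi_sp[OF n] r_plus_sp[OF n] r_minus_sp[OF n] zk_car[OF n] U.env_incl_car U.smult_car[OF R.one_closed] R.m_closed by blast
  qed
qed

text \<open>The property holds for the generators and passes to negatives, sums and products, so no
  relation between generators has to be checked.\<close>

theorem A_compat: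
  assumes n: "n \<ge> 1" and u: "u \<in> carrier (A_alg n (l + 2))"
  shows "\<exists>T. compat n l (urep n u) T"
proof -
  interpret U: lie_rep "sp n" "osc_rep n" by (rule lie_rep_osc)
  interpret R: ring "env n" by (rule U.ring_E)
  note car = subsetD[OF A_car[OF n, of "l + 2", unfolded A_alg_simps]]
  show ?thesis using u unfolding A_alg_simps
  proof induction
    case one
    have "compat n l (urep n \<one>\<^bsub>env n\<^esub>) (\<lambda>g. g)" by (rule compat_cong[OF compat_id]) (simp add: U.rep_one)
    then show ?case by blast
  next
    case (incl h)
    then consider c where "h = c \<odot>\<^bsub>env n\<^esub> \<one>\<^bsub>env n\<^esub>" | x where "h = env_incl (sp n) x" "x \<in> levi n"
      | x where "h = env_incl (sp n) x" "x \<in> r_minus n" | x where "h = env_incl (sp n) x \<otimes>\<^bsub>env n\<^esub> zk_elt n (l + 2)" "x \<in> r_plus n"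
      by blast
    then show ?case
    proof cases
      case 1
      have "compat n l (urep n h) (\<lambda>g. kconst c * g)"
        by (rule compat_cong[OF compat_scale[OF compat_id]]) (simp add: 1 U.rep_smult U.rep_one)
      then show ?thesis by blast
    next
      case 2
      then have "urep n h = osc_rep n x" using levi_sp[OF n] U.rep_env_incl by blast
      then show ?thesis using levi_compat[of x n l] levi_graded[OF n] 2 by auto
    next
      case 3
      then have "urep n h = osc_rep n x" using r_minus_sp[OF n] U.rep_env_incl by blast
      then show ?thesis using r_minus_compat[of x n l] r_minus_graded[OF n] 3 by auto
    next
      case 4
      have x: "x \<in> sp n" "x \<in> sp_graded n 1" using 4(2) r_plus_sp[OF n] r_plus_graded[OF n] by auto
      have e: "urep n h w = osc_rep n x (urep n (zk_elt n (l + 2)) w)" for w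
        unfolding 4(1) U.rep_mult[OF U.env_incl_car[OF x(1)] zk_car[OF n]] U.rep_env_incl[OF x(1)] ..
      obtain T where "compat n l (\<lambda>w. osc_rep n x (urep n (zk_elt n (l + 2)) w)) T"
        using r_plus_compat[of n l "urep n (zk_elt n (l + 2))" x, OF urep_zk[OF n] x(2)] by blast
      then have "compat n l (urep n h) T" by (rule compat_cong) (simp only: e)
      then show ?thesis by blast
    qed
  next
    case (a_inv h)
    then obtain T where T: "compat n l (urep n h) T" by blast
    have "compat n l (urep n (\<ominus>\<^bsub>env n\<^esub> h)) (\<lambda>g. kconst (- 1) * T g)"
      by (rule compat_cong[OF compat_scale[OF T]]) (simp add: U.rep_uminus[OF car[OF a_inv.hyps]])
    then show ?case by blast
  next
    case (eng_add h1 h2)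
    then obtain S T where ST: "compat n l (urep n h1) S" "compat n l (urep n h2) T" by blast
    have "compat n l (urep n (h1 \<oplus>\<^bsub>env n\<^esub> h2)) (\<lambda>g. S g + T g)"
      by (rule compat_cong[OF compat_add[OF ST]]) (simp add: U.rep_add[OF car[OF eng_add.hyps(1)] car[OF eng_add.hyps(2)]])
    then show ?case by blast
  next
    case (eng_mult h1 h2)
    then obtain S T where ST: "compat n l (urep n h1) S" "compat n l (urep n h2) T" by blast
    have "compat n l (urep n (h1 \<otimes>\<^bsub>env n\<^esub> h2)) (\<lambda>g. S (T g))"
      by (rule compat_cong[OF compat_comp[OF ST]]) (simp add: U.rep_mult[OF car[OF eng_mult.hyps(1)] car[OF eng_mult.hyps(2)]])
    then show ?case by blast
  qed
qed

section \<open>Operators in the image\<close>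

text \<open>The operators that correspond to elements of the algebra of index l + 2. Surjectivity
  will mean that every global differential operator agrees with one of them in degree l.\<close>

definition alg_ops :: "nat \<Rightarrow> int \<Rightarrow> (rat_fun \<Rightarrow> rat_fun) set" where
  "alg_ops n l = {T. \<exists>u\<in>carrier (A_alg n (l + 2)). compat n l (urep n u) T}"

lemma alg_opsI: "u \<in> carrier (A_alg n (l + 2)) \<Longrightarrow> compat n l (urep n u) T \<Longrightarrow> T \<in> alg_ops n l"
  unfolding alg_ops_def by blast

lemma A_alg_const: "c \<odot>\<^bsub>env n\<^esub> \<one>\<^bsub>env n\<^esub> \<in> carrier (A_alg n k)"
  unfolding A_alg_simps by (rule generate_ring.incl) blast

lemma A_alg_levi: "x \<in> levi n \<Longrightarrow> env_incl (sp n) x \<in> carrier (A_alg n k)"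
  and A_alg_r_minus: "x \<in> r_minus n \<Longrightarrow> env_incl (sp n) x \<in> carrier (A_alg n k)"
  and A_alg_r_plus: "x \<in> r_plus n \<Longrightarrow> env_incl (sp n) x \<otimes>\<^bsub>env n\<^esub> zk_elt n k \<in> carrier (A_alg n k)"
  unfolding A_alg_simps by (rule generate_ring.incl; blast)+

lemma alg_ops_id: "(\<lambda>g. g) \<in> alg_ops n l"
proof (rule alg_opsI)
  interpret U: lie_rep "sp n" "osc_rep n" by (rule lie_rep_osc)
  show "\<one>\<^bsub>env n\<^esub> \<in> carrier (A_alg n (l + 2))" unfolding A_alg_simps by (rule generate_ring.one)
  show "compat n l (urep n \<one>\<^bsub>env n\<^esub>) (\<lambda>g. g)" by (rule compat_cong[OF compat_id]) (simp add: U.rep_one)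
qed

lemma alg_ops_add:
  assumes n: "n \<ge> 1" and "S \<in> alg_ops n l" "T \<in> alg_ops n l" shows "(\<lambda>g. S g + T g) \<in> alg_ops n l"
proof -
  interpret U: lie_rep "sp n" "osc_rep n" by (rule lie_rep_osc)
  obtain u v where uv: "u \<in> carrier (A_alg n (l + 2))" "v \<in> carrier (A_alg n (l + 2))"
    "compat n l (urep n u) S" "compat n l (urep n v) T" using assms unfolding alg_ops_def by blast
  note car = subsetD[OF A_car[OF n] uv(1)] subsetD[OF A_car[OF n] uv(2)]
  show ?thesis
  proof (rule alg_opsI)
    show "u \<oplus>\<^bsub>env n\<^esub> v \<in> carrier (A_alg n (l + 2))" using uv(1,2) unfolding A_alg_simps by (rule generate_ring.eng_add)
    show "compat n l (urep n (u \<oplus>\<^bsub>env n\<^esub> v)) (\<lambda>g. S g + T g)"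
      by (rule compat_cong[OF compat_add[OF uv(3,4)]]) (simp add: U.rep_add[OF car])
  qed
qed

lemma alg_ops_comp:
  assumes n: "n \<ge> 1" and "S \<in> alg_ops n l" "T \<in> alg_ops n l" shows "(\<lambda>g. S (T g)) \<in> alg_ops n l"
proof -
  interpret U: lie_rep "sp n" "osc_rep n" by (rule lie_rep_osc)
  obtain u v where uv: "u \<in> carrier (A_alg n (l + 2))" "v \<in> carrier (A_alg n (l + 2))"
    "compat n l (urep n u) S" "compat n l (urep n v) T" using assms unfolding alg_ops_def by blast
  note car = subsetD[OF A_car[OF n] uv(1)] subsetD[OF A_car[OF n] uv(2)]
  show ?thesis
  proof (rule alg_opsI)
    show "u \<otimes>\<^bsub>env n\<^esub> v \<in> carrier (A_alg n (l + 2))" using uv(1,2) unfolding A_alg_simps by (rule generate_ring.eng_mult)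
    show "compat n l (urep n (u \<otimes>\<^bsub>env n\<^esub> v)) (\<lambda>g. S (T g))"
      by (rule compat_cong[OF compat_comp[OF uv(3,4)]]) (simp add: U.rep_mult[OF car])
  qed
qed

lemma alg_ops_scale:
  assumes n: "n \<ge> 1" and "T \<in> alg_ops n l" shows "(\<lambda>g. kconst c * T g) \<in> alg_ops n l"
proof -
  interpret U: lie_rep "sp n" "osc_rep n" by (rule lie_rep_osc)
  interpret R: ring "env n" by (rule U.ring_E)
  have "(\<lambda>g. kconst c * g) \<in> alg_ops n l"
  proof (rule alg_opsI)
    show "c \<odot>\<^bsub>env n\<^esub> \<one>\<^bsub>env n\<^esub> \<in> carrier (A_alg n (l + 2))" by (rule A_alg_const)
    show "compat n l (urep n (c \<odot>\<^bsub>env n\<^esub> \<one>\<^bsub>env n\<^esub>)) (\<lambda>g. kconst c * g)"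
      by (rule compat_cong[OF compat_scale[OF compat_id]]) (simp add: U.rep_smult U.rep_one)
  qed
  from alg_ops_comp[OF n this assms(2)] show ?thesis .
qed

definition realized :: "nat \<Rightarrow> int \<Rightarrow> (nat \<Rightarrow> int) \<Rightarrow> ((nat \<Rightarrow> complex) \<Rightarrow> complex) \<Rightarrow> bool" where
  "realized n l \<nu> p \<longleftrightarrow> (\<exists>T\<in>alg_ops n l. \<forall>\<mu>\<in>lat n l. T (mon n \<mu>) = kconst (p (cvec \<mu>)) * mon n (\<lambda>k. \<mu> k + \<nu> k))"

lemma realizedI: "T \<in> alg_ops n l \<Longrightarrow> (\<And>\<mu>. \<mu> \<in> lat n l \<Longrightarrow> T (mon n \<mu>) = kconst (p (cvec \<mu>)) * mon n (\<lambda>k. \<mu> k + \<nu> k)) \<Longrightarrow> realized n l \<nu> p"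
  unfolding realized_def by blast

lemma realizedE:
  assumes "realized n l \<nu> p"
  obtains T where "T \<in> alg_ops n l" "\<And>\<mu>. \<mu> \<in> lat n l \<Longrightarrow> T (mon n \<mu>) = kconst (p (cvec \<mu>)) * mon n (\<lambda>k. \<mu> k + \<nu> k)"
  using assms unfolding realized_def by blast

lemma realized_cong:
  assumes "realized n l \<nu> p" "\<And>x. x \<in> hyper n l \<Longrightarrow> p x = q x"
  shows "realized n l \<nu> q"
proof -
  obtain T where T: "T \<in> alg_ops n l" "\<And>\<mu>. \<mu> \<in> lat n l \<Longrightarrow> T (mon n \<mu>) = kconst (p (cvec \<mu>)) * mon n (\<lambda>k. \<mu> k + \<nu> k)"
    using assms(1) by (rule realizedE) blast
  show ?thesis by (rule realizedI[OF T(1)]) (simp only: T(2) assms(2)[OF hyper_cvec])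
qed

lemma realized_add:
  assumes n: "n \<ge> 1" and "realized n l \<nu> p" "realized n l \<nu> q" shows "realized n l \<nu> (\<lambda>x. p x + q x)"
proof -
  obtain S where S: "S \<in> alg_ops n l" "\<And>\<mu>. \<mu> \<in> lat n l \<Longrightarrow> S (mon n \<mu>) = kconst (p (cvec \<mu>)) * mon n (\<lambda>k. \<mu> k + \<nu> k)"
    using assms(2) by (rule realizedE) blast
  obtain T where T: "T \<in> alg_ops n l" "\<And>\<mu>. \<mu> \<in> lat n l \<Longrightarrow> T (mon n \<mu>) = kconst (q (cvec \<mu>)) * mon n (\<lambda>k. \<mu> k + \<nu> k)"
    using assms(3) by (rule realizedE) blast
  show ?thesis by (rule realizedI[OF alg_ops_add[OF n S(1) T(1)]]) (simp only: S(2) T(2) kconst_add distrib_right)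
qed

lemma realized_mult:
  assumes n: "n \<ge> 1" and "realized n l \<nu> p" and \<nu>': "\<nu>' \<in> lat n 0" and "realized n l \<nu>' p'"
  shows "realized n l (\<lambda>k. \<nu>' k + \<nu> k) (\<lambda>x. p (\<lambda>k. x k + cvec \<nu>' k) * p' x)"
proof -
  obtain S where S: "S \<in> alg_ops n l" "\<And>\<mu>. \<mu> \<in> lat n l \<Longrightarrow> S (mon n \<mu>) = kconst (p (cvec \<mu>)) * mon n (\<lambda>k. \<mu> k + \<nu> k)"
    using assms(2) by (rule realizedE) blast
  obtain T where T: "T \<in> alg_ops n l" "\<And>\<mu>. \<mu> \<in> lat n l \<Longrightarrow> T (mon n \<mu>) = kconst (p' (cvec \<mu>)) * mon n (\<lambda>k. \<mu> k + \<nu>' k)"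
    using assms(4) by (rule realizedE) blast
  have S': "S (kconst c * g) = kconst c * S g" for c g
    using S(1) unfolding alg_ops_def compat_def good_op_def by blast
  show ?thesis
  proof (rule realizedI[OF alg_ops_comp[OF n S(1) T(1)]])
    fix \<mu> assume m: "\<mu> \<in> lat n l"
    have m': "(\<lambda>k. \<mu> k + \<nu>' k) \<in> lat n l" using lat_add[OF m \<nu>'] by simp
    have e: "cvec (\<lambda>k. \<mu> k + \<nu>' k) = (\<lambda>k. cvec \<mu> k + cvec \<nu>' k)" by (simp add: cvec_def)
    show "S (T (mon n \<mu>)) = kconst (p (\<lambda>k. cvec \<mu> k + cvec \<nu>' k) * p' (cvec \<mu>)) * mon n (\<lambda>k. \<mu> k + (\<nu>' k + \<nu> k))"
      unfolding T(2)[OF m] S' S(2)[OF m'] e kconst_mult by (simp only: mult_ac add.assoc)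
  qed
qed

lemma zero_lat: "(\<lambda>_. 0) \<in> lat n 0"
  by (simp add: lat_def wt_def)

lemma realized_const: 
  assumes n: "n \<ge> 1" shows "realized n l (\<lambda>_. 0) (\<lambda>x. c)"
  by (rule realizedI[OF alg_ops_scale[OF n alg_ops_id]]) simp

text \<open>The symmetrised product is b_j a_i plus half a commutator, a constant that is nonzero
  for i = j only. The constants contained in the algebra remove it in
  \<open>realized_gl\<close>.\<close>

lemma compat_gl_osc_rep:
  assumes ij: "i < n" "j < n"
  shows "compat n l (osc_rep n (sp_unit n i j))
    (\<lambda>g. kconst (- 1) * (kvar (j + 1) * kder (i + 1) g) + kconst (- osc_form n i (j + n) / 2) * g)"
proof (rule compat_cong[OF compat_add[OF compat_scale[OF compat_gl[OF ij]] compat_scale[OF compat_id]]])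
  fix w x
  have b: "bar n j = j + n" "half_sg n j = - 1 / 2" using ij by (simp_all add: bar_def half_sg_def sg_def)
  have "i < 2 * n" "j < 2 * n" "j + n < 2 * n" using ij by auto
  from osc_rep_sp_unit[OF this(1,2), of w x] osc_commute[OF this(1,3), of w x]
  show "- 1 * osc n (j + n) (osc n i w) x + - osc_form n i (j + n) / 2 * w x = osc_rep n (sp_unit n i j) w x"
    unfolding b by (simp add: algebra_simps)
qed

lemma realized_gl:
  assumes n: "n \<ge> 1" and ij: "i < n" "j < n" shows "realized n l (nu_gl i j) (\<lambda>x. x (i + 1))"
proof (rule realizedI)
  interpret U: lie_rep "sp n" "osc_rep n" by (rule lie_rep_osc)
  let ?T = "\<lambda>g. kconst (- 1) * (kvar (j + 1) * kder (i + 1) g) + kconst (- osc_form n i (j + n) / 2) * g"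
  have lv: "sp_unit n i j \<in> levi n" by (rule sp_unit_levi[OF n ij])
  have "urep n (env_incl (sp n) (sp_unit n i j)) = osc_rep n (sp_unit n i j)"
    by (rule U.rep_env_incl[OF subsetD[OF levi_sp[OF n] lv]])
  then have "?T \<in> alg_ops n l"
    using alg_opsI[OF A_alg_levi[OF lv], of l ?T] compat_gl_osc_rep[OF ij, of l] by simp
  from alg_ops_add[OF n alg_ops_scale[OF n this, of "- 1"] alg_ops_scale[OF n alg_ops_id, of "- osc_form n i (j + n) / 2"]]
  show "(\<lambda>g. kvar (j + 1) * kder (i + 1) g) \<in> alg_ops n l"
    by (simp add: kconst_uminus)
qed (simp only: gl_mon[OF ij])

lemma realized_low:
  assumes n: "n \<ge> 1" and ij: "i < n" "j < n" shows "realized n l (nu_low n i j) (\<lambda>x. x (n + 1))"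
proof (rule realizedI)
  interpret U: lie_rep "sp n" "osc_rep n" by (rule lie_rep_osc)
  let ?D = "\<lambda>g. kvar (i + 1) * (kvar (j + 1) * kder (n + 1) g)"
  have rm: "sp_unit n (i + n) j \<in> r_minus n" by (rule sp_unit_r_minus[OF n ij])
  have b: "bar n j = j + n" "half_sg n j = - 1 / 2" using ij by (simp_all add: bar_def half_sg_def sg_def)
  have r: "i + n < 2 * n" "j < 2 * n" "j + n < 2 * n" "osc_form n (i + n) (j + n) = 0" using ij by (auto simp: osc_form_def bar_def)
  have "compat n l (urep n (env_incl (sp n) (sp_unit n (i + n) j))) (\<lambda>g. kconst (- 1) * ?D g)"
    unfolding U.rep_env_incl[OF subsetD[OF r_minus_sp[OF n] rm]]
  proof (rule compat_cong[OF compat_scale[OF compat_low[OF ij]]])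
    fix w x
    show "- 1 * osc n (i + n) (osc n (j + n) w) x = osc_rep n (sp_unit n (i + n) j) w x"
      unfolding osc_rep_sp_unit[OF r(1,2)] b using osc_commute[OF r(1,3), of w x] r(4) by simp
  qed
  from alg_ops_scale[OF n alg_opsI[OF A_alg_r_minus[OF rm] this], of "- 1"]
  show "?D \<in> alg_ops n l" by (simp add: kconst_uminus)
qed (simp only: low_mon[OF ij])

text \<open>As a_i and a_j commute, the symmetrised product is a_i a_j itself and no constant has to
  be removed; z_k turns it into a differential operator.\<close>

lemma realized_up:
  assumes n: "n \<ge> 1" and ij: "i < n" "j < n"
  shows "realized n l (nu_up n i j) (\<lambda>x. x (j + 1) * (x (i + 1) - of_int (unit_at (j + 1) (i + 1))))"
proof (rule realizedI)
  interpret U: lie_rep "sp n" "osc_rep n" by (rule lie_rep_osc)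
  let ?D = "\<lambda>g. kvar (n + 1) * kder (i + 1) (kder (j + 1) g)"
  let ?zk = "zk_elt n (l + 2)" and ?x = "sp_unit n i (j + n)"
  have rp: "?x \<in> r_plus n" by (rule sp_unit_r_plus[OF n ij])
  have xs: "?x \<in> sp n" by (rule subsetD[OF r_plus_sp[OF n] rp])
  have b: "bar n (j + n) = j" "half_sg n (j + n) = 1 / 2" using ij by (simp_all add: bar_def half_sg_def sg_def)
  have r: "i < 2 * n" "j + n < 2 * n" "j < 2 * n" "osc_form n i j = 0" using ij by (auto simp: osc_form_def bar_def)
  have "compat n l (urep n (env_incl (sp n) ?x \<otimes>\<^bsub>env n\<^esub> ?zk)) ?D"
  proof (rule compat_cong[OF compat_up[OF ij, of l "urep n ?zk"]])
    fix w y assume "y \<in> hyper n l"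
    then show "urep n ?zk w y = (y (n + 1) + 1) * w y" by (rule urep_zk[OF n])
  next
    fix w x
    show "osc n i (osc n j (urep n ?zk w)) x = urep n (env_incl (sp n) ?x \<otimes>\<^bsub>env n\<^esub> ?zk) w x"
      unfolding U.rep_mult[OF U.env_incl_car[OF xs] zk_car[OF n]] U.rep_env_incl[OF xs] osc_rep_sp_unit[OF r(1,2)] b
      using osc_commute[OF r(1,3), of "urep n ?zk w" x] r(4) by simp
  qed
  from alg_opsI[OF A_alg_r_plus[OF rp] this] show "?D \<in> alg_ops n l" .
qed (simp only: up_mon[OF ij])

text \<open>For i \<le> n the operator Q_i d_i multiplies Q^\<mu> by \<mu>_i; the last exponent is a
  linear function of these in fixed degree l.\<close>

lemma realized_polyfun:
  assumes n: "n \<ge> 1" and "q \<in> polyfun n" shows "realized n l (\<lambda>_. 0) q"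
  using assms(2)
proof induction
  case (const c)
  then show ?case by (rule realized_const[OF n])
next
  case (add p q)
  then show ?case by (intro realized_add[OF n])
next
  case (mult p q)
  from realized_mult[OF n mult.IH(1) zero_lat mult.IH(2)] show ?case by (simp add: cvec_def)
next
  case (coord i)
  have c: "realized n l (\<lambda>_. 0) (\<lambda>x. x i)" if i: "i \<in> {1..n}" for i
  proof -
    have "i - 1 < n" "i - 1 + 1 = i" using i by auto
    with realized_gl[OF n this(1) this(1), of l] show ?thesis by (simp add: nu_gl_def)
  qed
  show ?case
  proof (cases "i = n + 1")
    case False
    then show ?thesis using c coord by auto
  next
    case True
    have s: "realized n l (\<lambda>_. 0) (\<lambda>x. \<Sum>i\<in>A. x i)" if "finite A" "A \<subseteq> {1..n}" for A
      using that
    proof (induction A)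
      case empty
      then show ?case using realized_const[OF n, of l 0] by simp
    next
      case (insert a A)
      have "realized n l (\<lambda>_. 0) (\<lambda>x. x a + (\<Sum>i\<in>A. x i))"
        by (rule realized_add[OF n c insert.IH]) (use insert.prems in auto)
      then show ?case using insert.hyps by simp
    qed
    have m: "realized n l (\<lambda>_. 0) (\<lambda>x. c * p x)" if "realized n l (\<lambda>_. 0) p" for c p
      using realized_mult[OF n realized_const[OF n, of l c] zero_lat that] by simp
    have "realized n l (\<lambda>_. 0) (\<lambda>x. of_int l / 2 + (- 1 / 2) * (\<Sum>i\<in>{1..n}. x i))"
      by (rule realized_add[OF n realized_const[OF n] m[OF s]]) auto
    then show ?thesis
    proof (rule realized_cong)
      fix x assume x: "x \<in> hyper n l"
      have i: "{1..n+1} = insert (n + 1) {1..n}" by auto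
      have "(\<Sum>i\<in>{1..n}. of_int (wvar n i) * x i) = (\<Sum>i\<in>{1..n}. x i)"
        by (intro sum.cong) (auto simp: wvar_def)
      moreover have "of_int (wvar n (n + 1)) = (2 :: complex)" by (simp add: wvar_def)
      moreover have "n + 1 \<notin> {1..n}" by simp
      moreover have "(\<Sum>i\<in>insert (n + 1) {1..n}. of_int (wvar n i) * x i) = of_int l"
        using x unfolding hyper_def i[symmetric] by simp
      ultimately have "2 * x (n + 1) + (\<Sum>i\<in>{1..n}. x i) = of_int l"
        by (simp only: sum.insert[OF finite_atLeastAtMost] not_False_eq_True)
      then show "of_int l / 2 + (- 1 / 2) * (\<Sum>i\<in>{1..n}. x i) = x i" unfolding True by (simp add: field_simps)
    qed
  qed
qed

section \<open>Falling factorials and shifts without cancellation\<close>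

definition fall :: "nat \<Rightarrow> complex \<Rightarrow> complex" where "fall m x = (\<Prod>c<m. x - of_nat c)"

lemma fall_0 [simp]: "fall 0 x = 1" by (simp add: fall_def)

lemma fall_1 [simp]: "fall (Suc 0) x = x" by (simp add: fall_def)

lemma fall_2: "fall 2 x = x * (x - 1)" by (simp add: fall_def numeral_2_eq_2)

lemma fall_add: "fall (a + b) x = fall b (x - of_nat a) * fall a x"
  by (induction b) (simp_all add: fall_def algebra_simps)

text \<open>The factor by which the derivatives of order - \<nu>_j for all \<nu>_j < 0, followed by
  multiplication with the variables of positive \<nu>_j, act on Q^x; \<open>nat\<close> gives order
  0 where \<nu>_j \<ge> 0.\<close>

definition ffac :: "nat \<Rightarrow> (nat \<Rightarrow> int) \<Rightarrow> (nat \<Rightarrow> complex) \<Rightarrow> complex" where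
  "ffac n \<nu> x = (\<Prod>j\<in>{1..n+1}. fall (nat (- \<nu> j)) (x j))"

text \<open>Where both shifts are negative, one falling factorial continues the other by
  \<open>fall_add\<close>; where both are nonnegative, all factors are 1. Opposite signs must be
  excluded: Q_j d_j has symbol x_j, while its total shift 0 gives 1.\<close>

lemma ffac_add:
  assumes "\<And>j. j \<in> {1..n+1} \<Longrightarrow> 0 \<le> \<nu> j \<and> 0 \<le> \<nu>' j \<or> \<nu> j \<le> 0 \<and> \<nu>' j \<le> 0"
  shows "ffac n (\<lambda>k. \<nu>' k + \<nu> k) x = ffac n \<nu> (\<lambda>k. x k + cvec \<nu>' k) * ffac n \<nu>' x"
  unfolding ffac_def prod.distrib[symmetric]
proof (rule prod.cong[OF refl])
  fix j assume "j \<in> {1..n+1}"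
  then consider "0 \<le> \<nu> j" "0 \<le> \<nu>' j" | "\<nu> j \<le> 0" "\<nu>' j \<le> 0" using assms by blast
  then show "fall (nat (- (\<nu>' j + \<nu> j))) (x j) = fall (nat (- \<nu> j)) (x j + cvec \<nu>' j) * fall (nat (- \<nu>' j)) (x j)"
  proof cases
    case 2
    have "nat (- (\<nu>' j + \<nu> j)) = nat (- \<nu>' j) + nat (- \<nu> j)" using 2 by simp
    moreover have "x j - of_nat (nat (- \<nu>' j)) = x j + cvec \<nu>' j" using 2 by (simp add: cvec_def)
    ultimately show ?thesis by (simp only: fall_add)
  qed simp
qed

lemma ffac_supp:
  assumes "finite A" "A \<subseteq> {1..n+1}" "\<And>j. j \<in> {1..n+1} \<Longrightarrow> j \<notin> A \<Longrightarrow> \<nu> j \<ge> 0"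
  shows "ffac n \<nu> x = (\<Prod>j\<in>A. fall (nat (- \<nu> j)) (x j))"
  unfolding ffac_def by (rule prod.mono_neutral_right) (use assms in auto)

text \<open>For i = j the shift \<open>nu_gl\<close> is zero and its \<open>ffac\<close> is 1,
  whereas the operator multiplies by x_(i+1); hence the restriction in the first claim. For
  \<open>nu_up\<close> with i = j a falling factorial of length 2 appears.\<close>

lemma realized_ffac_gens:
  assumes n: "n \<ge> 1" and ij: "i < n" "j < n"
  shows "i \<noteq> j \<Longrightarrow> realized n l (nu_gl i j) (ffac n (nu_gl i j))"
    and "realized n l (nu_low n i j) (ffac n (nu_low n i j))"
    and "realized n l (nu_up n i j) (ffac n (nu_up n i j))"
proof -
  show "realized n l (nu_gl i j) (ffac n (nu_gl i j))" if d: "i \<noteq> j"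
  proof (rule realized_cong[OF realized_gl[OF n ij]])
    fix x
    have "ffac n (nu_gl i j) x = (\<Prod>k\<in>{i + 1}. fall (nat (- nu_gl i j k)) (x k))"
      by (rule ffac_supp) (use ij in \<open>auto simp: nu_gl_def unit_at_def\<close>)
    then show "x (i + 1) = ffac n (nu_gl i j) x" using d by (simp add: nu_gl_def unit_at_def)
  qed
  show "realized n l (nu_low n i j) (ffac n (nu_low n i j))"
  proof (rule realized_cong[OF realized_low[OF n ij]])
    fix x
    have "ffac n (nu_low n i j) x = (\<Prod>k\<in>{n + 1}. fall (nat (- nu_low n i j k)) (x k))"
      by (rule ffac_supp) (use ij in \<open>auto simp: nu_low_def unit_at_def\<close>)
    then show "x (n + 1) = ffac n (nu_low n i j) x" using ij by (simp add: nu_low_def unit_at_def)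
  qed
  show "realized n l (nu_up n i j) (ffac n (nu_up n i j))"
  proof (rule realized_cong[OF realized_up[OF n ij]])
    fix x
    have e: "ffac n (nu_up n i j) x = (\<Prod>k\<in>{i + 1, j + 1}. fall (nat (- nu_up n i j k)) (x k))"
      by (rule ffac_supp) (use ij in \<open>auto simp: nu_up_def unit_at_def\<close>)
    show "x (j + 1) * (x (i + 1) - of_int (unit_at (j + 1) (i + 1))) = ffac n (nu_up n i j) x"
      unfolding e using ij by (cases "i = j") (auto simp: nu_up_def unit_at_def fall_2)
  qed
qed

lemma sum_wvar_split: "(\<Sum>i\<in>{1..n+1}. wvar n i * \<mu> i) = (\<Sum>i\<in>{1..n}. \<mu> i) + 2 * \<mu> (n + 1)"
proof -
  have "{1..n+1} = insert (n + 1) {1..n}" by auto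
  moreover have "(\<Sum>i\<in>{1..n}. wvar n i * \<mu> i) = (\<Sum>i\<in>{1..n}. \<mu> i)" by (intro sum.cong) (auto simp: wvar_def)
  ultimately show ?thesis by (simp add: wvar_def)
qed

lemma exists_neg: "(\<Sum>i\<in>A. f i) < (0 :: int) \<Longrightarrow> \<exists>i\<in>A. f i < 0"
  using sum_nonneg[of A f] by (metis linorder_not_less)

text \<open>After one negative coordinate is raised by 1, the sum is still negative and a second
  index can be chosen. It may be the same one if that coordinate was at most -2, the case i = j of
  \<open>nu_up\<close> and \<open>nu_low\<close>.\<close>

lemma exists_two_neg:
  assumes "(\<Sum>i\<in>{1..n}. f i) \<le> (- 2 :: int)"
  obtains i j where "i < n" "j < n" "f (i + 1) < 0" "f (j + 1) + unit_at (i + 1) (j + 1) < 0"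
proof -
  obtain a where a: "a \<in> {1..n}" "f a < 0" using exists_neg[of f "{1..n}"] assms by auto
  have "(\<Sum>k\<in>{1..n}. f k + unit_at a k) = (\<Sum>k\<in>{1..n}. f k) + 1"
    using a by (simp add: sum.distrib unit_at_def sum.delta)
  then obtain b where b: "b \<in> {1..n}" "f b + unit_at a b < 0" using exists_neg[of "\<lambda>k. f k + unit_at a k" "{1..n}"] assms by auto
  have "a - 1 < n" "b - 1 < n" "a - 1 + 1 = a" "b - 1 + 1 = b" using a b by auto
  then show ?thesis using that[of "a - 1" "b - 1"] a b by simp
qed

text \<open>A nonzero lattice vector of degree \<open>0\<close> splits off one of the generating directions without cancellation in any
  coordinate.\<close>

lemma conformal_split:
  assumes nu: "\<nu> \<in> lat n 0" "\<nu> \<noteq> (\<lambda>_. 0)"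
  obtains \<delta> where "(\<exists>i<n. \<exists>j<n. i \<noteq> j \<and> \<delta> = nu_gl i j) \<or> (\<exists>i<n. \<exists>j<n. \<delta> = nu_low n i j) \<or> (\<exists>i<n. \<exists>j<n. \<delta> = nu_up n i j)"
    "\<forall>k. \<delta> k > 0 \<longrightarrow> \<delta> k \<le> \<nu> k" "\<forall>k. \<delta> k < 0 \<longrightarrow> \<nu> k \<le> \<delta> k"
proof -
  have z: "\<nu> i = 0" if "i \<notin> {1..n+1}" for i using nu that by (simp add: lat_def)
  have s: "(\<Sum>i\<in>{1..n}. \<nu> i) + 2 * \<nu> (n + 1) = 0" using nu(1) unfolding lat_def wt_def sum_wvar_split by simp
  consider "\<nu> (n + 1) > 0" | "\<nu> (n + 1) < 0" | "\<nu> (n + 1) = 0" by linarith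
  then show ?thesis
  proof cases
    \<comment> \<open>The last coordinate has weight 2 and the total degree is 0, so the other
      coordinates add up to at most -2.\<close>
    case 1
    then have "(\<Sum>i\<in>{1..n}. \<nu> i) \<le> - 2" using s by linarith
    then obtain i j where ij: "i < n" "j < n" "\<nu> (i + 1) < 0" "\<nu> (j + 1) + unit_at (i + 1) (j + 1) < 0" by (rule exists_two_neg)
    show ?thesis
    proof (rule that[of "nu_up n i j"])
      show "\<forall>k. nu_up n i j k > 0 \<longrightarrow> nu_up n i j k \<le> \<nu> k"
        using ij 1 by (auto simp: nu_up_def unit_at_def split: if_splits)
      show "\<forall>k. nu_up n i j k < 0 \<longrightarrow> \<nu> k \<le> nu_up n i j k"
        using ij 1 by (auto simp: nu_up_def unit_at_def split: if_splits)
    qed (use ij in blast)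
  next
    case 2
    have "(\<Sum>i\<in>{1..n}. - \<nu> i) \<le> - 2" using s 2 by (simp add: sum_negf)
    then obtain i j where ij: "i < n" "j < n" "- \<nu> (i + 1) < 0" "- \<nu> (j + 1) + unit_at (i + 1) (j + 1) < 0"
      by (rule exists_two_neg)
    show ?thesis
    proof (rule that[of "nu_low n i j"])
      show "\<forall>k. nu_low n i j k > 0 \<longrightarrow> nu_low n i j k \<le> \<nu> k"
        using ij 2 by (auto simp: nu_low_def unit_at_def split: if_splits)
      show "\<forall>k. nu_low n i j k < 0 \<longrightarrow> \<nu> k \<le> nu_low n i j k"
        using ij 2 by (auto simp: nu_low_def unit_at_def split: if_splits)
    qed (use ij in blast)
  next
    \<comment> \<open>The coordinates up to n add up to 0 and do not all vanish, so one of them is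
      positive and one negative; the generator moves one unit between them.\<close>
    case 3
    obtain a where a: "\<nu> a \<noteq> 0" using nu(2) by (auto simp: fun_eq_iff)
    then have "a \<in> {1..n+1}" "a \<noteq> n + 1" using z 3 by auto
    then have aI: "a \<in> {1..n}" by auto
    have s0: "(\<Sum>i\<in>{1..n}. \<nu> i) = 0" using s 3 by simp
    have r: "(\<Sum>i\<in>{1..n} - {a}. \<nu> i) = - \<nu> a" using s0 sum.remove[OF _ aI, of \<nu>] by simp
    have "\<exists>i\<in>{1..n}. \<nu> i < 0"
    proof (cases "\<nu> a < 0")
      case False
      then show ?thesis using exists_neg[of \<nu> "{1..n} - {a}"] r a by auto
    qed (use aI in blast)
    then obtain p where p: "p \<in> {1..n}" "\<nu> p < 0" by blast
    have "\<exists>i\<in>{1..n}. - \<nu> i < 0"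
    proof (cases "\<nu> a > 0")
      case False
      then show ?thesis using exists_neg[of "\<lambda>i. - \<nu> i" "{1..n} - {a}"] r a by (auto simp: sum_negf)
    qed (use aI in force)
    then obtain q where q: "q \<in> {1..n}" "\<nu> q > 0" by auto
    have pq: "p - 1 < n" "q - 1 < n" "p - 1 + 1 = p" "q - 1 + 1 = q" using p q by auto
    have ne: "p - 1 \<noteq> q - 1"
    proof
      assume "p - 1 = q - 1"
      then have "p = q" using pq(3,4) by metis
      then show False using p q by simp
    qed
    have e: "nu_gl (p - 1) (q - 1) = (\<lambda>k. unit_at q k - unit_at p k)" unfolding nu_gl_def pq(3,4) ..
    show ?thesis
    proof (rule that[of "nu_gl (p - 1) (q - 1)"])
      show "\<forall>k. nu_gl (p - 1) (q - 1) k > 0 \<longrightarrow> nu_gl (p - 1) (q - 1) k \<le> \<nu> k"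
        unfolding e using q by (auto simp: unit_at_def split: if_splits)
      show "\<forall>k. nu_gl (p - 1) (q - 1) k < 0 \<longrightarrow> \<nu> k \<le> nu_gl (p - 1) (q - 1) k"
        unfolding e using p by (auto simp: unit_at_def split: if_splits)
    qed (use pq ne in blast)
  qed
qed

text \<open>Induction on the sum of the absolute values: \<open>conformal_split\<close> removes a
  generator without a change of sign in any coordinate, and by \<open>ffac_add\<close> the composite
  has the required symbol.\<close>

lemma realized_ffac:
  assumes n: "n \<ge> 1" and nu: "\<nu> \<in> lat n 0"
  shows "realized n l \<nu> (ffac n \<nu>)"
  using nu
proof (induction "\<Sum>j\<in>{1..n+1}. nat \<bar>\<nu> j\<bar>" arbitrary: \<nu> rule: less_induct)
  case less
  show ?case
  proof (cases "\<nu> = (\<lambda>_. 0)")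
    case True
    show ?thesis unfolding True by (rule realized_cong[OF realized_const[OF n, of _ 1]]) (simp add: ffac_def)
  next
    case False
    obtain \<delta> where d: "(\<exists>i<n. \<exists>j<n. i \<noteq> j \<and> \<delta> = nu_gl i j) \<or> (\<exists>i<n. \<exists>j<n. \<delta> = nu_low n i j) \<or> (\<exists>i<n. \<exists>j<n. \<delta> = nu_up n i j)"
      and dp: "\<forall>k. \<delta> k > 0 \<longrightarrow> \<delta> k \<le> \<nu> k" and dn: "\<forall>k. \<delta> k < 0 \<longrightarrow> \<nu> k \<le> \<delta> k"
      by (rule conformal_split[OF less.prems False]) (rule that)
    have dl: "\<delta> \<in> lat n 0" using d by (elim disjE exE conjE) (simp_all only: nu_lat)
    have dr: "realized n l \<delta> (ffac n \<delta>)" using d by (elim disjE exE conjE) (simp_all only: realized_ffac_gens[OF n] not_False_eq_True)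
    have dnz: "\<exists>k\<in>{1..n+1}. \<delta> k \<noteq> 0"
    proof -
      consider i j where "i < n" "j < n" "i \<noteq> j" "\<delta> = nu_gl i j" | i j where "i < n" "j < n" "\<delta> = nu_low n i j"
        | i j where "i < n" "j < n" "\<delta> = nu_up n i j" using d by blast
      then show ?thesis
      proof cases
        case 1
        then show ?thesis by (intro bexI[of _ "i + 1"]) (auto simp: nu_gl_def unit_at_def)
      next
        case 2
        then show ?thesis by (intro bexI[of _ "n + 1"]) (auto simp: nu_low_def unit_at_def)
      next
        case 3
        then show ?thesis by (intro bexI[of _ "n + 1"]) (auto simp: nu_up_def unit_at_def)
      qed
    qed
    define \<nu>' where "\<nu>' = (\<lambda>k. \<nu> k - \<delta> k)"
    have nl: "\<nu>' \<in> lat n 0" unfolding \<nu>'_def using lat0_diff[OF less.prems dl] by simp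
    have sgn: "0 \<le> \<nu>' k \<and> 0 \<le> \<delta> k \<or> \<nu>' k \<le> 0 \<and> \<delta> k \<le> 0" for k
      using dp[rule_format, of k] dn[rule_format, of k] unfolding \<nu>'_def by linarith
    have le: "\<bar>\<nu>' k\<bar> \<le> \<bar>\<nu> k\<bar>" "\<delta> k \<noteq> 0 \<Longrightarrow> \<bar>\<nu>' k\<bar> < \<bar>\<nu> k\<bar>" for k
      using dp[rule_format, of k] dn[rule_format, of k] unfolding \<nu>'_def by linarith+
    have "(\<Sum>j\<in>{1..n+1}. nat \<bar>\<nu>' j\<bar>) < (\<Sum>j\<in>{1..n+1}. nat \<bar>\<nu> j\<bar>)"
    proof (rule sum_strict_mono_ex1)
      show "\<forall>x\<in>{1..n+1}. nat \<bar>\<nu>' x\<bar> \<le> nat \<bar>\<nu> x\<bar>" using le(1) by (simp add: nat_mono)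
      show "\<exists>a\<in>{1..n+1}. nat \<bar>\<nu>' a\<bar> < nat \<bar>\<nu> a\<bar>"
      proof -
        obtain k where k: "k \<in> {1..n+1}" "\<delta> k \<noteq> 0" using dnz by blast
        have "nat \<bar>\<nu>' k\<bar> < nat \<bar>\<nu> k\<bar>" using le(2)[OF k(2)] by simp
        then show ?thesis using k(1) by blast
      qed
    qed simp
    from less.hyps[OF this nl] have "realized n l \<nu>' (ffac n \<nu>')" .
    from realized_mult[OF n this dl dr] have r: "realized n l (\<lambda>k. \<delta> k + \<nu>' k) (\<lambda>x. ffac n \<nu>' (\<lambda>k. x k + cvec \<delta> k) * ffac n \<delta> x)" .
    have e: "(\<lambda>k. \<delta> k + \<nu>' k) = \<nu>" by (simp add: \<nu>'_def)
    have "realized n l (\<lambda>k. \<delta> k + \<nu>' k) (ffac n (\<lambda>k. \<delta> k + \<nu>' k))"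
      by (rule realized_cong[OF r]) (simp only: ffac_add[OF sgn])
    then show ?thesis unfolding e .
  qed
qed

section \<open>Coefficients of global differential operators\<close>

lemma kvar_inverse_reg:
  assumes P: "P \<in> pts n" and j: "j \<in> {1..n+1}" "varp j \<notin> P"
  shows "inverse (kvar j) \<in> reg n P (- wvar n j)"
proof -
  have "Fract 1 (varp j) \<in> reg n P (- wvar n j)" by (rule regI[OF _ varp_G[OF j(1)] j(2)]) simp
  then show ?thesis by (simp add: Fract_eq_emb kvar_def inverse_eq_divide)
qed

lemma reg_power: "P \<in> pts n \<Longrightarrow> g \<in> reg n P m \<Longrightarrow> g ^ k \<in> reg n P (int k * m)"
proof (induction k)
  case 0
  then show ?case using reg_const[OF 0(1), of 1] by simp
next
  case (Suc k)
  from reg_mult[OF Suc.prems Suc.IH[OF Suc.prems]] show ?case by (simp add: algebra_simps)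
qed

lemma kvar_powi_reg:
  assumes P: "P \<in> pts n" and j: "j \<in> {1..n+1}" "varp j \<notin> P \<or> e \<ge> 0"
  shows "kvar j powi e \<in> reg n P (wvar n j * e)"
proof (cases "e \<ge> 0")
  case True
  then show ?thesis using reg_power[OF P reg_kvar[OF P j(1)], of "nat e"] by (simp add: power_int_def mult.commute)
next
  case False
  then show ?thesis using reg_power[OF P kvar_inverse_reg[OF P j(1)], of "nat (- e)"] j(2)
    by (simp add: power_int_def mult.commute)
qed

lemma reg_prod:
  assumes P: "P \<in> pts n" and "\<And>i. i \<in> A \<Longrightarrow> f i \<in> reg n P (m i)"
  shows "(\<Prod>i\<in>A. f i) \<in> reg n P (\<Sum>i\<in>A. m i)"
  using assms(2)
proof (induction A rule: infinite_finite_induct)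
  case (insert a A)
  then show ?case using reg_mult[OF P, of "f a" "m a"] by simp
qed (use reg_const[OF P, of 1] in simp_all)

lemma mon_reg:
  assumes P: "P \<in> pts n" and "\<And>j. j \<in> {1..n+1} \<Longrightarrow> varp j \<notin> P \<or> \<mu> j \<ge> 0"
  shows "mon n \<mu> \<in> reg n P (wt n \<mu>)"
  unfolding mon_def wt_def by (rule reg_prod[OF P kvar_powi_reg[OF P _ assms(2)]])

text \<open>The monomial has poles along the variables of S at most, so it is regular where their
  product f does not vanish, and so is its image. By \<open>regular_off_hypersurface\<close> a power
  of f times the image is a polynomial; dividing by that power creates poles along S only. S is the
  set of all variables for the Laurent property and a single variable for the charts.\<close>

lemma preserving_mon_coef:
  assumes F: "preserving n l (pts n) F" and S: "S \<subseteq> {1..n+1}" "S \<noteq> {}"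
    and \<mu>: "\<mu> \<in> lat n l" "\<And>k. k \<in> {1..n+1} \<Longrightarrow> k \<notin> S \<Longrightarrow> \<mu> k \<ge> 0"
  shows "\<exists>c. is_coef n l (F (mon n \<mu>)) c \<and> (\<forall>\<kappa>. c \<kappa> \<noteq> 0 \<longrightarrow> (\<forall>i. i \<notin> S \<longrightarrow> \<kappa> i \<ge> 0))"
proof -
  define f where "f = (\<Prod>k\<in>S. varp k)"
  define e where "e = (\<Sum>k\<in>S. wvar n k)"
  have fS: "finite S" using S(1) finite_subset by blast
  have G_prod: "(\<Prod>k\<in>A. varp k) \<in> G n (\<Sum>k\<in>A. wvar n k)" if "finite A" "A \<subseteq> {1..n+1}" for A
    using that
  proof (induction A)
    case (insert a A)
    have "a \<in> {1..n+1}" "A \<subseteq> {1..n+1}" using insert.prems by auto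
    from G_mult[OF varp_G[OF this(1)] insert.IH[OF this(2)]] show ?case using insert.hyps by simp
  qed simp
  have fG: "f \<in> G n e" unfolding f_def e_def by (rule G_prod[OF fS S(1)])
  have e0: "e > 0" unfolding e_def by (rule sum_pos[OF fS S(2)]) (simp add: wvar_def)
  have nP: "varp k \<notin> P" if P: "P \<in> pts n" "f \<notin> P" and k: "k \<in> S" for P k
  proof
    assume "varp k \<in> P"
    moreover have "(\<Prod>k\<in>S - {k}. varp k) \<in> wcar n" by (rule G_car[OF G_prod]) (use fS S in auto)
    ultimately have "(\<Prod>k\<in>S - {k}. varp k) * varp k \<in> P" by (rule ideal_wpoly_mult[OF point_ideal[OF P(1)]])
    moreover have "f = (\<Prod>k\<in>S - {k}. varp k) * varp k" unfolding f_def by (simp add: prod.remove[OF fS k] mult.commute)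
    ultimately show False using P(2) by simp
  qed
  have reg: "F (mon n \<mu>) \<in> reg n P l" if P: "P \<in> pts n" "f \<notin> P" for P
  proof -
    have "mon n \<mu> \<in> reg n P (wt n \<mu>)" by (rule mon_reg[OF P(1)]) (use nP[OF P] \<mu>(2) in blast)
    moreover have "wt n \<mu> = l" using \<mu>(1) by (simp add: lat_def)
    ultimately show ?thesis using F P(1) unfolding preserving_def by simp
  qed
  obtain k a where a: "a \<in> G n (int k * e + l)" "emb (f ^ k) * F (mon n \<mu>) = emb a"
    by (rule regular_off_hypersurface[OF fG e0 reg])
  define \<chi> where "\<chi> = (\<lambda>i. if i \<in> S then int k else 0)"
  have "mon n \<chi> = (\<Prod>i\<in>S. kvar i powi \<chi> i)"
    unfolding mon_def by (rule prod.mono_neutral_right) (use S(1) in \<open>auto simp: \<chi>_def\<close>)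
  also have "\<dots> = (\<Prod>i\<in>S. kvar i ^ k)" by (rule prod.cong) (simp_all add: \<chi>_def)
  also have "\<dots> = emb (f ^ k)" by (simp add: f_def emb_power emb_prod kvar_def prod_power_distrib)
  finally have m\<chi>: "mon n \<chi> = emb (f ^ k)" .
  have w\<chi>: "wt n \<chi> = int k * e"
  proof -
    have "wt n \<chi> = (\<Sum>i\<in>S. wvar n i * \<chi> i)"
      unfolding wt_def by (rule sum.mono_neutral_right) (use S(1) in \<open>auto simp: \<chi>_def\<close>)
    also have "\<dots> = (\<Sum>i\<in>S. int k * wvar n i)" by (rule sum.cong) (simp_all add: \<chi>_def)
    finally show ?thesis by (simp add: e_def sum_distrib_left)
  qed
  have "\<chi> \<in> lat n (int k * e)" using S(1) w\<chi> by (auto simp: lat_def \<chi>_def)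
  from lat_scale[OF this, of "- 1"] have \<kappa>: "(\<lambda>i. - \<chi> i) \<in> lat n (- (int k * e))" by simp
  obtain c where c: "is_coef n (int k * e + l) (emb a) c" "\<And>\<mu> i. c \<mu> \<noteq> 0 \<Longrightarrow> \<mu> i \<ge> 0" using emb_is_coef[OF a(1)] by blast
  have "mon n (\<lambda>i. - \<chi> i) * mon n \<chi> = mon n (\<lambda>_. 0)" by (simp add: mon_add[symmetric])
  then have inv: "mon n (\<lambda>i. - \<chi> i) * mon n \<chi> = 1" by (simp only: mon_0)
  have "mon n (\<lambda>i. - \<chi> i) * emb a = (mon n (\<lambda>i. - \<chi> i) * mon n \<chi>) * F (mon n \<mu>)"
    by (simp only: a(2)[symmetric] m\<chi> mult.assoc)
  then have E: "F (mon n \<mu>) = mon n (\<lambda>i. - \<chi> i) * emb a" by (simp only: inv mult_1)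
  show ?thesis
  proof (intro exI conjI allI impI)
    show "is_coef n l (F (mon n \<mu>)) (\<lambda>\<mu>. c (\<lambda>k. \<mu> k - - \<chi> k))"
      unfolding E using is_coef_shift[OF c(1) \<kappa>] by simp
    show "\<kappa> i \<ge> 0" if "c (\<lambda>k. \<kappa> k - - \<chi> k) \<noteq> 0" "i \<notin> S" for \<kappa> i
      using c(2)[OF that(1), of i] that(2) by (simp add: \<chi>_def)
  qed
qed

section \<open>The coefficients of an operator on Laurent monomials\<close>

definition coef :: "nat \<Rightarrow> int \<Rightarrow> rat_fun \<Rightarrow> (nat \<Rightarrow> int) \<Rightarrow> complex" where
  "coef n m g = (SOME c. is_coef n m g c)"

lemma is_coef_coef: "\<exists>c. is_coef n m g c \<Longrightarrow> is_coef n m g (coef n m g)"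
  unfolding coef_def by (rule someI_ex[where P = "is_coef n m g"])

lemma coef_eq: "is_coef n m g c \<Longrightarrow> coef n m g = c"
  using is_coef_unique is_coef_coef by blast

definition laurent :: "nat \<Rightarrow> int \<Rightarrow> (rat_fun \<Rightarrow> rat_fun) \<Rightarrow> bool" where
  "laurent n l F \<longleftrightarrow> (\<forall>\<mu>\<in>lat n l. \<exists>c. is_coef n l (F (mon n \<mu>)) c)"

text \<open>This is p_\<nu>(\<mu>), at this stage a function of lattice points without any
  regularity.\<close>

definition shift_coef :: "nat \<Rightarrow> int \<Rightarrow> (rat_fun \<Rightarrow> rat_fun) \<Rightarrow> (nat \<Rightarrow> int) \<Rightarrow> (nat \<Rightarrow> int) \<Rightarrow> complex" where
  "shift_coef n l F \<nu> \<mu> = coef n l (F (mon n \<mu>)) (\<lambda>k. \<mu> k + \<nu> k)"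

text \<open>Multiplication by Q^\<kappa> before or after F leads to the same target exponent, but F
  is evaluated at different monomials; hence a difference in \<mu>. This links the order of F to the
  degree of its coefficients.\<close>

lemma shift_coef_commutator:
  assumes F: "laurent n l F" and \<kappa>: "\<kappa> \<in> lat n 0"
  defines "H \<equiv> \<lambda>g. F (mon n \<kappa> * g) - mon n \<kappa> * F g"
  shows "laurent n l H"
    and "\<mu> \<in> lat n l \<Longrightarrow> shift_coef n l H (\<lambda>k. \<kappa> k + \<nu> k) \<mu> = shift_coef n l F \<nu> (\<lambda>k. \<mu> k + \<kappa> k) - shift_coef n l F \<nu> \<mu>"
proof -
  have c: "is_coef n l (H (mon n \<mu>)) (\<lambda>\<tau>. coef n l (F (mon n (\<lambda>k. \<mu> k + \<kappa> k))) \<tau> - coef n l (F (mon n \<mu>)) (\<lambda>k. \<tau> k - \<kappa> k))"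
    if m: "\<mu> \<in> lat n l" for \<mu>
  proof -
    have m': "(\<lambda>k. \<mu> k + \<kappa> k) \<in> lat n l" using lat_add[OF m \<kappa>] by simp
    have e: "mon n \<kappa> * mon n \<mu> = mon n (\<lambda>k. \<mu> k + \<kappa> k)" by (simp only: mon_add mult.commute)
    have "is_coef n l (F (mon n \<mu>)) (coef n l (F (mon n \<mu>)))" using F m unfolding laurent_def by (blast intro: is_coef_coef)
    from is_coef_shift[OF this \<kappa>] have 1: "is_coef n l (mon n \<kappa> * F (mon n \<mu>)) (\<lambda>\<tau>. coef n l (F (mon n \<mu>)) (\<lambda>k. \<tau> k - \<kappa> k))" by simp
    have "is_coef n l (F (mon n (\<lambda>k. \<mu> k + \<kappa> k))) (coef n l (F (mon n (\<lambda>k. \<mu> k + \<kappa> k))))"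
      using F m' unfolding laurent_def by (blast intro: is_coef_coef)
    from is_coef_diff[OF this 1] show ?thesis unfolding H_def e .
  qed
  show "laurent n l H" unfolding laurent_def using c by blast
  show "shift_coef n l H (\<lambda>k. \<kappa> k + \<nu> k) \<mu> = shift_coef n l F \<nu> (\<lambda>k. \<mu> k + \<kappa> k) - shift_coef n l F \<nu> \<mu>" if "\<mu> \<in> lat n l"
    unfolding shift_coef_def coef_eq[OF c[OF that]] by (simp add: add_ac)
qed

text \<open>The coordinates 2 to n + 1 are adjusted one at a time along the directions
  \<open>hdir n 1 j\<close>. The first coordinate then agrees as well, because the degrees agree and
  its weight is 1.\<close>

lemma lat_connected:
  fixes f :: "(nat \<Rightarrow> int) \<Rightarrow> 'a"
  assumes n: "n \<ge> 1" and inv: "\<And>j \<mu>. j \<in> {2..n+1} \<Longrightarrow> \<mu> \<in> lat n l \<Longrightarrow> f (\<lambda>k. \<mu> k + hdir n 1 j k) = f \<mu>"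
    and m: "\<mu> \<in> lat n l" "\<mu>' \<in> lat n l"
  shows "f \<mu> = f \<mu>'"
proof -
  have hl: "hdir n 1 j \<in> lat n 0" if "j \<in> {2..n+1}" for j by (rule hdir_lat) (use n that in auto)
  have scl: "(\<lambda>k. \<mu> k + c * hdir n 1 j k) \<in> lat n l" if "j \<in> {2..n+1}" "\<mu> \<in> lat n l" for j \<mu> c
    using lat_add[OF that(2) lat_scale[OF hl[OF that(1)], of c]] by simp
  have pos: "f (\<lambda>k. \<mu> k + int c * hdir n 1 j k) = f \<mu>" if j: "j \<in> {2..n+1}" and m: "\<mu> \<in> lat n l" for j \<mu> c
  proof (induction c)
    case (Suc c)
    have "f (\<lambda>k. \<mu> k + int c * hdir n 1 j k + hdir n 1 j k) = f (\<lambda>k. \<mu> k + int c * hdir n 1 j k)"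
      by (rule inv[OF j scl[OF j m]])
    moreover have "(\<lambda>k. \<mu> k + int (Suc c) * hdir n 1 j k) = (\<lambda>k. \<mu> k + int c * hdir n 1 j k + hdir n 1 j k)"
      by (simp add: algebra_simps fun_eq_iff)
    ultimately show ?case using Suc.IH by simp
  qed simp
  have step: "f (\<lambda>k. \<mu> k + c * hdir n 1 j k) = f \<mu>" if j: "j \<in> {2..n+1}" and m: "\<mu> \<in> lat n l" for j \<mu> c
  proof (cases "c \<ge> 0")
    case True
    then show ?thesis using pos[OF j m, of "nat c"] by simp
  next
    case False
    then show ?thesis using pos[OF j scl[OF j m, of c], of "nat (- c)"] by simp
  qed
  have "f \<mu> = f \<mu>'" if "finite J" "J \<subseteq> {2..n+1}" "\<mu> \<in> lat n l" "\<mu>' \<in> lat n l" "\<And>k. k \<notin> J \<Longrightarrow> k \<noteq> 1 \<Longrightarrow> \<mu> k = \<mu>' k" for J \<mu> \<mu>'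
    using that
  proof (induction J arbitrary: \<mu>)
    case empty
    have "(\<Sum>i\<in>{2..n+1}. wvar n i * \<mu> i) = (\<Sum>i\<in>{2..n+1}. wvar n i * \<mu>' i)"
      by (intro sum.cong refl) (use empty.prems(4) in auto)
    moreover have "{1..n+1} = insert 1 {2..n+1}" by auto
    moreover have "wt n \<mu> = wt n \<mu>'" using empty.prems by (simp add: lat_def)
    moreover have "wvar n 1 = 1" using n by (simp add: wvar_def)
    ultimately have "\<mu> 1 = \<mu>' 1" unfolding wt_def by simp
    then have "\<mu> = \<mu>'" using empty.prems(4) by (metis ext empty_iff)
    then show ?case by simp
  next
    case (insert j J)
    have j: "j \<in> {2..n+1}" "J \<subseteq> {2..n+1}" using insert.prems by auto
    let ?m = "\<lambda>k. \<mu> k + (\<mu>' j - \<mu> j) * hdir n 1 j k"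
    have "f ?m = f \<mu>'"
    proof (rule insert.IH[OF j(2) scl[OF j(1) insert.prems(2)] insert.prems(3)])
      fix k assume "k \<notin> J" "k \<noteq> 1"
      then show "?m k = \<mu>' k" using insert.prems(4)[of k] j by (auto simp: hdir_def unit_at_def)
    qed
    then show ?case using step[OF j(1) insert.prems(2)] by simp
  qed
  from this[of "{2..n+1}", OF _ order_refl m] show ?thesis using m by (force simp: lat_def)
qed

definition poly_symbol :: "nat \<Rightarrow> int \<Rightarrow> (rat_fun \<Rightarrow> rat_fun) \<Rightarrow> bool" where
  "poly_symbol n l F \<longleftrightarrow> finite {\<nu>. \<exists>\<mu>\<in>lat n l. shift_coef n l F \<nu> \<mu> \<noteq> 0} \<and>
     (\<forall>\<nu>. \<exists>p\<in>polyfun n. \<forall>\<mu>\<in>lat n l. shift_coef n l F \<nu> \<mu> = p (cvec \<mu>))"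

text \<open>Polynomiality is \<open>polyfun_of_differences\<close>. For finiteness, a shift that is
  not seen by any of the commutators has a coefficient constant in \<mu>, so it already occurs in
  the image of one fixed monomial.\<close>

lemma poly_symbol_step:
  assumes n: "n \<ge> 1" and F: "laurent n l F"
    and c: "\<And>j. j \<in> {2..n+1} \<Longrightarrow> poly_symbol n l (\<lambda>g. F (mon n (hdir n 1 j) * g) - mon n (hdir n 1 j) * F g)"
  shows "poly_symbol n l F"
proof -
  define H where "H = (\<lambda>j g. F (mon n (hdir n 1 j) * g) - mon n (hdir n 1 j) * F g)"
  have ps: "poly_symbol n l (H j)" if "j \<in> {2..n+1}" for j using c[OF that] by (simp add: H_def)
  have hl: "hdir n 1 j \<in> lat n 0" if "j \<in> {2..n+1}" for j by (rule hdir_lat) (use n that in auto)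
  have d: "shift_coef n l F \<nu> (\<lambda>k. \<mu> k + hdir n 1 j k) - shift_coef n l F \<nu> \<mu> = shift_coef n l (H j) (\<lambda>k. hdir n 1 j k + \<nu> k) \<mu>"
    if "j \<in> {2..n+1}" "\<mu> \<in> lat n l" for j \<mu> \<nu>
    using shift_coef_commutator(2)[OF F hl[OF that(1)] that(2), of \<nu>] by (simp add: H_def)
  have poly: "\<exists>p\<in>polyfun n. \<forall>\<mu>\<in>lat n l. shift_coef n l F \<nu> \<mu> = p (cvec \<mu>)" for \<nu>
  proof (rule polyfun_of_differences[OF n])
    fix j assume j: "j \<in> {2..n+1}"
    obtain p where "p \<in> polyfun n" "\<forall>\<mu>\<in>lat n l. shift_coef n l (H j) (\<lambda>k. hdir n 1 j k + \<nu> k) \<mu> = p (cvec \<mu>)"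
      using ps[OF j] unfolding poly_symbol_def by blast
    then show "\<exists>p\<in>polyfun n. \<forall>\<mu>\<in>lat n l. shift_coef n l F \<nu> (\<lambda>k. \<mu> k + hdir n 1 j k) - shift_coef n l F \<nu> \<mu> = p (cvec \<mu>)"
      by (intro bexI[of _ p] ballI) (simp_all only: d[OF j])
  qed
  have "1 \<in> {1..n+1}" "wvar n 1 = 1" using n by (auto simp: wvar_def)
  from lat_scale[OF lat_unit[OF this(1)], of l] this(2) have m0: "(\<lambda>k. l * unit_at 1 k) \<in> lat n l" by simp
  define \<mu>0 where "\<mu>0 = (\<lambda>k. l * unit_at 1 k)"
  note m0 = m0[folded \<mu>0_def]
  let ?N = "\<lambda>F. {\<nu>. \<exists>\<mu>\<in>lat n l. shift_coef n l F \<nu> \<mu> \<noteq> 0}"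
  let ?C = "{\<kappa>. coef n l (F (mon n \<mu>0)) \<kappa> \<noteq> 0}"
  have "?N F \<subseteq> (\<Union>j\<in>{2..n+1}. (\<lambda>\<nu>' k. \<nu>' k - hdir n 1 j k) ` ?N (H j)) \<union> (\<lambda>\<kappa> k. \<kappa> k - \<mu>0 k) ` ?C"
  proof
    fix \<nu> assume "\<nu> \<in> ?N F"
    then obtain \<mu> where mu: "\<mu> \<in> lat n l" "shift_coef n l F \<nu> \<mu> \<noteq> 0" by blast
    show "\<nu> \<in> (\<Union>j\<in>{2..n+1}. (\<lambda>\<nu>' k. \<nu>' k - hdir n 1 j k) ` ?N (H j)) \<union> (\<lambda>\<kappa> k. \<kappa> k - \<mu>0 k) ` ?C"
    proof (cases "\<exists>j\<in>{2..n+1}. (\<lambda>k. hdir n 1 j k + \<nu> k) \<in> ?N (H j)")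
      case True
      then obtain j where j: "j \<in> {2..n+1}" "(\<lambda>k. hdir n 1 j k + \<nu> k) \<in> ?N (H j)" by blast
      have "\<nu> = (\<lambda>k. (hdir n 1 j k + \<nu> k) - hdir n 1 j k)" by simp
      from image_eqI[where f = "\<lambda>\<nu>' k. \<nu>' k - hdir n 1 j k", OF this j(2)] j(1) show ?thesis by blast
    next
      case False
      have "shift_coef n l F \<nu> \<mu> = shift_coef n l F \<nu> \<mu>0"
      proof (rule lat_connected[OF n _ mu(1) m0])
        fix j \<mu> assume jm: "j \<in> {2..n+1}" "\<mu> \<in> lat n l"
        have "shift_coef n l (H j) (\<lambda>k. hdir n 1 j k + \<nu> k) \<mu> = 0" using False jm by blast
        then show "shift_coef n l F \<nu> (\<lambda>k. \<mu> k + hdir n 1 j k) = shift_coef n l F \<nu> \<mu>" using d[OF jm, of \<nu>] by simp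
      qed
      then have "(\<lambda>k. \<mu>0 k + \<nu> k) \<in> ?C" using mu(2) by (simp add: shift_coef_def)
      moreover have "\<nu> = (\<lambda>k. (\<mu>0 k + \<nu> k) - \<mu>0 k)" by simp
      ultimately show ?thesis by (intro UnI2) (rule image_eqI[where f = "\<lambda>\<kappa> k. \<kappa> k - \<mu>0 k"])
    qed
  qed
  moreover have "finite ?C"
    using F m0 is_coef_coef[of n l "F (mon n \<mu>0)"] unfolding laurent_def is_coef_def by blast
  moreover have "finite (?N (H j))" if "j \<in> {2..n+1}" for j using ps[OF that] by (simp add: poly_symbol_def)
  ultimately have "finite (?N F)" by (elim finite_subset) (intro finite_UnI finite_UN_I finite_imageI finite_atLeastAtMost)
  with poly show ?thesis unfolding poly_symbol_def by blast
qed

text \<open>An operator of order 0 commutes with monomials of degree 0, so its differences vanish;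
  this starts the induction on the order.\<close>

lemma poly_symbol_dop:
  assumes n: "n \<ge> 1" and "laurent n l F" "dop (homfrac n 0) (homfrac n l) k F"
  shows "poly_symbol n l F"
  using assms(2,3)
proof (induction k arbitrary: F)
  have hl: "hdir n 1 j \<in> lat n 0" if "j \<in> {2..n+1}" for j by (rule hdir_lat) (use n that in auto)
  {
    case 0
    show ?case
    proof (rule poly_symbol_step[OF n 0(1)])
      fix j assume j: "j \<in> {2..n+1}"
      let ?H = "\<lambda>g. F (mon n (hdir n 1 j) * g) - mon n (hdir n 1 j) * F g"
      have "?H (mon n \<mu>) = 0" if "\<mu> \<in> lat n l" for \<mu>
        using 0(2)[unfolded dop.simps] mon_homfrac[OF hl[OF j]] mon_homfrac[OF that] by simp
      then have "shift_coef n l ?H \<nu> \<mu> = 0" if "\<mu> \<in> lat n l" for \<nu> \<mu>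
        using that coef_eq[OF is_coef_0[of n l]] by (simp add: shift_coef_def)
      then show "poly_symbol n l ?H" unfolding poly_symbol_def
        by (intro conjI allI bexI[of _ "\<lambda>x. 0"] polyfun.const) simp_all
    qed
  next
    case (Suc k)
    show ?case
    proof (rule poly_symbol_step[OF n Suc.prems(1)])
      fix j assume j: "j \<in> {2..n+1}"
      show "poly_symbol n l (\<lambda>g. F (mon n (hdir n 1 j) * g) - mon n (hdir n 1 j) * F g)"
        by (rule Suc.IH[OF shift_coef_commutator(1)[OF Suc.prems(1) hl[OF j]]
          bspec[OF Suc.prems(2)[unfolded dop.simps] mon_homfrac[OF hl[OF j]]]])
    qed
  }
qed

lemma shift_coef_lat0: "laurent n l F \<Longrightarrow> \<mu> \<in> lat n l \<Longrightarrow> shift_coef n l F \<nu> \<mu> \<noteq> 0 \<Longrightarrow> \<nu> \<in> lat n 0"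
proof -
  assume a: "laurent n l F" "\<mu> \<in> lat n l" "shift_coef n l F \<nu> \<mu> \<noteq> 0"
  then have "is_coef n l (F (mon n \<mu>)) (coef n l (F (mon n \<mu>)))" unfolding laurent_def by (blast intro: is_coef_coef)
  then have "(\<lambda>k. \<mu> k + \<nu> k) \<in> lat n l" using a(3) unfolding is_coef_def shift_coef_def by blast
  from lat0_diff[OF this a(2)] show "\<nu> \<in> lat n 0" by simp
qed

lemma shift_coef_expansion:
  assumes F: "laurent n l F" and N: "finite N" "\<And>\<nu>. shift_coef n l F \<nu> \<mu> \<noteq> 0 \<Longrightarrow> \<nu> \<in> N" and m: "\<mu> \<in> lat n l"
  shows "F (mon n \<mu>) = (\<Sum>\<nu>\<in>N. kconst (shift_coef n l F \<nu> \<mu>) * mon n (\<lambda>k. \<mu> k + \<nu> k))"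
proof -
  let ?s = "\<lambda>\<nu> k. \<mu> k + \<nu> k"
  have c: "is_coef n l (F (mon n \<mu>)) (coef n l (F (mon n \<mu>)))" using F m unfolding laurent_def by (blast intro: is_coef_coef)
  have "F (mon n \<mu>) = torus_lin n (?s ` N) (coef n l (F (mon n \<mu>)))"
  proof (rule is_coef_superset[OF c])
    show "finite (?s ` N)" using N(1) by simp
    show "{\<kappa>. coef n l (F (mon n \<mu>)) \<kappa> \<noteq> 0} \<subseteq> ?s ` N"
    proof
      fix \<kappa> assume k: "\<kappa> \<in> {\<kappa>. coef n l (F (mon n \<mu>)) \<kappa> \<noteq> 0}"
      have "(\<lambda>k. \<kappa> k - \<mu> k) \<in> N" by (rule N(2)) (use k in \<open>simp add: shift_coef_def\<close>)
      then have "?s (\<lambda>k. \<kappa> k - \<mu> k) \<in> ?s ` N" by (rule imageI)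
      then show "\<kappa> \<in> ?s ` N" by simp
    qed
  qed
  moreover have "inj_on ?s N" by (auto simp: inj_on_def fun_eq_iff)
  ultimately show ?thesis by (simp add: torus_lin_def sum.reindex shift_coef_def)
qed

text \<open>On the chart \<open>Q\<^sub>i \<noteq> 0\<close> the operator maps monomials with a pole only along \<open>Q\<^sub>i\<close> to such monomials, so the
  coefficients leading out of this cone vanish.\<close>

lemma symbol_vanishing:
  assumes F: "preserving n l (pts n) F" and i: "i \<in> {1..n}" and j: "j \<in> {1..n+1}" "j \<noteq> i"
    and p: "p \<in> polyfun n" "\<And>\<mu>. \<mu> \<in> lat n l \<Longrightarrow> shift_coef n l F \<nu> \<mu> = p (cvec \<mu>)"
    and c: "int c + \<nu> j < 0" and x: "x \<in> hyper n l" "x j = of_nat c"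
  shows "p x = 0"
proof -
  let ?y = "\<lambda>y k. if k = j then of_nat c else (y k :: complex)"
  \<comment> \<open>Coordinate j is set to c and coordinate i, of weight 1, is solved for. So
    \<sigma> parametrises the slice x_j = c of the hyperplane, and natural values of the remaining
    coordinates can be prescribed freely.\<close>
  define \<sigma> where "\<sigma> = (\<lambda>y k. if k = i then of_int l - (\<Sum>k\<in>{1..n+1} - {i}. of_int (wvar n k) * ?y y k) else ?y y k)"
  have yk: "(\<lambda>y. ?y y k) \<in> polyfun n" if "k \<in> {1..n+1}" for k
    using polyfun.const[of "of_nat c" n] polyfun.coord[OF that] by (cases "k = j") simp_all
  have sp: "(\<lambda>y. \<sigma> y k) \<in> polyfun n" if k: "k \<in> {1..n+1}" for k
  proof (cases "k = i")
    case True
    have "(\<lambda>y. of_int l - (\<Sum>k\<in>{1..n+1} - {i}. of_int (wvar n k) * ?y y k)) \<in> polyfun n"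
      by (intro polyfun_diff polyfun.const polyfun_sum polyfun.mult yk) auto
    then show ?thesis using True by (simp add: \<sigma>_def)
  next
    case False
    then show ?thesis using yk[OF k] by (simp add: \<sigma>_def)
  qed
  have wi: "wvar n i = 1" using i by (simp add: wvar_def)
  have iI: "i \<in> {1..n+1}" using i by simp
  have ps: "(\<lambda>y. p (\<sigma> y)) \<in> polyfun n" by (rule polyfun_subst[OF p(1)]) (rule sp)
  have "(\<lambda>y. p (\<sigma> y)) x = 0"
  proof (rule polyfun_zero_of_Nats[OF ps, where J = "{1..n+1}"])
    fix y :: "nat \<Rightarrow> complex" assume "\<And>i. i \<in> {1..n+1} \<Longrightarrow> y i \<in> \<nat>"
    then have "\<forall>i. \<exists>m. i \<in> {1..n+1} \<longrightarrow> y i = of_nat m" by (metis Nats_cases)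
    then obtain m where m: "\<And>i. i \<in> {1..n+1} \<Longrightarrow> y i = of_nat (m i)" by metis
    \<comment> \<open>The integral exponent vector with the coordinates of \<sigma> y: only its
      coordinate i may be negative, so the monomial is regular on the chart of Q_i.\<close>
    define \<mu> where "\<mu> = (\<lambda>k. if k \<in> {1..n+1} then if k = i then l - (\<Sum>k\<in>{1..n+1} - {i}. wvar n k * int (if k = j then c else m k))
      else int (if k = j then c else m k) else 0)"
    have "wt n \<mu> = wvar n i * \<mu> i + (\<Sum>k\<in>{1..n+1} - {i}. wvar n k * \<mu> k)"
      unfolding wt_def by (rule sum.remove[OF finite_atLeastAtMost iI])
    also have "(\<Sum>k\<in>{1..n+1} - {i}. wvar n k * \<mu> k) = (\<Sum>k\<in>{1..n+1} - {i}. wvar n k * int (if k = j then c else m k))"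
      by (intro sum.cong refl) (simp add: \<mu>_def)
    also have "wvar n i * \<mu> i = l - (\<Sum>k\<in>{1..n+1} - {i}. wvar n k * int (if k = j then c else m k))"
      using iI by (simp add: \<mu>_def wi)
    finally have "wt n \<mu> = l" by simp
    then have ml: "\<mu> \<in> lat n l" by (auto simp: lat_def \<mu>_def)
    have mnn: "\<mu> k \<ge> 0" if "k \<in> {1..n+1}" "k \<notin> {i}" for k using that by (simp add: \<mu>_def)
    have iS: "{i} \<subseteq> {1..n+1}" using iI by simp
    have "\<exists>d. is_coef n l (F (mon n \<mu>)) d \<and> (\<forall>\<kappa>. d \<kappa> \<noteq> 0 \<longrightarrow> (\<forall>k. k \<notin> {i} \<longrightarrow> \<kappa> k \<ge> 0))"
      by (rule preserving_mon_coef[OF F iS insert_not_empty ml]) (rule mnn)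
    then obtain d where d: "is_coef n l (F (mon n \<mu>)) d" "\<forall>\<kappa>. d \<kappa> \<noteq> 0 \<longrightarrow> (\<forall>k. k \<notin> {i} \<longrightarrow> \<kappa> k \<ge> 0)" by (elim exE conjE)
    have "\<mu> j = int c" using j by (simp add: \<mu>_def)
    \<comment> \<open>The target exponent has coordinate j equal to c + \<nu>_j < 0, a pole that the
      image cannot have because j \<noteq> i.\<close>
    then have "d (\<lambda>k. \<mu> k + \<nu> k) = 0" using d(2)[rule_format, of "\<lambda>k. \<mu> k + \<nu> k" j] j(2) c by force
    then have "p (cvec \<mu>) = 0" using p(2)[OF ml] by (simp add: shift_coef_def coef_eq[OF d(1)])
    moreover have "p (\<sigma> y) = p (cvec \<mu>)"
    proof (rule polyfun_local[OF p(1)])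
      fix k assume k: "k \<in> {1..n+1}"
      show "\<sigma> y k = cvec \<mu> k"
      proof (cases "k = i")
        case True
        have "(\<Sum>k\<in>{1..n+1} - {i}. of_int (wvar n k) * ?y y k) = of_int (\<Sum>k\<in>{1..n+1} - {i}. wvar n k * int (if k = j then c else m k))"
          unfolding of_int_sum by (intro sum.cong refl) (use m in auto)
        then show ?thesis using k True unfolding \<sigma>_def cvec_def \<mu>_def by simp
      next
        case False
        then show ?thesis using k m by (simp add: \<sigma>_def cvec_def \<mu>_def)
      qed
    qed
    ultimately show "p (\<sigma> y) = 0" by simp
  qed simp
  moreover have "p (\<sigma> x) = p x"
  proof (rule polyfun_local[OF p(1)])
    have yx: "?y x k = x k" for k using x(2) by simp
    have "(\<Sum>k\<in>{1..n+1}. of_int (wvar n k) * x k) = of_int (wvar n i) * x i + (\<Sum>k\<in>{1..n+1} - {i}. of_int (wvar n k) * x k)"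
      by (rule sum.remove[OF finite_atLeastAtMost iI])
    then have "of_int l = x i + (\<Sum>k\<in>{1..n+1} - {i}. of_int (wvar n k) * x k)"
      using x(1) unfolding hyper_def mem_Collect_eq wi by simp
    then show "\<sigma> x k = x k" for k unfolding \<sigma>_def yx by simp
  qed
  ultimately show ?thesis by simp
qed

section \<open>Divisibility on the hyperplane of degree l\<close>

lemma hyper_line: "x \<in> hyper n l \<Longrightarrow> \<nu> \<in> lat n 0 \<Longrightarrow> (\<lambda>k. x k + t * cvec \<nu> k) \<in> hyper n l"
  using hyper_cvec[of \<nu> n 0]
  by (simp only: hyper_def mem_Collect_eq distrib_left sum.distrib mult.left_commute[of _ t] sum_distrib_left[symmetric]) simp

text \<open>As n \<ge> 2, there is an index i \<noteq> j of weight 1, and \<open>hdir n i j\<close>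
  is a direction inside the hyperplane that moves x_j. The remainder in
  \<open>polyfun_divide\<close> along it is a value of p on the slice x_j = c, hence 0.\<close>

lemma hyper_divide:
  assumes n: "n \<ge> 2" and p: "p \<in> polyfun n" and j: "j \<in> {1..n+1}" and z: "\<And>x. x \<in> hyper n l \<Longrightarrow> x j = c \<Longrightarrow> p x = 0"
  shows "\<exists>q\<in>polyfun n. \<forall>x\<in>hyper n l. p x = (x j - c) * q x"
proof -
  define i :: nat where "i = (if j = 1 then 2 else 1)"
  have i: "i \<in> {1..n}" "i \<noteq> j" using n by (auto simp: i_def)
  let ?k = "hdir n i j"
  have kl: "?k \<in> lat n 0" by (rule hdir_lat[OF i(1) j])
  have kj: "cvec ?k j = 1" using i(2) by (simp add: cvec_def hdir_def unit_at_def)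
  obtain q where q: "q \<in> polyfun n" "\<And>x. p x - p (\<lambda>k. x k + (c - x j) * cvec ?k k) = (x j - c) * q x"
    using polyfun_divide[OF p j, of c "cvec ?k"] by blast
  have "p x = (x j - c) * q x" if x: "x \<in> hyper n l" for x
  proof -
    have "p (\<lambda>k. x k + (c - x j) * cvec ?k k) = 0" by (rule z[OF hyper_line[OF x kl]]) (simp add: kj)
    then show ?thesis using q(2)[of x] by simp
  qed
  then show ?thesis using q(1) by blast
qed

text \<open>For j \<noteq> j' every point of the slice x_j' = c' lies on a line inside the slice
  along which x_j varies. There q vanishes wherever x_j \<noteq> c, so it vanishes on the whole
  line.\<close>

lemma hyper_cancel:
  assumes n: "n \<ge> 2" and q: "q \<in> polyfun n" and j: "j \<in> {1..n+1}" "j' \<in> {1..n+1}" "(j, c) \<noteq> (j', c')"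
    and z: "\<And>x. x \<in> hyper n l \<Longrightarrow> x j' = c' \<Longrightarrow> x j \<noteq> c \<Longrightarrow> q x = 0" and x: "x \<in> hyper n l" "x j' = c'"
  shows "q x = 0"
proof (cases "j = j'")
  case True
  then show ?thesis using z[OF x] x j(3) by auto
next
  case False
  \<comment> \<open>A third index exists because there are n + 1 \<ge> 3 coordinates; moving it
    compensates the change of degree caused by moving x_j.\<close>
  define m :: nat where "m = (if j \<noteq> 1 \<and> j' \<noteq> 1 then 1 else if j \<noteq> 2 \<and> j' \<noteq> 2 then 2 else 3)"
  have m: "m \<in> {1..n+1}" "m \<noteq> j" "m \<noteq> j'" using n False unfolding m_def by auto
  define d where "d = (\<lambda>k. wvar n m * unit_at j k + (- wvar n j) * unit_at m k)"
  have dl: "d \<in> lat n 0"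
    using lat_add[OF lat_scale[OF lat_unit[OF j(1)], of "wvar n m"] lat_scale[OF lat_unit[OF m(1)], of "- wvar n j"]]
    by (simp add: d_def mult.commute)
  have dj: "cvec d j \<noteq> 0" "cvec d j' = 0" using m False by (auto simp: cvec_def d_def unit_at_def wvar_def)
  define t where "t = (c - x j) / cvec d j"
  \<comment> \<open>At parameter t the line meets x_j = c. The parameters t + 1 + s with s natural
    miss that point, and s = - t - 1 gives back x.\<close>
  have pf: "(\<lambda>y. q (\<lambda>k. x k + (t + 1 + y 1) * cvec d k)) \<in> polyfun n"
    by (rule polyfun_subst[OF q]) (intro polyfun.add polyfun.const polyfun.mult polyfun.coord, simp)
  have "(\<lambda>y. q (\<lambda>k. x k + (t + 1 + y 1) * cvec d k)) (\<lambda>_. - t - 1) = 0"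
  proof (rule polyfun_zero_of_Nats[OF pf, where J = "{1}"])
    fix y :: "nat \<Rightarrow> complex" assume "\<And>i. i \<in> {1} \<Longrightarrow> y i \<in> \<nat>"
    then have "y 1 \<in> \<nat>" by simp
    then obtain s where s: "y 1 = of_nat s" by (rule Nats_cases)
    show "q (\<lambda>k. x k + (t + 1 + y 1) * cvec d k) = 0"
    proof (rule z[OF hyper_line[OF x(1) dl]])
      show "x j' + (t + 1 + y 1) * cvec d j' = c'" by (simp add: dj x(2))
      have "x j + (t + 1 + y 1) * cvec d j = c + of_nat (Suc s) * cvec d j"
        unfolding s t_def using dj(1) by (simp add: field_simps)
      then show "x j + (t + 1 + y 1) * cvec d j \<noteq> c" using dj(1) of_nat_neq_0[of s, where 'a = complex] by simp
    qed
  qed simp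
  then show ?thesis by simp
qed

text \<open>The linear factors are divided out one at a time; by \<open>hyper_cancel\<close> each
  quotient still vanishes on the slices of the remaining factors.\<close>

lemma hyper_divide_all:
  assumes n: "n \<ge> 2" and A: "finite A" "\<And>j c. (j, c) \<in> A \<Longrightarrow> j \<in> {1..n+1}" and p: "p \<in> polyfun n"
    and z: "\<And>j c x. (j, c) \<in> A \<Longrightarrow> x \<in> hyper n l \<Longrightarrow> x j = c \<Longrightarrow> p x = 0"
  shows "\<exists>q\<in>polyfun n. \<forall>x\<in>hyper n l. p x = (\<Prod>(j, c)\<in>A. x j - c) * q x"
  using assms(2-)
proof (induction A arbitrary: p)
  case empty
  then show ?case by (intro bexI[of _ p]) simp_all
next
  case (insert a A)
  obtain j c where a: "a = (j, c)" by (cases a)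
  have j: "j \<in> {1..n+1}" using insert.prems(1) a by blast
  obtain q where q: "q \<in> polyfun n" "\<And>x. x \<in> hyper n l \<Longrightarrow> p x = (x j - c) * q x"
    using hyper_divide[OF n insert.prems(2) j insert.prems(3)[of j c]] a by blast
  have "\<exists>r\<in>polyfun n. \<forall>x\<in>hyper n l. q x = (\<Prod>(j, c)\<in>A. x j - c) * r x"
  proof (rule insert.IH)
    show "j \<in> {1..n+1}" if "(j, c) \<in> A" for j c using insert.prems(1) that by blast
    show "q \<in> polyfun n" by (rule q(1))
    fix j' c' x assume jc: "(j', c') \<in> A" and x: "x \<in> hyper n l" "x j' = c'"
    show "q x = 0"
    proof (rule hyper_cancel[OF n q(1) j, of j' c c' l x])
      show "j' \<in> {1..n+1}" using insert.prems(1) jc by blast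
      show "(j, c) \<noteq> (j', c')" using insert.hyps jc a by blast
      fix y assume y: "y \<in> hyper n l" "y j' = c'" "y j \<noteq> c"
      have "p y = 0" by (rule insert.prems(3)[OF _ y(1,2)]) (use jc in blast)
      then show "q y = 0" using q(2)[OF y(1)] y(3) by simp
    qed (rule x)+
  qed
  then obtain r where r: "r \<in> polyfun n" "\<And>x. x \<in> hyper n l \<Longrightarrow> q x = (\<Prod>(j, c)\<in>A. x j - c) * r x" by blast
  show ?case
    by (rule bexI[of _ r]) (use r q(2) insert.hyps in \<open>auto simp: a\<close>)
qed

text \<open>By \<open>symbol_vanishing\<close> p vanishes on all slices x_j = c with 0 \<le> c < -
  \<nu>_j, so on the hyperplane it is \<open>ffac n \<nu>\<close> times a polynomial. The first
  factor is realised with shift \<nu>, the second with shift 0.\<close>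

lemma realized_symbol:
  assumes n: "n \<ge> 2" and F: "preserving n l (pts n) F" and \<nu>: "\<nu> \<in> lat n 0"
    and p: "p \<in> polyfun n" "\<And>\<mu>. \<mu> \<in> lat n l \<Longrightarrow> shift_coef n l F \<nu> \<mu> = p (cvec \<mu>)"
  shows "realized n l \<nu> p"
proof -
  have n1: "n \<ge> 1" using n by simp
  let ?B = "Sigma {1..n+1} (\<lambda>j. {..<nat (- \<nu> j)})"
  let ?g = "\<lambda>(j, c). (j, of_nat c :: complex)"
  have inj: "inj_on ?g ?B" by (auto simp: inj_on_def)
  have "\<exists>q\<in>polyfun n. \<forall>x\<in>hyper n l. p x = (\<Prod>(j, c)\<in>?g ` ?B. x j - c) * q x"
  proof (rule hyper_divide_all[OF n _ _ p(1)])
    show "finite (?g ` ?B)" by simp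
    show "j \<in> {1..n+1}" if "(j, c) \<in> ?g ` ?B" for j c using that by auto
    fix j c x assume jc: "(j, c) \<in> ?g ` ?B" and x: "x \<in> hyper n l" "x j = c"
    then obtain k where k: "j \<in> {1..n+1}" "k < nat (- \<nu> j)" "c = of_nat k" by auto
    \<comment> \<open>The chart of Q_1 serves every j except j = 1, where the chart of Q_2 is
      taken.\<close>
    define i :: nat where "i = (if j = 1 then 2 else 1)"
    have i: "i \<in> {1..n}" "j \<noteq> i" using n by (auto simp: i_def)
    have c: "int k + \<nu> j < 0" using k(2) by linarith
    show "p x = 0" by (rule symbol_vanishing[OF F i(1) k(1) i(2) p c x(1) x(2)[unfolded k(3)]])
  qed
  then obtain q where q: "q \<in> polyfun n" "\<And>x. x \<in> hyper n l \<Longrightarrow> p x = (\<Prod>(j, c)\<in>?g ` ?B. x j - c) * q x" by blast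
  have ff: "(\<Prod>(j, c)\<in>?g ` ?B. x j - c) = ffac n \<nu> x" for x
    unfolding prod.reindex[OF inj] ffac_def fall_def by (subst prod.Sigma) (simp_all add: case_prod_unfold)
  from realized_mult[OF n1 realized_ffac[OF n1 \<nu>] zero_lat realized_polyfun[OF n1 q(1)], of l]
  have "realized n l \<nu> (\<lambda>x. ffac n \<nu> x * q x)" by (simp add: cvec_def)
  then show ?thesis by (rule realized_cong) (simp only: q(2) ff)
qed

section \<open>The homomorphism\<close>

lemma alg_ops_good: "T \<in> alg_ops n l \<Longrightarrow> good_op n l T"
  unfolding alg_ops_def compat_def by blast

lemma alg_ops_sum:
  assumes n: "n \<ge> 1" and "finite A" "\<And>i. i \<in> A \<Longrightarrow> T i \<in> alg_ops n l"
  shows "(\<lambda>g. \<Sum>i\<in>A. T i g) \<in> alg_ops n l"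
  using assms(2,3)
proof (induction A)
  case empty
  have "(\<lambda>g. kconst 0 * g) \<in> alg_ops n l" by (rule alg_ops_scale[OF n alg_ops_id])
  then show ?case by simp
next
  case (insert i A)
  have "(\<lambda>g. T i g + (\<Sum>i\<in>A. T i g)) \<in> alg_ops n l"
    by (rule alg_ops_add[OF n insert.prems insert.IH]) (use insert.prems in auto)
  then show ?case using insert.hyps by simp
qed

text \<open>Finitely many shifts occur, and each coefficient p_\<nu> is realised by the algebra. The
  sum of these operators agrees with F on Laurent monomials, hence in all of degree l because the
  difference has finite order.\<close>

theorem diffop_in_alg_ops:
  assumes n: "n \<ge> 2" and F: "preserving n l (pts n) F" "linear_op n l F" "dop (homfrac n 0) (homfrac n l) k F"
  shows "\<exists>T\<in>alg_ops n l. \<forall>g\<in>homfrac n l. F g = T g"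
proof -
  have n1: "n \<ge> 1" using n by simp
  have ne: "{1..n+1} \<noteq> {}" by simp
  have lau: "laurent n l F" unfolding laurent_def
  proof
    fix \<mu> assume m: "\<mu> \<in> lat n l"
    have "\<exists>c. is_coef n l (F (mon n \<mu>)) c \<and> (\<forall>\<kappa>. c \<kappa> \<noteq> 0 \<longrightarrow> (\<forall>i. i \<notin> {1..n+1} \<longrightarrow> \<kappa> i \<ge> 0))"
      by (rule preserving_mon_coef[OF F(1) order_refl ne m]) simp
    then show "\<exists>c. is_coef n l (F (mon n \<mu>)) c" by blast
  qed
  have ps: "poly_symbol n l F" by (rule poly_symbol_dop[OF n1 lau F(3)])
  define N where "N = {\<nu>. \<exists>\<mu>\<in>lat n l. shift_coef n l F \<nu> \<mu> \<noteq> 0}"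
  have fN: "finite N" using ps unfolding poly_symbol_def N_def by (rule conjunct1)
  have "\<exists>T\<in>alg_ops n l. \<forall>\<mu>\<in>lat n l. T (mon n \<mu>) = kconst (shift_coef n l F \<nu> \<mu>) * mon n (\<lambda>k. \<mu> k + \<nu> k)" if "\<nu> \<in> N" for \<nu>
  proof -
    have \<nu>: "\<nu> \<in> lat n 0" using that shift_coef_lat0[OF lau] unfolding N_def by blast
    obtain p where p: "p \<in> polyfun n" "\<forall>\<mu>\<in>lat n l. shift_coef n l F \<nu> \<mu> = p (cvec \<mu>)"
      using ps unfolding poly_symbol_def by blast
    have "realized n l \<nu> p" by (rule realized_symbol[OF n F(1) \<nu> p(1) bspec[OF p(2)]])
    then obtain T where T: "T \<in> alg_ops n l" "\<And>\<mu>. \<mu> \<in> lat n l \<Longrightarrow> T (mon n \<mu>) = kconst (p (cvec \<mu>)) * mon n (\<lambda>k. \<mu> k + \<nu> k)"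
      by (rule realizedE) blast
    show ?thesis
    proof (rule bexI[OF _ T(1)], rule ballI)
      fix \<mu> assume m: "\<mu> \<in> lat n l"
      show "T (mon n \<mu>) = kconst (shift_coef n l F \<nu> \<mu>) * mon n (\<lambda>k. \<mu> k + \<nu> k)"
        unfolding T(2)[OF m] bspec[OF p(2) m] ..
    qed
  qed
  then obtain T where T: "\<And>\<nu>. \<nu> \<in> N \<Longrightarrow> T \<nu> \<in> alg_ops n l"
    "\<And>\<nu> \<mu>. \<nu> \<in> N \<Longrightarrow> \<mu> \<in> lat n l \<Longrightarrow> T \<nu> (mon n \<mu>) = kconst (shift_coef n l F \<nu> \<mu>) * mon n (\<lambda>k. \<mu> k + \<nu> k)"
    by metis
  define S where "S = (\<lambda>g. \<Sum>\<nu>\<in>N. T \<nu> g)"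
  have S: "S \<in> alg_ops n l" unfolding S_def by (rule alg_ops_sum[OF n1 fN T(1)])
  have eq: "F (mon n \<mu>) = S (mon n \<mu>)" if m: "\<mu> \<in> lat n l" for \<mu>
  proof -
    have "F (mon n \<mu>) = (\<Sum>\<nu>\<in>N. kconst (shift_coef n l F \<nu> \<mu>) * mon n (\<lambda>k. \<mu> k + \<nu> k))"
      by (rule shift_coef_expansion[OF lau fN _ m]) (use m in \<open>auto simp: N_def\<close>)
    also have "\<dots> = S (mon n \<mu>)" unfolding S_def by (rule sum.cong[OF refl]) (simp only: T(2)[OF _ m])
    finally show ?thesis .
  qed
  have gS: "good_op n l S" by (rule alg_ops_good[OF S])
  obtain m where m: "dop UNIV UNIV m S" using gS unfolding good_op_def by blast
  let ?D = "\<lambda>g. F g + kconst (- 1) * S g"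
  have cl: "f * g \<in> homfrac n l" if "f \<in> homfrac n 0" "g \<in> homfrac n l" for f g using homfrac_mult[OF that] by simp
  have "dop (homfrac n 0) (homfrac n l) (max k m) ?D"
  proof (rule dop_add[OF dop_mono_on[OF _ F(3)] dop_scale[OF dop_antimono[OF dop_mono[OF m]]]])
    show "f * g \<in> homfrac n l" if "f \<in> homfrac n 0" "g \<in> homfrac n l" for f g by (rule cl[OF that])
  qed simp_all
  moreover have "linear_op n l ?D"
    using F(2) good_op_linear[OF gS] unfolding linear_op_def
    by (auto simp: distrib_left mult.left_commute[of "kconst _" "kconst _"])
  ultimately have "?D g = 0" if "g \<in> homfrac n l" for g
    using dop_zero_of_torus[OF n1, of l ?D] eq that by (simp add: kconst_uminus)
  then have "F g = S g" if "g \<in> homfrac n l" for g using that by (simp add: kconst_uminus)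
  then show ?thesis using S by blast
qed

text \<open>The choice affects values outside degree l only: for n \<ge> 1 and u in the algebra,
  \<open>compat_unique\<close> fixes the values on fractions of degree l, and
  \<open>sheafify\<close> sees no others.\<close>

definition alg_op :: "nat \<Rightarrow> int \<Rightarrow> (complex mat word \<Rightarrow>\<^sub>0 complex) set \<Rightarrow> rat_fun \<Rightarrow> rat_fun" where
  "alg_op n l u = (SOME T. compat n l (urep n u) T)"

lemma alg_op: "n \<ge> 1 \<Longrightarrow> u \<in> carrier (A_alg n (l + 2)) \<Longrightarrow> compat n l (urep n u) (alg_op n l u)"
  unfolding alg_op_def by (rule someI_ex[where P = "compat n l (urep n u)"]) (rule A_compat)

lemma sheafify_alg_op:
  assumes "n \<ge> 1" "u \<in> carrier (A_alg n (l + 2))" "compat n l (urep n u) T"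
  shows "sheafify n l (pts n) (alg_op n l u) = sheafify n l (pts n) T"
  by (rule sheafify_cong[OF compat_unique[OF assms(1) alg_op[OF assms(1,2)] assms(3)]])

lemma compat_preserving: "compat n l R T \<Longrightarrow> preserving n l (pts n) T"
  by (simp add: compat_def good_op_def)

lemma sheafify_compat:
  assumes T: "compat n l R T"
  shows "sheafify n l (pts n) T \<in> carrier (D_alg n l)"
proof -
  obtain k where k: "dop UNIV UNIV k T" using T unfolding compat_def good_op_def by blast
  have g: "good_op n l T" using T by (simp add: compat_def)
  show ?thesis unfolding D_alg_simps(1)
    by (rule sheafify_diffop[OF compat_preserving[OF T] good_op_linear[OF g] dop_antimono[OF k subset_UNIV subset_UNIV]])
qed

theorem corollary1p3:
  fixes n :: nat and l :: int
  assumes "n \<ge> 2" and "even l"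
  shows "\<exists>h \<in> alg_hom (A_alg n (l + 2)) (D_alg n l).
           h ` carrier (A_alg n (l + 2)) = carrier (D_alg n l)"
proof -
  have n: "n \<ge> 1" using assms(1) by simp
  interpret U: lie_rep "sp n" "osc_rep n" by (rule lie_rep_osc)
  let ?A = "A_alg n (l + 2)"
  define h where "h = (\<lambda>u. sheafify n l (pts n) (alg_op n l u))"
  note car = subsetD[OF A_car[OF n, of "l + 2"]]
  note op = alg_op[OF n, of _ l]
  have pres: "preserving n l (pts n) (alg_op n l u)" if "u \<in> carrier ?A" for u by (rule compat_preserving[OF op[OF that]])
  have hc: "h u \<in> carrier (D_alg n l)" if "u \<in> carrier ?A" for u
    unfolding h_def by (rule sheafify_compat[OF op[OF that]])
  have hom: "h \<in> Ring.ring_hom ?A (D_alg n l)"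
  proof (rule ring_hom_memI)
    show "h u \<in> carrier (D_alg n l)" if "u \<in> carrier ?A" for u by (rule hc[OF that])
    fix u v assume u: "u \<in> carrier ?A" and v: "v \<in> carrier ?A"
    have m: "u \<otimes>\<^bsub>env n\<^esub> v \<in> carrier ?A" using u v unfolding A_alg_simps(1) by (rule generate_ring.eng_mult)
    have a: "u \<oplus>\<^bsub>env n\<^esub> v \<in> carrier ?A" using u v unfolding A_alg_simps(1) by (rule generate_ring.eng_add)
    have cm: "compat n l (urep n (u \<otimes>\<^bsub>env n\<^esub> v)) (\<lambda>g. alg_op n l u (alg_op n l v g))"
      by (rule compat_cong[OF compat_comp[OF op[OF u] op[OF v]]]) (simp add: U.rep_mult[OF car[OF u] car[OF v]])
    have ca: "compat n l (urep n (u \<oplus>\<^bsub>env n\<^esub> v)) (\<lambda>g. alg_op n l u g + alg_op n l v g)"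
      by (rule compat_cong[OF compat_add[OF op[OF u] op[OF v]]]) (simp add: U.rep_add[OF car[OF u] car[OF v]])
    show "h (u \<otimes>\<^bsub>?A\<^esub> v) = h u \<otimes>\<^bsub>D_alg n l\<^esub> h v"
      unfolding A_alg_simps(2) h_def D_alg_mult[OF pres[OF v]] by (rule sheafify_alg_op[OF n m cm])
    show "h (u \<oplus>\<^bsub>?A\<^esub> v) = h u \<oplus>\<^bsub>D_alg n l\<^esub> h v"
      unfolding A_alg_simps(3) h_def D_alg_add[OF pres[OF u] pres[OF v]] by (rule sheafify_alg_op[OF n a ca])
  next
    have o: "\<one>\<^bsub>env n\<^esub> \<in> carrier ?A" unfolding A_alg_simps(1) by (rule generate_ring.one)
    have "compat n l (urep n \<one>\<^bsub>env n\<^esub>) (\<lambda>g. g)" by (rule compat_cong[OF compat_id]) (simp add: U.rep_one)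
    then show "h \<one>\<^bsub>?A\<^esub> = \<one>\<^bsub>D_alg n l\<^esub>"
      unfolding A_alg_simps(4) h_def D_alg_one by (rule sheafify_alg_op[OF n o])
  qed
  have smult: "h (c \<odot>\<^bsub>?A\<^esub> u) = c \<odot>\<^bsub>D_alg n l\<^esub> h u" if u: "u \<in> carrier ?A" for c u
  proof -
    have s: "c \<odot>\<^bsub>env n\<^esub> u \<in> carrier ?A"
      unfolding U.smult_eq_mult[OF car[OF u], of c] A_alg_simps(1)
      by (rule generate_ring.eng_mult) (use A_alg_const u in \<open>simp_all only: A_alg_simps(1)\<close>)
    have "compat n l (urep n (c \<odot>\<^bsub>env n\<^esub> u)) (\<lambda>g. kconst c * alg_op n l u g)"
      by (rule compat_cong[OF compat_scale[OF op[OF u]]]) (simp add: U.rep_smult[OF car[OF u]])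
    then show ?thesis
      unfolding A_alg_simps(5) h_def D_alg_smult[OF pres[OF u]] by (rule sheafify_alg_op[OF n s])
  qed
  have surj: "\<phi> \<in> h ` carrier ?A" if phi: "\<phi> \<in> carrier (D_alg n l)" for \<phi>
  proof -
    obtain F k where F: "preserving n l (pts n) F" "linear_op n l F" "dop (homfrac n 0) (homfrac n l) k F"
      "\<phi> = sheafify n l (pts n) F" using phi unfolding D_alg_simps(1) by (rule diffop_cases)
    obtain T where T: "T \<in> alg_ops n l" "\<And>g. g \<in> homfrac n l \<Longrightarrow> F g = T g"
      using diffop_in_alg_ops[OF assms(1) F(1-3)] by blast
    obtain u where u: "u \<in> carrier ?A" "compat n l (urep n u) T" using T(1) unfolding alg_ops_def by blast
    have "\<phi> = h u" unfolding F(4) h_def sheafify_alg_op[OF n u] by (rule sheafify_cong[OF T(2)])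
    then show ?thesis using u(1) by (rule image_eqI)
  qed
  show ?thesis
  proof (rule bexI[of _ h])
    show "h ` carrier ?A = carrier (D_alg n l)" using hc surj by blast
    show "h \<in> alg_hom ?A (D_alg n l)" unfolding alg_hom_def using hom smult by blast
  qed
qed

end
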